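(* Let $N\ge2$ and let $h:\mathbb{R}\to\mathbb{R}$, with $H(t)=\int_0^th(s)\,ds$, satisfy: (h1) $h\in C(\mathbb{R},\mathbb{R})$ and $h(t)=o(t)$ as $t\to0$; (h2) there exist real numbers $\mu_1\le\mu_2$ with $\mu_1\ge2\cdot2^*$ such that $0<\mu_1H(t)\le h(t)t\le\mu_2H(t)$ for all $t\in\mathbb{R}\setminus\{0\}$; (h3) the function $t\mapsto\frac{h(t)t-2H(t)}{|t|^{3+\frac4N}t}$ is nondecreasing on $(-\infty,0)$ and on $(0,+\infty)$. Then for any $a>0$, the problem $$-\Delta u-\Delta(u^2)u=h(u)+\lambda u\ \text{ in }\mathbb{R}^N,\qquad\int_{\mathbb{R}^N}u^2\,dx=a,$$ has no solution $(u,\lambda)$ in $\hat{\mathcal{S}}_a\times(-\infty,0)$.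
   Context: $2^*=\frac{2N}{N-2}$ if $N\ge3$ and $2^*=+\infty$ if $N=2$. Set $$\mathcal{K}=\left\{u\in H^1(\mathbb{R}^N):\int_{\mathbb{R}^N}|\nabla u|^2u^2\,dx<+\infty\right\},\qquad\hat{\mathcal{S}}_a=\left\{u\in\mathcal{K}:\int_{\mathbb{R}^N}|u|^2dx=a\right\}.$$ A solution is a pair $(u,\lambda)$ such that $u$ is a weak solution of the equation, i.e. $\lim_{t\to0^+}\frac{J_\lambda(u+t\phi)-J_\lambda(u)}{t}=0$ for every $\phi\in C_0^\infty(\mathbb{R}^N)$, where $J_\lambda(u)=\frac12\int_{\mathbb{R}^N}(1+2u^2)|\nabla u|^2dx-\frac\lambda2\int_{\mathbb{R}^N}u^2dx-\int_{\mathbb{R}^N}H(u)dx$. Equivalently, with $u=f(v)$, $v\in H^1(\mathbb{R}^N)$ solves $-\Delta v=h(f(v))f'(v)+\lambda f(v)f'(v)$, where $f$ is the odd function with $f(0)=0$ and $f'(t)=(1+2f^2(t))^{-1/2}$; the energy functional $\Psi(v)=\frac12\int_{\mathbb{R}^N}|\nabla v|^2dx-\int_{\mathbb{R}^N}H(f(v))dx$ is taken in the paper to be well defined and of class $C^1$ on $H^1(\mathbb{R}^N)$. *)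

theory Defs
  imports "HOL-Analysis.Analysis" "HOL-Library.Landau_Symbols"
begin

section \<open>Test functions\<close>

fun C_k :: "nat \<Rightarrow> (real ^ 'n \<Rightarrow> real) \<Rightarrow> bool" where
  "C_k 0 \<phi> \<longleftrightarrow> continuous_on UNIV \<phi>"
| "C_k (Suc k) \<phi> \<longleftrightarrow> (\<exists>g. (\<forall>x. GDERIV \<phi> x :> g x) \<and> (\<forall>i. C_k k (\<lambda>x. g x $ i)))"

definition test_function :: "(real ^ 'n \<Rightarrow> real) \<Rightarrow> bool" where
  "test_function \<phi> \<longleftrightarrow> (\<forall>k. C_k k \<phi>) \<and> compact (closure {x. \<phi> x \<noteq> 0})"


section \<open>The Sobolev space\<close>

text \<open>Elements of $H^1$ are represented by functions rather than by classes modulo equality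
  almost everywhere; every notion below is invariant under changes on null sets.\<close>

definition locally_integrable :: "(real ^ 'n \<Rightarrow> 'b::euclidean_space) \<Rightarrow> bool" where
  "locally_integrable u \<longleftrightarrow> (\<forall>C. compact C \<longrightarrow> set_integrable lebesgue C u)"

definition has_weak_gradient ::
    "(real ^ 'n \<Rightarrow> real) \<Rightarrow> (real ^ 'n \<Rightarrow> real ^ 'n) \<Rightarrow> bool" where
  "has_weak_gradient u G \<longleftrightarrow>
     locally_integrable u \<and> locally_integrable G \<and>
     (\<forall>\<phi> g. test_function \<phi> \<longrightarrow> (\<forall>x. GDERIV \<phi> x :> g x) \<longrightarrow>
        (LINT x|lebesgue. u x *\<^sub>R g x) = - (LINT x|lebesgue. \<phi> x *\<^sub>R G x))"

definition weak_gradient :: "(real ^ 'n \<Rightarrow> real) \<Rightarrow> real ^ 'n \<Rightarrow> real ^ 'n" where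
  "weak_gradient u = (SOME G. has_weak_gradient u G)"

definition H1 :: "(real ^ 'n \<Rightarrow> real) set" where
  "H1 = {u. u \<in> borel_measurable lebesgue \<and> integrable lebesgue (\<lambda>x. (u x)\<^sup>2) \<and>
            (\<exists>G. has_weak_gradient u G \<and> integrable lebesgue (\<lambda>x. (norm (G x))\<^sup>2))}"

definition H1_norm :: "(real ^ 'n \<Rightarrow> real) \<Rightarrow> real" where
  "H1_norm u = sqrt ((LINT x|lebesgue. (norm (weak_gradient u x))\<^sup>2) + (LINT x|lebesgue. (u x)\<^sup>2))"

definition K_set :: "(real ^ 'n \<Rightarrow> real) set" where
  "K_set = {u \<in> H1. integrable lebesgue (\<lambda>x. (norm (weak_gradient u x))\<^sup>2 * (u x)\<^sup>2)}"

definition S_hat :: "real \<Rightarrow> (real ^ 'n \<Rightarrow> real) set" where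
  "S_hat a = {u \<in> K_set. (LINT x|lebesgue. \<bar>u x\<bar>\<^sup>2) = a}"

text \<open>Bounded linear functionals on $H^1$, and $C^1$ functionals in the sense of Frechet.\<close>

definition H1_dual :: "((real ^ 'n \<Rightarrow> real) \<Rightarrow> real) \<Rightarrow> bool" where
  "H1_dual L \<longleftrightarrow>
     (\<forall>v\<in>H1. \<forall>w\<in>H1. L (\<lambda>x. v x + w x) = L v + L w) \<and>
     (\<forall>c. \<forall>v\<in>H1. L (\<lambda>x. c * v x) = c * L v) \<and>
     (\<exists>B. \<forall>v\<in>H1. \<bar>L v\<bar> \<le> B * H1_norm v)"

definition C1_on_H1 :: "((real ^ 'n \<Rightarrow> real) \<Rightarrow> real) \<Rightarrow> bool" where
  "C1_on_H1 F \<longleftrightarrow> (\<exists>D.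
     (\<forall>v\<in>H1. H1_dual (D v)) \<and>
     (\<forall>v\<in>H1. \<forall>e>0. \<exists>d>0. \<forall>w\<in>H1. H1_norm w < d \<longrightarrow>
        \<bar>F (\<lambda>x. v x + w x) - F v - D v w\<bar> \<le> e * H1_norm w) \<and>
     (\<forall>v\<in>H1. \<forall>e>0. \<exists>d>0. \<forall>v'\<in>H1. H1_norm (\<lambda>x. v' x - v x) < d \<longrightarrow>
        (\<forall>w\<in>H1. \<bar>D v' w - D v w\<bar> \<le> e * H1_norm w)))"


section \<open>The equation\<close>

definition critical_exponent :: "nat \<Rightarrow> ereal" where
  "critical_exponent N = (if N \<ge> 3 then ereal (2 * real N / (real N - 2)) else \<infinity>)"

text \<open>The interval integral is oriented, so this is also the intended primitive for $t < 0$.\<close>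

definition primitive :: "(real \<Rightarrow> real) \<Rightarrow> real \<Rightarrow> real" where
  "primitive h t = (LBINT s=ereal 0..ereal t. h s)"

definition J :: "(real \<Rightarrow> real) \<Rightarrow> real \<Rightarrow> (real ^ 'n \<Rightarrow> real) \<Rightarrow> real" where
  "J h lam u =
     1/2 * (LINT x|lebesgue. (1 + 2 * (u x)\<^sup>2) * (norm (weak_gradient u x))\<^sup>2)
     - lam/2 * (LINT x|lebesgue. (u x)\<^sup>2)
     - (LINT x|lebesgue. primitive h (u x))"

definition weak_solution :: "(real \<Rightarrow> real) \<Rightarrow> (real ^ 'n \<Rightarrow> real) \<Rightarrow> real \<Rightarrow> bool" where
  "weak_solution h u lam \<longleftrightarrow>
     (\<forall>\<phi>. test_function \<phi> \<longrightarrow>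
        ((\<lambda>t. (J h lam (\<lambda>x. u x + t * \<phi> x) - J h lam u) / t) \<longlongrightarrow> 0) (at_right 0))"


section \<open>The dual formulation\<close>

definition is_dual_change :: "(real \<Rightarrow> real) \<Rightarrow> bool" where
  "is_dual_change f \<longleftrightarrow>
     (\<forall>t. f (- t) = - f t) \<and> f 0 = 0 \<and>
     (\<forall>t. (f has_real_derivative (1 + 2 * (f t)\<^sup>2) powr (-1/2)) (at t))"

definition dual_change :: "real \<Rightarrow> real" where
  "dual_change = (THE f. is_dual_change f)"

text \<open>Well-definedness of \<open>dual_change\<close>, via its explicit inverse.\<close>

definition dual_inverse :: "real \<Rightarrow> real" where
  "dual_inverse s = s * sqrt (1 + 2 * s\<^sup>2) / 2 + arsinh (sqrt 2 * s) / (2 * sqrt 2)"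

lemma one_two_sq_pos: "1 + 2 * s\<^sup>2 > 0" for s :: real
  by (intro add_pos_nonneg) auto

lemma dual_inverse_deriv:
  "(dual_inverse has_real_derivative sqrt (1 + 2 * s\<^sup>2)) (at s)"
proof -
  let ?r = "sqrt (1 + 2 * s\<^sup>2)"
  have pos: "1 + 2 * s\<^sup>2 > 0" by (rule one_two_sq_pos)
  have r: "?r > 0" "?r * ?r = 1 + 2 * s\<^sup>2" using pos by auto
  have e: "(sqrt 2 * s)\<^sup>2 + 1 = 1 + 2 * s\<^sup>2" by (simp add: power_mult_distrib)
  have a: "((\<lambda>s. arsinh (sqrt 2 * s)) has_real_derivative 1 / ?r * sqrt 2) (at s)"
    using DERIV_chain2[OF arsinh_real_has_field_derivative[of "sqrt 2 * s"] DERIV_cmult_Id]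
    by (simp only: e)
  have "((\<lambda>s. 1 + 2 * s\<^sup>2) has_real_derivative 4 * s) (at s)"
    by (auto intro!: derivative_eq_intros)
  from DERIV_chain2[OF DERIV_real_sqrt[OF pos] this]
  have b: "((\<lambda>s. sqrt (1 + 2 * s\<^sup>2)) has_real_derivative inverse ?r / 2 * (4 * s)) (at s)" .
  have d: "(dual_inverse has_real_derivative
     (1 * ?r + inverse ?r / 2 * (4 * s) * s) / 2 + (1 / ?r * sqrt 2) / (2 * sqrt 2)) (at s)"
    unfolding dual_inverse_def
    by (rule DERIV_add[OF DERIV_cdivide[OF DERIV_mult[OF DERIV_ident b]] DERIV_cdivide[OF a]])
  have "(1 * ?r + inverse ?r / 2 * (4 * s) * s) / 2 + (1 / ?r * sqrt 2) / (2 * sqrt 2)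
        = (?r * ?r + (2 * s\<^sup>2 + 1)) / (2 * ?r)"
  proof -
    have "sqrt 2 / (2 * sqrt 2) = (1/2::real)" by simp
    then show ?thesis using r(1)
      by (simp add: divide_simps power2_eq_square del: real_sqrt_mult_self)
  qed
  also have "\<dots> = (?r * ?r + ?r * ?r) / (2 * ?r)" by (simp only: r(2) add.commute)
  also have "\<dots> = ?r" using r(1) by (simp only: add_divide_distrib) (simp add: field_simps)
  finally show ?thesis using d by simp
qed

lemma dual_inverse_strict_mono: "strict_mono dual_inverse"
proof (rule strict_monoI)
  fix x y :: real assume "x < y"
  moreover have "sqrt (1 + 2 * s\<^sup>2) > 0" for s :: real
    using one_two_sq_pos by simp
  ultimately show "dual_inverse x < dual_inverse y"
    using dual_inverse_deriv by (intro DERIV_pos_imp_increasing[of x y dual_inverse]) blast+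
qed

lemma dual_inverse_odd: "dual_inverse (- s) = - dual_inverse s"
  by (simp add: dual_inverse_def)

lemma dual_inverse_bij: "bij dual_inverse"
proof -
  have cont: "continuous_on A dual_inverse" for A
    by (rule DERIV_continuous_on[OF has_field_derivative_at_within[OF dual_inverse_deriv]])
  have ge: "dual_inverse s \<ge> s / 2" if "s \<ge> 0" for s
  proof -
    have le: "s * 1 \<le> s * sqrt (1 + 2 * s\<^sup>2)" using that by (intro mult_left_mono) auto
    have "arsinh (sqrt 2 * s) \<ge> 0"
      using that arsinh_real_neg_iff[of "sqrt 2 * s"] by (simp add: not_less[symmetric] mult_less_0_iff)
    then have ars: "arsinh (sqrt 2 * s) / (2 * sqrt 2) \<ge> 0" by simp
    show ?thesis using le ars unfolding dual_inverse_def by linarith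
  qed
  have nonneg: "\<exists>s. dual_inverse s = t" if "t \<ge> 0" for t
  proof -
    have "dual_inverse 0 \<le> t" "t \<le> dual_inverse (2 * t)"
      using that ge[of "2 * t"] by (auto simp: dual_inverse_def)
    then show ?thesis using IVT'[of dual_inverse 0 t "2 * t"] that cont by auto
  qed
  have "\<exists>s. dual_inverse s = t" for t
  proof (cases "t \<ge> 0")
    case False
    then obtain s where "dual_inverse s = - t" using nonneg[of "- t"] by auto
    then show ?thesis by (intro exI[of _ "- s"]) (simp add: dual_inverse_odd)
  qed (use nonneg in blast)
  then have "surj dual_inverse" by (metis surjI)
  then show ?thesis
    using dual_inverse_strict_mono strict_mono_imp_inj_on by (auto simp: bij_def)
qed

lemma sqrt_inverse_powr: "inverse (sqrt (1 + 2 * s\<^sup>2)) = (1 + 2 * s\<^sup>2) powr (-1/2)" for s :: real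
proof -
  have "1 + 2 * s\<^sup>2 > 0" by (rule one_two_sq_pos)
  then show ?thesis by (simp add: powr_half_sqrt[symmetric] powr_minus[symmetric])
qed

lemma ex1_dual_change: "\<exists>!f. is_dual_change f"
proof (rule ex1I)
  let ?f = "inv dual_inverse"
  have fg: "dual_inverse (?f t) = t" and gf: "?f (dual_inverse t) = t" for t
    using dual_inverse_bij by (auto simp: bij_def surj_f_inv_f)
  have gc: "isCont dual_inverse s" for s using dual_inverse_deriv DERIV_isCont by blast
  have "isCont ?f (dual_inverse s)" for s
    by (rule isCont_inverse_function[where d = 1]) (use gf gc in auto)
  then have fc: "isCont ?f t" for t by (metis fg)
  have "(?f has_real_derivative inverse (sqrt (1 + 2 * (?f t)\<^sup>2))) (at t)" for t
    by (rule DERIV_inverse_function[where a = "t - 1" and b = "t + 1"])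
       (use dual_inverse_deriv fg fc in \<open>auto simp: one_two_sq_pos less_imp_neq[symmetric]\<close>)
  moreover have "?f (- t) = - ?f t" for t by (metis fg gf dual_inverse_odd)
  moreover have "?f 0 = 0" using gf[of 0] by (simp add: dual_inverse_def)
  ultimately show "is_dual_change ?f" by (simp add: is_dual_change_def sqrt_inverse_powr)
  fix f assume f: "is_dual_change f"
  have "((\<lambda>t. dual_inverse (f t) - t) has_real_derivative 0) (at t)" for t
  proof -
    have p: "1 + 2 * (f t)\<^sup>2 > 0" by (rule one_two_sq_pos)
    have "(f has_real_derivative inverse (sqrt (1 + 2 * (f t)\<^sup>2))) (at t)"
      using f by (simp add: is_dual_change_def sqrt_inverse_powr)
    from DERIV_diff[OF DERIV_chain2[OF dual_inverse_deriv this] DERIV_ident]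
    show ?thesis using p by simp
  qed
  then have "dual_inverse (f t) - t = dual_inverse (f 0) - 0" for t
    by (rule DERIV_isconst_all[rule_format])
  then have "dual_inverse (f t) = t" for t
    using f by (simp add: is_dual_change_def dual_inverse_def)
  then show "f = ?f" by (metis gf ext)
qed

lemma dual_change: "is_dual_change dual_change"
  unfolding dual_change_def by (rule theI'[OF ex1_dual_change])

definition Psi :: "(real \<Rightarrow> real) \<Rightarrow> (real ^ 'n \<Rightarrow> real) \<Rightarrow> real" where
  "Psi h v = 1/2 * (LINT x|lebesgue. (norm (weak_gradient v x))\<^sup>2)
             - (LINT x|lebesgue. primitive h (dual_change (v x)))"

text \<open>The standing assumption on the energy. The integrability clause is what makes \<open>Psi\<close>
  well defined, since the library's integral of a non-integrable function is 0. Substituting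
  \<open>u = dual_change v\<close>, it also makes every integral in \<open>J h lam u\<close> converge for
  \<open>u \<in> K_set\<close>.\<close>

definition Psi_well_defined_C1 :: "'n::finite itself \<Rightarrow> (real \<Rightarrow> real) \<Rightarrow> bool" where
  "Psi_well_defined_C1 _ h \<longleftrightarrow>
     (\<forall>v\<in>H1. integrable lebesgue (\<lambda>x::real ^ 'n. primitive h (dual_change (v x)))) \<and>
     C1_on_H1 (Psi h :: (real ^ 'n \<Rightarrow> real) \<Rightarrow> real)"

end

theory Submission
  imports Defs
begin

text \<open>Let $p = 2^*$. For $N = 2$ condition (h2) cannot hold. For $N \ge 3$, testing the boundedness of
  \<open>Psi\<close> near 0 against concentrating dilations yields both the Sobolev inequality and the growth
  bound $H(t) \le C|t|^{2p}$. A Brezis--Kato argument improves the integrability of a solution $u$ just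
  enough to pass rigorously to the dual variable $v = f^{-1}(u)$ and to its Pohozaev identity
  $\int|\nabla v|^2 = p\int (H(u) + \frac\lambda2 u^2)$. The dual equation tested with $v$ gives
  $\int|\nabla v|^2 = \int (h(u) + \lambda u) f'(v) v$. Since $f'(v) v / u$ lies in $[1/2, 1]$ and
  $h(t) t \ge 2p H(t)$, the right-hand side is at least $p\int H(u) + \lambda\int u^2$. Comparing,
  $\lambda (\frac p2 - 1) \int u^2 \ge 0$, which forces $u = 0$ when $\lambda < 0$.\<close>

section \<open>Smooth functions\<close>

text \<open>A solution comes with no more than square integrability of \<open>u\<close>,
  \<open>|grad u|\<close> and \<open>u |grad u|\<close>, and its equation holds only for smooth test
  functions, so neither powers of \<open>u\<close> nor \<open>x . grad u\<close> can be inserted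
  directly. The flux \<open>(1 + 2 u^2) grad u\<close> is however the gradient of
  \<open>W = u + 2/3 u^3\<close>, so the problem reads \<open>- Laplace W = F\<close> with
  \<open>F\<close> merely locally integrable; after mollification it may be tested with bounded
  functions of \<open>W\<close>, and Fatou's lemma keeps an inequality in the limit. This inequality
  drives the Brezis-Kato step. The Pohozaev identity is likewise proved for mollified fields, which
  avoids second derivatives of \<open>v\<close>, but the passage to the limit uses local square
  integrability of the right-hand side of the dual equation. That right-hand side grows like
  \<open>|u|^(2p-2)\<close>, which dictates the target of the improvement: \<open>u\<close> in
  \<open>L^(4p)\<close>, together with \<open>u^3 grad u\<close> in \<open>L^2\<close>. The factor 2
  in the lower bound for \<open>\<mu>1\<close> pays exactly for the constant 1/2; the constant 1
  serves the term with the negative \<open>lam\<close>.\<close>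

lemma C_k_Suc_imp: "C_k (Suc k) \<phi> \<Longrightarrow> C_k k \<phi>"
proof (induction k arbitrary: \<phi>)
  case 0
  then have "isCont \<phi> x" for x
    by (auto simp: gderiv_def dest!: spec intro: has_derivative_continuous)
  then show ?case by (simp add: continuous_on_eq_continuous_at)
next
  case (Suc k)
  then obtain g where "\<forall>x. GDERIV \<phi> x :> g x" "\<forall>i. C_k (Suc k) (\<lambda>x. g x $ i)"
    by auto
  then show ?case using Suc.IH by (auto intro!: exI[of _ g])
qed

lemma C_k_cong: "C_k k \<phi> \<Longrightarrow> (\<And>x. \<phi> x = \<psi> x) \<Longrightarrow> C_k k \<psi>"
  by (metis ext)

lemma C_k_const: "C_k k (\<lambda>x :: real ^ 'n. c)"
proof (induction k arbitrary: c)
  case (Suc k)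
  have "GDERIV (\<lambda>x :: real ^ 'n. c) x :> 0" for x by (rule GDERIV_const)
  then show ?case using Suc by (auto intro!: exI[of _ "\<lambda>x. 0"])
qed simp

lemma GDERIV_component: "GDERIV (\<lambda>x :: real ^ 'n. x $ i) x :> axis i 1"
  unfolding gderiv_def
  by (rule has_derivative_eq_rhs, rule bounded_linear.has_derivative[OF bounded_linear_vec_nth], rule has_derivative_ident)
     (auto simp: inner_axis)

lemma C_k_component: "C_k k (\<lambda>x :: real ^ 'n. x $ i)"
proof (cases k)
  case (Suc m)
  show ?thesis unfolding Suc C_k.simps
    using GDERIV_component C_k_const by (intro exI[of _ "\<lambda>x. axis i 1"]) blast
qed (auto intro: continuous_intros)

lemma C_k_add:
  "C_k k \<phi> \<Longrightarrow> C_k k \<psi> \<Longrightarrow> C_k k (\<lambda>x. \<phi> x + \<psi> x)"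
proof (induction k arbitrary: \<phi> \<psi>)
  case (Suc k)
  then obtain g h where "\<forall>x. GDERIV \<phi> x :> g x" "\<forall>i. C_k k (\<lambda>x. g x $ i)"
    and "\<forall>x. GDERIV \<psi> x :> h x" "\<forall>i. C_k k (\<lambda>x. h x $ i)" by auto
  then show ?case using Suc.IH by (auto intro!: exI[of _ "\<lambda>x. g x + h x"] GDERIV_add)
qed (auto intro: continuous_intros)

lemma C_k_mult:
  "C_k k \<phi> \<Longrightarrow> C_k k \<psi> \<Longrightarrow> C_k k (\<lambda>x. \<phi> x * \<psi> x)"
proof (induction k arbitrary: \<phi> \<psi>)
  case (Suc k)
  then obtain g h where g: "\<forall>x. GDERIV \<phi> x :> g x" "\<forall>i. C_k k (\<lambda>x. g x $ i)"
    and h: "\<forall>x. GDERIV \<psi> x :> h x" "\<forall>i. C_k k (\<lambda>x. h x $ i)" by auto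
  have "C_k k (\<lambda>x. \<phi> x * h x $ i + \<psi> x * g x $ i)" for i
    using Suc g h by (intro C_k_add Suc.IH) (auto intro: C_k_Suc_imp simp del: C_k.simps)
  then show ?case using g h
    by (auto intro!: exI[of _ "\<lambda>x. \<phi> x *\<^sub>R h x + \<psi> x *\<^sub>R g x"] GDERIV_mult)
qed (auto intro: continuous_intros)

lemma C_k_sum: "finite I \<Longrightarrow> (\<And>i. i \<in> I \<Longrightarrow> C_k k (f i)) \<Longrightarrow> C_k k (\<lambda>x. \<Sum>i\<in>I. f i x)"
  by (induction I rule: finite_induct) (auto intro: C_k_const C_k_add)

text \<open>The outer function is supplied together with all its derivatives as a sequence
  \<open>E\<close>, so the chain rule only moves from \<open>E m\<close> to \<open>E (Suc m)\<close>
  and the induction closes for every \<open>m\<close> at once.\<close>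

lemma C_k_compose:
  assumes "\<And>m t. (E m has_real_derivative E (Suc m) t) (at t)"
  shows "C_k k \<phi> \<Longrightarrow> C_k k (\<lambda>x. E m (\<phi> x))"
proof (induction k arbitrary: m)
  case 0
  have "continuous_on UNIV (E m)"
    using assms by (meson DERIV_continuous continuous_at_imp_continuous_on)
  with 0 show ?case using continuous_on_compose2[of UNIV "E m" UNIV \<phi>] by simp
next
  case (Suc k)
  then obtain g where g: "\<forall>x. GDERIV \<phi> x :> g x" "\<forall>i. C_k k (\<lambda>x. g x $ i)" by auto
  have "C_k k (\<lambda>x. E (Suc m) (\<phi> x) * g x $ i)" for i
    using Suc g by (intro C_k_mult Suc.IH) (auto intro: C_k_Suc_imp simp del: C_k.simps)
  moreover have "GDERIV (\<lambda>x. E m (\<phi> x)) x :> E (Suc m) (\<phi> x) *\<^sub>R g x" for x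
    by (rule GDERIV_DERIV_compose) (use g assms in auto)
  ultimately show ?case
    unfolding C_k.simps by (intro exI[of _ "\<lambda>x. E (Suc m) (\<phi> x) *\<^sub>R g x"]) simp
qed

lemma GDERIV_dilate:
  assumes "GDERIV \<phi> (r *\<^sub>R x) :> d"
  shows "GDERIV (\<lambda>x. \<phi> (r *\<^sub>R x)) x :> r *\<^sub>R d"
proof -
  have "((\<lambda>x. r *\<^sub>R x) has_derivative (\<lambda>h. r *\<^sub>R h)) (at x)"
    by (auto intro!: derivative_eq_intros)
  from has_derivative_compose[OF this assms[unfolded gderiv_def]] show ?thesis
    by (simp add: gderiv_def)
qed

lemma C_k_dilate: "C_k k \<phi> \<Longrightarrow> C_k k (\<lambda>x. \<phi> (r *\<^sub>R x))"
proof (induction k arbitrary: \<phi>)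
  case 0
  then have "continuous_on UNIV \<phi>" by simp
  from continuous_on_compose2[OF this continuous_on_scaleR[OF continuous_on_const continuous_on_id]] show ?case
    by simp
next
  case (Suc k)
  then obtain g where g: "\<forall>x. GDERIV \<phi> x :> g x" "\<forall>i. C_k k (\<lambda>x. g x $ i)" by auto
  have "C_k k (\<lambda>x. r * g (r *\<^sub>R x) $ i)" for i
    using C_k_mult[OF C_k_const Suc.IH[OF g(2)[rule_format]]] .
  moreover have "GDERIV (\<lambda>x. \<phi> (r *\<^sub>R x)) x :> r *\<^sub>R g (r *\<^sub>R x)" for x
    by (rule GDERIV_dilate) (use g in blast)
  ultimately show ?case
    unfolding C_k.simps by (intro exI[of _ "\<lambda>x. r *\<^sub>R g (r *\<^sub>R x)"]) simp
qed

lemma test_function_C_k: "test_function \<phi> \<Longrightarrow> C_k k \<phi>"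
  by (simp add: test_function_def)

section \<open>A smooth bump\<close>

text \<open>The family \<open>p(1/t) * exp(-1/t)\<close>, extended by 0, is closed under
  differentiation. Smoothness at the origin then follows from a single argument for all polynomials
  \<open>p\<close>, without formulas for higher derivatives.\<close>

definition exp_cut :: "real poly \<Rightarrow> real \<Rightarrow> real" where
  "exp_cut p t = (if t > 0 then poly p (1 / t) * exp (- (1 / t)) else 0)"

definition exp_cut_step :: "real poly \<Rightarrow> real poly" where
  "exp_cut_step p = [:0, 0, 1:] * (p - pderiv p)"

lemma poly_exp_tendsto_0: "((\<lambda>s. poly p s * exp (- s)) \<longlongrightarrow> (0::real)) at_top"
proof -
  have "((\<lambda>s. \<Sum>i\<le>degree p. coeff p i * (s ^ i / exp s)) \<longlongrightarrow> (\<Sum>i\<le>degree p. coeff p i * 0)) at_top"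
    by (intro tendsto_intros tendsto_power_div_exp_0)
  moreover have "(\<Sum>i\<le>degree p. coeff p i * (s ^ i / exp s)) = poly p s * exp (- s)" for s
    by (simp add: poly_altdef exp_minus sum_distrib_right divide_simps)
  ultimately show ?thesis by simp
qed

lemma exp_cut_deriv: "(exp_cut p has_real_derivative exp_cut (exp_cut_step p) t) (at t)"
proof -
  consider "t > 0" | "t < 0" | "t = 0" by linarith
  then show ?thesis
  proof cases
    case 1
    have "((\<lambda>t. poly p (1 / t) * exp (- (1 / t))) has_real_derivative
        poly (exp_cut_step p) (1 / t) * exp (- (1 / t))) (at t)"
      using 1 by (auto intro!: derivative_eq_intros DERIV_chain2[OF poly_DERIV]
          simp: exp_cut_step_def field_simps power2_eq_square)
    moreover have "eventually (\<lambda>t. poly p (1 / t) * exp (- (1 / t)) = exp_cut p t) (nhds t)"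
      using eventually_nhds_in_open[of "{0<..}" t] 1
      by (auto elim!: eventually_mono simp: exp_cut_def)
    ultimately have "(exp_cut p has_real_derivative
        poly (exp_cut_step p) (1 / t) * exp (- (1 / t))) (at t)"
      using DERIV_cong_ev[of t t "\<lambda>t. poly p (1 / t) * exp (- (1 / t))" "exp_cut p"] by blast
    then show ?thesis using 1 by (simp add: exp_cut_def)
  next
    case 2
    have "eventually (\<lambda>t. 0 = exp_cut p t) (nhds t)"
      using eventually_nhds_in_open[of "{..<0}" t] 2
      by (auto elim!: eventually_mono simp: exp_cut_def)
    then have "(exp_cut p has_real_derivative 0) (at t) \<longleftrightarrow> ((\<lambda>t. 0) has_real_derivative 0) (at t)"
      by (intro DERIV_cong_ev) (auto elim: eventually_mono)
    then show ?thesis using 2 by (simp add: exp_cut_def)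
  next
    case 3
    have lim: "((\<lambda>h. exp_cut p h / h) \<longlongrightarrow> 0) (at 0)"
    proof (rule filterlim_split_at)
      have "eventually (\<lambda>h::real. 0 = exp_cut p h / h) (at_left 0)"
        by (auto simp: exp_cut_def eventually_at_filter)
      then show "((\<lambda>h. exp_cut p h / h) \<longlongrightarrow> 0) (at_left 0)"
        by (rule tendsto_eventually[OF eventually_mono]) auto
      \<comment> \<open>With \<open>s = 1/h\<close> the quotient \<open>exp_cut p h / h\<close> is
        \<open>s * p(s) * exp(- s)\<close>, and \<open>pCons 0 p\<close> is the polynomial
        \<open>s * p(s)\<close>.\<close>
      have "((\<lambda>h. poly (pCons 0 p) (inverse h) * exp (- inverse h)) \<longlongrightarrow> 0) (at_right 0)"
        using filterlim_compose[OF poly_exp_tendsto_0 filterlim_inverse_at_top_right] .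
      moreover have "eventually (\<lambda>h::real. poly (pCons 0 p) (inverse h) * exp (- inverse h) = exp_cut p h / h) (at_right 0)"
        using eventually_at_right_less[of "0::real"]
        by eventually_elim (auto simp: exp_cut_def field_simps)
      ultimately show "((\<lambda>h. exp_cut p h / h) \<longlongrightarrow> 0) (at_right 0)"
        by (rule Lim_transform_eventually)
    qed
    then show ?thesis using 3 by (simp add: DERIV_def exp_cut_def)
  qed
qed

text \<open>The \<open>m\<close>-th derivative of \<open>exp(-1/t)\<close> on the positive half
  line, zero elsewhere: a sequence in the form that \<open>C_k_compose\<close> asks for.\<close>

definition bump :: "nat \<Rightarrow> real \<Rightarrow> real" where
  "bump m = exp_cut ((exp_cut_step ^^ m) 1)"

lemma bump_deriv: "(bump m has_real_derivative bump (Suc m) t) (at t)"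
  unfolding bump_def using exp_cut_deriv by simp

lemma bump_0: "t \<le> 0 \<Longrightarrow> bump m t = 0"
  by (simp add: bump_def exp_cut_def)

lemma bump_pos: "t > 0 \<Longrightarrow> bump 0 t > 0"
  by (simp add: bump_def exp_cut_def)

lemma bump_nonneg: "bump 0 t \<ge> 0"
  by (simp add: bump_def exp_cut_def)

lemma bump_cont: "continuous_on A (bump m)"
  using bump_deriv by (meson DERIV_continuous continuous_at_imp_continuous_on)

section \<open>Integration\<close>

lemma
  fixes f :: "'a::euclidean_space \<Rightarrow> 'b::{banach, second_countable_topology}"
  assumes c: "c \<noteq> 0"
  shows lebesgue_integrable_affine_iff:
      "integrable lebesgue (\<lambda>x. f (t + c *\<^sub>R x)) \<longleftrightarrow> integrable lebesgue f" (is ?A)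
    and lebesgue_integral_affine:
      "(LINT x|lebesgue. f x) = (\<bar>c\<bar> ^ DIM('a)) *\<^sub>R (LINT x|lebesgue. f (t + c *\<^sub>R x))" (is ?B)
proof -
  have T: "(t + (\<Sum>j\<in>Basis. (c * (x \<bullet> j)) *\<^sub>R j)) = t + c *\<^sub>R x" for x t :: 'a and c
    unfolding scaleR_scaleR[symmetric] scaleR_sum_right[symmetric] euclidean_representation ..
  have eq: "lebesgue = density (distr lebesgue lebesgue (\<lambda>x. t + c *\<^sub>R x)) (\<lambda>_. ennreal (\<bar>c\<bar> ^ DIM('a)))"
    if "c \<noteq> 0" for c and t :: 'a
    using lebesgue_affine_euclidean[where c = "\<lambda>_ :: 'a. c" and t = t] that
    by (simp add: T prod_constant)
  have m[measurable]: "(\<lambda>x. t + c *\<^sub>R x) \<in> lebesgue \<rightarrow>\<^sub>M lebesgue" if "c \<noteq> 0" for c and t :: 'a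
    using lebesgue_affine_measurable[where c = "\<lambda>_ :: 'a. c" and t = t] that
    by (simp add: T)
  have imp: "integrable lebesgue (\<lambda>x. f (t + c *\<^sub>R x))"
    if f: "integrable lebesgue f" and c: "c \<noteq> 0" for c and t :: 'a and f :: "'a \<Rightarrow> 'b"
  proof -
    have [measurable]: "f \<in> borel_measurable lebesgue" using f by auto
    have "integrable (density (distr lebesgue lebesgue (\<lambda>x. t + c *\<^sub>R x)) (\<lambda>_. ennreal (\<bar>c\<bar> ^ DIM('a)))) f"
      using f eq[OF c, of t] by simp
    then have "integrable (distr lebesgue lebesgue (\<lambda>x. t + c *\<^sub>R x)) (\<lambda>x. (\<bar>c\<bar> ^ DIM('a)) *\<^sub>R f x)"
      by (subst (asm) integrable_density) auto
    from integrable_scaleR_right[OF this, of "inverse (\<bar>c\<bar> ^ DIM('a))"]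
    have "integrable (distr lebesgue lebesgue (\<lambda>x. t + c *\<^sub>R x)) f"
      using c by simp
    then show ?thesis
      by (subst (asm) integrable_distr_eq) (use m[OF c] in auto)
  qed
  show ?A
  proof
    assume "integrable lebesgue (\<lambda>x. f (t + c *\<^sub>R x))"
    from imp[OF this, of "inverse c" "- (inverse c *\<^sub>R t)"] c
    show "integrable lebesgue f" by (simp add: algebra_simps)
  qed (use imp c in blast)
  show ?B
  proof (cases "integrable lebesgue f")
    case True
    then have [measurable]: "f \<in> borel_measurable lebesgue" by auto
    have "(LINT x|lebesgue. f x) =
        (LINT x|density (distr lebesgue lebesgue (\<lambda>x. t + c *\<^sub>R x)) (\<lambda>_. ennreal (\<bar>c\<bar> ^ DIM('a))). f x)"
      using eq[OF c, of t] by simp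
    also have "\<dots> = (LINT x|distr lebesgue lebesgue (\<lambda>x. t + c *\<^sub>R x). (\<bar>c\<bar> ^ DIM('a)) *\<^sub>R f x)"
      by (subst integral_density) auto
    also have "\<dots> = (\<bar>c\<bar> ^ DIM('a)) *\<^sub>R (LINT x|distr lebesgue lebesgue (\<lambda>x. t + c *\<^sub>R x). f x)"
      by simp
    also have "(LINT x|distr lebesgue lebesgue (\<lambda>x. t + c *\<^sub>R x). f x) = (LINT x|lebesgue. f (t + c *\<^sub>R x))"
      by (subst integral_distr) (use m[OF c] in auto)
    finally show ?thesis .
  next
    \<comment> \<open>Neither side is integrable, so both integrals take the default value
      0.\<close>
    case False
    with \<open>?A\<close> show ?thesis by (simp add: not_integrable_integral_eq)
  qed
qed

lemma integrable_bounded_scaleR: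
  fixes u :: "'a \<Rightarrow> 'b::{banach, second_countable_topology}"
  assumes "integrable M u" "\<phi> \<in> borel_measurable M" "AE x in M. \<bar>\<phi> x\<bar> \<le> B"
  shows "integrable M (\<lambda>x. \<phi> x *\<^sub>R u x)"
proof (rule Bochner_Integration.integrable_bound)
  show "integrable M (\<lambda>x. B *\<^sub>R u x)" using assms by simp
  show "(\<lambda>x. \<phi> x *\<^sub>R u x) \<in> borel_measurable M" using assms by measurable
  show "AE x in M. norm (\<phi> x *\<^sub>R u x) \<le> norm (B *\<^sub>R u x)"
    using assms(3) by eventually_elim (auto intro!: mult_right_mono)
qed

lemma continuous_on_imp_lebesgue_measurable:
  fixes f :: "'a::euclidean_space \<Rightarrow> 'b::topological_space"
  shows "continuous_on UNIV f \<Longrightarrow> f \<in> borel_measurable lebesgue"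
  by (intro measurable_completion) (simp add: borel_measurable_continuous_onI)

lemma continuous_supp_bounded:
  fixes f :: "'a::euclidean_space \<Rightarrow> 'b::real_normed_vector"
  assumes "continuous_on UNIV f" "\<And>x. norm x > R \<Longrightarrow> f x = 0"
  obtains B where "\<And>x. norm (f x) \<le> B" "B > 0"
proof -
  have "compact (f ` cball 0 R)"
    using assms(1) by (intro compact_continuous_image) (auto intro: continuous_on_subset)
  then obtain B where "\<forall>y\<in>f ` cball 0 R. norm y \<le> B"
    using compact_imp_bounded[of "f ` cball 0 R"] unfolding bounded_iff by blast
  then have B: "\<And>x. norm x \<le> R \<Longrightarrow> norm (f x) \<le> B" by auto
  show thesis
  proof (rule that[of "max B 1"])
    show "norm (f x) \<le> max B 1" for x
      using B[of x] assms(2)[of x] by (cases "norm x \<le> R") auto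
  qed auto
qed

lemma integrable_continuous_supp:
  fixes f :: "'a::euclidean_space \<Rightarrow> 'b::{banach, second_countable_topology}"
  assumes "continuous_on UNIV f" "\<And>x. norm x > R \<Longrightarrow> f x = 0"
  shows "integrable lebesgue f"
proof -
  have "integrable lborel (\<lambda>x. indicator (cball 0 R) x *\<^sub>R f x)"
    using assms(1) by (intro borel_integrable_compact) (auto intro: continuous_on_subset)
  moreover have "(\<lambda>x. indicator (cball 0 R) x *\<^sub>R f x) = f"
    using assms(2) by (auto simp: indicator_def)
  ultimately show ?thesis
    using assms(1) by (simp add: integrable_completion borel_measurable_continuous_onI)
qed

lemma integrable_supp_scaleR:
  fixes u :: "real ^ 'n \<Rightarrow> 'b::euclidean_space"
  assumes "locally_integrable u" "continuous_on UNIV \<phi>" "\<And>x. norm x > R \<Longrightarrow> \<phi> x = 0"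
  shows "integrable lebesgue (\<lambda>x. \<phi> x *\<^sub>R u x)"
proof -
  obtain B where B: "\<And>x. norm (\<phi> x) \<le> B" using continuous_supp_bounded[OF assms(2,3)] by blast
  have "integrable lebesgue (\<lambda>x. indicator (cball 0 R) x *\<^sub>R u x)"
    using assms(1) by (auto simp: locally_integrable_def set_integrable_def)
  then have "integrable lebesgue (\<lambda>x. \<phi> x *\<^sub>R (indicator (cball 0 R) x *\<^sub>R u x))"
    by (rule integrable_bounded_scaleR[where B = B])
      (use B assms(2) in \<open>auto intro: continuous_on_imp_lebesgue_measurable\<close>)
  moreover have "(\<lambda>x. \<phi> x *\<^sub>R indicator (cball 0 R) x *\<^sub>R u x) = (\<lambda>x. \<phi> x *\<^sub>R u x)"
    using assms(3) by (auto simp: indicator_def fun_eq_iff not_le[symmetric])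
  ultimately show ?thesis by simp
qed

lemma GDERIV_along_line:
  fixes f :: "'a::euclidean_space \<Rightarrow> real"
  assumes "\<And>x. GDERIV f x :> g x"
  shows "((\<lambda>t. f (x + t *\<^sub>R e)) has_real_derivative g (x + t *\<^sub>R e) \<bullet> e) (at t)"
proof -
  have "((\<lambda>t. x + t *\<^sub>R e) has_derivative (\<lambda>h. h *\<^sub>R e)) (at t)"
    by (auto intro!: derivative_eq_intros)
  from has_derivative_compose[OF this assms[unfolded gderiv_def]]
  show ?thesis
    unfolding has_field_derivative_def by (rule has_derivative_eq_rhs) (auto simp: inner_commute)
qed

lemma GDERIV_lipschitz:
  fixes f :: "'a::euclidean_space \<Rightarrow> real"
  assumes "\<And>x. GDERIV f x :> g x" "\<And>x. norm (g x) \<le> B"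
  shows "\<bar>f y - f x\<bar> \<le> B * norm (y - x)"
proof -
  obtain t where "0 < t" "t < 1"
    and t: "f (x + 1 *\<^sub>R (y - x)) - f (x + 0 *\<^sub>R (y - x)) = (1 - 0) * (g (x + t *\<^sub>R (y - x)) \<bullet> (y - x))"
    using MVT2[of 0 1 "\<lambda>t. f (x + t *\<^sub>R (y - x))" "\<lambda>t. g (x + t *\<^sub>R (y - x)) \<bullet> (y - x)"]
      GDERIV_along_line[of f g x "y - x", OF assms(1)] by auto
  have "\<bar>g (x + t *\<^sub>R (y - x)) \<bullet> (y - x)\<bar> \<le> norm (g (x + t *\<^sub>R (y - x))) * norm (y - x)"
    by (rule Cauchy_Schwarz_ineq2)
  also have "\<dots> \<le> B * norm (y - x)" by (intro mult_right_mono assms(2)) simp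
  finally show ?thesis using t by simp
qed

lemma GDERIV_supp:
  fixes f :: "'a::euclidean_space \<Rightarrow> real"
  assumes "\<And>x. GDERIV f x :> g x" "\<And>x. norm x > R \<Longrightarrow> f x = 0" "norm x > R"
  shows "g x = 0"
proof -
  have "eventually (\<lambda>y. y \<in> - cball 0 R) (nhds x)"
    using assms(3) by (intro eventually_nhds_in_open) auto
  then have ev: "eventually (\<lambda>y. f y = 0) (at x)"
    using assms(2) by (auto simp: eventually_at_filter elim: eventually_mono)
  have "((\<lambda>y. 0) has_derivative (\<lambda>h. h \<bullet> g x)) (at x)"
    using has_derivative_transform_eventually[OF assms(1)[of x, unfolded gderiv_def] ev] assms(2,3) by simp
  then have "(\<lambda>h. h \<bullet> g x) = (\<lambda>h. 0)"
    using has_derivative_unique[OF _ has_derivative_const] by blast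
  then have "g x \<bullet> g x = 0" by metis
  then show ?thesis by simp
qed

lemma GDERIV_continuous_on: "(\<And>x. GDERIV f x :> g x) \<Longrightarrow> continuous_on A f"
  unfolding gderiv_def
  by (rule continuous_at_imp_continuous_on) (auto dest: has_derivative_continuous)

text \<open>Translation invariance makes the integral of a difference quotient vanish.\<close>

lemma integral_GDERIV_eq_0:
  fixes f :: "'a::euclidean_space \<Rightarrow> real"
  assumes f: "\<And>x. GDERIV f x :> g x" and g: "continuous_on UNIV g"
    and supp: "\<And>x. norm x > R \<Longrightarrow> f x = 0"
  shows "integrable lebesgue g" "(LINT x|lebesgue. g x) = 0"
proof -
  have gsupp: "g x = 0" if "norm x > R" for x using GDERIV_supp[OF f supp that] .
  show int: "integrable lebesgue g" using integrable_continuous_supp[OF g gsupp] .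
  obtain B where B: "\<And>x. norm (g x) \<le> B" "B > 0" using continuous_supp_bounded[OF g gsupp] by blast
  have fc: "continuous_on UNIV f" using GDERIV_continuous_on[OF f] .
  have fi: "integrable lebesgue f" using integrable_continuous_supp[OF fc supp] .
  have "(LINT x|lebesgue. g x \<bullet> e) = 0" if e: "e \<in> Basis" for e :: 'a
  proof -
    define F where "F n x = (f (inverse (real (Suc n)) *\<^sub>R e + x) - f x) / inverse (real (Suc n))" for n x
    have tr: "integrable lebesgue (\<lambda>x. f (a + x)) \<and> (LINT x|lebesgue. f (a + x)) = (LINT x|lebesgue. f x)" for a
      using lebesgue_integrable_affine_iff[of 1 f a] lebesgue_integral_affine[of 1 f a] fi by simp
    have Fi: "integrable lebesgue (F n)" and F0: "(LINT x|lebesgue. F n x) = 0" for n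
      unfolding F_def using tr fi by auto
    \<comment> \<open>The quotients are bounded by \<open>B\<close> through the Lipschitz estimate
      and vanish outside the ball of radius \<open>R + 1\<close>, because the shift has length at
      most 1.\<close>
    have "(\<lambda>n. LINT x|lebesgue. F n x) \<longlonglongrightarrow> (LINT x|lebesgue. g x \<bullet> e)"
    proof (rule integral_dominated_convergence[where w = "\<lambda>x. B *\<^sub>R indicator (cball 0 (R + 1)) x"])
      show "integrable lebesgue (\<lambda>x :: 'a. B *\<^sub>R indicator (cball 0 (R + 1)) x :: real)"
        by (intro integrable_scaleR_right integrable_real_indicator)
          (use emeasure_lborel_cball_finite[of "0 :: 'a" "R + 1"] in \<open>auto simp: less_top[symmetric]\<close>)
      show "AE x in lebesgue. (\<lambda>n. F n x) \<longlonglongrightarrow> g x \<bullet> e"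
      proof (intro AE_I2)
        fix x
        have "((\<lambda>h. (f (x + h *\<^sub>R e) - f x) / h) \<longlongrightarrow> g x \<bullet> e) (at 0)"
          using GDERIV_along_line[of f g x e 0, OF f] by (simp add: DERIV_def)
        moreover have "filterlim (\<lambda>n. inverse (real (Suc n))) (at 0) sequentially"
          using LIMSEQ_inverse_real_of_nat by (auto simp: filterlim_at)
        ultimately show "(\<lambda>n. F n x) \<longlonglongrightarrow> g x \<bullet> e"
          unfolding F_def by (auto dest: filterlim_compose simp: add.commute)
      qed
      show "AE x in lebesgue. norm (F n x) \<le> B *\<^sub>R indicator (cball 0 (R + 1)) x" for n
      proof (intro AE_I2)
        fix x
        let ?h = "inverse (real (Suc n))"
        have h: "?h > 0" "?h \<le> 1" by (auto simp: field_simps)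
        show "norm (F n x) \<le> B *\<^sub>R indicator (cball 0 (R + 1)) x"
        proof (cases "norm x \<le> R + 1")
          case True
          have "\<bar>f (?h *\<^sub>R e + x) - f x\<bar> \<le> B * norm (?h *\<^sub>R e + x - x)"
            by (rule GDERIV_lipschitz[OF f B(1)])
          then have "\<bar>f (?h *\<^sub>R e + x) - f x\<bar> \<le> B * ?h" using e h by (simp del: of_nat_Suc)
          then show ?thesis using True h
            by (simp add: F_def pos_divide_le_eq del: of_nat_Suc)
        next
          case False
          have "norm x \<le> norm (?h *\<^sub>R e + x) + norm (?h *\<^sub>R e)"
            using norm_triangle_ineq4[of "?h *\<^sub>R e + x" "?h *\<^sub>R e"] by simp
          moreover have "norm (?h *\<^sub>R e) \<le> 1" using e h by (simp del: of_nat_Suc)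
          ultimately have "f (?h *\<^sub>R e + x) = 0" "f x = 0" using False by (intro supp; linarith)+
          then show ?thesis using False by (simp add: F_def)
        qed
      qed
      show "F n \<in> borel_measurable lebesgue" for n using Fi by blast
    qed (use int in auto)
    then show ?thesis using F0 by (simp add: LIMSEQ_const_iff)
  qed
  then have "(LINT x|lebesgue. g x) \<bullet> e = 0" if "e \<in> Basis" for e
    using that int by simp
  then show "(LINT x|lebesgue. g x) = 0"
    by (metis euclidean_eqI inner_zero_left)
qed

text \<open>Only the product has to vanish far out, so bounded support of \<open>\<psi>\<close>
  suffices and \<open>\<phi>\<close> may be any continuously differentiable function.\<close>

lemma integral_by_parts:
  fixes \<phi> \<psi> :: "'a::euclidean_space \<Rightarrow> real"
  assumes "\<And>x. GDERIV \<phi> x :> g x" "continuous_on UNIV g" "\<And>x. GDERIV \<psi> x :> k x" "continuous_on UNIV k"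
    and "\<And>x. norm x > R \<Longrightarrow> \<psi> x = 0"
  shows "(LINT x|lebesgue. \<phi> x *\<^sub>R k x) = - (LINT x|lebesgue. \<psi> x *\<^sub>R g x)"
proof -
  have c: "continuous_on UNIV \<phi>" "continuous_on UNIV \<psi>" using assms GDERIV_continuous_on by blast+
  have k0: "k x = 0" if "norm x > R" for x using GDERIV_supp[OF assms(3,5) that] .
  have i1: "integrable lebesgue (\<lambda>x. \<phi> x *\<^sub>R k x)" "integrable lebesgue (\<lambda>x. \<psi> x *\<^sub>R g x)"
    by (rule integrable_continuous_supp[where R = R]; (intro continuous_intros c assms | simp add: k0 assms(5)))+
  have "GDERIV (\<lambda>x. \<phi> x * \<psi> x) x :> \<phi> x *\<^sub>R k x + \<psi> x *\<^sub>R g x" for x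
    by (rule GDERIV_mult[OF assms(1,3)])
  then have "(LINT x|lebesgue. \<phi> x *\<^sub>R k x + \<psi> x *\<^sub>R g x) = 0"
  proof (rule integral_GDERIV_eq_0(2)[where R = R])
    show "continuous_on UNIV (\<lambda>x. \<phi> x *\<^sub>R k x + \<psi> x *\<^sub>R g x)"
      by (intro continuous_intros c assms)
  qed (simp add: assms(5))
  then show ?thesis using i1 by (simp add: eq_neg_iff_add_eq_0)
qed

section \<open>Mollification\<close>

definition kern :: "real \<Rightarrow> real ^ 'n \<Rightarrow> real" where
  "kern e x = bump 0 (1 - (x \<bullet> x) / e\<^sup>2)"

definition moll :: "real \<Rightarrow> real ^ 'n \<Rightarrow> real" where
  "moll e x = kern e x / (LINT y|lebesgue. kern e (y :: real ^ 'n))"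

text \<open>The kernel depends on \<open>x \<bullet> x\<close> only, so each differentiation of a
  radial factor produces a new radial factor times \<open>x\<close>. \<open>moll_slope m\<close> is
  the factor after \<open>m\<close> steps; the values 0, 1 and 2 of \<open>m\<close> give the
  kernel, its gradient and its Hessian.\<close>

definition moll_slope :: "nat \<Rightarrow> real \<Rightarrow> real ^ 'n \<Rightarrow> real" where
  "moll_slope m e x = (- 2 / e\<^sup>2) ^ m * bump m (1 - (x \<bullet> x) / e\<^sup>2) / (LINT y|lebesgue. kern e (y :: real ^ 'n))"

definition moll_grad :: "real \<Rightarrow> real ^ 'n \<Rightarrow> real ^ 'n" where
  "moll_grad e x = moll_slope 1 e x *\<^sub>R x"

definition moll_hess :: "real \<Rightarrow> real ^ 'n \<Rightarrow> 'n \<Rightarrow> real ^ 'n" where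
  "moll_hess e x j = moll_slope 1 e x *\<^sub>R axis j 1 + (x $ j * moll_slope 2 e x) *\<^sub>R x"

definition conv :: "(real ^ 'n \<Rightarrow> real) \<Rightarrow> (real ^ 'n \<Rightarrow> 'b::euclidean_space) \<Rightarrow> real ^ 'n \<Rightarrow> 'b" where
  "conv \<phi> u x = (LINT y|lebesgue. \<phi> (x - y) *\<^sub>R u y)"

lemma moll_slope_0: "moll_slope 0 e = moll e"
  by (simp add: moll_slope_def moll_def kern_def fun_eq_iff)

lemma GDERIV_moll_slope:
  fixes x :: "real ^ 'n"
  shows "GDERIV (moll_slope m e) x :> moll_slope (Suc m) e x *\<^sub>R x"
proof -
  have "((\<lambda>x::real ^ 'n. 1 - (x \<bullet> x) / e\<^sup>2) has_derivative (\<lambda>h. - (2 * (h \<bullet> x) / e\<^sup>2))) (at x)"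
    unfolding divide_inverse
    by (auto intro!: derivative_eq_intros simp: inner_commute)
  then have "GDERIV (\<lambda>x::real ^ 'n. 1 - (x \<bullet> x) / e\<^sup>2) x :> (- 2 / e\<^sup>2) *\<^sub>R x"
    by (simp add: gderiv_def)
  from GDERIV_DERIV_compose[OF this bump_deriv[of m]]
  have "GDERIV (\<lambda>x::real ^ 'n. bump m (1 - (x \<bullet> x) / e\<^sup>2)) x :>
      bump (Suc m) (1 - (x \<bullet> x) / e\<^sup>2) *\<^sub>R (- 2 / e\<^sup>2) *\<^sub>R x" .
  from GDERIV_mult[OF GDERIV_const[of "(- 2 / e\<^sup>2) ^ m / (LINT y|lebesgue. kern e (y :: real ^ 'n))"] this]
  have "GDERIV (\<lambda>x::real ^ 'n. (- 2 / e\<^sup>2) ^ m / (LINT y|lebesgue. kern e (y :: real ^ 'n)) * bump m (1 - (x \<bullet> x) / e\<^sup>2)) x :>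
      moll_slope (Suc m) e x *\<^sub>R x"
    by (rule GDERIV_subst) (simp add: moll_slope_def mult_ac)
  then show ?thesis by (simp add: moll_slope_def[abs_def] mult_ac)
qed

lemma GDERIV_moll: "GDERIV (moll e) x :> moll_grad e x"
  using GDERIV_moll_slope[of 0 e x] by (simp add: moll_slope_0 moll_grad_def)

lemma GDERIV_moll_grad: "GDERIV (\<lambda>x. moll_grad e x $ j) x :> moll_hess e x j"
  using GDERIV_mult[OF GDERIV_moll_slope[of 1 e x] GDERIV_component[of j x]]
  by (simp add: moll_grad_def moll_hess_def numeral_2_eq_2)

lemma moll_hess_sym: "moll_hess e x j $ i = moll_hess e x i $ j"
  by (simp add: moll_hess_def axis_def)

lemma moll_slope_supp: "0 < e \<Longrightarrow> norm x \<ge> e \<Longrightarrow> moll_slope m e x = 0"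
  by (auto simp: moll_slope_def dot_square_norm power_mono intro!: bump_0)

lemma C_k_moll_slope_shift:
  fixes x :: "real ^ 'n"
  shows "C_k k (\<lambda>y. moll_slope m e (x - y))"
proof -
  let ?c = "(- 2 / e\<^sup>2) ^ m / (LINT y|lebesgue. kern e (y :: real ^ 'n))"
  let ?s = "\<lambda>y::real ^ 'n. 1 + (- 1 / e\<^sup>2) * (\<Sum>i\<in>UNIV. (x $ i + - 1 * y $ i) * (x $ i + - 1 * y $ i))"
  have "C_k k (\<lambda>y. ?c * bump m (?s y))"
    by (intro C_k_mult C_k_const C_k_compose[of bump, OF bump_deriv] C_k_add C_k_sum C_k_component) auto
  then show ?thesis
    by (rule C_k_cong) (simp add: moll_slope_def inner_vec_def mult_ac)
qed

text \<open>The factor \<open>q\<close> is 1 for the kernel and a coordinate of \<open>x - y\<close>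
  for a component of its gradient; both have to be admissible test functions, the second one for the
  symmetry of mollified Jacobians.\<close>

lemma test_function_moll_slope:
  fixes x :: "real ^ 'n"
  assumes "0 < e" "\<And>k. C_k k q"
  shows "test_function (\<lambda>y. moll_slope m e (x - y) * q y)"
proof -
  have "{y. moll_slope m e (x - y) * q y \<noteq> 0} \<subseteq> cball x e"
    using moll_slope_supp[OF assms(1)] by (force simp: dist_norm not_le[symmetric] dest: less_imp_le)
  then have "compact (closure {y. moll_slope m e (x - y) * q y \<noteq> 0})"
    using bounded_subset[OF bounded_cball] by (simp add: compact_closure)
  then show ?thesis
    using assms by (auto simp: test_function_def intro!: C_k_mult C_k_moll_slope_shift)
qed

lemma GDERIV_reflect:
  assumes "GDERIV \<phi> (x - y) :> d"
  shows "GDERIV (\<lambda>y. \<phi> (x - y)) y :> - d"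
proof -
  have "((\<lambda>y. x - y) has_derivative (\<lambda>h. - h)) (at y)"
    by (auto intro!: derivative_eq_intros)
  from has_derivative_compose[OF this assms[unfolded gderiv_def]]
  show ?thesis by (simp add: gderiv_def)
qed

lemma test_function_moll:
  assumes "0 < e"
  shows "test_function (\<lambda>y. moll e (x - y))" "GDERIV (\<lambda>y. moll e (x - y)) y :> - moll_grad e (x - y)"
  using test_function_moll_slope[OF assms C_k_const[where c = 1], where m = 0 and x = x]
  by (simp_all add: moll_slope_0 GDERIV_reflect GDERIV_moll)

lemma test_function_moll_grad:
  assumes "0 < e"
  shows "test_function (\<lambda>y. moll_grad e (x - y) $ j)"
    "GDERIV (\<lambda>y. moll_grad e (x - y) $ j) y :> - moll_hess e (x - y) j"
proof -
  have "C_k k (\<lambda>y. x $ j + - 1 * y $ j)" for k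
    by (intro C_k_add C_k_mult C_k_const C_k_component)
  then show "test_function (\<lambda>y. moll_grad e (x - y) $ j)"
    using test_function_moll_slope[OF assms, of "\<lambda>y. x $ j - y $ j" 1 x]
    by (simp add: moll_grad_def)
  show "GDERIV (\<lambda>y. moll_grad e (x - y) $ j) y :> - moll_hess e (x - y) j"
    by (rule GDERIV_reflect[OF GDERIV_moll_grad])
qed

lemma continuous_on_moll_slope: "continuous_on A (moll_slope m e)"
  by (rule GDERIV_continuous_on[OF GDERIV_moll_slope])

lemma moll_continuous:
  "continuous_on A (moll e)" "continuous_on A (moll_grad e)" "continuous_on A (\<lambda>x. moll_hess e x j)"
proof -
  show "continuous_on A (moll e)" using continuous_on_moll_slope[of A 0 e] by (simp add: moll_slope_0)
qed (unfold moll_grad_def moll_hess_def, (intro continuous_intros continuous_on_moll_slope)+)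

lemma moll_supp: "0 < e \<Longrightarrow> norm x \<ge> e \<Longrightarrow> moll e x = 0"
  using moll_slope_supp[of e x 0] by (simp add: moll_slope_0)

lemma moll_grad_supp: "0 < e \<Longrightarrow> norm x \<ge> e \<Longrightarrow> moll_grad e x = 0"
  using moll_slope_supp[of e x 1] by (simp add: moll_grad_def)

lemma
  assumes e: "0 < e"
  shows integrable_moll: "integrable lebesgue (moll e :: real ^ 'n \<Rightarrow> real)"
    and integral_moll: "(LINT x|lebesgue. moll e (x :: real ^ 'n)) = 1"
    and moll_nonneg: "moll e (x :: real ^ 'n) \<ge> 0"
    and moll_pos: "norm (x :: real ^ 'n) < e \<Longrightarrow> moll e x > 0"
proof -
  let ?k = "kern e :: real ^ 'n \<Rightarrow> real"
  have kc: "continuous_on UNIV ?k"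
    unfolding kern_def using e by (intro continuous_on_compose2[OF bump_cont] continuous_intros) auto
  have k0: "?k x = 0" if "norm x > e" for x
    using that e by (auto simp: kern_def dot_square_norm intro!: bump_0 power_mono)
  have ki: "integrable lebesgue ?k"
    using integrable_continuous_supp[OF kc k0] .
  have kn: "?k x \<ge> 0" for x by (simp add: kern_def bump_nonneg)
  have kp: "?k x > 0" if "norm x < e" for x
    using that e by (auto simp: kern_def dot_square_norm intro!: bump_pos power_strict_mono)
  \<comment> \<open>Normalization divides by the mass. A nonnegative kernel with integral 0 would
    vanish almost everywhere, but it is positive on an open ball.\<close>
  have "(LINT x|lebesgue. ?k x) \<noteq> 0"
  proof
    assume "(LINT x|lebesgue. ?k x) = 0"
    then have "AE x in lebesgue. ?k x = 0"
      using integral_nonneg_eq_0_iff_AE[OF ki] kn by simp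
    then have "AE x in lebesgue. x \<notin> ball (0 :: real ^ 'n) e"
      by (rule eventually_mono) (use kp in force)
    then have "emeasure lebesgue (ball (0 :: real ^ 'n) e) = 0"
      by (subst (asm) AE_iff_measurable[of "ball (0 :: real ^ 'n) e"]) auto
    then show False
      using e open_not_negligible[of "ball (0 :: real ^ 'n) e"]
      by (simp add: negligible_iff_emeasure0)
  qed
  moreover have "(LINT x|lebesgue. ?k x) \<ge> 0" using kn by (simp add: integral_nonneg_AE)
  ultimately have Z: "(LINT x|lebesgue. ?k x) > 0" by linarith
  show "integrable lebesgue (moll e :: real ^ 'n \<Rightarrow> real)" "(LINT x|lebesgue. moll e (x :: real ^ 'n)) = 1"
    using ki Z by (simp_all add: moll_def[abs_def])
  show "moll e x \<ge> 0" "norm x < e \<Longrightarrow> moll e x > 0"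
    using kn kp Z by (auto simp: moll_def)
qed


lemma integrable_conv:
  fixes u :: "real ^ 'n \<Rightarrow> 'b::euclidean_space"
  assumes "locally_integrable u" "continuous_on UNIV \<phi>" "\<And>x. norm x > R \<Longrightarrow> \<phi> x = 0"
  shows "integrable lebesgue (\<lambda>y. \<phi> (x - y) *\<^sub>R u y)"
proof (rule integrable_supp_scaleR[OF assms(1)])
  show "continuous_on UNIV (\<lambda>y. \<phi> (x - y))"
    by (intro continuous_on_compose2[OF assms(2)] continuous_intros) auto
  show "\<phi> (x - y) = 0" if "norm y > norm x + R" for y
    using that norm_triangle_ineq2[of y x] by (intro assms(3)) (simp add: norm_minus_commute)
qed

lemma set_integrable_cball: "locally_integrable u \<Longrightarrow> integrable lebesgue (\<lambda>y. indicator (cball 0 R) y *\<^sub>R u y)"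
  by (auto simp: locally_integrable_def set_integrable_def)

lemma continuous_on_conv:
  fixes u :: "real ^ 'n \<Rightarrow> 'b::euclidean_space"
  assumes u: "locally_integrable u" and c: "continuous_on UNIV \<phi>" and s: "\<And>x. norm x > R \<Longrightarrow> \<phi> x = 0"
  shows "continuous_on A (conv \<phi> u)"
proof -
  obtain B where B: "\<And>x. norm (\<phi> x) \<le> B" "B > 0" using continuous_supp_bounded[OF c s] by blast
  have "isCont (conv \<phi> u) x" for x
    unfolding continuous_at_sequentially
  proof (intro allI impI)
    fix X assume X: "X \<longlonglongrightarrow> x"
    then obtain M where M: "\<And>n. norm (X n) \<le> M"
      using convergent_imp_Bseq[of X] by (auto simp: convergent_def Bseq_def)
    have "(\<lambda>n. LINT y|lebesgue. \<phi> (X n - y) *\<^sub>R u y) \<longlonglongrightarrow> (LINT y|lebesgue. \<phi> (x - y) *\<^sub>R u y)"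
    proof (rule integral_dominated_convergence[where w = "\<lambda>y. B * norm (indicator (cball 0 (M + R)) y *\<^sub>R u y)"])
      show "integrable lebesgue (\<lambda>y. B * norm (indicator (cball 0 (M + R)) y *\<^sub>R u y))"
        by (intro integrable_mult_right integrable_norm set_integrable_cball u)
      show "AE y in lebesgue. (\<lambda>n. \<phi> (X n - y) *\<^sub>R u y) \<longlonglongrightarrow> \<phi> (x - y) *\<^sub>R u y"
      proof (intro AE_I2 tendsto_scaleR tendsto_const)
        fix y
        have "isCont \<phi> (x - y)" using c by (simp add: continuous_on_eq_continuous_at)
        then show "(\<lambda>n. \<phi> (X n - y)) \<longlonglongrightarrow> \<phi> (x - y)"
          by (rule isCont_tendsto_compose) (intro tendsto_intros X)
      qed
      show "AE y in lebesgue. norm (\<phi> (X n - y) *\<^sub>R u y) \<le> B * norm (indicator (cball 0 (M + R)) y *\<^sub>R u y)" for n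
      proof (intro AE_I2)
        fix y
        show "norm (\<phi> (X n - y) *\<^sub>R u y) \<le> B * norm (indicator (cball 0 (M + R)) y *\<^sub>R u y)"
        proof (cases "norm y \<le> M + R")
          case True
          then show ?thesis using B(1)[of "X n - y"] by (auto intro: mult_right_mono)
        next
          case False
          then have "norm (X n - y) > R"
            using M[of n] norm_triangle_ineq2[of y "X n"] by (simp add: norm_minus_commute)
          then show ?thesis using s B(2) by simp
        qed
      qed
    qed (use integrable_conv[OF u c s] in auto)
    then show "(conv \<phi> u \<circ> X) \<longlonglongrightarrow> conv \<phi> u x" by (simp add: conv_def o_def)
  qed
  then show ?thesis by (simp add: continuous_at_imp_continuous_on)
qed

text \<open>Differentiation under the integral, along arbitrary sequences of increments tending to
  0; the gradient falls on the kernel, so \<open>u\<close> needs no regularity.\<close>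

lemma GDERIV_conv:
  fixes u :: "real ^ 'n \<Rightarrow> real"
  assumes u: "locally_integrable u" and k: "\<And>x. GDERIV \<phi> x :> k x" and c: "continuous_on UNIV k"
    and s: "\<And>x. norm x > R \<Longrightarrow> \<phi> x = 0"
  shows "GDERIV (conv \<phi> u) x :> (LINT y|lebesgue. u y *\<^sub>R k (x - y))"
proof -
  have k0: "k x = 0" if "norm x > R" for x using GDERIV_supp[OF k s that] .
  obtain B where B: "\<And>x. norm (k x) \<le> B" "B > 0" using continuous_supp_bounded[OF c k0] by blast
  have pc: "continuous_on UNIV \<phi>" using GDERIV_continuous_on[OF k] .
  have i1: "integrable lebesgue (\<lambda>y. \<phi> (x - y) * u y)" for x
    using integrable_conv[OF u pc s] by simp
  have i2i: "integrable lebesgue (\<lambda>y. k (x - y) $ i *\<^sub>R u y)" for x i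
    by (rule integrable_conv[OF u, where R = R]) (auto intro!: continuous_intros c simp: k0)
  have "integrable lebesgue (\<lambda>y. \<Sum>i\<in>UNIV. (k (x - y) $ i *\<^sub>R u y) *\<^sub>R axis i (1::real))" for x
    by (intro Bochner_Integration.integrable_sum integrable_scaleR_left i2i) 
  moreover have "(\<Sum>i\<in>UNIV. (k (x - y) $ i *\<^sub>R u y) *\<^sub>R axis i (1::real)) = u y *\<^sub>R k (x - y)" for x y
    by (simp add: vec_eq_iff axis_def mult.commute if_distrib cong: if_cong)
  ultimately have i2: "integrable lebesgue (\<lambda>y. u y *\<^sub>R k (x - y))" for x by simp
  let ?D = "LINT y|lebesgue. u y *\<^sub>R k (x - y)"
  let ?r = "\<lambda>h y. (\<phi> (x + h - y) * u y - \<phi> (x - y) * u y - h \<bullet> (u y *\<^sub>R k (x - y))) / norm h"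
  have ri: "integrable lebesgue (?r h)" for h
    by (intro integrable_divide Bochner_Integration.integrable_diff i1 integrable_inner_right i2)
  have lim: "((\<lambda>h. (conv \<phi> u (x + h) - conv \<phi> u x - h \<bullet> ?D) / norm h) \<longlongrightarrow> 0) (at 0)"
    unfolding tendsto_at_iff_sequentially
  proof (intro allI impI)
    fix X assume X0: "\<forall>n. X n \<in> UNIV - {0 :: real ^ 'n}" and X: "X \<longlonglongrightarrow> 0"
    then obtain M where M: "\<And>n. norm (X n) \<le> M"
      using convergent_imp_Bseq[of X] by (auto simp: convergent_def Bseq_def)
    have X1: "filterlim X (at 0) sequentially" using X X0 by (simp add: filterlim_at)
    let ?S = "norm x + M + R"
    have "(\<lambda>n. LINT y|lebesgue. ?r (X n) y) \<longlonglongrightarrow> (LINT y|(lebesgue :: (real ^ 'n) measure). 0)"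
    proof (rule integral_dominated_convergence[where w = "\<lambda>y. 2 * B * norm (indicator (cball 0 ?S) y *\<^sub>R u y)"])
      show "integrable lebesgue (\<lambda>y. 2 * B * norm (indicator (cball 0 ?S) y *\<^sub>R u y))"
        by (intro integrable_mult_right integrable_norm set_integrable_cball u)
      show "AE y in lebesgue. (\<lambda>n. ?r (X n) y) \<longlonglongrightarrow> 0"
      proof (intro AE_I2)
        fix y
        have "((\<lambda>h. norm (\<phi> ((x - y) + h) - \<phi> (x - y) - h \<bullet> k (x - y)) / norm h) \<longlongrightarrow> 0) (at 0)"
          using k[of "x - y"] by (simp add: gderiv_def has_derivative_at)
        from tendsto_mult[OF tendsto_const[of "norm (u y)"] filterlim_compose[OF this X1]]
        have "(\<lambda>n. norm (?r (X n) y)) \<longlonglongrightarrow> 0"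
          by (simp add: algebra_simps abs_mult[symmetric] abs_divide)
        then show "(\<lambda>n. ?r (X n) y) \<longlonglongrightarrow> 0" by (simp only: tendsto_norm_zero_iff)
      qed
      show "AE y in lebesgue. norm (?r (X n) y) \<le> 2 * B * norm (indicator (cball 0 ?S) y *\<^sub>R u y)" for n
      proof (intro AE_I2)
        fix y
        have h: "norm (X n) > 0" using X0 by simp
        show "norm (?r (X n) y) \<le> 2 * B * norm (indicator (cball 0 ?S) y *\<^sub>R u y)"
        proof (cases "norm y \<le> ?S")
          case True
          have "\<bar>\<phi> (x + X n - y) - \<phi> (x - y)\<bar> \<le> B * norm ((x + X n - y) - (x - y))"
            by (rule GDERIV_lipschitz[OF k B(1)])
          moreover have "\<bar>X n \<bullet> k (x - y)\<bar> \<le> norm (X n) * B"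
            using Cauchy_Schwarz_ineq2[of "X n" "k (x - y)"] B(1)[of "x - y"]
            by (meson mult_left_mono norm_ge_zero order_trans)
          ultimately have "\<bar>\<phi> (x + X n - y) - \<phi> (x - y) - X n \<bullet> k (x - y)\<bar> \<le> 2 * B * norm (X n)"
            by (simp add: algebra_simps)
          then have "\<bar>u y\<bar> * \<bar>\<phi> (x + X n - y) - \<phi> (x - y) - X n \<bullet> k (x - y)\<bar> \<le> \<bar>u y\<bar> * (2 * B * norm (X n))"
            by (rule mult_left_mono) simp
          then have "\<bar>\<phi> (x + X n - y) * u y - \<phi> (x - y) * u y - X n \<bullet> (u y *\<^sub>R k (x - y))\<bar> \<le> (2 * B * \<bar>u y\<bar>) * norm (X n)"
            by (simp add: abs_mult[symmetric] algebra_simps)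
          then show ?thesis using h True by (simp add: pos_divide_le_eq)
        next
          case False
          have "norm (x + X n) \<le> norm x + M" using norm_triangle_ineq[of x "X n"] M[of n] by simp
          then have "norm (x + X n - y) > R"
            using False norm_triangle_ineq2[of y "x + X n"] by (simp add: norm_minus_commute)
          moreover have "M \<ge> 0" using M[of 0] norm_ge_zero order_trans by blast
          then have "norm (x - y) > R"
            using False norm_triangle_ineq2[of y x] by (simp add: norm_minus_commute)
          ultimately show ?thesis using s k0 B(2) by simp
        qed
      qed
    qed (use ri in auto)
    moreover have eq: "(LINT y|lebesgue. ?r h y) = (conv \<phi> u (x + h) - conv \<phi> u x - h \<bullet> ?D) / norm h" for h
      using i1[of "x + h"] i1[of x] integrable_inner_right[OF i2[of x], of h] integral_inner_right[OF i2[of x], of h]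
      by (simp add: conv_def del: inner_scaleR_right)
    ultimately show "((\<lambda>h. (conv \<phi> u (x + h) - conv \<phi> u x - h \<bullet> ?D) / norm h) \<circ> X) \<longlonglongrightarrow> 0"
      unfolding o_def eq by simp
  qed
  have "((\<lambda>h. norm (conv \<phi> u (x + h) - conv \<phi> u x - h \<bullet> ?D) / norm h) \<longlongrightarrow> 0) (at 0)"
    using tendsto_norm_zero[OF lim] by simp
  then show ?thesis
    by (simp add: gderiv_def has_derivative_at bounded_linear_inner_left)
qed

section \<open>Continuity of translations in the mean\<close>

definition translation_continuous :: "('a::euclidean_space \<Rightarrow> 'b::euclidean_space) \<Rightarrow> bool" where
  "translation_continuous f \<longleftrightarrow> integrable lebesgue f \<and>
     ((\<lambda>z. LINT x|lebesgue. norm (f (x - z) - f x)) \<longlongrightarrow> 0) (nhds 0)"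

lemma
  fixes f :: "'a::euclidean_space \<Rightarrow> 'b::euclidean_space"
  shows integrable_shift: "integrable lebesgue f \<Longrightarrow> integrable lebesgue (\<lambda>x. f (x - z))"
    and integral_shift: "(LINT x|lebesgue. f (x - z)) = (LINT x|lebesgue. f x)"
  using lebesgue_integrable_affine_iff[of 1 f "- z"] lebesgue_integral_affine[of 1 f "- z"]
  by (simp_all add: add.commute)

text \<open>Three thirds of \<open>d\<close>: the error \<open>f - g\<close> enters twice, once
  translated, and translation does not change its integral. This closes the property under limits in
  the mean.\<close>

lemma translation_continuous_approx:
  fixes f :: "'a::euclidean_space \<Rightarrow> 'b::euclidean_space"
  assumes f: "integrable lebesgue f"
    and ap: "\<And>d. d > 0 \<Longrightarrow> \<exists>g. translation_continuous g \<and> (LINT x|lebesgue. norm (f x - g x)) < d"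
  shows "translation_continuous f"
  unfolding translation_continuous_def
proof (intro conjI f tendstoI)
  fix d :: real assume "d > 0"
  then obtain g where g: "translation_continuous g" and fg: "(LINT x|lebesgue. norm (f x - g x)) < d / 3"
    using ap[of "d / 3"] by auto
  have gi: "integrable lebesgue g" using g by (simp add: translation_continuous_def)
  have "eventually (\<lambda>z. (LINT x|lebesgue. norm (g (x - z) - g x)) < d / 3) (nhds 0)"
    using g \<open>d > 0\<close> by (intro order_tendstoD(2)[where y = 0]) (auto simp: translation_continuous_def)
  then show "eventually (\<lambda>z. dist (LINT x|lebesgue. norm (f (x - z) - f x)) 0 < d) (nhds 0)"
  proof eventually_elim
    case (elim z)
    have i: "integrable lebesgue (\<lambda>x. norm (f x - g x))" using f gi by auto
    have j: "integrable lebesgue (\<lambda>x. norm (f (x - z) - g (x - z)))"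
      using integrable_shift[OF f] integrable_shift[OF gi] by auto
    have k: "integrable lebesgue (\<lambda>x. norm (g (x - z) - g x))"
      using integrable_shift[OF gi] gi by auto
    have "(LINT x|lebesgue. norm (f (x - z) - f x)) \<le>
        (LINT x|lebesgue. norm (f (x - z) - g (x - z)) + norm (g (x - z) - g x) + norm (f x - g x))"
    proof (rule integral_mono)
      show "norm (f (x - z) - f x) \<le> norm (f (x - z) - g (x - z)) + norm (g (x - z) - g x) + norm (f x - g x)" for x
        using norm_triangle_ineq[of "f (x - z) - g (x - z)" "g (x - z) - g x"]
          norm_triangle_ineq[of "f (x - z) - g x" "g x - f x"] by (simp add: norm_minus_commute)
    qed (use i j k f integrable_shift[OF f] in auto)
    also have "\<dots> = (LINT x|lebesgue. norm (f (x - z) - g (x - z))) + (LINT x|lebesgue. norm (g (x - z) - g x))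
        + (LINT x|lebesgue. norm (f x - g x))" using i j k by simp
    also have "(LINT x|lebesgue. norm (f (x - z) - g (x - z))) = (LINT x|lebesgue. norm (f x - g x))"
      using integral_shift[of "\<lambda>x. norm (f x - g x)" z] .
    finally show ?case using fg elim by (simp add: integral_nonneg_AE)
  qed
qed

lemma translation_continuous_add:
  fixes f g :: "'a::euclidean_space \<Rightarrow> 'b::euclidean_space"
  assumes "translation_continuous f" "translation_continuous g"
  shows "translation_continuous (\<lambda>x. f x + g x)"
proof -
  have fi: "integrable lebesgue f" and gi: "integrable lebesgue g"
    using assms by (auto simp: translation_continuous_def)
  have "((\<lambda>z. (LINT x|lebesgue. norm (f (x - z) - f x)) + (LINT x|lebesgue. norm (g (x - z) - g x))) \<longlongrightarrow> 0) (nhds 0)"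
    using assms by (intro tendsto_add_zero) (auto simp: translation_continuous_def)
  then have "((\<lambda>z. LINT x|lebesgue. norm ((f (x - z) + g (x - z)) - (f x + g x))) \<longlongrightarrow> 0) (nhds 0)"
  proof (rule tendsto_0_le[where K = 1], intro always_eventually allI)
    fix z
    have i: "integrable lebesgue (\<lambda>x. norm (f (x - z) - f x))" "integrable lebesgue (\<lambda>x. norm (g (x - z) - g x))"
      using fi gi integrable_shift[OF fi] integrable_shift[OF gi] by auto
    have "(LINT x|lebesgue. norm ((f (x - z) + g (x - z)) - (f x + g x))) \<le>
       (LINT x|lebesgue. norm (f (x - z) - f x) + norm (g (x - z) - g x))"
    proof (rule integral_mono)
      show "norm ((f (x - z) + g (x - z)) - (f x + g x)) \<le> norm (f (x - z) - f x) + norm (g (x - z) - g x)" for x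
        by (rule norm_diff_triangle_ineq)
      show "integrable lebesgue (\<lambda>x. norm (f (x - z) + g (x - z) - (f x + g x)))"
        using fi gi integrable_shift by (intro integrable_norm Bochner_Integration.integrable_diff Bochner_Integration.integrable_add) auto
    qed (use i in auto)
    then show "norm (LINT x|lebesgue. norm ((f (x - z) + g (x - z)) - (f x + g x))) \<le>
       norm ((LINT x|lebesgue. norm (f (x - z) - f x)) + (LINT x|lebesgue. norm (g (x - z) - g x))) * 1"
      using i by (simp add: integral_nonneg_AE)
  qed
  then show ?thesis using fi gi by (simp add: translation_continuous_def)
qed

text \<open>For open sets, \<open>|1\<^sub>U(x - z) - 1\<^sub>U(x)|\<close> integrates to twice the measure of
  \<open>{x \<in> U. x - z \<notin> U}\<close>; so the boundary of \<open>U\<close>, which may have positive measure, plays no role.\<close>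

lemma translation_continuous_open:
  fixes U :: "'a::euclidean_space set" and c :: "'b::euclidean_space"
  assumes U: "open U" "emeasure lebesgue U < \<infinity>"
  shows "translation_continuous (\<lambda>x. indicator U x *\<^sub>R c)"
proof -
  let ?I = "indicator U :: 'a \<Rightarrow> real"
  have Ii: "integrable lebesgue ?I" using U by (intro integrable_real_indicator) auto
  have mS: "(\<lambda>x. ?I (x - z)) \<in> borel_measurable lebesgue" for z
    using integrable_shift[OF Ii] by auto
  have pi: "integrable lebesgue (\<lambda>x. ?I (x - z) * ?I x)" for z
    using integrable_bounded_scaleR[OF Ii mS[of z], of 1] by (simp add: indicator_def)
  have eq: "(LINT x|lebesgue. norm (?I (x - z) *\<^sub>R c - ?I x *\<^sub>R c)) =
      norm c * (2 * (LINT x|lebesgue. ?I x - ?I (x - z) * ?I x))" for z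
  proof -
    \<comment> \<open>For values in {0, 1} one has \<open>|a - b| = a + b - 2 * a * b\<close>, and
      the two single terms have the same integral.\<close>
    have "norm (?I (x - z) *\<^sub>R c - ?I x *\<^sub>R c) = norm c * (?I (x - z) + ?I x - 2 * (?I (x - z) * ?I x))" for x
      by (auto simp: indicator_def)
    then show ?thesis
      using integrable_shift[OF Ii, of z] Ii pi[of z] integral_shift[of ?I z] by simp
  qed
  have "((\<lambda>z. LINT x|lebesgue. ?I x - ?I (x - z) * ?I x) \<longlongrightarrow> (LINT x|(lebesgue :: 'a measure). 0)) (nhds 0)"
  proof (subst tendsto_nhds_iff, intro conjI)
    show "((\<lambda>z. LINT x|lebesgue. ?I x - ?I (x - z) * ?I x) \<longlongrightarrow> (LINT x|(lebesgue :: 'a measure). 0)) (at 0)"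
      unfolding tendsto_at_iff_sequentially o_def
    proof (intro allI impI integral_dominated_convergence[where w = ?I])
      fix X :: "nat \<Rightarrow> 'a" assume X: "X \<longlonglongrightarrow> 0"
      show "AE x in lebesgue. (\<lambda>n. ?I x - ?I (x - X n) * ?I x) \<longlonglongrightarrow> 0"
      proof (intro AE_I2)
        fix x
        show "(\<lambda>n. ?I x - ?I (x - X n) * ?I x) \<longlonglongrightarrow> 0"
        proof (cases "x \<in> U")
          case True
          have "(\<lambda>n. x - X n) \<longlonglongrightarrow> x - 0" by (intro tendsto_intros X)
          then have "eventually (\<lambda>n. x - X n \<in> U) sequentially"
            using U(1) True by (auto dest: topological_tendstoD)
          then have "eventually (\<lambda>n. ?I x - ?I (x - X n) * ?I x = 0) sequentially"
            by eventually_elim (use True in auto)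
          then show ?thesis by (rule tendsto_eventually)
        qed simp
      qed
      show "(\<lambda>x. ?I x - ?I (x - X n) * ?I x) \<in> borel_measurable lebesgue" for n
        using borel_measurable_integrable[OF Bochner_Integration.integrable_diff[OF Ii pi]] .
    qed (use Ii in \<open>auto simp: indicator_def\<close>)
  qed (simp add: indicator_def flip: of_bool_conj)
  from tendsto_mult[OF tendsto_const[of "norm c * 2"] this]
  show ?thesis
    using Ii by (simp add: translation_continuous_def eq mult.assoc)
qed

text \<open>The induction principle for integrable functions reduces everything to indicators of
  measurable sets of finite measure, and outer regularity replaces such a set by an open
  one.\<close>

lemma translation_continuous_integrable:
  fixes f :: "'a::euclidean_space \<Rightarrow> 'b::euclidean_space"
  assumes "integrable lebesgue f"
  shows "translation_continuous f"
  using assms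
proof (induction rule: integrable_induct)
  case (base A c)
  have Ai: "integrable lebesgue (\<lambda>x. indicator A x *\<^sub>R c)" using base by auto
  show ?case
  proof (rule translation_continuous_approx[OF Ai])
    fix d :: real assume d: "d > 0"
    \<comment> \<open>Adding 1 to \<open>norm c\<close> avoids division by zero, while
      \<open>norm c * (d / (norm c + 1))\<close> stays below \<open>d\<close>.\<close>
    obtain T where T: "open T" "A \<subseteq> T" "T - A \<in> lmeasurable" "emeasure lebesgue (T - A) < ennreal (d / (norm c + 1))"
      using sets_lebesgue_outer_open[of A "d / (norm c + 1)"] base d
      by (metis add_nonneg_pos divide_pos_pos norm_ge_zero zero_less_one)
    have "emeasure lebesgue T = emeasure lebesgue A + emeasure lebesgue (T - A)"
      using base T plus_emeasure[of A lebesgue "T - A"] by (auto simp: Un_absorb1)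
    then have fin: "emeasure lebesgue T < \<infinity>"
      using base(2) T(3) by (auto simp: fmeasurable_def)
    have "norm (indicator A x *\<^sub>R c - indicator T x *\<^sub>R c) = norm c * indicator (T - A) x" for x
      using T(2) by (auto simp: indicator_def)
    then have "(LINT x|lebesgue. norm (indicator A x *\<^sub>R c - indicator T x *\<^sub>R c)) = norm c * measure lebesgue (T - A)"
      using T(3) by simp
    also have "measure lebesgue (T - A) \<le> d / (norm c + 1)"
      using T(3,4) d ennreal_less_iff[of "measure lebesgue (T - A)"]
      by (simp add: emeasure_eq_measure2 less_imp_le)
    then have "norm c * measure lebesgue (T - A) \<le> norm c * (d / (norm c + 1))"
      by (rule mult_left_mono) simp
    also have "\<dots> < d" using d by (simp add: field_simps add_pos_nonneg)
    finally show "\<exists>g. translation_continuous g \<and> (LINT x|lebesgue. norm (indicator A x *\<^sub>R c - g x)) < d"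
      using translation_continuous_open[OF T(1) fin] by blast
  qed
next
  case (add f g)
  then show ?case by (intro translation_continuous_add)
next
  case (lim f s)
  show ?case
  proof (rule translation_continuous_approx[OF lim.hyps(4)])
    fix d :: real assume d: "d > 0"
    have "(\<lambda>i. LINT x|lebesgue. norm (f x - s i x)) \<longlonglongrightarrow> (LINT x|(lebesgue :: 'a measure). 0)"
    proof (rule integral_dominated_convergence[where w = "\<lambda>x. 3 * norm (f x)"])
      show "AE x in lebesgue. (\<lambda>i. norm (f x - s i x)) \<longlonglongrightarrow> 0"
      proof (intro AE_I2)
        fix x
        have "(\<lambda>i. f x - s i x) \<longlonglongrightarrow> f x - f x" by (intro tendsto_intros lim.hyps(2)) simp
        then show "(\<lambda>i. norm (f x - s i x)) \<longlonglongrightarrow> 0" by (simp add: tendsto_norm_zero)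
      qed
      show "AE x in lebesgue. norm (norm (f x - s i x)) \<le> 3 * norm (f x)" for i
      proof (intro AE_I2)
        fix x
        show "norm (norm (f x - s i x)) \<le> 3 * norm (f x)"
          using norm_triangle_ineq4[of "f x" "s i x"] lim.hyps(3)[of x i] by simp
      qed
    qed (use lim.hyps in auto)
    then have "eventually (\<lambda>i. (LINT x|lebesgue. norm (f x - s i x)) < d) sequentially"
      using d by (intro order_tendstoD(2)) auto
    then obtain i where "(LINT x|lebesgue. norm (f x - s i x)) < d"
      by (auto simp: eventually_sequentially)
    then show "\<exists>g. translation_continuous g \<and> (LINT x|lebesgue. norm (f x - g x)) < d"
      using lim.IH by blast
  qed
qed


text \<open>The interchange of integrals below takes place over \<open>lborel\<close>, where the
  joint integrand built from \<open>g (x - y)\<close> must be Borel measurable; a Lebesgue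
  measurable \<open>f\<close> is therefore replaced by a Borel function equal to it almost
  everywhere.\<close>

lemma borel_representative:
  fixes f :: "'a::euclidean_space \<Rightarrow> 'b::euclidean_space"
  assumes "f \<in> borel_measurable lebesgue"
  obtains g where "g \<in> borel_measurable borel" "AE x in lebesgue. f x = g x"
proof -
  have "\<exists>g. g \<in> borel_measurable borel \<and> (AE x in lborel. f x \<bullet> i = g x)" if "i \<in> Basis" for i
    using completion_ex_borel_measurable_real[of "\<lambda>x. f x \<bullet> i" lborel] assms by auto
  then obtain g where g: "\<And>i. i \<in> Basis \<Longrightarrow> g i \<in> borel_measurable borel"
    "\<And>i. i \<in> Basis \<Longrightarrow> AE x in lborel. f x \<bullet> i = g i x" by metis
  show thesis
  proof (rule that)
    show "(\<lambda>x. \<Sum>i\<in>Basis. g i x *\<^sub>R i) \<in> borel_measurable borel" using g by measurable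
    have "AE x in lborel. \<forall>i\<in>Basis. f x \<bullet> i = g i x" using g(2) by (simp add: AE_finite_all)
    then show "AE x in lebesgue. f x = (\<Sum>i\<in>Basis. g i x *\<^sub>R i)"
      by (intro AE_completion, eventually_elim) (metis (no_types, lifting) euclidean_representation sum.cong)
  qed
qed

lemma conv_flip: "conv \<phi> f x = (LINT y|lebesgue. \<phi> y *\<^sub>R f (x - y))"
  using lebesgue_integral_affine[of "-1" "\<lambda>y. \<phi> y *\<^sub>R f (x - y)" x] by (simp add: conv_def algebra_simps)

text \<open>Affine maps preserve null sets. Applying the transformation formula to the integral of
  \<open>norm (f x - g x)\<close> yields this without handling null sets directly.\<close>

lemma AE_reflect:
  fixes f g :: "'a::euclidean_space \<Rightarrow> 'b::euclidean_space"
  assumes "integrable lebesgue f" "integrable lebesgue g" "AE x in lebesgue. f x = g x" "c \<noteq> 0"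
  shows "AE y in lebesgue. f (x + c *\<^sub>R y) = g (x + c *\<^sub>R y)"
proof -
  let ?h = "\<lambda>x. norm (f x - g x)"
  have hi: "integrable lebesgue ?h" using assms by auto
  have "(LINT y|lebesgue. ?h y) = (LINT y|(lebesgue :: 'a measure). 0)"
    using assms by (intro integral_cong_AE) auto
  then have "(LINT y|lebesgue. ?h (x + c *\<^sub>R y)) = 0"
    using lebesgue_integral_affine[of c ?h x] assms(4) by simp
  moreover have "integrable lebesgue (\<lambda>y. ?h (x + c *\<^sub>R y))"
    using lebesgue_integrable_affine_iff[of c ?h x] assms(4) hi by simp
  ultimately have "AE y in lebesgue. ?h (x + c *\<^sub>R y) = 0"
    using integral_nonneg_eq_0_iff_AE[of lebesgue "\<lambda>y. ?h (x + c *\<^sub>R y)"] by simp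
  then show ?thesis by simp
qed

lemma integrable_imp_locally_integrable: "integrable lebesgue f \<Longrightarrow> locally_integrable f"
  unfolding locally_integrable_def set_integrable_def
  by (auto intro!: integrable_mult_indicator lmeasurable_compact[THEN fmeasurableD])

text \<open>The kernel has mass 1, so \<open>conv (moll e) f - f\<close> averages the differences
  \<open>f (x - y) - f x\<close> with the weight \<open>moll e y\<close>. Exchanging the integrals
  leaves the average of translation errors with \<open>norm y < e\<close>.\<close>

lemma conv_L1_bound:
  fixes f :: "real ^ 'n \<Rightarrow> 'b::euclidean_space"
  assumes f: "integrable lebesgue f" and e: "0 < e" and d: "d \<ge> 0"
    and T: "\<And>z. norm z < e \<Longrightarrow> (LINT x|lebesgue. norm (f (x - z) - f x)) \<le> d"
  shows "integrable lebesgue (\<lambda>x. norm (conv (moll e) f x - f x))"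
    "(LINT x|lebesgue. norm (conv (moll e) f x - f x)) \<le> d"
proof -
  let ?m = "moll e :: real ^ 'n \<Rightarrow> real"
  have loc: "locally_integrable f"
    by (rule integrable_imp_locally_integrable[OF f])
  have s: "?m x = 0" if "norm x > e" for x using moll_supp e that by (auto intro: less_imp_le)
  have cc: "continuous_on UNIV (conv ?m f)"
    by (rule continuous_on_conv[OF loc moll_continuous(1) s])
  have cm: "conv ?m f \<in> borel_measurable borel"
    by (rule borel_measurable_continuous_onI[OF cc])
  have mm: "?m \<in> borel_measurable borel"
    by (rule borel_measurable_continuous_onI[OF moll_continuous(1)])
  have fm: "f \<in> borel_measurable lebesgue" using f by (rule borel_measurable_integrable)
  obtain g where g: "g \<in> borel_measurable borel" and fg: "AE x in lebesgue. f x = g x"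
    using borel_representative[OF fm] .
  have gm: "g \<in> borel_measurable lebesgue" using g by (intro measurable_completion) simp
  have gi: "integrable lebesgue g"
    using f integrable_cong_AE[OF fm gm fg] by simp
  note [measurable] = g cm mm
  have shift: "integrable lebesgue (\<lambda>x. norm (g (x - y) - g x))"
    "(LINT x|lebesgue. norm (g (x - y) - g x)) = (LINT x|lebesgue. norm (f (x - y) - f x))" for y
  proof -
    show i: "integrable lebesgue (\<lambda>x. norm (g (x - y) - g x))"
      using gi integrable_shift[OF gi] by auto
    have "AE x in lebesgue. f (- y + 1 *\<^sub>R x) = g (- y + 1 *\<^sub>R x)"
      by (rule AE_reflect[OF f gi fg]) simp
    with fg have ae: "AE x in lebesgue. norm (g (x - y) - g x) = norm (f (x - y) - f x)"
      by eventually_elim simp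
    have "integrable lebesgue (\<lambda>x. norm (f (x - y) - f x))"
      using f integrable_shift[OF f] by auto
    then show "(LINT x|lebesgue. norm (g (x - y) - g x)) = (LINT x|lebesgue. norm (f (x - y) - f x))"
      using i ae by (intro integral_cong_AE) auto
  qed
  have pt: "ennreal (norm (conv ?m f x - g x)) \<le> (\<integral>\<^sup>+y. ennreal (?m y * norm (g (x - y) - g x)) \<partial>lborel)" for x
  proof -
    have "AE y in lebesgue. f (x + (-1) *\<^sub>R y) = g (x + (-1) *\<^sub>R y)"
      using AE_reflect[OF f gi fg, of "-1" x] by simp
    then have ae: "AE y in lebesgue. ?m y *\<^sub>R f (x - y) = ?m y *\<^sub>R g (x - y)"
      by (rule eventually_mono) simp
    obtain B where B: "\<And>x. norm (?m x) \<le> B" "B > 0"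
      using continuous_supp_bounded[OF moll_continuous(1) s] by blast
    have ff: "integrable lebesgue (\<lambda>y. f (x - y))" and gg: "integrable lebesgue (\<lambda>y. g (x - y))"
      using lebesgue_integrable_affine_iff[of "-1" _ x] f gi by auto
    have i1: "integrable lebesgue (\<lambda>y. ?m y *\<^sub>R f (x - y))"
      by (rule integrable_bounded_scaleR[where B = B, OF ff]) (use B in \<open>auto intro: measurable_completion\<close>)
    have i2: "integrable lebesgue (\<lambda>y. ?m y *\<^sub>R g (x - y))"
      by (rule integrable_bounded_scaleR[where B = B, OF gg]) (use B in \<open>auto intro: measurable_completion\<close>)
    have i3: "integrable lebesgue (\<lambda>y. ?m y *\<^sub>R g x)"
      by (rule integrable_scaleR_left) (rule integrable_moll[OF e])
    have "conv ?m f x = (LINT y|lebesgue. ?m y *\<^sub>R g (x - y))"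
      unfolding conv_flip using ae i1 i2 by (intro integral_cong_AE) auto
    moreover have "g x = (LINT y|lebesgue. ?m y *\<^sub>R g x)"
      using integrable_moll[OF e, where 'n = 'n] integral_moll[OF e, where 'n = 'n] by simp
    ultimately have "conv ?m f x - g x = (LINT y|lebesgue. ?m y *\<^sub>R g (x - y) - ?m y *\<^sub>R g x)"
      using i2 i3 by (simp only: Bochner_Integration.integral_diff)
    also have "ennreal (norm \<dots>) \<le> (\<integral>\<^sup>+y. ennreal (norm (?m y *\<^sub>R g (x - y) - ?m y *\<^sub>R g x)) \<partial>lebesgue)"
      by (intro integral_norm_bound_ennreal Bochner_Integration.integrable_diff i2 i3)
    also have "\<dots> = (\<integral>\<^sup>+y. ennreal (?m y * norm (g (x - y) - g x)) \<partial>lebesgue)"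
      by (simp add: abs_of_nonneg[OF moll_nonneg[OF e]] flip: scaleR_diff_right)
    finally show ?thesis by (simp add: nn_integral_completion)
  qed
  have "(\<integral>\<^sup>+x. ennreal (norm (conv ?m f x - g x)) \<partial>lborel) \<le>
      (\<integral>\<^sup>+x. \<integral>\<^sup>+y. ennreal (?m y * norm (g (x - y) - g x)) \<partial>lborel \<partial>lborel)"
    by (intro nn_integral_mono pt)
  also have "\<dots> = (\<integral>\<^sup>+y. \<integral>\<^sup>+x. ennreal (?m y * norm (g (x - y) - g x)) \<partial>lborel \<partial>lborel)"
    by (rule lborel_pair.Fubini') measurable
  also have "\<dots> \<le> (\<integral>\<^sup>+y. ennreal (?m y) * ennreal d \<partial>lborel)"
  proof (intro nn_integral_mono)
    fix y :: "real ^ 'n"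
    have "(\<integral>\<^sup>+x. ennreal (?m y * norm (g (x - y) - g x)) \<partial>lborel)
        = ennreal (?m y) * (\<integral>\<^sup>+x. ennreal (norm (g (x - y) - g x)) \<partial>lebesgue)"
      using moll_nonneg[OF e, where 'n = 'n] by (simp add: ennreal_mult nn_integral_cmult nn_integral_completion)
    also have "\<dots> = ennreal (?m y) * ennreal (LINT x|lebesgue. norm (f (x - y) - f x))"
      using shift[of y] by (simp add: nn_integral_eq_integral)
    also have "\<dots> \<le> ennreal (?m y) * ennreal d"
    proof (cases "norm y < e")
      case True
      then show ?thesis using T by (intro mult_left_mono ennreal_leI) auto
    next
      case False
      then show ?thesis using moll_supp[OF e, of y] by simp
    qed
    finally show "(\<integral>\<^sup>+x. ennreal (?m y * norm (g (x - y) - g x)) \<partial>lborel) \<le> ennreal (?m y) * ennreal d" .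
  qed
  also have "\<dots> = ennreal d * (\<integral>\<^sup>+y. ennreal (?m y) \<partial>lebesgue)"
    by (simp add: nn_integral_cmult mult.commute nn_integral_completion)
  also have "(\<integral>\<^sup>+y. ennreal (?m y) \<partial>lebesgue) = 1"
    using integrable_moll[OF e, where 'n = 'n] integral_moll[OF e, where 'n = 'n] moll_nonneg[OF e, where 'n = 'n]
    by (simp add: nn_integral_eq_integral)
  finally have *: "(\<integral>\<^sup>+x. ennreal (norm (conv ?m f x - g x)) \<partial>lebesgue) \<le> ennreal d"
    by (simp add: nn_integral_completion)
  have "(\<integral>\<^sup>+x. ennreal (norm (conv ?m f x - f x)) \<partial>lebesgue) = (\<integral>\<^sup>+x. ennreal (norm (conv ?m f x - g x)) \<partial>lebesgue)"
    using fg by (intro nn_integral_cong_AE) auto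
  with * have **: "(\<integral>\<^sup>+x. ennreal (norm (conv ?m f x - f x)) \<partial>lebesgue) \<le> ennreal d" by simp
  have "(\<lambda>x. conv ?m f x - f x) \<in> borel_measurable lebesgue"
    using fm continuous_on_imp_lebesgue_measurable[OF cc] by measurable
  then show i: "integrable lebesgue (\<lambda>x. norm (conv ?m f x - f x))"
    using ** by (intro integrable_norm integrableI_bounded) (auto simp: order_le_less_trans)
  show "(LINT x|lebesgue. norm (conv ?m f x - f x)) \<le> d"
    using ** i d by (simp add: nn_integral_eq_integral)
qed

lemma conv_L1_tendsto:
  fixes f :: "real ^ 'n \<Rightarrow> 'b::euclidean_space"
  assumes f: "integrable lebesgue f" and d: "d > 0"
  obtains e where "0 < e" "e < 1"
    "integrable lebesgue (\<lambda>x. norm (conv (moll e) f x - f x))"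
    "(LINT x|lebesgue. norm (conv (moll e) f x - f x)) \<le> d"
proof -
  have "eventually (\<lambda>z. (LINT x|lebesgue. norm (f (x - z) - f x)) < d) (nhds 0)"
    using translation_continuous_integrable[OF f] d
    by (intro order_tendstoD(2)[where y = 0]) (auto simp: translation_continuous_def)
  then obtain r where r: "r > 0" "\<And>z. norm z < r \<Longrightarrow> (LINT x|lebesgue. norm (f (x - z) - f x)) < d"
    by (auto simp: eventually_nhds_metric)
  define e where "e = min r (1 / 2)"
  have e: "0 < e" "e < 1" using r by (auto simp: e_def)
  have "(LINT x|lebesgue. norm (f (x - z) - f x)) \<le> d" if "norm z < e" for z
    using r(2)[of z] that by (auto simp: e_def)
  from conv_L1_bound[OF f e(1) less_imp_le[OF d] this] show thesis
    using that e by blast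
qed

text \<open>Choosing the radii fast enough makes the sum of the errors integrable; this provides
  almost everywhere convergence together with a single dominating function.\<close>

lemma mollify_local:
  fixes F :: "real ^ 'n \<Rightarrow> 'b::euclidean_space"
  assumes F: "locally_integrable F"
  obtains e D where "\<forall>n. 0 < e n" "integrable lebesgue D"
    "AE x in lebesgue. norm x \<le> R \<longrightarrow> (\<lambda>n. conv (moll (e n)) F x) \<longlonglongrightarrow> F x"
    "AE x in lebesgue. norm x \<le> R \<longrightarrow> (\<forall>n. norm (conv (moll (e n)) F x) \<le> D x)"
proof -
  \<comment> \<open>All radii are below 1, so for \<open>norm x \<le> R\<close> a mollification only
    sees values of \<open>F\<close> in the ball of radius \<open>R + 1\<close>; cutting off there
    makes \<open>F\<close> integrable.\<close>
  define f where "f y = indicator (cball 0 (R + 1)) y *\<^sub>R F y" for y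
  have fi: "integrable lebesgue f" unfolding f_def by (rule set_integrable_cball[OF F])
  define P where "P n e \<longleftrightarrow> 0 < e \<and> e < 1 \<and> integrable lebesgue (\<lambda>x. norm (conv (moll e) f x - f x))
     \<and> (LINT x|lebesgue. norm (conv (moll e) f x - f x)) \<le> (1/2)^n" for n and e :: real
  have "\<exists>e. P n e" for n
  proof -
    have "(1/2 :: real) ^ n > 0" by simp
    from conv_L1_tendsto[OF fi this] show ?thesis unfolding P_def by blast
  qed
  then obtain e where "\<And>n. P n (e n)" by metis
  then have e: "\<And>n. 0 < e n" "\<And>n. e n < 1"
    and ei: "\<And>n. integrable lebesgue (\<lambda>x. norm (conv (moll (e n)) f x - f x))"
    and eb: "\<And>n. (LINT x|lebesgue. norm (conv (moll (e n)) f x - f x)) \<le> (1/2)^n"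
    by (simp_all add: P_def)
  define S where "S x = (\<Sum>n. ennreal (norm (conv (moll (e n)) f x - f x)))" for x
  have Sm: "S \<in> borel_measurable lebesgue" unfolding S_def using ei by measurable
  have "(\<integral>\<^sup>+x. S x \<partial>lebesgue) = (\<Sum>n. \<integral>\<^sup>+x. ennreal (norm (conv (moll (e n)) f x - f x)) \<partial>lebesgue)"
    unfolding S_def using ei by (intro nn_integral_suminf) auto
  also have "\<dots> \<le> (\<Sum>n. ennreal ((1/2)^n))"
    using ei eb by (intro suminf_le) (auto simp: nn_integral_eq_integral intro!: ennreal_leI)
  also have "\<dots> = ennreal (\<Sum>n. (1/2)^n)"
    by (intro suminf_ennreal2) auto
  finally have Sfin: "(\<integral>\<^sup>+x. S x \<partial>lebesgue) < \<infinity>" by (simp add: order_le_less_trans)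
  then have SAE: "AE x in lebesgue. S x \<noteq> \<infinity>"
    using Sm by (intro nn_integral_PInf_AE) auto
  \<comment> \<open>\<open>enn2real\<close> turns the value infinity into 0; this only concerns the
    null set where \<open>S\<close> is infinite.\<close>
  define D where "D x = enn2real (S x) + norm (f x)" for x
  have "integrable lebesgue (\<lambda>x. enn2real (S x))"
  proof (rule integrableI_bounded)
    have "(\<integral>\<^sup>+x. ennreal (norm (enn2real (S x))) \<partial>lebesgue) = (\<integral>\<^sup>+x. S x \<partial>lebesgue)"
      using SAE by (intro nn_integral_cong_AE) (auto simp: less_top)
    then show "(\<integral>\<^sup>+x. ennreal (norm (enn2real (S x))) \<partial>lebesgue) < \<infinity>" using Sfin by simp
  qed (use Sm in measurable)
  then have Di: "integrable lebesgue D" unfolding D_def using fi by simp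
  have eq: "conv (moll (e n)) F x = conv (moll (e n)) f x" "f x = F x" if "norm x \<le> R" for n x
  proof -
    have "moll (e n) (x - y) *\<^sub>R F y = moll (e n) (x - y) *\<^sub>R f y" for y
    proof (cases "norm y \<le> R + 1")
      case False
      then have "norm (x - y) \<ge> e n"
        using that e(2)[of n] norm_triangle_ineq2[of y x] by (simp add: norm_minus_commute)
      then show ?thesis using moll_supp[OF e(1), of n "x - y"] by simp
    qed (simp add: f_def)
    then show "conv (moll (e n)) F x = conv (moll (e n)) f x" by (simp only: conv_def)
    show "f x = F x" using that by (simp add: f_def)
  qed
  have *: "summable (\<lambda>n. norm (conv (moll (e n)) f x - f x))" if "S x \<noteq> \<infinity>" for x
    using that unfolding S_def by (intro summable_suminf_not_top) auto
  show thesis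
  proof (rule that[OF allI[OF e(1)] Di])
    show "AE x in lebesgue. norm x \<le> R \<longrightarrow> (\<lambda>n. conv (moll (e n)) F x) \<longlonglongrightarrow> F x"
      using SAE
    proof eventually_elim
      case (elim x)
      have "(\<lambda>n. conv (moll (e n)) f x - f x) \<longlonglongrightarrow> 0"
        using summable_LIMSEQ_zero[OF *[OF elim]] by (simp add: tendsto_norm_zero_iff)
      then have "(\<lambda>n. conv (moll (e n)) f x) \<longlonglongrightarrow> f x" by (rule LIM_zero_cancel)
      then show ?case using eq[of x] by auto
    qed
    show "AE x in lebesgue. norm x \<le> R \<longrightarrow> (\<forall>n. norm (conv (moll (e n)) F x) \<le> D x)"
      using SAE
    proof eventually_elim
      case (elim x)
      have Seq: "S x = ennreal (\<Sum>n. norm (conv (moll (e n)) f x - f x))"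
        unfolding S_def by (intro suminf_ennreal2 * elim) auto
      have "norm (conv (moll (e n)) f x - f x) \<le> enn2real (S x)" for n
      proof -
        have "norm (conv (moll (e n)) f x - f x) = (\<Sum>n\<in>{n}. norm (conv (moll (e n)) f x - f x))" by simp
        also have "\<dots> \<le> (\<Sum>n. norm (conv (moll (e n)) f x - f x))"
          by (intro sum_le_suminf * elim) auto
        finally show ?thesis by (simp add: Seq suminf_nonneg[OF *[OF elim]])
      qed
      then have "norm (conv (moll (e n)) f x) \<le> D x" for n
        using norm_triangle_ineq[of "conv (moll (e n)) f x - f x" "f x"]
        unfolding D_def by (smt (verit) diff_add_cancel)
      then show ?case using eq[of x] by simp
    qed
  qed
qed

lemma locally_integrable_bounded_linear:
  fixes u :: "real ^ 'n \<Rightarrow> 'b::euclidean_space" and T :: "'b \<Rightarrow> 'c::euclidean_space"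
  assumes "locally_integrable u" "bounded_linear T"
  shows "locally_integrable (\<lambda>x. T (u x))"
  unfolding locally_integrable_def set_integrable_def
proof (intro allI impI)
  fix C :: "(real ^ 'n) set" assume "compact C"
  then have "integrable lebesgue (\<lambda>x. T (indicator C x *\<^sub>R u x))"
    using assms by (intro integrable_bounded_linear[OF assms(2)]) (auto simp: locally_integrable_def set_integrable_def)
  then show "integrable lebesgue (\<lambda>x. indicator C x *\<^sub>R T (u x))"
    by (simp add: linear_simps(5)[OF assms(2)])
qed


lemma locally_integrable_measurable:
  fixes u :: "real ^ 'n \<Rightarrow> 'b::euclidean_space"
  assumes "locally_integrable u"
  shows "u \<in> borel_measurable lebesgue"
proof (rule borel_measurable_LIMSEQ_metric)
  show "(\<lambda>y. indicator (cball 0 (real n)) y *\<^sub>R u y) \<in> borel_measurable lebesgue" for n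
    using borel_measurable_integrable[OF set_integrable_cball[OF assms]] .
  show "(\<lambda>n. indicator (cball 0 (real n)) x *\<^sub>R u x) \<longlonglongrightarrow> u x" for x
  proof (rule tendsto_eventually)
    obtain N where "norm x \<le> real N" using real_arch_simple by blast
    then show "eventually (\<lambda>n. indicator (cball 0 (real n)) x *\<^sub>R u x = u x) sequentially"
      by (intro eventually_sequentiallyI[of N]) (auto simp: indicator_def)
  qed
qed

lemma locally_integrable_bound:
  fixes u :: "real ^ 'n \<Rightarrow> 'b::euclidean_space" and v :: "real ^ 'n \<Rightarrow> 'c::euclidean_space"
  assumes "locally_integrable u" "v \<in> borel_measurable lebesgue" "AE x in lebesgue. norm (v x) \<le> norm (u x)"
  shows "locally_integrable v"
  unfolding locally_integrable_def set_integrable_def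
proof (intro allI impI)
  fix C :: "(real ^ 'n) set" assume C: "compact C"
  show "integrable lebesgue (\<lambda>x. indicator C x *\<^sub>R v x)"
  proof (rule Bochner_Integration.integrable_bound)
    show "integrable lebesgue (\<lambda>x. indicator C x *\<^sub>R u x)"
      using assms C by (auto simp: locally_integrable_def set_integrable_def)
    have "C \<in> sets lebesgue" using C by (intro fmeasurableD lmeasurable_compact)
    then show "(\<lambda>x. indicator C x *\<^sub>R v x) \<in> borel_measurable lebesgue" using assms(2) by measurable
    show "AE x in lebesgue. norm (indicator C x *\<^sub>R v x) \<le> norm (indicator C x *\<^sub>R u x)"
      using assms(3) by eventually_elim (auto simp: indicator_def)
  qed
qed

lemma locally_integrable_add:
  "locally_integrable u \<Longrightarrow> locally_integrable v \<Longrightarrow> locally_integrable (\<lambda>x. u x + v x)"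
  unfolding locally_integrable_def by (auto intro: set_integral_add)

lemma locally_integrable_cmult: "locally_integrable u \<Longrightarrow> locally_integrable (\<lambda>x. c * u x)" for c :: real
  unfolding locally_integrable_def by auto

lemma locally_integrable_norm: "locally_integrable u \<Longrightarrow> locally_integrable (\<lambda>x. norm (u x))"
  unfolding locally_integrable_def by (auto intro: set_integrable_norm)

lemma locally_integrable_continuous:
  fixes u :: "real ^ 'n \<Rightarrow> 'b::euclidean_space"
  shows "continuous_on UNIV u \<Longrightarrow> locally_integrable u"
  unfolding locally_integrable_def set_integrable_def
proof (intro allI impI)
  fix C :: "(real ^ 'n) set" assume C: "compact C" and u: "continuous_on UNIV u"
  have "integrable lborel (\<lambda>x. indicator C x *\<^sub>R u x)"
    using C u by (intro borel_integrable_compact) (auto intro: continuous_on_subset)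
  then show "integrable lebesgue (\<lambda>x. indicator C x *\<^sub>R u x)"
    by (subst integrable_completion) auto
qed

text \<open>Pairing lets one sequence of radii and one majorant serve several functions at once:
  convergence and domination of the pair pass to its components.\<close>

lemma locally_integrable_Pair:
  fixes u :: "real ^ 'n \<Rightarrow> 'b::euclidean_space" and v :: "real ^ 'n \<Rightarrow> 'c::euclidean_space"
  assumes "locally_integrable u" "locally_integrable v"
  shows "locally_integrable (\<lambda>x. (u x, v x))"
proof -
  have "locally_integrable (\<lambda>x. (u x, 0))" "locally_integrable (\<lambda>x. (0, v x))"
    by (rule locally_integrable_bounded_linear[OF assms(1)] locally_integrable_bounded_linear[OF assms(2)];
        intro bounded_linear_Pair bounded_linear_ident bounded_linear_zero)+
  from locally_integrable_add[OF this] show ?thesis by simp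
qed

lemma integrable_conv_moll:
  "locally_integrable u \<Longrightarrow> 0 < e \<Longrightarrow> integrable lebesgue (\<lambda>y. moll e (x - y) *\<^sub>R u y)"
  by (rule integrable_conv[OF _ moll_continuous(1), where R = e]) (auto intro: moll_supp less_imp_le)

lemma continuous_on_conv_moll:
  "locally_integrable u \<Longrightarrow> 0 < e \<Longrightarrow> continuous_on A (conv (moll e) u)"
  by (rule continuous_on_conv[OF _ moll_continuous(1), where R = e]) (auto intro: moll_supp less_imp_le)

lemma conv_bounded_linear:
  fixes u :: "real ^ 'n \<Rightarrow> 'b::euclidean_space" and T :: "'b \<Rightarrow> 'c::euclidean_space"
  assumes "locally_integrable u" "0 < e" "bounded_linear T"
  shows "T (conv (moll e) u x) = conv (moll e) (\<lambda>y. T (u y)) x"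
  unfolding conv_def
  using integral_bounded_linear[OF assms(3) integrable_conv_moll[OF assms(1,2), of x]]
  by (simp add: linear_simps(5)[OF assms(3)])

lemma conv_Pair:
  fixes u :: "real ^ 'n \<Rightarrow> 'b::euclidean_space" and v :: "real ^ 'n \<Rightarrow> 'c::euclidean_space"
  assumes "locally_integrable u" "locally_integrable v" "0 < e"
  shows "conv (moll e) (\<lambda>x. (u x, v x)) x = (conv (moll e) u x, conv (moll e) v x)"
  using conv_bounded_linear[OF locally_integrable_Pair[OF assms(1,2)] assms(3) bounded_linear_fst, of x]
    conv_bounded_linear[OF locally_integrable_Pair[OF assms(1,2)] assms(3) bounded_linear_snd, of x]
  by (simp add: prod_eq_iff)

lemma integral_moll_shift:
  fixes x :: "real ^ 'n"
  assumes "0 < e"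
  shows "(LINT y|lebesgue. moll e (x - y)) = 1" "integrable lebesgue (\<lambda>y. moll e (x - y))"
  using lebesgue_integral_affine[of "-1" "moll e" x] lebesgue_integrable_affine_iff[of "-1" "moll e" x]
    integral_moll[OF assms, where 'n = 'n] integrable_moll[OF assms, where 'n = 'n] by simp_all

text \<open>The kernel is a probability density, and the variance of \<open>norm (u y)\<close> under
  it is nonnegative; \<open>?c\<close> is the mean.\<close>

lemma conv_jensen:
  fixes u :: "real ^ 'n \<Rightarrow> 'b::euclidean_space"
  assumes u: "locally_integrable u" and u2: "locally_integrable (\<lambda>x. (norm (u x))\<^sup>2)" and e: "0 < e"
  shows "(norm (conv (moll e) u x))\<^sup>2 \<le> conv (moll e) (\<lambda>x. (norm (u x))\<^sup>2) x"
proof -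
  let ?m = "\<lambda>y. moll e (x - y)"
  let ?c = "LINT y|lebesgue. ?m y * norm (u y)"
  have i1: "integrable lebesgue (\<lambda>y. ?m y * norm (u y))"
    using integrable_norm[OF integrable_conv_moll[OF u e, of x]] by (simp add: abs_of_nonneg[OF moll_nonneg[OF e]])
  have i2: "integrable lebesgue (\<lambda>y. ?m y * (norm (u y))\<^sup>2)"
    using integrable_conv_moll[OF u2 e, of x] by simp
  note im = integral_moll_shift[OF e, of x]
  have eq: "?m y * (norm (u y) - ?c)\<^sup>2 = ?m y * (norm (u y))\<^sup>2 - 2 * ?c * (?m y * norm (u y)) + ?c\<^sup>2 * ?m y" for y
    by (simp add: power2_eq_square algebra_simps)
  have "0 \<le> (LINT y|lebesgue. ?m y * (norm (u y) - ?c)\<^sup>2)"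
    by (intro integral_nonneg_AE AE_I2 mult_nonneg_nonneg moll_nonneg[OF e]) simp
  also have "\<dots> = (LINT y|lebesgue. ?m y * (norm (u y))\<^sup>2) - 2 * ?c * ?c + ?c\<^sup>2 * 1"
    unfolding eq using i1 i2 im by (simp add: Bochner_Integration.integral_diff)
  finally have "?c\<^sup>2 \<le> (LINT y|lebesgue. ?m y * (norm (u y))\<^sup>2)" by (simp add: power2_eq_square)
  moreover have "norm (conv (moll e) u x) \<le> ?c"
    unfolding conv_def using integral_norm_bound[of lebesgue "\<lambda>y. ?m y *\<^sub>R u y"]
    by (simp add: abs_of_nonneg[OF moll_nonneg[OF e]])
  then have "(norm (conv (moll e) u x))\<^sup>2 \<le> ?c\<^sup>2" by (rule power_mono) simp
  ultimately show ?thesis by (simp add: conv_def)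
qed

section \<open>Weak gradients\<close>

text \<open>Shaped to fit \<open>mollify_local\<close>, whose convergence and domination hold only
  on a ball; all functions involved vanish outside it.\<close>

lemma ball_dominated_convergence:
  fixes f :: "nat \<Rightarrow> 'a::euclidean_space \<Rightarrow> 'b::euclidean_space"
  assumes m: "\<And>n. f n \<in> borel_measurable lebesgue" "g \<in> borel_measurable lebesgue"
    and z: "\<And>n x. norm x > R \<Longrightarrow> f n x = 0" "\<And>x. norm x > R \<Longrightarrow> g x = 0"
    and l: "AE x in lebesgue. norm x \<le> R \<longrightarrow> (\<lambda>n. f n x) \<longlonglongrightarrow> g x"
    and W: "integrable lebesgue W" "AE x in lebesgue. norm x \<le> R \<longrightarrow> (\<forall>n. norm (f n x) \<le> W x)"
  shows "(\<lambda>n. LINT x|lebesgue. f n x) \<longlonglongrightarrow> (LINT x|lebesgue. g x)"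
    "integrable lebesgue g" "\<And>n. integrable lebesgue (f n)"
proof -
  have Wi: "integrable lebesgue (\<lambda>x. \<bar>W x\<bar>)" using W by simp
  have l': "AE x in lebesgue. (\<lambda>n. f n x) \<longlonglongrightarrow> g x"
    using l
  proof eventually_elim
    case (elim x)
    then show ?case using z by (cases "norm x \<le> R") auto
  qed
  have W': "AE x in lebesgue. norm (f n x) \<le> \<bar>W x\<bar>" for n
    using W(2)
  proof eventually_elim
    case (elim x)
    then show ?case using z(1)[of x n] by (cases "norm x \<le> R") (auto intro: order_trans)
  qed
  show "(\<lambda>n. LINT x|lebesgue. f n x) \<longlonglongrightarrow> (LINT x|lebesgue. g x)"
    by (rule integral_dominated_convergence[OF m(2) m(1) Wi l' W'])
  show "integrable lebesgue g"
    by (rule integrable_dominated_convergence[OF m(2) m(1) Wi l' W'])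
  show "integrable lebesgue (f n)" for n
    by (rule Bochner_Integration.integrable_bound[OF Wi m(1)]) (use W'[of n] in simp)
qed

lemma test_function_supp:
  assumes "test_function \<phi>"
  obtains R where "R > 0" "\<And>x. norm x > R \<Longrightarrow> \<phi> x = 0"
proof -
  have "bounded {x. \<phi> x \<noteq> 0}"
    using assms by (auto simp: test_function_def compact_closure)
  then obtain R where R: "\<And>x. \<phi> x \<noteq> 0 \<Longrightarrow> norm x \<le> R" by (auto simp: bounded_iff)
  show thesis by (rule that[of "max R 1"]) (use R in force)+
qed

lemma GDERIV_unique:
  assumes "GDERIV \<phi> x :> g" "GDERIV \<phi> x :> k"
  shows "g = (k :: 'a::real_inner)"
proof -
  have "(\<lambda>h. h \<bullet> g) = (\<lambda>h. h \<bullet> k)"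
    using assms has_derivative_unique unfolding gderiv_def by blast
  then have "h \<bullet> (g - k) = 0" for h by (simp add: inner_diff_right fun_eq_iff)
  then show ?thesis by (metis eq_iff_diff_eq_0 inner_eq_zero_iff)
qed

lemma test_function_gradient:
  fixes \<phi> :: "real ^ 'n \<Rightarrow> real"
  assumes "test_function \<phi>" "\<And>x. GDERIV \<phi> x :> g x"
  shows "continuous_on UNIV g"
proof -
  have "C_k (Suc 0) \<phi>" using assms(1) by (rule test_function_C_k)
  then obtain k where k: "\<And>x. GDERIV \<phi> x :> k x" "\<And>i. continuous_on UNIV (\<lambda>x. k x $ i)" by auto
  have "g x = k x" for x using GDERIV_unique[OF assms(2) k(1)] .
  moreover have "continuous_on UNIV (\<lambda>x. \<chi> i. k x $ i)"
    by (intro continuous_on_vec_lambda k(2))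
  ultimately show ?thesis by simp
qed

lemma test_function_has_gradient:
  assumes "test_function \<phi>"
  obtains g where "\<And>x. GDERIV \<phi> x :> g x" "continuous_on UNIV g"
proof -
  have "C_k (Suc 0) \<phi>" using assms by (rule test_function_C_k)
  then obtain g where "\<forall>x. GDERIV \<phi> x :> g x" by auto
  with test_function_gradient[OF assms, of g] show thesis by (intro that[of g]) blast+
qed

text \<open>The reflected kernel \<open>moll e (x - y)\<close> is a test function in
  \<open>y\<close>, so every mollification of \<open>F\<close> is 0, and mollifications converge to
  \<open>F\<close> almost everywhere on each ball of integer radius.\<close>

lemma eq_0_AE_of_test_functions:
  fixes F :: "real ^ 'n \<Rightarrow> 'b::euclidean_space"
  assumes F: "locally_integrable F" and t: "\<And>\<phi>. test_function \<phi> \<Longrightarrow> (LINT x|lebesgue. \<phi> x *\<^sub>R F x) = 0"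
  shows "AE x in lebesgue. F x = 0"
proof -
  have "AE x in lebesgue. norm x \<le> real R \<longrightarrow> F x = 0" for R
  proof -
    obtain e D where e: "\<forall>n. 0 < e n" and "integrable lebesgue D"
      and l: "AE x in lebesgue. norm x \<le> real R \<longrightarrow> (\<lambda>n. conv (moll (e n)) F x) \<longlonglongrightarrow> F x"
      and "AE x in lebesgue. norm x \<le> real R \<longrightarrow> (\<forall>n. norm (conv (moll (e n)) F x) \<le> D x)"
      using mollify_local[OF F, of "real R"] .
    have "conv (moll (e n)) F x = 0" for n x
      unfolding conv_def by (rule t[OF test_function_moll(1)[OF e[rule_format]]])
    with l show ?thesis by (auto simp: LIMSEQ_const_iff elim: eventually_mono)
  qed
  then have "AE x in lebesgue. \<forall>R. norm x \<le> real R \<longrightarrow> F x = 0" by (rule AE_all_countable[THEN iffD2, rule_format])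
  then show ?thesis
  proof eventually_elim
    case (elim x)
    obtain R where "norm x \<le> real R" using real_arch_simple by blast
    with elim show ?case by blast
  qed
qed

lemma has_weak_gradientD:
  fixes u :: "real ^ 'n \<Rightarrow> real"
  assumes "has_weak_gradient u G"
  shows "locally_integrable u" "locally_integrable G"
    "u \<in> borel_measurable lebesgue" "G \<in> borel_measurable lebesgue"
    "test_function \<phi> \<Longrightarrow> (\<And>x. GDERIV \<phi> x :> g x) \<Longrightarrow> (LINT x|lebesgue. u x *\<^sub>R g x) = - (LINT x|lebesgue. \<phi> x *\<^sub>R G x)"
  using assms by (auto simp: has_weak_gradient_def locally_integrable_measurable)

lemma weak_gradient_unique:
  fixes u :: "real ^ 'n \<Rightarrow> real"
  assumes "has_weak_gradient u G" "has_weak_gradient u G'"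
  shows "AE x in lebesgue. G x = G' x"
proof -
  note G = has_weak_gradientD[OF assms(1)] and G' = has_weak_gradientD[OF assms(2)]
  have m: "locally_integrable (\<lambda>x. - G' x)"
    by (rule locally_integrable_bounded_linear[OF G'(2) bounded_linear_minus[OF bounded_linear_ident]])
  have "AE x in lebesgue. G x + - G' x = 0"
  proof (rule eq_0_AE_of_test_functions[OF locally_integrable_add[OF G(2) m]])
    fix \<phi> :: "real ^ 'n \<Rightarrow> real" assume t: "test_function \<phi>"
    obtain g where g: "\<And>x. GDERIV \<phi> x :> g x" using test_function_has_gradient[OF t] by blast
    obtain R where R: "\<And>x. norm x > R \<Longrightarrow> \<phi> x = 0" using test_function_supp[OF t] by blast
    note i = integrable_supp_scaleR[OF _ GDERIV_continuous_on[OF g] R]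
    have "(LINT x|lebesgue. \<phi> x *\<^sub>R (G x + - G' x)) = (LINT x|lebesgue. \<phi> x *\<^sub>R G x) - (LINT x|lebesgue. \<phi> x *\<^sub>R G' x)"
      using i[OF G(2)] i[OF G'(2)] by (simp add: scaleR_diff_right)
    then show "(LINT x|lebesgue. \<phi> x *\<^sub>R (G x + - G' x)) = 0"
      using G(5)[OF t g] G'(5)[OF t g] by simp
  qed
  then show ?thesis by eventually_elim simp
qed

lemma has_weak_gradient_weak_gradient: "has_weak_gradient u G \<Longrightarrow> has_weak_gradient u (weak_gradient u)"
  unfolding weak_gradient_def by (rule someI[of "has_weak_gradient u"])

lemma weak_gradient_AE: "has_weak_gradient u G \<Longrightarrow> AE x in lebesgue. weak_gradient u x = G x"
  by (rule weak_gradient_unique[OF has_weak_gradient_weak_gradient])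

text \<open>The gradient on the kernel moves onto \<open>u\<close> by the definition of the weak
  gradient; the sign from reflecting the kernel cancels the one from partial integration.\<close>

lemma GDERIV_mollify:
  fixes u :: "real ^ 'n \<Rightarrow> real"
  assumes "has_weak_gradient u G" "0 < e"
  shows "GDERIV (conv (moll e) u) x :> conv (moll e) G x"
proof -
  note G = has_weak_gradientD[OF assms(1)]
  have "GDERIV (conv (moll e) u) x :> (LINT y|lebesgue. u y *\<^sub>R moll_grad e (x - y))"
    by (rule GDERIV_conv[OF G(1) GDERIV_moll moll_continuous(2), of e])
      (use assms(2) in \<open>auto intro: moll_supp less_imp_le\<close>)
  moreover have "(LINT y|lebesgue. u y *\<^sub>R (- moll_grad e (x - y))) = - (LINT y|lebesgue. moll e (x - y) *\<^sub>R G y)"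
    by (rule G(5)[OF test_function_moll[OF assms(2)]])
  ultimately show ?thesis by (simp add: conv_def)
qed

lemma C1_has_weak_gradient:
  fixes u :: "real ^ 'n \<Rightarrow> real"
  assumes "\<And>x. GDERIV u x :> g x" "continuous_on UNIV g"
  shows "has_weak_gradient u g"
  unfolding has_weak_gradient_def
proof (intro conjI allI impI)
  show "locally_integrable u" "locally_integrable g"
    using assms(2) GDERIV_continuous_on[OF assms(1)] by (auto intro: locally_integrable_continuous)
  fix \<phi> :: "real ^ 'n \<Rightarrow> real" and k assume t: "test_function \<phi>" and k: "\<forall>x. GDERIV \<phi> x :> k x"
  obtain R where R: "\<And>x. norm x > R \<Longrightarrow> \<phi> x = 0" using test_function_supp[OF t] by blast
  show "(LINT x|lebesgue. u x *\<^sub>R k x) = - (LINT x|lebesgue. \<phi> x *\<^sub>R g x)"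
    by (rule integral_by_parts[OF assms k[rule_format] _ R])
      (use test_function_gradient[OF t] k in blast)
qed

lemma has_weak_gradient_add:
  fixes u v :: "real ^ 'n \<Rightarrow> real"
  assumes "has_weak_gradient u G" "has_weak_gradient v K"
  shows "has_weak_gradient (\<lambda>x. u x + v x) (\<lambda>x. G x + K x)"
  unfolding has_weak_gradient_def
proof (intro conjI allI impI)
  note G = has_weak_gradientD[OF assms(1)] and K = has_weak_gradientD[OF assms(2)]
  show "locally_integrable (\<lambda>x. u x + v x)" "locally_integrable (\<lambda>x. G x + K x)"
    using G K by (auto intro: locally_integrable_add)
  fix \<phi> :: "real ^ 'n \<Rightarrow> real" and k assume t: "test_function \<phi>" and "\<forall>x. GDERIV \<phi> x :> k x"
  then have k: "\<And>x. GDERIV \<phi> x :> k x" by blast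
  obtain R where R: "\<And>x. norm x > R \<Longrightarrow> \<phi> x = 0" using test_function_supp[OF t] by blast
  note kc = test_function_gradient[OF t k]
  have k0: "norm x > R \<Longrightarrow> k x = 0" for x by (rule GDERIV_supp[OF k R])
  note i = integrable_supp_scaleR[OF _ GDERIV_continuous_on[OF k] R]
  have j: "integrable lebesgue (\<lambda>x. u x *\<^sub>R k x)" if "locally_integrable u" for u
  proof -
    have "integrable lebesgue (\<lambda>x. \<Sum>j\<in>Basis. (((k x \<bullet> j) *\<^sub>R u x) *\<^sub>R j))"
      by (intro Bochner_Integration.integrable_sum integrable_scaleR_left impI
          integrable_supp_scaleR[OF that, where R = R] continuous_intros kc) (simp add: k0)
    moreover have "(\<Sum>j\<in>Basis. (((k x \<bullet> j) *\<^sub>R u x) *\<^sub>R j)) = u x *\<^sub>R k x" for x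
      by (subst (2) euclidean_representation[of "k x", symmetric])
        (simp add: scaleR_sum_right mult.commute)
    ultimately show ?thesis by simp
  qed
  show "(LINT x|lebesgue. (u x + v x) *\<^sub>R k x) = - (LINT x|lebesgue. \<phi> x *\<^sub>R (G x + K x))"
    using i[OF G(2)] i[OF K(2)] j[OF G(1)] j[OF K(1)] G(5)[OF t k] K(5)[OF t k]
    by (simp add: scaleR_add_left scaleR_add_right)
qed

text \<open>Testing \<open>u\<close> with \<open>\<phi> (x / c)\<close> and rescaling both integrals
  gives the same Jacobian factor on each side; only the factor \<open>c\<close> of the gradient
  survives.\<close>

lemma has_weak_gradient_dilate:
  fixes u :: "real ^ 'n \<Rightarrow> real"
  assumes "has_weak_gradient u G" "c > 0"
  shows "has_weak_gradient (\<lambda>x. s * u (c *\<^sub>R x)) (\<lambda>x. (s * c) *\<^sub>R G (c *\<^sub>R x))"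
  unfolding has_weak_gradient_def
proof (intro conjI allI impI)
  note G = has_weak_gradientD[OF assms(1)]
  have loc: "locally_integrable (\<lambda>x. a *\<^sub>R v (c *\<^sub>R x))" if "locally_integrable v"
    for v :: "real ^ 'n \<Rightarrow> 'b::euclidean_space" and a
    unfolding locally_integrable_def
  proof (intro allI impI)
    fix C :: "(real ^ 'n) set" assume "compact C"
    then have "compact ((\<lambda>x. c *\<^sub>R x) ` C)" by (rule compact_scaling)
    then have "integrable lebesgue (\<lambda>x. indicator ((\<lambda>x. c *\<^sub>R x) ` C) x *\<^sub>R v x)"
      using that by (auto simp: locally_integrable_def set_integrable_def)
    then have "integrable lebesgue (\<lambda>x. indicator ((\<lambda>x. c *\<^sub>R x) ` C) (0 + c *\<^sub>R x) *\<^sub>R v (0 + c *\<^sub>R x))"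
      by (subst lebesgue_integrable_affine_iff) (use assms in auto)
    moreover have "indicator ((\<lambda>x. c *\<^sub>R x) ` C) (c *\<^sub>R x) = (indicator C x :: real)" for x
      using assms(2) by (auto simp: indicator_def)
    ultimately have "integrable lebesgue (\<lambda>x. indicator C x *\<^sub>R v (c *\<^sub>R x))" by simp
    from integrable_scaleR_right[OF this, of a] show "set_integrable lebesgue C (\<lambda>x. a *\<^sub>R v (c *\<^sub>R x))"
      by (simp add: set_integrable_def mult.commute)
  qed
  show "locally_integrable (\<lambda>x. s * u (c *\<^sub>R x))" using loc[OF G(1), of s] by simp
  show "locally_integrable (\<lambda>x. (s * c) *\<^sub>R G (c *\<^sub>R x))" by (rule loc[OF G(2)])
  fix \<phi> :: "real ^ 'n \<Rightarrow> real" and k assume t: "test_function \<phi>" and "\<forall>x. GDERIV \<phi> x :> k x"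
  then have k: "\<And>x. GDERIV \<phi> x :> k x" by blast
  let ?c = "inverse c"
  obtain R where R: "\<And>x. norm x > R \<Longrightarrow> \<phi> x = 0" using test_function_supp[OF t] by blast
  have "{x. \<phi> (?c *\<^sub>R x) \<noteq> 0} \<subseteq> cball 0 (c * R)"
  proof
    fix x assume "x \<in> {x. \<phi> (?c *\<^sub>R x) \<noteq> 0}"
    then have "norm (?c *\<^sub>R x) \<le> R" using R[of "?c *\<^sub>R x"] by force
    then show "x \<in> cball 0 (c * R)" using assms(2) by (simp add: field_simps)
  qed
  then have "bounded {x. \<phi> (?c *\<^sub>R x) \<noteq> 0}" using bounded_subset bounded_cball by blast
  then have t': "test_function (\<lambda>x. \<phi> (?c *\<^sub>R x))"
    using t by (auto simp: test_function_def compact_closure intro: C_k_dilate)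
  have k': "GDERIV (\<lambda>x. \<phi> (?c *\<^sub>R x)) x :> ?c *\<^sub>R k (?c *\<^sub>R x)" for x by (rule GDERIV_dilate[OF k])
  have "(LINT x|lebesgue. u x *\<^sub>R (?c *\<^sub>R k (?c *\<^sub>R x))) = - (LINT x|lebesgue. \<phi> (?c *\<^sub>R x) *\<^sub>R G x)"
    by (rule G(5)[OF t' k'])
  moreover have "(LINT x|lebesgue. u x *\<^sub>R (?c *\<^sub>R k (?c *\<^sub>R x))) = \<bar>c\<bar> ^ DIM(real ^ 'n) *\<^sub>R (LINT x|lebesgue. ?c *\<^sub>R (u (c *\<^sub>R x) *\<^sub>R k x))"
    by (subst lebesgue_integral_affine[of c _ 0]) (use assms(2) in \<open>simp_all add: mult.commute\<close>)
  moreover have "(LINT x|lebesgue. \<phi> (?c *\<^sub>R x) *\<^sub>R G x) = \<bar>c\<bar> ^ DIM(real ^ 'n) *\<^sub>R (LINT x|lebesgue. \<phi> x *\<^sub>R G (c *\<^sub>R x))"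
    by (subst lebesgue_integral_affine[of c _ 0]) (use assms(2) in simp_all)
  ultimately have "\<bar>c\<bar> ^ DIM(real ^ 'n) *\<^sub>R (?c *\<^sub>R (LINT x|lebesgue. u (c *\<^sub>R x) *\<^sub>R k x)) = \<bar>c\<bar> ^ DIM(real ^ 'n) *\<^sub>R (- (LINT x|lebesgue. \<phi> x *\<^sub>R G (c *\<^sub>R x)))"
    by (simp only: integral_scaleR_right scaleR_minus_right)
  then have "?c *\<^sub>R (LINT x|lebesgue. u (c *\<^sub>R x) *\<^sub>R k x) = - (LINT x|lebesgue. \<phi> x *\<^sub>R G (c *\<^sub>R x))"
    using assms(2) by (simp only: scaleR_cancel_left) simp
  then have "(s * c) *\<^sub>R (?c *\<^sub>R (LINT x|lebesgue. u (c *\<^sub>R x) *\<^sub>R k x)) = (s * c) *\<^sub>R (- (LINT x|lebesgue. \<phi> x *\<^sub>R G (c *\<^sub>R x)))"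
    by simp
  moreover have "s * c * inverse c = s" using assms(2) by simp
  ultimately have "s *\<^sub>R (LINT x|lebesgue. u (c *\<^sub>R x) *\<^sub>R k x) = - ((s * c) *\<^sub>R (LINT x|lebesgue. \<phi> x *\<^sub>R G (c *\<^sub>R x)))"
    by (simp only: scaleR_scaleR scaleR_minus_right)
  moreover have "(LINT x|lebesgue. (s * u (c *\<^sub>R x)) *\<^sub>R k x) = s *\<^sub>R (LINT x|lebesgue. u (c *\<^sub>R x) *\<^sub>R k x)"
    by (simp flip: integral_scaleR_right)
  moreover have "(LINT x|lebesgue. \<phi> x *\<^sub>R ((s * c) *\<^sub>R G (c *\<^sub>R x))) = (s * c) *\<^sub>R (LINT x|lebesgue. \<phi> x *\<^sub>R G (c *\<^sub>R x))"
    by (simp add: mult.commute flip: integral_scaleR_right)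
  ultimately show "(LINT x|lebesgue. (s * u (c *\<^sub>R x)) *\<^sub>R k x) = - (LINT x|lebesgue. \<phi> x *\<^sub>R ((s * c) *\<^sub>R G (c *\<^sub>R x)))"
    by simp
qed


text \<open>The triple \<open>(u, G, V)\<close> is mollified as one function. The free slot
  \<open>V\<close> later carries right-hand sides or squared norms whose mollifications must
  converge along the same radii.\<close>

lemma mollify_weak_gradient:
  fixes u :: "real ^ 'n \<Rightarrow> real"
  assumes w: "has_weak_gradient u G" and V: "locally_integrable (V :: real ^ 'n \<Rightarrow> 'b::euclidean_space)"
  obtains e D where "\<forall>n. 0 < e n" "integrable lebesgue D"
    "AE x in lebesgue. norm x \<le> R \<longrightarrow> (\<lambda>n. conv (moll (e n)) u x) \<longlonglongrightarrow> u x"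
    "AE x in lebesgue. norm x \<le> R \<longrightarrow> (\<lambda>n. conv (moll (e n)) G x) \<longlonglongrightarrow> G x"
    "AE x in lebesgue. norm x \<le> R \<longrightarrow> (\<lambda>n. conv (moll (e n)) V x) \<longlonglongrightarrow> V x"
    "AE x in lebesgue. norm x \<le> R \<longrightarrow> (\<forall>n. \<bar>conv (moll (e n)) u x\<bar> \<le> D x \<and>
       norm (conv (moll (e n)) G x) \<le> D x \<and> norm (conv (moll (e n)) V x) \<le> D x)"
proof -
  note G = has_weak_gradientD[OF w]
  note GV = locally_integrable_Pair[OF G(2) V]
  note uGV = locally_integrable_Pair[OF G(1) GV]
  obtain e D where e: "\<forall>n. 0 < e n" and D: "integrable lebesgue D"
    and l: "AE x in lebesgue. norm x \<le> R \<longrightarrow> (\<lambda>n. conv (moll (e n)) (\<lambda>x. (u x, G x, V x)) x) \<longlonglongrightarrow> (u x, G x, V x)"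
    and b: "AE x in lebesgue. norm x \<le> R \<longrightarrow> (\<forall>n. norm (conv (moll (e n)) (\<lambda>x. (u x, G x, V x)) x) \<le> D x)"
    using mollify_local[OF uGV, of R] .
  have eq: "conv (moll (e n)) (\<lambda>x. (u x, G x, V x)) x = (conv (moll (e n)) u x, conv (moll (e n)) G x, conv (moll (e n)) V x)" for n x
    using conv_Pair[OF G(1) GV e[rule_format]] conv_Pair[OF G(2) V e[rule_format]] by simp
  have nb: "\<bar>a\<bar> \<le> d \<and> norm b \<le> d \<and> norm c \<le> d" if "norm (a, b, c) \<le> d"
    for a d :: real and b :: "real ^ 'n" and c :: 'b
    using that norm_fst_le[of a "(b, c)"] norm_snd_le[of "(b, c)" a] norm_fst_le[of b c] norm_snd_le[of c b] by simp
  show thesis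
  proof (rule that[OF e D])
    show "AE x in lebesgue. norm x \<le> R \<longrightarrow> (\<lambda>n. conv (moll (e n)) u x) \<longlonglongrightarrow> u x"
      using l unfolding eq by eventually_elim (auto dest: tendsto_fst)
    show "AE x in lebesgue. norm x \<le> R \<longrightarrow> (\<lambda>n. conv (moll (e n)) G x) \<longlonglongrightarrow> G x"
      using l unfolding eq by eventually_elim (auto dest!: tendsto_snd[THEN tendsto_fst])
    show "AE x in lebesgue. norm x \<le> R \<longrightarrow> (\<lambda>n. conv (moll (e n)) V x) \<longlonglongrightarrow> V x"
      using l unfolding eq by eventually_elim (auto dest!: tendsto_snd)
    show "AE x in lebesgue. norm x \<le> R \<longrightarrow> (\<forall>n. \<bar>conv (moll (e n)) u x\<bar> \<le> D x \<and>
       norm (conv (moll (e n)) G x) \<le> D x \<and> norm (conv (moll (e n)) V x) \<le> D x)"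
      using b unfolding eq by eventually_elim (use nb in blast)
  qed
qed

lemma DERIV_bounded_lipschitz:
  assumes "\<And>t. (\<Phi> has_real_derivative \<Phi>' t) (at t)" "\<And>t. \<bar>\<Phi>' t\<bar> \<le> B"
  shows "\<bar>\<Phi> t\<bar> \<le> \<bar>\<Phi> 0\<bar> + B * \<bar>t :: real\<bar>"
  using field_differentiable_bound[of UNIV \<Phi> \<Phi>' B t 0] assms by (auto simp: has_field_derivative_at_within)

text \<open>The classical chain rule holds for mollifications, which are continuously
  differentiable; the bound on \<open>\<Phi>'\<close> provides linear growth of
  \<open>\<Phi>\<close> and hence majorants for the limit.\<close>

lemma has_weak_gradient_chain_bounded:
  fixes u :: "real ^ 'n \<Rightarrow> real"
  assumes w: "has_weak_gradient u G"
    and d: "\<And>t. (\<Phi> has_real_derivative \<Phi>' t) (at t)" and c: "continuous_on UNIV \<Phi>'" and b: "\<And>t. \<bar>\<Phi>' t\<bar> \<le> B"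
  shows "has_weak_gradient (\<lambda>x. \<Phi> (u x)) (\<lambda>x. \<Phi>' (u x) *\<^sub>R G x)"
  unfolding has_weak_gradient_def
proof (intro conjI allI impI)
  note G = has_weak_gradientD[OF w]
  have B: "B \<ge> 0" using b[of 0] by linarith
  have cP: "continuous_on UNIV \<Phi>" using d by (meson DERIV_continuous continuous_at_imp_continuous_on)
  have [measurable]: "\<Phi> \<in> borel_measurable borel" "\<Phi>' \<in> borel_measurable borel"
    using cP c by (auto intro: borel_measurable_continuous_onI)
  note [measurable] = G(3,4)
  note L = DERIV_bounded_lipschitz[OF d b]
  show "locally_integrable (\<lambda>x. \<Phi> (u x))"
  proof (rule locally_integrable_bound)
    show "locally_integrable (\<lambda>x. \<bar>\<Phi> 0\<bar> + B * \<bar>u x\<bar>)"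
      by (rule locally_integrable_add[OF locally_integrable_continuous locally_integrable_cmult])
        (use locally_integrable_norm[OF G(1)] in auto)
  qed (use L B in auto)
  show "locally_integrable (\<lambda>x. \<Phi>' (u x) *\<^sub>R G x)"
  proof (rule locally_integrable_bound)
    show "locally_integrable (\<lambda>x. B * norm (G x))"
      using locally_integrable_norm[OF G(2)] by (intro locally_integrable_cmult)
    show "AE x in lebesgue. norm (\<Phi>' (u x) *\<^sub>R G x) \<le> norm (B * norm (G x))"
      using B by (intro AE_I2) (simp add: abs_mult mult_right_mono b)
  qed simp
  fix \<phi> :: "real ^ 'n \<Rightarrow> real" and k assume t: "test_function \<phi>" and "\<forall>x. GDERIV \<phi> x :> k x"
  then have k: "\<And>x. GDERIV \<phi> x :> k x" by blast
  obtain R where R: "\<And>x. norm x > R \<Longrightarrow> \<phi> x = 0" using test_function_supp[OF t] by blast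
  note kc = test_function_gradient[OF t k]
  note pc = GDERIV_continuous_on[OF k, of UNIV]
  have k0: "norm x > R \<Longrightarrow> k x = 0" for x by (rule GDERIV_supp[OF k R])
  obtain Bk where Bk: "\<And>x. norm (k x) \<le> Bk" "Bk > 0" using continuous_supp_bounded[OF kc k0] by blast
  obtain Bp where Bp: "\<And>x. norm (\<phi> x) \<le> Bp" "Bp > 0" using continuous_supp_bounded[OF pc R] by blast
  \<comment> \<open>No third field is needed here; \<open>u\<close> fills the free slot.\<close>
  obtain e D where e: "\<forall>n. 0 < e n" and D: "integrable lebesgue D"
    and lu: "AE x in lebesgue. norm x \<le> R \<longrightarrow> (\<lambda>n. conv (moll (e n)) u x) \<longlonglongrightarrow> u x"
    and lG: "AE x in lebesgue. norm x \<le> R \<longrightarrow> (\<lambda>n. conv (moll (e n)) G x) \<longlonglongrightarrow> G x"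
    and "AE x in lebesgue. norm x \<le> R \<longrightarrow> (\<lambda>n. conv (moll (e n)) u x) \<longlonglongrightarrow> u x"
    and bD: "AE x in lebesgue. norm x \<le> R \<longrightarrow> (\<forall>n. \<bar>conv (moll (e n)) u x\<bar> \<le> D x \<and>
       norm (conv (moll (e n)) G x) \<le> D x \<and> norm (conv (moll (e n)) u x) \<le> D x)"
    using mollify_weak_gradient[OF w G(1), of R] .
  let ?u = "\<lambda>n. conv (moll (e n)) u" and ?G = "\<lambda>n. conv (moll (e n)) G"
  have uc: "continuous_on UNIV (?u n)" "continuous_on UNIV (?G n)" for n
    using continuous_on_conv_moll[OF G(1)] continuous_on_conv_moll[OF G(2)] e by blast+
  have cc: "continuous_on UNIV (\<lambda>x. \<Phi> (?u n x))" "continuous_on UNIV (\<lambda>x. \<Phi>' (?u n x))" for n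
    by (rule continuous_on_compose2[OF cP uc(1)] continuous_on_compose2[OF c uc(1)]; simp)+
  \<comment> \<open>The constant \<open>|\<Phi> 0|\<close> of the Lipschitz bound becomes an
    integrable majorant only after restriction to the ball.\<close>
  have Fi: "integrable lebesgue (\<lambda>x :: real ^ 'n. if norm x \<le> R then 1 else 0 :: real)"
  proof -
    have "integrable lebesgue (\<lambda>x. indicator (cball (0 :: real ^ 'n) R) x *\<^sub>R (1 :: real))"
      by (rule set_integrable_cball, rule locally_integrable_continuous) simp
    moreover have "(\<lambda>x. indicator (cball (0 :: real ^ 'n) R) x *\<^sub>R (1 :: real)) = (\<lambda>x. if norm x \<le> R then 1 else 0)"
      by (auto simp: indicator_def)
    ultimately show ?thesis by simp
  qed
  have ibp: "(LINT x|lebesgue. \<Phi> (?u n x) *\<^sub>R k x) = - (LINT x|lebesgue. \<phi> x *\<^sub>R (\<Phi>' (?u n x) *\<^sub>R ?G n x))" for n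
  proof (rule integral_by_parts[OF _ _ k kc R])
    show "GDERIV (\<lambda>x. \<Phi> (?u n x)) x :> \<Phi>' (?u n x) *\<^sub>R ?G n x" for x
      by (rule GDERIV_DERIV_compose[OF GDERIV_mollify[OF w] d]) (use e in blast)
  qed (intro continuous_intros cc uc)
  have l1: "(\<lambda>n. LINT x|lebesgue. \<Phi> (?u n x) *\<^sub>R k x) \<longlonglongrightarrow> (LINT x|lebesgue. \<Phi> (u x) *\<^sub>R k x)"
  proof (rule ball_dominated_convergence(1))
    show "(\<lambda>x. \<Phi> (?u n x) *\<^sub>R k x) \<in> borel_measurable lebesgue" for n
      by (intro continuous_on_imp_lebesgue_measurable continuous_intros cc kc)
    show "(\<lambda>x. \<Phi> (u x) *\<^sub>R k x) \<in> borel_measurable lebesgue"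
      using continuous_on_imp_lebesgue_measurable[OF kc] by measurable
    show "AE x in lebesgue. norm x \<le> R \<longrightarrow> (\<lambda>n. \<Phi> (?u n x) *\<^sub>R k x) \<longlonglongrightarrow> \<Phi> (u x) *\<^sub>R k x"
      using lu
    proof eventually_elim
      case (elim x)
      have "isCont \<Phi> (u x)" using cP by (simp add: continuous_on_eq_continuous_at)
      with elim show ?case by (auto intro!: tendsto_scaleR isCont_tendsto_compose[of _ \<Phi>])
    qed
    show "integrable lebesgue (\<lambda>x. (\<bar>\<Phi> 0\<bar> * (if norm x \<le> R then 1 else 0) + B * D x) * Bk)"
      using Fi D by (intro integrable_mult_left Bochner_Integration.integrable_add integrable_mult_right) auto
    show "AE x in lebesgue. norm x \<le> R \<longrightarrow> (\<forall>n. norm (\<Phi> (?u n x) *\<^sub>R k x) \<le>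
        (\<bar>\<Phi> 0\<bar> * (if norm x \<le> R then 1 else 0) + B * D x) * Bk)"
      using bD
    proof eventually_elim
      case (elim x)
      show ?case
      proof (intro impI allI)
        fix n assume x: "norm x \<le> R"
        have "\<bar>\<Phi> (?u n x)\<bar> \<le> \<bar>\<Phi> 0\<bar> + B * \<bar>?u n x\<bar>" by (rule L)
        also have "B * \<bar>?u n x\<bar> \<le> B * D x" using elim x B by (intro mult_left_mono) auto
        finally have 1: "\<bar>\<Phi> (?u n x)\<bar> \<le> \<bar>\<Phi> 0\<bar> + B * D x" by simp
        have "\<bar>\<Phi> (?u n x)\<bar> * norm (k x) \<le> (\<bar>\<Phi> 0\<bar> + B * D x) * Bk"
          by (rule mult_mono[OF 1 Bk(1)]) (use 1 in auto)
        then show "norm (\<Phi> (?u n x) *\<^sub>R k x) \<le> (\<bar>\<Phi> 0\<bar> * (if norm x \<le> R then 1 else 0) + B * D x) * Bk"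
          using x by simp
      qed
    qed
  qed (use k0 in auto)
  have l2: "(\<lambda>n. LINT x|lebesgue. \<phi> x *\<^sub>R (\<Phi>' (?u n x) *\<^sub>R ?G n x)) \<longlonglongrightarrow> (LINT x|lebesgue. \<phi> x *\<^sub>R (\<Phi>' (u x) *\<^sub>R G x))"
  proof (rule ball_dominated_convergence(1))
    show "(\<lambda>x. \<phi> x *\<^sub>R (\<Phi>' (?u n x) *\<^sub>R ?G n x)) \<in> borel_measurable lebesgue" for n
      by (intro continuous_on_imp_lebesgue_measurable continuous_intros cc pc uc)
    show "(\<lambda>x. \<phi> x *\<^sub>R (\<Phi>' (u x) *\<^sub>R G x)) \<in> borel_measurable lebesgue"
      using continuous_on_imp_lebesgue_measurable[OF pc] by measurable
    show "AE x in lebesgue. norm x \<le> R \<longrightarrow> (\<lambda>n. \<phi> x *\<^sub>R (\<Phi>' (?u n x) *\<^sub>R ?G n x)) \<longlonglongrightarrow> \<phi> x *\<^sub>R (\<Phi>' (u x) *\<^sub>R G x)"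
      using lu lG
    proof eventually_elim
      case (elim x)
      have "isCont \<Phi>' (u x)" using c by (simp add: continuous_on_eq_continuous_at)
      with elim show ?case by (auto intro!: tendsto_scaleR tendsto_mult isCont_tendsto_compose[of _ \<Phi>'])
    qed
    show "integrable lebesgue (\<lambda>x. Bp * (B * D x))" using D by simp
    show "AE x in lebesgue. norm x \<le> R \<longrightarrow> (\<forall>n. norm (\<phi> x *\<^sub>R (\<Phi>' (?u n x) *\<^sub>R ?G n x)) \<le> Bp * (B * D x))"
      using bD
    proof eventually_elim
      case (elim x)
      show ?case
      proof (intro impI allI)
        fix n assume x: "norm x \<le> R"
        have "\<bar>\<Phi>' (?u n x)\<bar> * norm (?G n x) \<le> B * D x"
          using elim x B b by (intro mult_mono) auto
        then show "norm (\<phi> x *\<^sub>R (\<Phi>' (?u n x) *\<^sub>R ?G n x)) \<le> Bp * (B * D x)"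
          using mult_mono[of "\<bar>\<phi> x\<bar>" Bp "\<bar>\<Phi>' (?u n x)\<bar> * norm (?G n x)" "B * D x"] Bp(1)[of x] Bp(2)
          by (simp add: abs_mult mult.assoc)
      qed
    qed
  qed (use R in auto)
  show "(LINT x|lebesgue. \<Phi> (u x) *\<^sub>R k x) = - (LINT x|lebesgue. \<phi> x *\<^sub>R (\<Phi>' (u x) *\<^sub>R G x))"
    using LIMSEQ_unique[OF l1[unfolded ibp] tendsto_minus[OF l2]] .
qed

text \<open>Enlarges the class of test functions from smooth ones to continuously differentiable
  ones with bounded support, because \<open>cutoff\<close> is only of class C^1.\<close>

lemma weak_gradient_C1_test:
  fixes u :: "real ^ 'n \<Rightarrow> real"
  assumes w: "has_weak_gradient u G"
    and k: "\<And>x. GDERIV \<psi> x :> k x" and kc: "continuous_on UNIV k" and R: "\<And>x. norm x > R \<Longrightarrow> \<psi> x = 0"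
  shows "(LINT x|lebesgue. u x *\<^sub>R k x) = - (LINT x|lebesgue. \<psi> x *\<^sub>R G x)"
proof -
  note G = has_weak_gradientD[OF w]
  note [measurable] = G(3,4)
  note pc = GDERIV_continuous_on[OF k, of UNIV]
  have k0: "norm x > R \<Longrightarrow> k x = 0" for x by (rule GDERIV_supp[OF k R])
  obtain Bk where Bk: "\<And>x. norm (k x) \<le> Bk" "Bk > 0" using continuous_supp_bounded[OF kc k0] by blast
  obtain Bp where Bp: "\<And>x. norm (\<psi> x) \<le> Bp" "Bp > 0" using continuous_supp_bounded[OF pc R] by blast
  obtain e D where e: "\<forall>n. 0 < e n" and D: "integrable lebesgue D"
    and lu: "AE x in lebesgue. norm x \<le> R \<longrightarrow> (\<lambda>n. conv (moll (e n)) u x) \<longlonglongrightarrow> u x"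
    and lG: "AE x in lebesgue. norm x \<le> R \<longrightarrow> (\<lambda>n. conv (moll (e n)) G x) \<longlonglongrightarrow> G x"
    and "AE x in lebesgue. norm x \<le> R \<longrightarrow> (\<lambda>n. conv (moll (e n)) u x) \<longlonglongrightarrow> u x"
    and bD: "AE x in lebesgue. norm x \<le> R \<longrightarrow> (\<forall>n. \<bar>conv (moll (e n)) u x\<bar> \<le> D x \<and>
       norm (conv (moll (e n)) G x) \<le> D x \<and> norm (conv (moll (e n)) u x) \<le> D x)"
    using mollify_weak_gradient[OF w G(1), of R] .
  let ?u = "\<lambda>n. conv (moll (e n)) u" and ?G = "\<lambda>n. conv (moll (e n)) G"
  have uc: "continuous_on UNIV (?u n)" "continuous_on UNIV (?G n)" for n
    using continuous_on_conv_moll[OF G(1)] continuous_on_conv_moll[OF G(2)] e by blast+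
  have ibp: "(LINT x|lebesgue. ?u n x *\<^sub>R k x) = - (LINT x|lebesgue. \<psi> x *\<^sub>R ?G n x)" for n
    by (rule integral_by_parts[OF GDERIV_mollify[OF w e[rule_format]] uc(2) k kc R])
  have l1: "(\<lambda>n. LINT x|lebesgue. ?u n x *\<^sub>R k x) \<longlonglongrightarrow> (LINT x|lebesgue. u x *\<^sub>R k x)"
  proof (rule ball_dominated_convergence(1))
    show "(\<lambda>x. ?u n x *\<^sub>R k x) \<in> borel_measurable lebesgue" for n
      by (intro continuous_on_imp_lebesgue_measurable continuous_intros uc kc)
    show "(\<lambda>x. u x *\<^sub>R k x) \<in> borel_measurable lebesgue"
      using continuous_on_imp_lebesgue_measurable[OF kc] by measurable
    show "AE x in lebesgue. norm x \<le> R \<longrightarrow> (\<lambda>n. ?u n x *\<^sub>R k x) \<longlonglongrightarrow> u x *\<^sub>R k x"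
      using lu by eventually_elim (auto intro!: tendsto_scaleR)
    show "integrable lebesgue (\<lambda>x. D x * Bk)" using D by simp
    show "AE x in lebesgue. norm x \<le> R \<longrightarrow> (\<forall>n. norm (?u n x *\<^sub>R k x) \<le> D x * Bk)"
      using bD
    proof eventually_elim
      case (elim x)
      then show ?case using Bk(1)[of x] Bk(2) by (auto intro!: mult_mono)
    qed
  qed (use k0 in auto)
  have l2: "(\<lambda>n. LINT x|lebesgue. \<psi> x *\<^sub>R ?G n x) \<longlonglongrightarrow> (LINT x|lebesgue. \<psi> x *\<^sub>R G x)"
  proof (rule ball_dominated_convergence(1))
    show "(\<lambda>x. \<psi> x *\<^sub>R ?G n x) \<in> borel_measurable lebesgue" for n
      by (intro continuous_on_imp_lebesgue_measurable continuous_intros pc uc)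
    show "(\<lambda>x. \<psi> x *\<^sub>R G x) \<in> borel_measurable lebesgue"
      using continuous_on_imp_lebesgue_measurable[OF pc] by measurable
    show "AE x in lebesgue. norm x \<le> R \<longrightarrow> (\<lambda>n. \<psi> x *\<^sub>R ?G n x) \<longlonglongrightarrow> \<psi> x *\<^sub>R G x"
      using lG by eventually_elim (auto intro!: tendsto_scaleR)
    show "integrable lebesgue (\<lambda>x. Bp * D x)" using D by simp
    show "AE x in lebesgue. norm x \<le> R \<longrightarrow> (\<forall>n. norm (\<psi> x *\<^sub>R ?G n x) \<le> Bp * D x)"
      using bD
    proof eventually_elim
      case (elim x)
      then show ?case using Bp(1)[of x] Bp(2) by (auto intro!: mult_mono)
    qed
  qed (use R in auto)
  show ?thesis
    using LIMSEQ_unique[OF l1[unfolded ibp] tendsto_minus[OF l2]] .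
qed

section \<open>Truncation by bounded increasing functions\<close>

definition trunc_weight :: "nat \<Rightarrow> real \<Rightarrow> real" where
  "trunc_weight k t = sqrt (1 + (t / real (Suc k))\<^sup>2)"

text \<open>A truncation at height \<open>k + 1\<close> that is continuously differentiable with
  positive derivative, so that the chain rule applies directly and signs are kept.
  \<open>Suc k\<close> avoids dividing by zero for \<open>k = 0\<close>.\<close>

definition trunc :: "nat \<Rightarrow> real \<Rightarrow> real" where
  "trunc k t = t / trunc_weight k t"

definition trunc' :: "nat \<Rightarrow> real \<Rightarrow> real" where
  "trunc' k t = 1 / trunc_weight k t ^ 3"

lemma one_plus_sq_pos: "1 + x\<^sup>2 > (0 :: real)"
  by (intro add_pos_nonneg) auto

lemma trunc_weight_ge_1: "trunc_weight k t \<ge> 1"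
  unfolding trunc_weight_def by (rule real_le_rsqrt) simp

lemma trunc_weight_pos: "trunc_weight k t > 0"
  using trunc_weight_ge_1[of k t] by linarith

lemma abs_le_trunc_weight: "\<bar>t\<bar> \<le> real (Suc k) * trunc_weight k t"
proof -
  have "\<bar>t / real (Suc k)\<bar> \<le> trunc_weight k t"
    unfolding trunc_weight_def by (rule real_le_rsqrt) (simp only: power2_abs less_add_same_cancel2 le_add_same_cancel2 zero_le_one)
  then show ?thesis by (simp add: abs_divide pos_divide_le_eq mult.commute del: of_nat_Suc)
qed

lemma trunc_deriv_aux:
  assumes "s > 0" "s * s = 1 + z\<^sup>2" "z = t * c"
  shows "1 * s - t * (inverse s / 2 * (2 * z * c)) = 1 / (s :: real)"
proof -
  have "t * (inverse s / 2 * (2 * z * c)) = inverse s * (z * (t * c))" by simp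
  also have "\<dots> = (s * s - 1) / s" using assms by (simp add: divide_inverse power2_eq_square)
  finally show ?thesis using assms(1) by (simp add: diff_divide_distrib)
qed

lemma DERIV_trunc: "(trunc k has_real_derivative trunc' k t) (at t)"
proof -
  let ?c = "real (Suc k)" and ?s = "trunc_weight k t"
  have s: "?s * ?s = 1 + (t / ?c)\<^sup>2"
    unfolding trunc_weight_def using one_plus_sq_pos[of "t / ?c"] by (intro real_sqrt_mult_self[THEN trans]) linarith
  have "((\<lambda>t. 1 + (t / ?c)\<^sup>2) has_real_derivative 2 * (t / ?c) * (1 / ?c)) (at t)"
    by (auto intro!: derivative_eq_intros)
  from DERIV_chain2[OF DERIV_real_sqrt[OF one_plus_sq_pos[of "t / ?c"]] this]
  have "(trunc_weight k has_real_derivative inverse ?s / 2 * (2 * (t / ?c) * (1 / ?c))) (at t)"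
    unfolding trunc_weight_def[abs_def] .
  from DERIV_divide[OF DERIV_ident this less_imp_neq[OF trunc_weight_pos, symmetric]]
  have "(trunc k has_real_derivative (1 * ?s - t * (inverse ?s / 2 * (2 * (t / ?c) * (1 / ?c)))) / (?s * ?s)) (at t)"
    unfolding trunc_def[abs_def] .
  moreover have "1 * ?s - t * (inverse ?s / 2 * (2 * (t / ?c) * (1 / ?c))) = 1 / ?s"
    by (rule trunc_deriv_aux[OF trunc_weight_pos s]) simp
  ultimately have "(trunc k has_real_derivative 1 / ?s / (?s * ?s)) (at t)" by (simp only:)
  then show ?thesis by (simp add: trunc'_def power3_eq_cube mult.assoc)
qed

lemma trunc'_pos: "trunc' k t > 0"
  by (simp add: trunc'_def trunc_weight_pos)

lemma trunc'_le_1: "trunc' k t \<le> 1"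
  using one_le_power[OF trunc_weight_ge_1, of k t 3] trunc_weight_pos[of k t] by (simp add: trunc'_def)

lemma continuous_on_trunc': "continuous_on A (trunc' k)"
proof -
  have "trunc_weight k t \<noteq> 0" for t using trunc_weight_pos[of k t] by simp
  moreover have "continuous_on A (trunc_weight k)"
    unfolding trunc_weight_def by (intro continuous_intros) auto
  ultimately show ?thesis unfolding trunc'_def by (intro continuous_intros) auto
qed

lemma continuous_on_trunc: "continuous_on A (trunc k)"
  using DERIV_trunc by (meson DERIV_continuous continuous_at_imp_continuous_on)

lemma abs_trunc_le: "\<bar>trunc k t\<bar> \<le> \<bar>t\<bar>"
proof -
  have "\<bar>t\<bar> / trunc_weight k t \<le> \<bar>t\<bar> / 1"
    using trunc_weight_ge_1[of k t] by (intro divide_left_mono) auto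
  then show ?thesis by (simp add: trunc_def abs_divide abs_of_pos[OF trunc_weight_pos])
qed

lemma abs_trunc_bound: "\<bar>trunc k t\<bar> \<le> real (Suc k)"
  using abs_le_trunc_weight[of t k] trunc_weight_pos[of k t]
  by (simp add: trunc_def abs_divide pos_divide_le_eq del: of_nat_Suc)

lemma trunc_sgn: "0 \<le> trunc k t * t"
  using trunc_weight_pos[of k t] by (simp add: trunc_def)

text \<open>The derivative carries the third power of the weight and the truncation only the first.
  Products such as \<open>t^2 * (trunc k t)^2\<close> therefore have derivatives bounded as if they
  were homogeneous, up to a constant factor.\<close>

lemma abs_mult_trunc'_le: "\<bar>t\<bar> * trunc' k t \<le> \<bar>trunc k t\<bar>"
proof -
  have "trunc_weight k t ^ 1 \<le> trunc_weight k t ^ 3"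
    using trunc_weight_ge_1 by (intro power_increasing) auto
  then have "\<bar>t\<bar> / trunc_weight k t ^ 3 \<le> \<bar>t\<bar> / trunc_weight k t"
    using trunc_weight_pos[of k t] by (intro divide_left_mono) auto
  then show ?thesis by (simp add: trunc_def trunc'_def abs_divide abs_of_pos[OF trunc_weight_pos])
qed

lemma trunc_weight_tendsto: "(\<lambda>k. trunc_weight k t) \<longlonglongrightarrow> 1"
proof -
  have "(\<lambda>k. t * inverse (real (Suc k))) \<longlonglongrightarrow> t * 0"
    by (intro tendsto_mult tendsto_const LIMSEQ_inverse_real_of_nat)
  then have "(\<lambda>k. sqrt (1 + (t * inverse (real (Suc k)))\<^sup>2)) \<longlonglongrightarrow> sqrt (1 + (t * 0)\<^sup>2)"
    by (intro tendsto_real_sqrt tendsto_add tendsto_const tendsto_power)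
  then show ?thesis by (simp add: trunc_weight_def divide_inverse del: of_nat_Suc)
qed

lemma trunc_tendsto: "(\<lambda>k. trunc k t) \<longlonglongrightarrow> t"
  using tendsto_divide[OF tendsto_const[of t] trunc_weight_tendsto[of t]] by (simp add: trunc_def)

lemma trunc'_tendsto: "(\<lambda>k. trunc' k t) \<longlonglongrightarrow> 1"
  using tendsto_divide[OF tendsto_const[of 1] tendsto_power[OF trunc_weight_tendsto[of t], of 3]] by (simp add: trunc'_def)

text \<open>Truncated values stay in a compact interval, where the continuous \<open>\<Phi>'\<close>
  is bounded, so the bounded chain rule applies to the composition.\<close>

lemma has_weak_gradient_chain_trunc:
  fixes u :: "real ^ 'n \<Rightarrow> real"
  assumes w: "has_weak_gradient u G"
    and d: "\<And>t. (\<Phi> has_real_derivative \<Phi>' t) (at t)" and c: "continuous_on UNIV \<Phi>'"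
  shows "has_weak_gradient (\<lambda>x. \<Phi> (trunc k (u x))) (\<lambda>x. (\<Phi>' (trunc k (u x)) * trunc' k (u x)) *\<^sub>R G x)"
proof -
  have "bounded (\<Phi>' ` cball 0 (real (Suc k)))"
    using c by (intro compact_imp_bounded compact_continuous_image) (auto intro: continuous_on_subset)
  then obtain B where "\<forall>y\<in>\<Phi>' ` cball 0 (real (Suc k)). norm y \<le> B"
    unfolding bounded_iff by blast
  then have B: "\<And>t. \<bar>t\<bar> \<le> real (Suc k) \<Longrightarrow> \<bar>\<Phi>' t\<bar> \<le> B" by (auto simp del: of_nat_Suc)
  show ?thesis
  proof (rule has_weak_gradient_chain_bounded[OF w, where \<Phi> = "\<lambda>t. \<Phi> (trunc k t)" and B = B and \<Phi>' = "\<lambda>t. \<Phi>' (trunc k t) * trunc' k t"])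
    show "((\<lambda>t. \<Phi> (trunc k t)) has_real_derivative \<Phi>' (trunc k t) * trunc' k t) (at t)" for t
      by (rule DERIV_chain2[OF d DERIV_trunc])
    show "continuous_on UNIV (\<lambda>t. \<Phi>' (trunc k t) * trunc' k t)"
      by (intro continuous_intros continuous_on_trunc' continuous_on_compose2[OF c continuous_on_trunc]) auto
    show "\<bar>\<Phi>' (trunc k t) * trunc' k t\<bar> \<le> B" for t
    proof -
      have 1: "\<bar>\<Phi>' (trunc k t)\<bar> \<le> B" by (rule B[OF abs_trunc_bound])
      have "\<bar>\<Phi>' (trunc k t)\<bar> * \<bar>trunc' k t\<bar> \<le> B * 1"
        using trunc'_pos[of k t] trunc'_le_1[of k t] 1 by (intro mult_mono) auto
      then show ?thesis by (simp add: abs_mult)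
    qed
  qed
qed

text \<open>Removes the truncation. \<open>E\<close> and \<open>D\<close> majorize
  \<open>\<Phi>\<close> and \<open>\<Phi>'\<close> on all of \<open>[-|t|, |t|]\<close>, hence also
  at \<open>trunc k t\<close> for every \<open>k\<close>, which dominates both sides of the
  truncated identity.\<close>

lemma has_weak_gradient_chain:
  fixes u :: "real ^ 'n \<Rightarrow> real"
  assumes w: "has_weak_gradient u G"
    and d: "\<And>t. (\<Phi> has_real_derivative \<Phi>' t) (at t)" and c: "continuous_on UNIV \<Phi>'"
    and E: "\<And>s t. \<bar>s\<bar> \<le> \<bar>t\<bar> \<Longrightarrow> \<bar>\<Phi> s\<bar> \<le> E t" "locally_integrable (\<lambda>x. E (u x))"
    and D: "\<And>s t. \<bar>s\<bar> \<le> \<bar>t\<bar> \<Longrightarrow> \<bar>\<Phi>' s\<bar> \<le> D t" "locally_integrable (\<lambda>x. D (u x) * norm (G x))"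
  shows "has_weak_gradient (\<lambda>x. \<Phi> (u x)) (\<lambda>x. \<Phi>' (u x) *\<^sub>R G x)"
  unfolding has_weak_gradient_def
proof (intro conjI allI impI)
  note G = has_weak_gradientD[OF w]
  have cP: "continuous_on UNIV \<Phi>" using d by (meson DERIV_continuous continuous_at_imp_continuous_on)
  have [measurable]: "\<Phi> \<in> borel_measurable borel" "\<Phi>' \<in> borel_measurable borel"
    using cP c by (auto intro: borel_measurable_continuous_onI)
  note [measurable] = G(3,4)
  have E0: "E t \<ge> 0" and D0: "D t \<ge> 0" for t using E(1)[of t t] D(1)[of t t] by linarith+
  show "locally_integrable (\<lambda>x. \<Phi> (u x))"
  proof (rule locally_integrable_bound[OF E(2)])
    show "AE x in lebesgue. norm (\<Phi> (u x)) \<le> norm (E (u x))"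
      using E(1)[OF order_refl] E0 by (intro AE_I2) simp
  qed measurable
  show "locally_integrable (\<lambda>x. \<Phi>' (u x) *\<^sub>R G x)"
  proof (rule locally_integrable_bound[OF D(2)])
    show "AE x in lebesgue. norm (\<Phi>' (u x) *\<^sub>R G x) \<le> norm (D (u x) * norm (G x))"
      using D0 by (intro AE_I2) (auto simp: abs_mult intro!: mult_right_mono D(1))
  qed measurable
  fix \<phi> :: "real ^ 'n \<Rightarrow> real" and k assume t: "test_function \<phi>" and "\<forall>x. GDERIV \<phi> x :> k x"
  then have k: "\<And>x. GDERIV \<phi> x :> k x" by blast
  obtain R where R: "\<And>x. norm x > R \<Longrightarrow> \<phi> x = 0" using test_function_supp[OF t] by blast
  note kc = test_function_gradient[OF t k]
  note pc = GDERIV_continuous_on[OF k, of UNIV]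
  have k0: "norm x > R \<Longrightarrow> k x = 0" for x by (rule GDERIV_supp[OF k R])
  obtain Bk where Bk: "\<And>x. norm (k x) \<le> Bk" "Bk > 0" using continuous_supp_bounded[OF kc k0] by blast
  obtain Bp where Bp: "\<And>x. norm (\<phi> x) \<le> Bp" "Bp > 0" using continuous_supp_bounded[OF pc R] by blast
  have [measurable]: "\<phi> \<in> borel_measurable lebesgue" "k \<in> borel_measurable lebesgue"
    "trunc n \<in> borel_measurable borel" "trunc' n \<in> borel_measurable borel" for n
    using continuous_on_imp_lebesgue_measurable[OF pc] continuous_on_imp_lebesgue_measurable[OF kc]
      borel_measurable_continuous_onI[OF continuous_on_trunc] borel_measurable_continuous_onI[OF continuous_on_trunc'] by auto
  have l1: "(\<lambda>n. LINT x|lebesgue. \<Phi> (trunc n (u x)) *\<^sub>R k x) \<longlonglongrightarrow> (LINT x|lebesgue. \<Phi> (u x) *\<^sub>R k x)"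
  proof (rule ball_dominated_convergence(1))
    show "AE x in lebesgue. norm x \<le> R \<longrightarrow> (\<lambda>n. \<Phi> (trunc n (u x)) *\<^sub>R k x) \<longlonglongrightarrow> \<Phi> (u x) *\<^sub>R k x"
    proof (intro AE_I2 impI)
      fix x :: "real ^ 'n"
      have "isCont \<Phi> (u x)" using cP by (simp add: continuous_on_eq_continuous_at)
      then show "(\<lambda>n. \<Phi> (trunc n (u x)) *\<^sub>R k x) \<longlonglongrightarrow> \<Phi> (u x) *\<^sub>R k x"
        by (intro tendsto_scaleR tendsto_const isCont_tendsto_compose[of _ \<Phi>] trunc_tendsto)
    qed
    show "integrable lebesgue (\<lambda>x. (indicator (cball 0 R) x *\<^sub>R E (u x)) * Bk)"
      using set_integrable_cball[OF E(2)] by (intro integrable_mult_left) auto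
    show "AE x in lebesgue. norm x \<le> R \<longrightarrow> (\<forall>n. norm (\<Phi> (trunc n (u x)) *\<^sub>R k x) \<le> (indicator (cball 0 R) x *\<^sub>R E (u x)) * Bk)"
      using Bk E(1)[OF abs_trunc_le] E0 by (auto intro!: AE_I2 mult_mono)
  qed (use k0 in auto)
  have l2: "(\<lambda>n. LINT x|lebesgue. \<phi> x *\<^sub>R ((\<Phi>' (trunc n (u x)) * trunc' n (u x)) *\<^sub>R G x)) \<longlonglongrightarrow> (LINT x|lebesgue. \<phi> x *\<^sub>R (\<Phi>' (u x) *\<^sub>R G x))"
  proof (rule ball_dominated_convergence(1))
    show "AE x in lebesgue. norm x \<le> R \<longrightarrow> (\<lambda>n. \<phi> x *\<^sub>R ((\<Phi>' (trunc n (u x)) * trunc' n (u x)) *\<^sub>R G x)) \<longlonglongrightarrow> \<phi> x *\<^sub>R (\<Phi>' (u x) *\<^sub>R G x)"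
    proof (intro AE_I2 impI)
      fix x :: "real ^ 'n"
      have "isCont \<Phi>' (u x)" using c by (simp add: continuous_on_eq_continuous_at)
      then have "(\<lambda>n. \<Phi>' (trunc n (u x)) * trunc' n (u x)) \<longlonglongrightarrow> \<Phi>' (u x) * 1"
        by (intro tendsto_mult isCont_tendsto_compose[of _ \<Phi>'] trunc_tendsto trunc'_tendsto)
      then show "(\<lambda>n. \<phi> x *\<^sub>R ((\<Phi>' (trunc n (u x)) * trunc' n (u x)) *\<^sub>R G x)) \<longlonglongrightarrow> \<phi> x *\<^sub>R (\<Phi>' (u x) *\<^sub>R G x)"
        by (intro tendsto_scaleR tendsto_const) simp
    qed
    show "integrable lebesgue (\<lambda>x. Bp * (indicator (cball 0 R) x *\<^sub>R (D (u x) * norm (G x))))"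
      using set_integrable_cball[OF D(2)] by (intro integrable_mult_right) auto
    show "AE x in lebesgue. norm x \<le> R \<longrightarrow> (\<forall>n. norm (\<phi> x *\<^sub>R ((\<Phi>' (trunc n (u x)) * trunc' n (u x)) *\<^sub>R G x)) \<le> Bp * (indicator (cball 0 R) x *\<^sub>R (D (u x) * norm (G x))))"
    proof (intro AE_I2 impI allI)
      fix x :: "real ^ 'n" and n assume x: "norm x \<le> R"
      have "\<bar>\<Phi>' (trunc n (u x))\<bar> * \<bar>trunc' n (u x)\<bar> \<le> D (u x) * 1"
        using trunc'_pos[of n "u x"] trunc'_le_1[of n "u x"] D(1)[OF abs_trunc_le] D0 by (intro mult_mono) auto
      then have "\<bar>\<Phi>' (trunc n (u x))\<bar> * \<bar>trunc' n (u x)\<bar> * norm (G x) \<le> D (u x) * norm (G x)"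
        by (intro mult_right_mono) auto
      then have "\<bar>\<phi> x\<bar> * (\<bar>\<Phi>' (trunc n (u x))\<bar> * \<bar>trunc' n (u x)\<bar> * norm (G x)) \<le> Bp * (D (u x) * norm (G x))"
        using Bp(1)[of x] Bp(2) by (rule_tac mult_mono) auto
      then show "norm (\<phi> x *\<^sub>R ((\<Phi>' (trunc n (u x)) * trunc' n (u x)) *\<^sub>R G x)) \<le> Bp * (indicator (cball 0 R) x *\<^sub>R (D (u x) * norm (G x)))"
        using x by (simp add: abs_mult)
    qed
  qed (use R in auto)
  have eq: "(LINT x|lebesgue. \<Phi> (trunc n (u x)) *\<^sub>R k x) = - (LINT x|lebesgue. \<phi> x *\<^sub>R ((\<Phi>' (trunc n (u x)) * trunc' n (u x)) *\<^sub>R G x))" for n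
    by (rule has_weak_gradientD(5)[OF has_weak_gradient_chain_trunc[OF w d c] t k])
  show "(LINT x|lebesgue. \<Phi> (u x) *\<^sub>R k x) = - (LINT x|lebesgue. \<phi> x *\<^sub>R (\<Phi>' (u x) *\<^sub>R G x))"
    using LIMSEQ_unique[OF l1[unfolded eq] tendsto_minus[OF l2]] .
qed

section \<open>The space H1\<close>

lemma H1I:
  assumes "has_weak_gradient u G" "integrable lebesgue (\<lambda>x. (u x)\<^sup>2)" "integrable lebesgue (\<lambda>x. (norm (G x))\<^sup>2)"
  shows "u \<in> H1"
  using assms has_weak_gradientD(3)[OF assms(1)] by (auto simp: H1_def)

lemma
  assumes "u \<in> H1"
  shows H1_integrable: "integrable lebesgue (\<lambda>x. (u x)\<^sup>2)"
    and H1_has_weak_gradient: "has_weak_gradient u (weak_gradient u)"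
    and H1_gradient_integrable: "integrable lebesgue (\<lambda>x. (norm (weak_gradient u x))\<^sup>2)"
proof -
  obtain G where G: "has_weak_gradient u G" "integrable lebesgue (\<lambda>x. (norm (G x))\<^sup>2)"
    using assms by (auto simp: H1_def)
  show w: "has_weak_gradient u (weak_gradient u)" by (rule has_weak_gradient_weak_gradient[OF G(1)])
  note [measurable] = has_weak_gradientD(4)[OF w] has_weak_gradientD(4)[OF G(1)]
  have "AE x in lebesgue. (norm (G x))\<^sup>2 = (norm (weak_gradient u x))\<^sup>2"
    using weak_gradient_AE[OF G(1)] by eventually_elim simp
  then show "integrable lebesgue (\<lambda>x. (norm (weak_gradient u x))\<^sup>2)"
    using G(2) by (subst integrable_cong_AE[of _ _ "\<lambda>x. (norm (G x))\<^sup>2"]) (auto elim: eventually_mono)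
qed (use assms in \<open>auto simp: H1_def\<close>)

text \<open>\<open>weak_gradient\<close> is a choice among fields that agree almost everywhere, so
  any concrete gradient computes the norm.\<close>

lemma H1_norm_eq:
  assumes "has_weak_gradient u G"
  shows "H1_norm u = sqrt ((LINT x|lebesgue. (norm (G x))\<^sup>2) + (LINT x|lebesgue. (u x)\<^sup>2))"
proof -
  note [measurable] = has_weak_gradientD(4)[OF assms] has_weak_gradientD(4)[OF has_weak_gradient_weak_gradient[OF assms]]
  have "(LINT x|lebesgue. (norm (weak_gradient u x))\<^sup>2) = (LINT x|lebesgue. (norm (G x))\<^sup>2)"
    using weak_gradient_AE[OF assms] by (intro integral_cong_AE) (auto elim: eventually_mono)
  then show ?thesis by (simp add: H1_norm_def)
qed

section \<open>The nonlinearity\<close>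

lemma primitive_0: "primitive h 0 = 0"
  by (simp add: primitive_def zero_ereal_def[symmetric])

lemma DERIV_primitive:
  assumes "continuous_on UNIV h"
  shows "(primitive h has_real_derivative h t) (at t)"
proof -
  \<comment> \<open>The integral is differentiated inside an interval that has both 0 and
    \<open>t\<close> in its interior.\<close>
  let ?a = "- \<bar>t\<bar> - 1" and ?b = "\<bar>t\<bar> + 1"
  have "((\<lambda>u. LBINT y=ereal 0..ereal u. h y) has_vector_derivative h t) (at t within {?a..?b})"
    by (rule interval_integral_FTC2) (auto intro: continuous_on_subset[OF assms])
  then have "((\<lambda>u. LBINT y=ereal 0..ereal u. h y) has_vector_derivative h t) (at t)"
    by (subst (asm) at_within_interior) (auto simp: interior_cbox)
  then show ?thesis
    by (simp add: primitive_def[abs_def] has_real_derivative_iff_has_vector_derivative)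
qed

text \<open>The derivative of \<open>H(t) * t^(-q)\<close> is
  \<open>t^(-q-1) * (h(t) * t - q * H(t))\<close>.\<close>

lemma power_ratio_mono:
  fixes H h :: "real \<Rightarrow> real"
  assumes d: "\<And>t. t > 0 \<Longrightarrow> (H has_real_derivative h t) (at t)"
    and q: "\<And>t. t > 0 \<Longrightarrow> q * H t \<le> h t * t" and st: "0 < s" "s \<le> t"
  shows "H s * s powr (- q) \<le> H t * t powr (- q)"
proof (rule DERIV_nonneg_imp_nondecreasing[OF st(2)])
  fix x assume x: "s \<le> x" "x \<le> t"
  then have x0: "x > 0" using st by simp
  have "((\<lambda>t. H t * t powr (- q)) has_real_derivative
      h x * x powr (- q) + (- q * x powr (- q - 1)) * H x) (at x)"
    by (rule DERIV_mult[OF d[OF x0] has_real_derivative_powr[OF x0]])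
  moreover have "h x * x powr (- q) + (- q * x powr (- q - 1)) * H x = x powr (- q - 1) * (h x * x - q * H x)"
    using x0 by (simp add: powr_diff field_simps)
  moreover have "x powr (- q - 1) * (h x * x - q * H x) \<ge> 0"
    using q[OF x0] by simp
  ultimately show "\<exists>y. ((\<lambda>t. H t * t powr (- q)) has_real_derivative y) (at x) \<and> 0 \<le> y"
    by auto
qed

section \<open>Bounds for the dual change of variables\<close>

lemma dual_inverse_dual_change: "dual_inverse (dual_change t) = t"
proof -
  let ?f = dual_change
  have f: "is_dual_change ?f" by (rule dual_change)
  have "((\<lambda>t. dual_inverse (?f t) - t) has_real_derivative 0) (at t)" for t
  proof -
    have "(?f has_real_derivative inverse (sqrt (1 + 2 * (?f t)\<^sup>2))) (at t)"
      using f by (simp add: is_dual_change_def sqrt_inverse_powr)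
    from DERIV_diff[OF DERIV_chain2[OF dual_inverse_deriv this] DERIV_ident]
    show ?thesis using one_two_sq_pos[of "?f t"] by simp
  qed
  then have "dual_inverse (?f t) - t = dual_inverse (?f 0) - 0"
    by (rule DERIV_isconst_all[rule_format])
  then show ?thesis using f by (simp add: is_dual_change_def dual_inverse_def)
qed

lemma dual_change_dual_inverse: "dual_change (dual_inverse s) = s"
  using dual_inverse_dual_change[of "dual_inverse s"] strict_mono_eq[OF dual_inverse_strict_mono] by simp

lemma arsinh_bounds:
  assumes "x \<ge> (0 :: real)"
  shows "0 \<le> arsinh x" "arsinh x \<le> x"
proof -
  show "0 \<le> arsinh x" using assms arsinh_real_neg_iff[of x] by (simp add: not_less[symmetric])
  have "arsinh x - x \<le> arsinh 0 - 0"
  proof (rule DERIV_nonpos_imp_nonincreasing[OF assms])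
    fix y :: real
    have "((\<lambda>x. arsinh x - x) has_real_derivative 1 / sqrt (y\<^sup>2 + 1) - 1) (at y)"
      by (rule DERIV_diff[OF arsinh_real_has_field_derivative DERIV_ident])
    moreover have "1 / s \<le> 1" if "1 \<le> s" for s :: real using that by simp
    then have "1 / sqrt (y\<^sup>2 + 1) \<le> 1" by this simp
    ultimately show "\<exists>z. ((\<lambda>x. arsinh x - x) has_real_derivative z) (at y) \<and> z \<le> 0"
      by (intro exI[of _ "1 / sqrt (y\<^sup>2 + 1) - 1"]) auto
  qed
  then show "arsinh x \<le> x" by simp
qed

lemma abs_dual_inverse: "\<bar>dual_inverse s\<bar> = dual_inverse \<bar>s\<bar>"
proof -
  have "dual_inverse \<bar>s\<bar> \<ge> dual_inverse 0"
    using strict_mono_less_eq[OF dual_inverse_strict_mono] by simp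
  then have "dual_inverse \<bar>s\<bar> \<ge> 0" by (simp add: dual_inverse_def)
  then show ?thesis by (cases "s \<ge> 0") (auto simp: dual_inverse_odd)
qed

text \<open>For \<open>s >= 0\<close> the first summand of the closed form is half of
  \<open>s * sqrt (1 + 2 * s^2)\<close>, and the \<open>arsinh\<close> term lies between 0 and
  \<open>s / 2\<close>, hence below the other half; negative \<open>s\<close> follow by
  oddness.\<close>

lemma dual_inverse_bounds:
  "\<bar>s\<bar> * sqrt (1 + 2 * s\<^sup>2) / 2 \<le> \<bar>dual_inverse s\<bar>"
  "\<bar>dual_inverse s\<bar> \<le> \<bar>s\<bar> * sqrt (1 + 2 * s\<^sup>2)"
proof -
  have A: "t * sqrt (1 + 2 * t\<^sup>2) / 2 \<le> dual_inverse t \<and> dual_inverse t \<le> t * sqrt (1 + 2 * t\<^sup>2)"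
    if "t \<ge> 0" for t
  proof -
    have b: "0 \<le> arsinh (sqrt 2 * t)" "arsinh (sqrt 2 * t) \<le> sqrt 2 * t"
      using that by (auto intro: arsinh_bounds)
    have "arsinh (sqrt 2 * t) / (2 * sqrt 2) \<le> sqrt 2 * t / (2 * sqrt 2)"
      by (intro divide_right_mono b) simp
    then have "arsinh (sqrt 2 * t) / (2 * sqrt 2) \<le> t * 1 / 2" by simp
    moreover have "t * 1 \<le> t * sqrt (1 + 2 * t\<^sup>2)" using that by (intro mult_left_mono) auto
    ultimately show ?thesis using b(1) by (auto simp: dual_inverse_def)
  qed
  from A[of "\<bar>s\<bar>"] show "\<bar>s\<bar> * sqrt (1 + 2 * s\<^sup>2) / 2 \<le> \<bar>dual_inverse s\<bar>"
    "\<bar>dual_inverse s\<bar> \<le> \<bar>s\<bar> * sqrt (1 + 2 * s\<^sup>2)"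
    by (simp_all add: abs_dual_inverse)
qed

lemma abs_dual_inverse_ge_half: "\<bar>s\<bar> / 2 \<le> \<bar>dual_inverse s\<bar>"
proof -
  have "\<bar>s\<bar> * 1 \<le> \<bar>s\<bar> * sqrt (1 + 2 * s\<^sup>2)" by (intro mult_left_mono) auto
  then show ?thesis using dual_inverse_bounds(1)[of s] by linarith
qed

lemma abs_dual_inverse_le_sq:
  assumes "\<bar>s\<bar> \<ge> 1"
  shows "\<bar>dual_inverse s\<bar> \<le> 2 * s\<^sup>2"
proof -
  have "1 \<le> s\<^sup>2" using assms by (metis abs_le_square_iff abs_one one_power2)
  then have "sqrt (1 + 2 * s\<^sup>2) \<le> 2 * \<bar>s\<bar>" by (intro real_le_lsqrt) (simp_all add: power_mult_distrib)
  then have "\<bar>s\<bar> * sqrt (1 + 2 * s\<^sup>2) \<le> \<bar>s\<bar> * (2 * \<bar>s\<bar>)"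
    by (intro mult_left_mono) auto
  then show ?thesis using dual_inverse_bounds(2)[of s] by (simp add: power2_eq_square abs_mult_self_eq mult.left_commute)
qed

section \<open>Consequences of the differentiability of the energy\<close>

lemma H1_0: "(\<lambda>x :: real ^ 'n. 0) \<in> H1"
  by (rule H1I[OF C1_has_weak_gradient[OF GDERIV_const]]) auto

text \<open>Frechet differentiability at 0 bounds \<open>|Psi|\<close> on a small ball of H1, and
  the Dirichlet part is bounded by the norm, so the remaining integral is bounded too. The
  differentiability of the energy enters the proof through this bound alone.\<close>

lemma Psi_bound:
  assumes "Psi_well_defined_C1 TYPE('n::finite) h"
  obtains d C where "d > 0" "C > 0"
    "\<forall>w :: real ^ 'n \<Rightarrow> real. w \<in> H1 \<and> H1_norm w < d \<longrightarrow>
       integrable lebesgue (\<lambda>x. primitive h (dual_change (w x))) \<and>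
       (LINT x|lebesgue. primitive h (dual_change (w x))) \<le> C"
proof -
  let ?P = "Psi h :: (real ^ 'n \<Rightarrow> real) \<Rightarrow> real" and ?z = "\<lambda>x :: real ^ 'n. 0 :: real"
  have "C1_on_H1 ?P" using assms by (simp add: Psi_well_defined_C1_def)
  then obtain D where DF: "(\<forall>v\<in>H1. H1_dual (D v)) \<and>
     (\<forall>v\<in>H1. \<forall>e>0. \<exists>d>0. \<forall>w\<in>H1. H1_norm w < d \<longrightarrow>
        \<bar>?P (\<lambda>x. v x + w x) - ?P v - D v w\<bar> \<le> e * H1_norm w) \<and>
     (\<forall>v\<in>H1. \<forall>e>0. \<exists>d>0. \<forall>v'\<in>H1. H1_norm (\<lambda>x. v' x - v x) < d \<longrightarrow>
        (\<forall>w\<in>H1. \<bar>D v' w - D v w\<bar> \<le> e * H1_norm w))"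
    unfolding C1_on_H1_def ..
  have D: "H1_dual (D ?z)" by (rule DF[THEN conjunct1, rule_format, OF H1_0])
  have Fr: "\<exists>d>0. \<forall>w\<in>H1. H1_norm w < d \<longrightarrow> \<bar>?P (\<lambda>x. ?z x + w x) - ?P ?z - D ?z w\<bar> \<le> 1 * H1_norm w"
    using DF[THEN conjunct2, THEN conjunct1, rule_format, OF H1_0 zero_less_one] .
  obtain B where B: "\<And>v. v \<in> H1 \<Longrightarrow> \<bar>D ?z v\<bar> \<le> B * H1_norm v"
    using D unfolding H1_dual_def by blast
  obtain d where d: "d > 0" "\<And>w. w \<in> H1 \<Longrightarrow> H1_norm w < d \<Longrightarrow> \<bar>?P w - ?P ?z - D ?z w\<bar> \<le> 1 * H1_norm w"
    using Fr by auto
  \<comment> \<open>In this order: half the Dirichlet integral, the value at 0, the derivative plus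
    the remainder with \<open>e = 1\<close>, and 1 for strict positivity.\<close>
  let ?C = "d\<^sup>2 / 2 + \<bar>?P ?z\<bar> + (\<bar>B\<bar> + 1) * d + 1"
  have main: "integrable lebesgue (\<lambda>x. primitive h (dual_change (w x))) \<and>
       (LINT x|lebesgue. primitive h (dual_change (w x))) \<le> ?C"
    if w: "w \<in> H1" "H1_norm w < d" for w :: "real ^ 'n \<Rightarrow> real"
  proof -
    let ?g = "LINT x|lebesgue. (norm (weak_gradient w x))\<^sup>2"
    have n0: "0 \<le> H1_norm w" by (simp add: H1_norm_def integral_nonneg_AE)
    have "?g \<le> (H1_norm w)\<^sup>2"
      by (simp add: H1_norm_def integral_nonneg_AE)
    also have "\<dots> \<le> d\<^sup>2" using w(2) n0 by (intro power_mono) auto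
    finally have g: "?g \<le> d\<^sup>2" .
    have "\<bar>D ?z w\<bar> \<le> B * H1_norm w" by (rule B[OF w(1)])
    also have "\<dots> \<le> \<bar>B\<bar> * d" using w(2) n0 by (intro mult_mono) auto
    finally have "\<bar>?P w\<bar> \<le> \<bar>?P ?z\<bar> + (\<bar>B\<bar> + 1) * d"
      using d(2)[OF w] w(2) by (simp add: distrib_right)
    moreover have "(LINT x|lebesgue. primitive h (dual_change (w x))) = ?g / 2 - ?P w"
      by (simp add: Psi_def)
    ultimately have "(LINT x|lebesgue. primitive h (dual_change (w x))) \<le> ?C" using g by linarith
    moreover have "integrable lebesgue (\<lambda>x. primitive h (dual_change (w x)))"
      using assms w(1) by (auto simp: Psi_well_defined_C1_def)
    ultimately show ?thesis by blast
  qed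
  show thesis
  proof (rule that[OF d(1), of ?C])
    have "0 \<le> (\<bar>B\<bar> + 1) * d" using d(1) by simp
    moreover have "0 \<le> d\<^sup>2" by simp
    ultimately show "?C > 0" by linarith
  qed (use main in blast)
qed

lemma
  fixes f :: "real ^ 'n \<Rightarrow> 'b::euclidean_space"
  assumes "c > 0"
  shows integrable_dilate: "integrable lebesgue (\<lambda>x. f (c *\<^sub>R x)) \<longleftrightarrow> integrable lebesgue f"
    and integral_dilate: "(LINT x|lebesgue. f (c *\<^sub>R x)) = (1 / c ^ CARD('n)) *\<^sub>R (LINT x|lebesgue. f x)"
  using lebesgue_integrable_affine_iff[of c f 0] lebesgue_integral_affine[of c f 0] assms
  by auto

lemma dilate_H1:
  fixes u :: "real ^ 'n \<Rightarrow> real"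
  assumes w: "has_weak_gradient u G" and i: "integrable lebesgue (\<lambda>x. (u x)\<^sup>2)" "integrable lebesgue (\<lambda>x. (norm (G x))\<^sup>2)"
    and c: "c > 0"
  shows "(\<lambda>x. s * u (c *\<^sub>R x)) \<in> H1"
    "(H1_norm (\<lambda>x. s * u (c *\<^sub>R x)))\<^sup>2 =
       s\<^sup>2 * c\<^sup>2 / c ^ CARD('n) * (LINT x|lebesgue. (norm (G x))\<^sup>2) + s\<^sup>2 / c ^ CARD('n) * (LINT x|lebesgue. (u x)\<^sup>2)"
proof -
  note w' = has_weak_gradient_dilate[OF w c, of s]
  have e: "(norm ((s * c) *\<^sub>R G (c *\<^sub>R x)))\<^sup>2 = (s\<^sup>2 * c\<^sup>2) * (norm (G (c *\<^sub>R x)))\<^sup>2" "(s * u (c *\<^sub>R x))\<^sup>2 = s\<^sup>2 * (u (c *\<^sub>R x))\<^sup>2" for x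
    using c by (simp_all add: power_mult_distrib)
  have j: "integrable lebesgue (\<lambda>x. (u (c *\<^sub>R x))\<^sup>2)" "integrable lebesgue (\<lambda>x. (norm (G (c *\<^sub>R x)))\<^sup>2)"
    using integrable_dilate[OF c, of "\<lambda>x. (u x)\<^sup>2"] integrable_dilate[OF c, of "\<lambda>x. (norm (G x))\<^sup>2"] i by auto
  show "(\<lambda>x. s * u (c *\<^sub>R x)) \<in> H1"
    by (rule H1I[OF w']) (use j in \<open>auto simp only: e intro!: integrable_mult_right\<close>)
  show "(H1_norm (\<lambda>x. s * u (c *\<^sub>R x)))\<^sup>2 =
       s\<^sup>2 * c\<^sup>2 / c ^ CARD('n) * (LINT x|lebesgue. (norm (G x))\<^sup>2) + s\<^sup>2 / c ^ CARD('n) * (LINT x|lebesgue. (u x)\<^sup>2)"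
    unfolding H1_norm_eq[OF w'] e
    using integral_dilate[OF c, of "\<lambda>x. (u x)\<^sup>2"] integral_dilate[OF c, of "\<lambda>x. (norm (G x))\<^sup>2"] c
    by (subst real_sqrt_pow2) (auto intro!: add_nonneg_nonneg mult_nonneg_nonneg integral_nonneg_AE)
qed

lemma Fatou_bound:
  fixes f :: "nat \<Rightarrow> 'a \<Rightarrow> real"
  assumes f: "\<And>n. integrable M (f n)" "\<And>n. AE x in M. 0 \<le> f n x" and g: "g \<in> borel_measurable M"
    and l: "AE x in M. (\<lambda>n. f n x) \<longlonglongrightarrow> g x" and K: "eventually (\<lambda>n. integral\<^sup>L M (f n) \<le> K) sequentially"
  shows "integrable M g" "integral\<^sup>L M g \<le> K"
proof -
  have g0: "AE x in M. 0 \<le> g x"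
  proof -
    have "AE x in M. \<forall>n. 0 \<le> f n x" using f(2) by (simp add: AE_all_countable)
    with l show ?thesis by eventually_elim (auto intro: LIMSEQ_le_const)
  qed
  obtain n where "integral\<^sup>L M (f n) \<le> K" using K by (auto simp: eventually_sequentially)
  then have K0: "0 \<le> K" using integral_nonneg_AE[OF f(2)[of n]] by linarith
  have "(\<integral>\<^sup>+x. ennreal (g x) \<partial>M) = (\<integral>\<^sup>+x. liminf (\<lambda>n. ennreal (f n x)) \<partial>M)"
  proof (rule nn_integral_cong_AE)
    show "AE x in M. ennreal (g x) = liminf (\<lambda>n. ennreal (f n x))"
      using l by eventually_elim (auto intro!: lim_imp_Liminf[symmetric] tendsto_ennrealI)
  qed
  also have "\<dots> \<le> liminf (\<lambda>n. \<integral>\<^sup>+x. ennreal (f n x) \<partial>M)"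
    using f(1) by (intro nn_integral_liminf) auto
  also have "\<dots> \<le> liminf (\<lambda>n. ennreal K)"
  proof (rule Liminf_mono)
    show "eventually (\<lambda>n. (\<integral>\<^sup>+x. ennreal (f n x) \<partial>M) \<le> ennreal K) sequentially"
      using K by eventually_elim (use f in \<open>simp add: nn_integral_eq_integral ennreal_leI\<close>)
  qed
  also have "\<dots> = ennreal K" by (simp add: Liminf_const)
  finally have *: "(\<integral>\<^sup>+x. ennreal (g x) \<partial>M) \<le> ennreal K" .
  show gi: "integrable M g"
    using * g g0 by (intro integrableI_nonneg) (auto simp: order_le_less_trans)
  show "integral\<^sup>L M g \<le> K"
    using * gi g0 K0 by (simp add: nn_integral_eq_integral)
qed

section \<open>Growth of the primitive \<open>H\<close>\<close>

locale energy_growth =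
  fixes h :: "real \<Rightarrow> real" and \<mu>1 \<mu>2 p :: real and T :: "'n::finite itself"
  assumes dim: "CARD('n) \<ge> 3" and p_def: "p = 2 * real CARD('n) / (real CARD('n) - 2)"
    and energy: "Psi_well_defined_C1 T h"
    and h_cont: "continuous_on UNIV h"
    and mu: "\<mu>1 \<le> \<mu>2" "2 * p \<le> \<mu>1"
    and AR: "\<And>t. t \<noteq> 0 \<Longrightarrow> 0 < \<mu>1 * primitive h t \<and> \<mu>1 * primitive h t \<le> h t * t \<and> h t * t \<le> \<mu>2 * primitive h t"
begin

abbreviation "H \<equiv> primitive h"

lemma p_gt_2: "p > 2"
  using dim by (simp add: p_def field_simps)

lemma p_eq: "(real CARD('n) - 2) * p = 2 * real CARD('n)"
  using dim by (simp add: p_def field_simps)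

lemma H_pos: "t \<noteq> 0 \<Longrightarrow> H t > 0"
  using AR[of t] mu(2) p_gt_2 by (simp add: zero_less_mult_iff)

lemma H_nonneg: "H t \<ge> 0"
  using H_pos[of t] primitive_0[of h] by (cases "t = 0") auto

lemma H_le_ht: "2 * p * H t \<le> h t * t"
proof (cases "t = 0")
  case False
  have "2 * p * H t \<le> \<mu>1 * H t" using mu H_nonneg by (intro mult_right_mono) auto
  then show ?thesis using AR[OF False] by linarith
qed (simp add: primitive_0)

lemma ht_le_H: "h t * t \<le> \<mu>2 * H t"
  using AR[of t] primitive_0[of h] by (cases "t = 0") auto

lemma h_sign: "0 \<le> h t * t"
  using H_le_ht[of t] H_nonneg[of t] p_gt_2 mult_nonneg_nonneg[of "2 * p" "H t"] by linarith

lemma DERIV_H: "(H has_real_derivative h t) (at t)"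
  by (rule DERIV_primitive[OF h_cont])

lemma continuous_on_H: "continuous_on A H"
  using DERIV_H by (meson DERIV_continuous continuous_at_imp_continuous_on)

lemma DERIV_H_neg: "((\<lambda>t. H (- t)) has_real_derivative - h (- t)) (at t)"
  using DERIV_chain2[OF DERIV_H DERIV_minus[OF DERIV_ident], of t] by simp

lemma H_ratio:
  assumes "0 < s" "s \<le> t"
  shows "H s * s powr (- (2 * p)) \<le> H t * t powr (- (2 * p))"
    "H (- s) * s powr (- (2 * p)) \<le> H (- t) * t powr (- (2 * p))"
proof -
  show "H s * s powr (- (2 * p)) \<le> H t * t powr (- (2 * p))"
    by (rule power_ratio_mono[OF DERIV_H H_le_ht assms])
  have "2 * p * H (- t) \<le> - h (- t) * t" for t using H_le_ht[of "- t"] by simp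
  from power_ratio_mono[OF DERIV_H_neg this assms]
  show "H (- s) * s powr (- (2 * p)) \<le> H (- t) * t powr (- (2 * p))" .
qed

text \<open>Along each half line, moving away from 0, \<open>H\<close> is the product of the
  nondecreasing functions \<open>H(t) * |t|^(-2p)\<close> and \<open>|t|^(2p)\<close>. Needed to
  compare the energy of a bump with that of a lower plateau.\<close>

lemma H_mono:
  assumes "\<bar>s\<bar> \<le> \<bar>t\<bar>" "0 \<le> s * t"
  shows "H s \<le> H t"
proof (cases "s = 0")
  case True
  then show ?thesis using H_nonneg by (simp add: primitive_0)
next
  case False
  define q where "q = 2 * p"
  have q: "q > 0" using p_gt_2 by (simp add: q_def)
  have st: "0 < \<bar>s\<bar>" using False by simp
  have r: "H s * \<bar>s\<bar> powr (- q) \<le> H t * \<bar>t\<bar> powr (- q)"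
  proof (cases "s > 0")
    case True
    then have "t > 0" using assms False by (auto simp: zero_le_mult_iff)
    then show ?thesis using H_ratio(1)[of s t] True assms by (simp add: q_def)
  next
    case F: False
    then have "t < 0" using assms False by (auto simp: zero_le_mult_iff)
    then show ?thesis using H_ratio(2)[of "- s" "- t"] F False assms by (simp add: q_def)
  qed
  have "\<bar>t\<bar> powr (- q) \<le> \<bar>s\<bar> powr (- q)" using assms st q by (intro powr_mono2') auto
  then have "H t * \<bar>t\<bar> powr (- q) \<le> H t * \<bar>s\<bar> powr (- q)" by (intro mult_left_mono H_nonneg)
  with r have "H s * \<bar>s\<bar> powr (- q) \<le> H t * \<bar>s\<bar> powr (- q)" by linarith
  then show ?thesis using st by simp
qed

definition "c0 = min (H 1) (H (- 1))"
definition "c1 = max (H 1) (H (- 1))"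

lemma c0_pos: "c0 > 0"
  using H_pos[of 1] H_pos[of "- 1"] by (simp add: c0_def)

lemma H_unit: "\<bar>s\<bar> = 1 \<Longrightarrow> c0 \<le> H s \<and> H s \<le> c1"
  by (auto simp: c0_def c1_def abs_if split: if_splits)

lemma H_lower: "\<bar>t\<bar> \<ge> 1 \<Longrightarrow> c0 * \<bar>t\<bar> powr (2 * p) \<le> H t"
proof -
  assume t: "\<bar>t\<bar> \<ge> 1"
  have "c0 \<le> H t * \<bar>t\<bar> powr (- (2 * p))"
  proof (cases "t \<ge> 0")
    case True
    then show ?thesis using H_ratio(1)[of 1 t] t H_unit[of 1] by simp
  next
    case False
    then show ?thesis using H_ratio(2)[of 1 "- t"] t H_unit[of "-1"] by simp
  qed
  then have "c0 * \<bar>t\<bar> powr (2 * p) \<le> H t * \<bar>t\<bar> powr (- (2 * p)) * \<bar>t\<bar> powr (2 * p)"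
    by (rule mult_right_mono) simp
  also have "\<dots> = H t" using t by (simp add: mult.assoc powr_add[symmetric])
  finally show ?thesis .
qed

lemma H_small: "\<bar>t\<bar> \<le> 1 \<Longrightarrow> H t \<le> c1 * \<bar>t\<bar> powr (2 * p)"
proof (cases "t = 0")
  case False
  assume t: "\<bar>t\<bar> \<le> 1"
  have "H t * \<bar>t\<bar> powr (- (2 * p)) \<le> c1"
  proof (cases "t \<ge> 0")
    case True
    then show ?thesis using H_ratio(1)[of t 1] t False H_unit[of 1] by simp
  next
    case F: False
    then show ?thesis using H_ratio(2)[of "- t" 1] t H_unit[of "-1"] by simp
  qed
  then have "H t * \<bar>t\<bar> powr (- (2 * p)) * \<bar>t\<bar> powr (2 * p) \<le> c1 * \<bar>t\<bar> powr (2 * p)"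
    by (rule mult_right_mono) simp
  moreover have "H t * \<bar>t\<bar> powr (- (2 * p)) * \<bar>t\<bar> powr (2 * p) = H t" using False by (simp add: mult.assoc powr_add[symmetric])
  ultimately show ?thesis by simp
qed (simp add: primitive_0)

text \<open>For \<open>s = dual_change v\<close>, the bound \<open>|v| >= 2\<close> forces
  \<open>|s| >= 1\<close>, since otherwise \<open>|v| <= 2 * |s| < 2\<close>. Then
  \<open>|v| <= 2 * s^2\<close>, and the lower bound of degree \<open>2p\<close> in \<open>s\<close>
  becomes one of degree \<open>p\<close> in \<open>v\<close>.\<close>

lemma H_dual_lower:
  assumes "\<bar>v\<bar> \<ge> 2"
  shows "c0 / 2 powr p * \<bar>v\<bar> powr p \<le> H (dual_change v)"
proof -
  define s where "s = dual_change v"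
  have v: "v = dual_inverse s" by (simp add: s_def dual_inverse_dual_change)
  have s1: "\<bar>s\<bar> \<ge> 1"
  proof (rule ccontr)
    assume "\<not> \<bar>s\<bar> \<ge> 1"
    then have s: "\<bar>s\<bar> < 1" by simp
    then have "s\<^sup>2 \<le> 1" using abs_le_square_iff[of s 1] by simp
    then have "sqrt (1 + 2 * s\<^sup>2) \<le> 2" by (intro real_le_lsqrt) auto
    then have "\<bar>s\<bar> * sqrt (1 + 2 * s\<^sup>2) \<le> \<bar>s\<bar> * 2" by (intro mult_left_mono) auto
    then have "\<bar>s\<bar> * sqrt (1 + 2 * s\<^sup>2) < 2" using s by linarith
    then show False using dual_inverse_bounds(2)[of s] assms v by simp
  qed
  have "\<bar>v\<bar> \<le> 2 * \<bar>s\<bar>\<^sup>2" using abs_dual_inverse_le_sq[OF s1] v by simp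
  then have "\<bar>v\<bar> powr p \<le> (2 * \<bar>s\<bar>\<^sup>2) powr p" using p_gt_2 by (intro powr_mono2) auto
  also have "(2 * \<bar>s\<bar>\<^sup>2) powr p = 2 powr p * \<bar>s\<bar> powr (2 * p)"
    using s1 by (subst powr_mult) (auto simp: powr_powr powr_numeral[symmetric] simp del: powr_numeral power2_abs)
  finally have "c0 / 2 powr p * \<bar>v\<bar> powr p \<le> c0 / 2 powr p * (2 powr p * \<bar>s\<bar> powr (2 * p))"
    using c0_pos by (intro mult_left_mono) auto
  also have "\<dots> = c0 * \<bar>s\<bar> powr (2 * p)" by simp
  also have "\<dots> \<le> H s" by (rule H_lower[OF s1])
  finally show ?thesis by (simp add: s_def)
qed

end

lemma dual_change_mono: "a \<le> b \<Longrightarrow> dual_change a \<le> dual_change b"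
  using strict_mono_less_eq[OF dual_inverse_strict_mono, of "dual_change a" "dual_change b"]
  by (simp add: dual_inverse_dual_change)

lemma dual_change_0: "dual_change 0 = 0"
  using dual_change_dual_inverse[of 0] by (simp add: dual_inverse_def)

lemma dual_change_odd: "dual_change (- t) = - dual_change t"
  using dual_change by (simp add: is_dual_change_def)

text \<open>Supplies the hypotheses of \<open>H_mono\<close> when the argument of
  \<open>dual_change\<close> is enlarged by a factor \<open>k\<close>.\<close>

lemma dual_change_scale:
  assumes "k \<ge> (1 :: real)"
  shows "\<bar>dual_change s\<bar> \<le> \<bar>dual_change (s * k)\<bar>" "0 \<le> dual_change s * dual_change (s * k)"
proof -
  have 1: "0 \<le> dual_change s \<and> dual_change s \<le> dual_change (s * k)" if "0 \<le> s" for s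
  proof -
    have "s * 1 \<le> s * k" using that assms by (intro mult_left_mono)
    then show ?thesis using dual_change_mono[of 0 s] dual_change_mono[of s "s * k"] that by (simp add: dual_change_0)
  qed
  show "\<bar>dual_change s\<bar> \<le> \<bar>dual_change (s * k)\<bar>" "0 \<le> dual_change s * dual_change (s * k)"
    using 1[of s] 1[of "- s"] by (cases "0 \<le> s"; simp add: dual_change_odd mult_nonneg_nonneg mult_nonpos_nonpos)+
qed

text \<open>Stated with a positive upper bound \<open>A\<close> of the Dirichlet integral, so that a
  vanishing gradient is no special case and uniform bounds on sequences can be inserted.
  Integrability of the critical power belongs to the conclusion, as an integral alone would default
  to 0.\<close>

definition sobolev_inequality :: "'n::finite itself \<Rightarrow> real \<Rightarrow> real \<Rightarrow> bool" where
  "sobolev_inequality _ p S \<longleftrightarrow> S > 0 \<and>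
     (\<forall>(u :: real ^ 'n \<Rightarrow> real) G A. has_weak_gradient u G \<longrightarrow> integrable lebesgue (\<lambda>x. (u x)\<^sup>2) \<longrightarrow>
       integrable lebesgue (\<lambda>x. (norm (G x))\<^sup>2) \<longrightarrow> (LINT x|lebesgue. (norm (G x))\<^sup>2) \<le> A \<longrightarrow> 0 < A \<longrightarrow>
       integrable lebesgue (\<lambda>x. \<bar>u x\<bar> powr p) \<and> (LINT x|lebesgue. \<bar>u x\<bar> powr p) \<le> S * A powr (p / 2))"

context energy_growth
begin

text \<open>Concentrating dilations \<open>s * u(c x)\<close> with \<open>s\<^sup>2 = k c\<^sup>N\<^sup>-\<^sup>2\<close> keep the Dirichlet integral and
  the critical integral fixed but shrink the \<open>L\<^sup>2\<close> norm; so the bound on the energy near 0,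
  which controls only large values of the function, yields the homogeneous Sobolev inequality.\<close>

lemma sobolev:
  obtains S where "sobolev_inequality TYPE('n) p S"
proof -
  let ?N = "CARD('n)"
  have "Psi_well_defined_C1 TYPE('n) h" using energy by (simp add: Psi_well_defined_C1_def)
  from Psi_bound[OF this] obtain d C where d: "d > 0" and C: "C > 0"
    and bd0: "\<forall>w :: real ^ 'n \<Rightarrow> real. w \<in> H1 \<and> H1_norm w < d \<longrightarrow>
       integrable lebesgue (\<lambda>x. H (dual_change (w x))) \<and> (LINT x|lebesgue. H (dual_change (w x))) \<le> C"
    by blast
  note bd = bd0[rule_format, OF conjI]
  define a where "a = c0 / 2 powr p"
  have a: "a > 0" using c0_pos by (simp add: a_def)
  have "sobolev_inequality TYPE('n) p (C / a * (4 / d\<^sup>2) powr (p / 2))"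
    unfolding sobolev_inequality_def
  proof (intro conjI[of "C / a * (4 / d\<^sup>2) powr (p / 2) > 0"] allI impI)
    show "C / a * (4 / d\<^sup>2) powr (p / 2) > 0" using C a d by simp
    fix u :: "real ^ 'n \<Rightarrow> real" and G A
    assume w: "has_weak_gradient u G" and i: "integrable lebesgue (\<lambda>x. (u x)\<^sup>2)" "integrable lebesgue (\<lambda>x. (norm (G x))\<^sup>2)"
      and A: "(LINT x|lebesgue. (norm (G x))\<^sup>2) \<le> A" "0 < A"
    have um[measurable]: "u \<in> borel_measurable lebesgue" by (rule has_weak_gradientD(3)[OF w])
    \<comment> \<open>\<open>k * A = d^2 / 4\<close>: the Dirichlet part of the squared norm uses at
      most a quarter of the available \<open>d^2\<close>.\<close>
    define k where "k = d\<^sup>2 / (4 * A)"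
    have k: "k > 0" using d A by (simp add: k_def)
    define B where "B = (LINT x|lebesgue. (u x)\<^sup>2)"
    have B: "B \<ge> 0" by (simp add: B_def integral_nonneg_AE)
    define c where "c j = real (Suc j)" for j
    have c: "c j \<ge> 1" "c j > 0" for j by (auto simp: c_def)
    define s where "s j = sqrt (k * c j ^ ?N / (c j)\<^sup>2)" for j
    have s2: "(s j)\<^sup>2 = k * c j ^ ?N / (c j)\<^sup>2" for j
      unfolding s_def using k c(2)[of j] by (intro real_sqrt_pow2) simp
    have s0: "s j > 0" for j unfolding s_def using k c(2)[of j] by simp
    have s_ge: "k * c j \<le> (s j)\<^sup>2" for j
    proof -
      have "c j ^ 3 \<le> c j ^ ?N" using c(1) dim by (intro power_increasing) auto
      then have "c j * (c j)\<^sup>2 \<le> c j ^ ?N" by (simp add: power3_eq_cube power2_eq_square)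
      then have "c j \<le> c j ^ ?N / (c j)\<^sup>2" using c(2)[of j] by (simp add: pos_le_divide_eq)
      then have "k * c j \<le> k * (c j ^ ?N / (c j)\<^sup>2)" using k by (intro mult_left_mono) auto
      then show ?thesis by (simp add: s2)
    qed
    have sp: "s j powr p = k powr (p / 2) * c j ^ ?N" for j
    proof -
      have "s j powr p = ((s j)\<^sup>2) powr (p / 2)"
        using s0[of j] by (simp add: powr_powr flip: powr_numeral)
      also have "(s j)\<^sup>2 = k * c j powr (real ?N - 2)"
        using c(2)[of j] by (simp add: s2 powr_diff powr_realpow)
      also have "\<dots> powr (p / 2) = k powr (p / 2) * c j powr ((real ?N - 2) * (p / 2))"
        using k by (simp add: powr_mult powr_powr)
      also have "(real ?N - 2) * (p / 2) = real ?N" using p_eq by simp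
      finally show ?thesis using c(2)[of j] by (simp add: powr_realpow)
    qed
    have clim: "filterlim c at_top sequentially"
      unfolding c_def by (rule filterlim_compose[OF filterlim_real_sequentially filterlim_Suc])
    have norm_lt: "eventually (\<lambda>j. H1_norm (\<lambda>x. s j * u (c j *\<^sub>R x)) < d) sequentially"
    proof -
      have "eventually (\<lambda>j. c j \<ge> 4 * k * B / d\<^sup>2) sequentially"
        using clim by (simp add: filterlim_at_top)
      then show ?thesis
      proof eventually_elim
        case (elim j)
        have n: "(H1_norm (\<lambda>x. s j * u (c j *\<^sub>R x)))\<^sup>2 =
            (s j)\<^sup>2 * (c j)\<^sup>2 / c j ^ ?N * (LINT x|lebesgue. (norm (G x))\<^sup>2) + (s j)\<^sup>2 / c j ^ ?N * B"
          unfolding B_def by (rule dilate_H1(2)[OF w i c(2)])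
        have e1: "(s j)\<^sup>2 * (c j)\<^sup>2 / c j ^ ?N = k" and e2: "(s j)\<^sup>2 / c j ^ ?N = k / (c j)\<^sup>2"
          using c(2)[of j] by (simp_all add: s2)
        have "k * (LINT x|lebesgue. (norm (G x))\<^sup>2) \<le> k * A" using k A by (intro mult_left_mono) auto
        moreover have "k * A = d\<^sup>2 / 4" using A by (simp add: k_def)
        moreover have "k / (c j)\<^sup>2 * B \<le> d\<^sup>2 / 4"
        proof -
          have "4 * k * B \<le> c j * d\<^sup>2" using elim d by (simp add: pos_divide_le_eq)
          also have "\<dots> \<le> (c j)\<^sup>2 * d\<^sup>2" using c(1)[of j] by (intro mult_right_mono) (auto simp: power2_eq_square)
          finally have "k * B \<le> d\<^sup>2 / 4 * (c j)\<^sup>2" by (simp add: mult_ac)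
          then show ?thesis using c(2)[of j] by (simp add: pos_divide_le_eq)
        qed
        moreover have "d\<^sup>2 > 0" using d by simp
        ultimately have "(H1_norm (\<lambda>x. s j * u (c j *\<^sub>R x)))\<^sup>2 < d\<^sup>2" unfolding n e1 e2 by linarith
        then show ?case by (rule power_less_imp_less_base) (use d in simp)
      qed
    qed
    \<comment> \<open>Only values with \<open>|s j * u x| >= 2\<close> are controlled by the energy;
      since \<open>s j\<close> tends to infinity, the restriction disappears in the limit wherever
      \<open>u\<close> is nonzero.\<close>
    define f where "f j x = (if 2 \<le> \<bar>s j * u x\<bar> then \<bar>u x\<bar> powr p else 0)" for j x
    have fm[measurable]: "f j \<in> borel_measurable lebesgue" for j unfolding f_def by measurable
    have ub: "a * s j powr p * f j x \<le> H (dual_change (s j * u x))" for j x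
    proof (cases "2 \<le> \<bar>s j * u x\<bar>")
      case True
      have "a * \<bar>s j * u x\<bar> powr p \<le> H (dual_change (s j * u x))"
        unfolding a_def by (rule H_dual_lower[OF True])
      moreover have "\<bar>s j * u x\<bar> powr p = s j powr p * \<bar>u x\<bar> powr p"
        using s0[of j] by (simp add: abs_mult powr_mult)
      ultimately show ?thesis using True by (simp add: f_def mult.assoc)
    qed (auto simp: f_def H_nonneg)
    have f_ok: "integrable lebesgue (f j) \<and> integral\<^sup>L lebesgue (f j) \<le> C / (a * k powr (p / 2))"
      if "H1_norm (\<lambda>x. s j * u (c j *\<^sub>R x)) < d" for j
    proof -
      have b: "integrable lebesgue (\<lambda>x. H (dual_change (s j * u (c j *\<^sub>R x))))"
        "(LINT x|lebesgue. H (dual_change (s j * u (c j *\<^sub>R x)))) \<le> C"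
        using bd[OF dilate_H1(1)[OF w i c(2)] that] by auto
      have Hi: "integrable lebesgue (\<lambda>x. H (dual_change (s j * u x)))"
        using b(1) integrable_dilate[OF c(2), of "\<lambda>x. H (dual_change (s j * u x))" j] by simp
      have HC: "(LINT x|lebesgue. H (dual_change (s j * u x))) \<le> C * c j ^ ?N"
        using b(2) integral_dilate[OF c(2)[of j], of "\<lambda>x. H (dual_change (s j * u x))"] c(2)[of j]
        by (simp add: pos_divide_le_eq)
      have as: "a * s j powr p > 0" using a s0[of j] by simp
      have i1: "integrable lebesgue (\<lambda>x. a * s j powr p * f j x)"
        by (rule Bochner_Integration.integrable_bound[OF Hi])
          (use ub as H_nonneg in \<open>auto simp: f_def abs_of_nonneg\<close>)
      then have fi: "integrable lebesgue (f j)" using a s0[of j] by simp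
      have "a * s j powr p * integral\<^sup>L lebesgue (f j) = (LINT x|lebesgue. a * s j powr p * f j x)" by simp
      also have "\<dots> \<le> (LINT x|lebesgue. H (dual_change (s j * u x)))"
        by (rule integral_mono[OF i1 Hi ub])
      also note HC
      finally have "a * k powr (p / 2) * integral\<^sup>L lebesgue (f j) * c j ^ ?N \<le> C * c j ^ ?N"
        by (simp add: sp mult_ac)
      then have "a * k powr (p / 2) * integral\<^sup>L lebesgue (f j) \<le> C"
        using c(2)[of j] by simp
      then show ?thesis using fi a k by (simp add: pos_le_divide_eq mult_ac)
    qed
    have Kj: "C / (a * k powr (p / 2)) = C / a * (4 / d\<^sup>2) powr (p / 2) * A powr (p / 2)"
    proof -
      have "k powr (p / 2) * ((4 / d\<^sup>2) powr (p / 2) * A powr (p / 2)) = (k * (4 / d\<^sup>2 * A)) powr (p / 2)"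
        by (simp only: powr_mult)
      also have "k * (4 / d\<^sup>2 * A) = 1" using d A by (simp add: k_def field_simps)
      finally have "k powr (p / 2) * ((4 / d\<^sup>2) powr (p / 2) * A powr (p / 2)) = 1" by simp
      then show ?thesis using a k by (simp add: field_simps)
    qed
    \<comment> \<open>Integrability is known only once the dilated function lies in the ball of
      radius \<open>d\<close>, so the sequence is started at \<open>j0\<close>.\<close>
    obtain j0 where j0: "\<And>j. j \<ge> j0 \<Longrightarrow> H1_norm (\<lambda>x. s j * u (c j *\<^sub>R x)) < d"
      using norm_lt by (auto simp: eventually_sequentially)
    have fl: "(\<lambda>j. f (j + j0) x) \<longlonglongrightarrow> \<bar>u x\<bar> powr p" for x
    proof (rule LIMSEQ_ignore_initial_segment, cases "u x = 0")
      case False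
      have "eventually (\<lambda>j. c j \<ge> (2 / \<bar>u x\<bar>)\<^sup>2 / k) sequentially"
        using clim by (simp add: filterlim_at_top)
      then have "eventually (\<lambda>j. f j x = \<bar>u x\<bar> powr p) sequentially"
      proof eventually_elim
        case (elim j)
        then have "(2 / \<bar>u x\<bar>)\<^sup>2 \<le> k * c j" using k by (simp add: pos_divide_le_eq mult.commute)
        also note s_ge[of j]
        finally have "2 / \<bar>u x\<bar> \<le> s j" using s0[of j] by (rule_tac power2_le_imp_le) auto
        then have "2 \<le> \<bar>s j * u x\<bar>" using False s0[of j] by (simp add: pos_divide_le_eq abs_mult)
        then show ?case by (simp add: f_def)
      qed
      then show "(\<lambda>j. f j x) \<longlonglongrightarrow> \<bar>u x\<bar> powr p" by (rule tendsto_eventually)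
    qed (simp add: f_def)
    have g1: "\<And>j. integrable lebesgue (f (j + j0))"
      and g2: "eventually (\<lambda>j. integral\<^sup>L lebesgue (f (j + j0)) \<le> C / (a * k powr (p / 2))) sequentially"
      using f_ok[OF j0] by simp_all
    have g3: "\<And>j. AE x in lebesgue. 0 \<le> f (j + j0) x" by (simp add: f_def)
    have g4: "(\<lambda>x. \<bar>u x\<bar> powr p) \<in> borel_measurable lebesgue" by measurable
    have "integrable lebesgue (\<lambda>x. \<bar>u x\<bar> powr p)" "(LINT x|lebesgue. \<bar>u x\<bar> powr p) \<le> C / (a * k powr (p / 2))"
      using Fatou_bound[OF g1 g3 g4 AE_I2[OF fl] g2] by auto
    then show "integrable lebesgue (\<lambda>x. \<bar>u x\<bar> powr p) \<and>
        (LINT x|lebesgue. \<bar>u x\<bar> powr p) \<le> C / a * (4 / d\<^sup>2) powr (p / 2) * A powr (p / 2)"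
      by (simp only: Kj simp_thms)
  qed
  then show thesis by (rule that)
qed

text \<open>Test the energy bound with a bump of modulus at least \<open>|s|\<close> on the half
  ball, concentrated by a factor \<open>c\<close>. The Dirichlet integral scales like
  \<open>s^2 * c^(2-N)\<close>, so \<open>c^(N-2)\<close> proportional to \<open>s^2\<close> keeps
  the norm small. The plateau contributes \<open>H (dual_change s)\<close> times a volume of order
  \<open>c^(-N)\<close>, and \<open>c^N\<close> is of order \<open>|s|^p\<close>.\<close>

lemma H_upper:
  obtains C where "C > 0" "\<And>t. H t \<le> C * \<bar>t\<bar> powr (2 * p)"
proof -
  let ?N = "CARD('n)"
  have "Psi_well_defined_C1 TYPE('n) h" using energy by (simp add: Psi_well_defined_C1_def)
  from Psi_bound[OF this] obtain d C where d: "d > 0" and C: "C > 0"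
    and bd0: "\<forall>w :: real ^ 'n \<Rightarrow> real. w \<in> H1 \<and> H1_norm w < d \<longrightarrow>
       integrable lebesgue (\<lambda>x. H (dual_change (w x))) \<and> (LINT x|lebesgue. H (dual_change (w x))) \<le> C"
    by blast
  note bd = bd0[rule_format, OF conjI]
  let ?u = "moll 1 :: real ^ 'n \<Rightarrow> real" and ?G = "moll_grad 1 :: real ^ 'n \<Rightarrow> real ^ 'n"
  let ?D = "cball 0 (1 / 2) :: (real ^ 'n) set"
  have w: "has_weak_gradient ?u ?G" by (rule C1_has_weak_gradient[OF GDERIV_moll moll_continuous(2)])
  have i: "integrable lebesgue (\<lambda>x. (?u x)\<^sup>2)" "integrable lebesgue (\<lambda>x. (norm (?G x))\<^sup>2)"
    by (rule integrable_continuous_supp[where R = 1];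
      auto intro!: continuous_intros moll_continuous simp: moll_supp moll_grad_supp)+
  obtain y where y: "y \<in> ?D" "\<And>x. x \<in> ?D \<Longrightarrow> ?u y \<le> ?u x"
    using continuous_attains_inf[of ?D ?u, OF _ _ moll_continuous(1)] by fastforce
  \<comment> \<open>Dividing by the minimum over the half ball makes the profile
    \<open>?u / m\<close> at least 1 there.\<close>
  define m where "m = ?u y"
  have m: "m > 0" "\<And>x. x \<in> ?D \<Longrightarrow> m \<le> ?u x"
    using y moll_pos[of 1 y] by (auto simp: m_def)
  define A where "A = (LINT x|lebesgue. (norm (?G x))\<^sup>2)"
  define B where "B = (LINT x|lebesgue. (?u x)\<^sup>2)"
  have AB: "A \<ge> 0" "B \<ge> 0" by (simp_all add: A_def B_def integral_nonneg_AE)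
  \<comment> \<open>The summand 4 makes \<open>K * s^2 >= 1\<close> for \<open>|s| >= 1/2\<close>,
    hence \<open>c >= 1\<close>; the other one brings the squared H1 norm down to at most
    \<open>d^2 / 4\<close>.\<close>
  define K where "K = 4 + 4 * (A + B) / (m\<^sup>2 * d\<^sup>2)"
  have K: "K \<ge> 4" "4 * (A + B) \<le> K * (m\<^sup>2 * d\<^sup>2)"
    using AB m(1) d by (auto simp: K_def field_simps)
  define V where "V = measure lebesgue ?D"
  have V: "V > 0"
  proof -
    have "\<not> negligible ?D"
      using open_not_negligible[of "ball (0 :: real ^ 'n) (1/2)"] negligible_subset[OF _ ball_subset_cball[of "0 :: real ^ 'n" "1/2"]]
      by auto
    then have "emeasure lebesgue ?D \<noteq> 0" by (simp only: negligible_iff_emeasure0[of ?D, OF lmeasurable_cball[THEN fmeasurableD]] not_False_eq_True)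
    moreover have "emeasure lebesgue ?D = ennreal V"
      unfolding V_def using lmeasurable_cball[of "0 :: real ^ 'n" "1/2"] by (intro emeasure_eq_measure2)
    moreover have "V \<ge> 0" by (simp add: V_def)
    ultimately show ?thesis by (cases "V = 0") auto
  qed
  have main: "H (dual_change s) \<le> C / V * K powr (p / 2) * \<bar>s\<bar> powr p" if s: "\<bar>s\<bar> \<ge> 1 / 2" for s
  proof -
    have s4: "s\<^sup>2 \<ge> 1 / 4" using power_mono[OF s, of 2] by (simp add: power2_eq_square)
    have Ks: "K * s\<^sup>2 \<ge> 1" using mult_mono[OF K(1) s4] K by simp
    \<comment> \<open>The solution of \<open>c^(N-2) = K * s^2\<close>.\<close>
    define c where "c = (K * s\<^sup>2) powr (1 / (real ?N - 2))"
    have c1: "c \<ge> 1" unfolding c_def using Ks dim by (intro ge_one_powr_ge_zero) auto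
    then have c: "c > 0" by simp
    have cN2: "c ^ ?N = K * s\<^sup>2 * c\<^sup>2"
    proof -
      have "c powr (real ?N - 2) = K * s\<^sup>2" using Ks dim by (simp add: c_def powr_powr)
      then show ?thesis using c by (simp add: powr_diff powr_realpow field_simps)
    qed
    have cN: "c ^ ?N = K powr (p / 2) * \<bar>s\<bar> powr p"
    proof -
      have "c ^ ?N = (K * s\<^sup>2) powr (real ?N / (real ?N - 2))"
        using c by (simp add: c_def powr_powr flip: powr_realpow)
      also have "real ?N / (real ?N - 2) = p / 2" using dim by (simp add: p_def field_simps)
      also have "(K * s\<^sup>2) powr (p / 2) = K powr (p / 2) * (\<bar>s\<bar>\<^sup>2) powr (p / 2)"
        using K by (simp add: powr_mult)
      also have "(\<bar>s\<bar>\<^sup>2) powr (p / 2) = \<bar>s\<bar> powr p"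
      proof -
        have "\<bar>s\<bar>\<^sup>2 = \<bar>s\<bar> powr 2" using s by (subst powr_numeral) auto
        then show ?thesis by (simp only: powr_powr) simp
      qed
      finally show ?thesis .
    qed
    let ?w = "\<lambda>x. s / m * ?u (c *\<^sub>R x)"
    have n: "(H1_norm ?w)\<^sup>2 = (s / m)\<^sup>2 * c\<^sup>2 / c ^ ?N * A + (s / m)\<^sup>2 / c ^ ?N * B"
      unfolding A_def B_def by (rule dilate_H1(2)[OF w i c])
    have n1: "(s / m)\<^sup>2 / c ^ ?N * B \<le> (s / m)\<^sup>2 * c\<^sup>2 / c ^ ?N * B"
    proof -
      have "(s / m)\<^sup>2 * 1 \<le> (s / m)\<^sup>2 * c\<^sup>2" using c1 by (intro mult_left_mono) auto
      then show ?thesis using AB c by (intro mult_right_mono divide_right_mono) auto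
    qed
    have n2: "(s / m)\<^sup>2 * c\<^sup>2 / c ^ ?N = 1 / (K * m\<^sup>2)"
      using c s m K by (simp add: cN2 power_divide)
    have "(H1_norm ?w)\<^sup>2 \<le> 1 / (K * m\<^sup>2) * A + 1 / (K * m\<^sup>2) * B" using n n1 n2 by simp
    also have "\<dots> = (A + B) / (K * m\<^sup>2)" by (simp add: add_divide_distrib)
    also have "\<dots> \<le> d\<^sup>2 / 4"
    proof -
      have "K * m\<^sup>2 > 0" using K m by simp
      moreover have "A + B \<le> d\<^sup>2 / 4 * (K * m\<^sup>2)" using K(2) by (simp add: mult_ac)
      ultimately show ?thesis by (simp only: pos_divide_le_eq)
    qed
    also have "d\<^sup>2 / 4 < d\<^sup>2" using d by simp
    finally have nlt: "H1_norm ?w < d" by (rule power_less_imp_less_base) (use d in simp)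
    have b: "integrable lebesgue (\<lambda>x. H (dual_change (?w x)))" "(LINT x|lebesgue. H (dual_change (?w x))) \<le> C"
      using bd[OF dilate_H1(1)[OF w i c] nlt] by auto
    have Hi: "integrable lebesgue (\<lambda>x. H (dual_change (s / m * ?u x)))"
      using b(1) integrable_dilate[OF c, of "\<lambda>x. H (dual_change (s / m * ?u x))"] by simp
    have HC: "(LINT x|lebesgue. H (dual_change (s / m * ?u x))) \<le> C * c ^ ?N"
      using b(2) integral_dilate[OF c, of "\<lambda>x. H (dual_change (s / m * ?u x))"] c
      by (simp add: pos_divide_le_eq)
    have "H (dual_change s) * V = (LINT x|lebesgue. H (dual_change s) * indicator ?D x)"
      by (simp add: V_def)
    also have "\<dots> \<le> (LINT x|lebesgue. H (dual_change (s / m * ?u x)))"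
    proof (rule integral_mono[OF _ Hi])
      show "integrable lebesgue (\<lambda>x. H (dual_change s) * indicator ?D x)"
        using emeasure_lborel_cball_finite[of "0 :: real ^ 'n" "1/2"] by (intro integrable_mult_right integrable_real_indicator) auto
      show "H (dual_change s) * indicator ?D x \<le> H (dual_change (s / m * ?u x))" for x
      proof (cases "x \<in> ?D")
        case True
        then have "?u x / m \<ge> 1" using m by simp
        from dual_change_scale[OF this, of s] have "H (dual_change s) \<le> H (dual_change (s * (?u x / m)))"
          by (rule H_mono)
        then show ?thesis using True by simp
      qed (simp add: H_nonneg)
    qed
    also note HC
    finally show ?thesis using V by (simp add: cN pos_le_divide_eq mult_ac)
  qed
  let ?C = "C / V * K powr (p / 2) * 2 powr p"
  have C0: "?C > 0" using C V K by simp
  show thesis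
  proof (rule that[of "max c1 ?C"])
    show "max c1 ?C > 0" using C0 by simp
    fix t
    show "H t \<le> max c1 ?C * \<bar>t\<bar> powr (2 * p)"
    proof (cases "\<bar>t\<bar> \<le> 1")
      case True
      have "c1 * \<bar>t\<bar> powr (2 * p) \<le> max c1 ?C * \<bar>t\<bar> powr (2 * p)" by (intro mult_right_mono) auto
      with H_small[OF True] show ?thesis by linarith
    next
      case False
      let ?s = "dual_inverse t"
      have s: "\<bar>?s\<bar> \<ge> 1 / 2" using abs_dual_inverse_ge_half[of t] False by simp
      have "\<bar>?s\<bar> powr p \<le> (2 * \<bar>t\<bar>\<^sup>2) powr p"
        using abs_dual_inverse_le_sq[of t] False p_gt_2 by (intro powr_mono2) auto
      also have "(2 * \<bar>t\<bar>\<^sup>2) powr p = 2 powr p * \<bar>t\<bar> powr (2 * p)"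
        using False by (subst powr_mult) (auto simp: powr_powr powr_numeral[symmetric] simp del: powr_numeral power2_abs)
      finally have "C / V * K powr (p / 2) * \<bar>?s\<bar> powr p \<le> C / V * K powr (p / 2) * (2 powr p * \<bar>t\<bar> powr (2 * p))"
        using C V by (intro mult_left_mono) auto
      also have "\<dots> = ?C * \<bar>t\<bar> powr (2 * p)" by simp
      also have "\<dots> \<le> max c1 ?C * \<bar>t\<bar> powr (2 * p)" by (intro mult_right_mono) auto
      finally show ?thesis using main[OF s] by (simp add: dual_change_dual_inverse)
    qed
  qed
qed

end

section \<open>Solutions of an equation with critical growth\<close>

lemma powr_interpolate:
  assumes "2 \<le> r" "r \<le> q"
  shows "\<bar>t\<bar> powr r \<le> t\<^sup>2 + \<bar>t :: real\<bar> powr q"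
proof (cases "t = 0")
  case False
  show ?thesis
  proof (cases "\<bar>t\<bar> \<le> 1")
    case True
    have "\<bar>t\<bar> powr r \<le> \<bar>t\<bar> powr 2" using True False assms by (intro powr_mono') auto
    also have "\<bar>t\<bar> powr 2 = t\<^sup>2" using False by simp
    finally show ?thesis using powr_ge_zero[of "\<bar>t\<bar>" q] by linarith
  next
    case F: False
    have "\<bar>t\<bar> powr r \<le> \<bar>t\<bar> powr q" using F assms by (intro powr_mono) auto
    then show ?thesis using zero_le_power2[of t] by linarith
  qed
qed simp

lemma powr_add_le:
  assumes "0 \<le> a" "0 \<le> b" "0 \<le> r"
  shows "(a + b) powr r \<le> 2 powr r * (a powr r + b powr (r :: real))"
proof -
  have "(a + b) powr r \<le> (2 * max a b) powr r" using assms by (intro powr_mono2) auto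
  also have "\<dots> = 2 powr r * (max a b) powr r" by (rule powr_mult)
  also have "(max a b) powr r \<le> a powr r + b powr r" by (auto simp: max_def)
  finally show ?thesis by simp
qed

lemma two_mult_le_squares: "2 * \<bar>a\<bar> * \<bar>b\<bar> \<le> a\<^sup>2 + (b :: real)\<^sup>2"
  using zero_le_power2[of "\<bar>a\<bar> - \<bar>b\<bar>"] by (simp add: power2_diff)

text \<open>Isolates one solution from the energy. Of the energy and the growth condition there
  remain the Sobolev inequality, bounds on \<open>h\<close> and its primitive with a common constant
  \<open>C\<close>, nonnegativity of the primitive, and its comparison with
  \<open>h t * t\<close>.\<close>

locale critical_solution =
  fixes h :: "real \<Rightarrow> real" and p S C lam :: real and u :: "real ^ 'n \<Rightarrow> real" and G :: "real ^ 'n \<Rightarrow> real ^ 'n"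
  assumes p_gt_2: "p > 2" and p_eq: "(real CARD('n) - 2) * p = 2 * real CARD('n)"
    and h_cont: "continuous_on UNIV h"
    and H_nonneg: "\<And>t. primitive h t \<ge> 0" and H_le_ht: "\<And>t. 2 * p * primitive h t \<le> h t * t"
    and C_pos: "C > 0"
    and H_growth: "\<And>t. primitive h t \<le> C * \<bar>t\<bar> powr (2 * p)"
    and h_growth: "\<And>t. \<bar>h t\<bar> \<le> C * \<bar>t\<bar> powr (2 * p - 1)"
    and sob: "sobolev_inequality TYPE('n) p S"
    and wg: "has_weak_gradient u G"
    and u2: "integrable lebesgue (\<lambda>x. (u x)\<^sup>2)" and G2: "integrable lebesgue (\<lambda>x. (norm (G x))\<^sup>2)"
    and uG2: "integrable lebesgue (\<lambda>x. (norm (G x))\<^sup>2 * (u x)\<^sup>2)"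
    and lam: "lam < 0" and sol: "weak_solution h u lam"
begin

abbreviation "H \<equiv> primitive h"

lemma DERIV_H: "(H has_real_derivative h t) (at t)"
  by (rule DERIV_primitive[OF h_cont])

lemma continuous_on_H: "continuous_on A H"
  using DERIV_H by (meson DERIV_continuous continuous_at_imp_continuous_on)

lemma measurables [measurable]:
  "u \<in> borel_measurable lebesgue" "G \<in> borel_measurable lebesgue"
  "h \<in> borel_measurable borel" "H \<in> borel_measurable borel"
  "trunc k \<in> borel_measurable borel" "trunc' k \<in> borel_measurable borel"
  using has_weak_gradientD(3,4)[OF wg] h_cont continuous_on_H continuous_on_trunc continuous_on_trunc'
  by (auto intro: borel_measurable_continuous_onI)

lemma sobolevD:
  assumes "has_weak_gradient (w :: real ^ 'n \<Rightarrow> real) K" "integrable lebesgue (\<lambda>x. (w x)\<^sup>2)"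
    "integrable lebesgue (\<lambda>x. (norm (K x))\<^sup>2)" "(LINT x|lebesgue. (norm (K x))\<^sup>2) \<le> A" "0 < A"
  shows "integrable lebesgue (\<lambda>x. \<bar>w x\<bar> powr p)" "(LINT x|lebesgue. \<bar>w x\<bar> powr p) \<le> S * A powr (p / 2)"
  using sob assms unfolding sobolev_inequality_def by blast+

lemma S_pos: "S > 0"
  using sob by (simp add: sobolev_inequality_def)

text \<open>Sobolev for \<open>u^2\<close>, whose gradient \<open>2 u G\<close> is square
  integrable. As \<open>u^2\<close> itself is not yet known to be square integrable, truncated
  squares are used, with a bound on their gradients that does not depend on
  \<open>k\<close>.\<close>

lemma integrable_u_2p: "integrable lebesgue (\<lambda>x. \<bar>u x\<bar> powr (2 * p))"
proof -
  \<comment> \<open>The 1 keeps the bound positive even if \<open>u * G\<close> vanishes.\<close>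
  let ?A = "4 * (LINT x|lebesgue. (norm (G x))\<^sup>2 * (u x)\<^sup>2) + 1"
  have A: "?A > 0" by (intro add_nonneg_pos mult_nonneg_nonneg integral_nonneg_AE) auto
  let ?q = "\<lambda>k x. (trunc k (u x))\<^sup>2" and ?K = "\<lambda>k x. (2 * trunc k (u x) * trunc' k (u x)) *\<^sub>R G x"
  have w: "has_weak_gradient (?q k) (?K k)" for k
    by (rule has_weak_gradient_chain_trunc[OF wg]) (auto intro!: derivative_eq_intros continuous_intros)
  have q2: "integrable lebesgue (\<lambda>x. (?q k x)\<^sup>2)" for k
  proof (rule Bochner_Integration.integrable_bound)
    show "integrable lebesgue (\<lambda>x. (real (Suc k))\<^sup>2 * (u x)\<^sup>2)" using u2 by simp
    show "AE x in lebesgue. norm ((?q k x)\<^sup>2) \<le> norm ((real (Suc k))\<^sup>2 * (u x)\<^sup>2)"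
    proof (intro AE_I2)
      fix x
      have "\<bar>trunc k (u x)\<bar>\<^sup>2 * \<bar>trunc k (u x)\<bar>\<^sup>2 \<le> (real (Suc k))\<^sup>2 * \<bar>u x\<bar>\<^sup>2"
        by (intro mult_mono power_mono abs_trunc_bound abs_trunc_le) auto
      then show "norm ((?q k x)\<^sup>2) \<le> norm ((real (Suc k))\<^sup>2 * (u x)\<^sup>2)"
        by (simp add: power2_eq_square[of "_ ^ 2"] del: of_nat_Suc)
    qed
  qed measurable
  have Kb: "(norm (?K k x))\<^sup>2 \<le> 4 * ((norm (G x))\<^sup>2 * (u x)\<^sup>2)" for k x
  proof -
    have "\<bar>trunc k (u x)\<bar> * \<bar>trunc' k (u x)\<bar> \<le> \<bar>u x\<bar> * 1"
      using trunc'_pos[of k "u x"] trunc'_le_1[of k "u x"] by (intro mult_mono abs_trunc_le) auto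
    from mult_right_mono[OF this norm_ge_zero[of "G x"]]
    have "norm (?K k x) \<le> 2 * \<bar>u x\<bar> * norm (G x)" by (simp add: abs_mult mult.assoc)
    from power_mono[OF this, of 2] show ?thesis by (simp add: power_mult_distrib mult_ac)
  qed
  have K2: "integrable lebesgue (\<lambda>x. (norm (?K k x))\<^sup>2)" for k
    by (rule Bochner_Integration.integrable_bound[of _ "\<lambda>x. 4 * ((norm (G x))\<^sup>2 * (u x)\<^sup>2)"])
      (use uG2 Kb in auto)
  have KA: "(LINT x|lebesgue. (norm (?K k x))\<^sup>2) \<le> ?A" for k
  proof -
    have "(LINT x|lebesgue. (norm (?K k x))\<^sup>2) \<le> (LINT x|lebesgue. 4 * ((norm (G x))\<^sup>2 * (u x)\<^sup>2))"
      using uG2 by (intro integral_mono K2 Kb) auto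
    then show ?thesis by simp
  qed
  note s = sobolevD[OF w q2 K2 KA A]
  have "integrable lebesgue (\<lambda>x. \<bar>(u x)\<^sup>2\<bar> powr p)"
  proof (rule Fatou_bound(1)[OF s(1) _ _ _ eventuallyI[OF s(2)]])
    show "AE x in lebesgue. (\<lambda>k. \<bar>?q k x\<bar> powr p) \<longlonglongrightarrow> \<bar>(u x)\<^sup>2\<bar> powr p"
    proof (intro AE_I2)
      fix x
      show "(\<lambda>k. \<bar>?q k x\<bar> powr p) \<longlonglongrightarrow> \<bar>(u x)\<^sup>2\<bar> powr p"
        using p_gt_2 by (intro tendsto_powr' tendsto_rabs tendsto_power trunc_tendsto tendsto_const) auto
    qed
  qed auto
  moreover have "\<bar>(u x)\<^sup>2\<bar> powr p = \<bar>u x\<bar> powr (2 * p)" for x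
  proof (cases "u x = 0")
    case False
    then have "\<bar>(u x)\<^sup>2\<bar> = \<bar>u x\<bar> powr 2" by simp
    then show ?thesis by (simp only: powr_powr)
  qed simp
  ultimately show ?thesis by simp
qed

lemma integrable_u_powr:
  assumes "2 \<le> r" "r \<le> 2 * p"
  shows "integrable lebesgue (\<lambda>x. \<bar>u x\<bar> powr r)"
  by (rule Bochner_Integration.integrable_bound[of _ "\<lambda>x. (u x)\<^sup>2 + \<bar>u x\<bar> powr (2 * p)"])
    (use u2 integrable_u_2p powr_interpolate[OF assms] in auto)

lemma integrable_u4: "integrable lebesgue (\<lambda>x. (u x) ^ 4)"
proof -
  have "\<bar>u x\<bar> powr 4 = u x ^ 4" for x by (cases "u x = 0") auto
  then show ?thesis using integrable_u_powr[of 4] p_gt_2 by simp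
qed

lemma integrable_H: "integrable lebesgue (\<lambda>x. H (u x))"
  by (rule Bochner_Integration.integrable_bound[of _ "\<lambda>x. C * \<bar>u x\<bar> powr (2 * p)"])
    (use integrable_u_2p H_growth H_nonneg C_pos in auto)

lemma h_growth_mono:
  assumes "\<bar>s\<bar> \<le> a"
  shows "\<bar>h s\<bar> \<le> C * a powr (2 * p - 1)"
proof -
  have "\<bar>s\<bar> powr (2 * p - 1) \<le> a powr (2 * p - 1)" using assms p_gt_2 by (intro powr_mono2) auto
  then have "C * \<bar>s\<bar> powr (2 * p - 1) \<le> C * a powr (2 * p - 1)" using C_pos by (intro mult_left_mono) auto
  then show ?thesis using h_growth[of s] by linarith
qed

lemma integrable_h: "integrable lebesgue (\<lambda>x. h (u x))"
  by (rule Bochner_Integration.integrable_bound[of _ "\<lambda>x. C * \<bar>u x\<bar> powr (2 * p - 1)"])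
    (use integrable_u_powr[of "2 * p - 1"] p_gt_2 h_growth C_pos in auto)

text \<open>By the mean value theorem the quotients are at most
  \<open>C * M * (|u| + M)^(2p-1)\<close>, and \<open>|u|^(2p-1)\<close> is integrable as
  \<open>2p - 1\<close> lies between 2 and \<open>2p\<close>. Outside the support of
  \<open>\<phi>\<close> the quotients vanish, so the constant part only matters on a ball.\<close>

lemma potential_derivative:
  assumes c: "continuous_on UNIV \<phi>" and R: "\<And>x. norm x > R \<Longrightarrow> \<phi> x = 0"
  shows "(\<lambda>n. LINT x|lebesgue. (H (u x + 1 / real (Suc n) * \<phi> x) - H (u x)) / (1 / real (Suc n))) \<longlonglongrightarrow> (LINT x|lebesgue. h (u x) * \<phi> x)"
    "\<And>n. integrable lebesgue (\<lambda>x. (H (u x + 1 / real (Suc n) * \<phi> x) - H (u x)) / (1 / real (Suc n)))"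
proof -
  obtain M where M: "\<And>x. norm (\<phi> x) \<le> M" "M > 0" using continuous_supp_bounded[OF c R] by blast
  have [measurable]: "\<phi> \<in> borel_measurable lebesgue" by (rule continuous_on_imp_lebesgue_measurable[OF c])
  let ?r = "2 * p - 1"
  let ?t = "\<lambda>n. 1 / real (Suc n)"
  let ?W = "\<lambda>x. C * M * (2 powr ?r * (\<bar>u x\<bar> powr ?r + M powr ?r))"
  have loc: "locally_integrable ?W"
    by (intro locally_integrable_cmult locally_integrable_add integrable_imp_locally_integrable integrable_u_powr
        locally_integrable_continuous continuous_on_const) (use p_gt_2 in auto)
  have t: "?t n > 0" "?t n \<le> 1" for n by auto
  note * = ball_dominated_convergence[where R = R and f = "\<lambda>n x. (H (u x + ?t n * \<phi> x) - H (u x)) / ?t n"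
      and g = "\<lambda>x. h (u x) * \<phi> x" and W = "\<lambda>x. indicator (cball 0 R) x *\<^sub>R ?W x"]
  have 1: "AE x in lebesgue. norm x \<le> R \<longrightarrow> (\<lambda>n. (H (u x + ?t n * \<phi> x) - H (u x)) / ?t n) \<longlonglongrightarrow> h (u x) * \<phi> x"
  proof (intro AE_I2 impI)
    fix x
    have "((\<lambda>s. H (u x + s * \<phi> x)) has_real_derivative h (u x + 0 * \<phi> x) * \<phi> x) (at 0)"
      by (rule DERIV_chain2[OF DERIV_H]) (auto intro!: derivative_eq_intros)
    then have "((\<lambda>s. (H (u x + s * \<phi> x) - H (u x)) / s) \<longlongrightarrow> h (u x) * \<phi> x) (at 0)"
      by (simp add: DERIV_def)
    moreover have "filterlim ?t (at 0) sequentially"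
      using LIMSEQ_inverse_real_of_nat by (auto simp: filterlim_at divide_inverse)
    ultimately show "(\<lambda>n. (H (u x + ?t n * \<phi> x) - H (u x)) / ?t n) \<longlonglongrightarrow> h (u x) * \<phi> x"
      by (rule filterlim_compose)
  qed
  have bd: "norm ((H (u x + ?t n * \<phi> x) - H (u x)) / ?t n) \<le> ?W x" for x n
  proof -
    have "\<bar>h s\<bar> \<le> C * (\<bar>u x\<bar> + M) powr ?r" if "s \<in> closed_segment (u x) (u x + ?t n * \<phi> x)" for s
    proof (rule h_growth_mono)
      have "\<bar>?t n * \<phi> x\<bar> \<le> 1 * M"
        unfolding abs_mult using M(1)[of x] t[of n] by (intro mult_mono) auto
      moreover have "\<bar>s - u x\<bar> \<le> \<bar>?t n * \<phi> x\<bar>"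
        using dist_in_closed_segment[OF that] by (auto simp: dist_real_def abs_minus_commute)
      ultimately show "\<bar>s\<bar> \<le> \<bar>u x\<bar> + M" by linarith
    qed
    then have "norm (H (u x + ?t n * \<phi> x) - H (u x)) \<le> C * (\<bar>u x\<bar> + M) powr ?r * norm (u x + ?t n * \<phi> x - u x)"
      by (intro field_differentiable_bound[of "closed_segment (u x) (u x + ?t n * \<phi> x)" _ h])
        (auto intro: has_field_derivative_at_within DERIV_H)
    also have "\<dots> \<le> C * (\<bar>u x\<bar> + M) powr ?r * (?t n * M)"
      using M(1)[of x] C_pos t[of n] by (intro mult_left_mono) (auto simp: abs_mult intro!: divide_right_mono)
    finally have *: "norm (H (u x + ?t n * \<phi> x) - H (u x)) \<le> C * (\<bar>u x\<bar> + M) powr ?r * (?t n * M)" .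
    have aux: "\<bar>D / \<tau>\<bar> \<le> K * M" if "\<bar>D\<bar> \<le> K * (\<tau> * M)" "0 < \<tau>" for D K \<tau> :: real
      using that by (simp add: abs_divide pos_divide_le_eq mult_ac)
    have "norm ((H (u x + ?t n * \<phi> x) - H (u x)) / ?t n) \<le> C * (\<bar>u x\<bar> + M) powr ?r * M"
      using aux[OF *[unfolded real_norm_def] t(1)] by simp
    then have "norm ((H (u x + ?t n * \<phi> x) - H (u x)) / ?t n) \<le> C * M * (\<bar>u x\<bar> + M) powr ?r"
      by (simp only: mult_ac)
    also have "\<dots> \<le> ?W x"
      using C_pos M(2) p_gt_2 by (intro mult_left_mono powr_add_le) auto
    finally show ?thesis .
  qed
  have 2: "AE x in lebesgue. norm x \<le> R \<longrightarrow> (\<forall>n. norm ((H (u x + ?t n * \<phi> x) - H (u x)) / ?t n) \<le> indicator (cball 0 R) x *\<^sub>R ?W x)"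
    by (intro AE_I2 impI allI order_trans[OF bd]) simp
  show "(\<lambda>n. LINT x|lebesgue. (H (u x + ?t n * \<phi> x) - H (u x)) / ?t n) \<longlonglongrightarrow> (LINT x|lebesgue. h (u x) * \<phi> x)"
    by (rule *(1)[OF _ _ _ _ 1 set_integrable_cball[OF loc] 2]) (auto simp: R)
  show "\<And>n. integrable lebesgue (\<lambda>x. (H (u x + ?t n * \<phi> x) - H (u x)) / ?t n)"
    by (rule *(3)[OF _ _ _ _ 1 set_integrable_cball[OF loc] 2]) (auto simp: R)
qed

end

lemma abs_mult_le_squares: "\<bar>a\<bar> * \<bar>b\<bar> \<le> a\<^sup>2 + (b :: real)\<^sup>2"
proof -
  have "0 \<le> \<bar>a\<bar> * \<bar>b\<bar>" by simp
  then show ?thesis using two_mult_le_squares[of a b] by linarith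
qed

lemma integral_quartic:
  fixes c0 c1 c2 c3 c4 :: "'a \<Rightarrow> real"
  assumes "integrable M c0" "integrable M c1" "integrable M c2" "integrable M c3" "integrable M c4"
  shows "(LINT x|M. c0 x + \<tau> * (2 * c1 x) + \<tau>\<^sup>2 * c2 x + \<tau> ^ 3 * c3 x + \<tau> ^ 4 * c4 x) =
    integral\<^sup>L M c0 + \<tau> * (2 * integral\<^sup>L M c1) + \<tau>\<^sup>2 * integral\<^sup>L M c2 + \<tau> ^ 3 * integral\<^sup>L M c3 + \<tau> ^ 4 * integral\<^sup>L M c4"
  using assms by simp

context critical_solution
begin

lemma kinetic_expansion:
  fixes a \<tau> b :: real and g k :: "real ^ 'n"
  shows "(1 + 2 * (a + \<tau> * b)\<^sup>2) * (norm (g + \<tau> *\<^sub>R k))\<^sup>2 =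
     (1 + 2 * a\<^sup>2) * (norm g)\<^sup>2 + \<tau> * (2 * ((1 + 2 * a\<^sup>2) * (g \<bullet> k) + 2 * a * (norm g)\<^sup>2 * b))
     + \<tau>\<^sup>2 * ((1 + 2 * a\<^sup>2) * (norm k)\<^sup>2 + 8 * (a * b * (g \<bullet> k)) + 2 * (b\<^sup>2 * (norm g)\<^sup>2))
     + \<tau> ^ 3 * (4 * (a * b * (norm k)\<^sup>2) + 4 * (b\<^sup>2 * (g \<bullet> k))) + \<tau> ^ 4 * (2 * (b\<^sup>2 * (norm k)\<^sup>2))"
proof -
  have "(norm (g + \<tau> *\<^sub>R k))\<^sup>2 = (norm g)\<^sup>2 + 2 * \<tau> * (g \<bullet> k) + \<tau>\<^sup>2 * (norm k)\<^sup>2"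
    unfolding power2_norm_eq_inner
    by (simp add: inner_add_left inner_add_right inner_commute[of k g] power2_eq_square algebra_simps)
  then show ?thesis by (simp add: power2_eq_square power3_eq_cube power4_eq_xxxx algebra_simps)
qed

text \<open>The kinetic energy along \<open>u + \<tau> * \<phi>\<close> is a polynomial of degree 4
  in \<open>\<tau>\<close>; once its coefficients are integrable, the derivative is read off, and
  only the potential needs a limit theorem. The definition of a solution provides the limit of the
  quotient, so it suffices to evaluate it along \<open>\<tau> = 1 / (n + 1)\<close>.\<close>

lemma weak_equation_u:
  assumes t: "test_function \<phi>" and k: "\<And>x. GDERIV \<phi> x :> k x"
  shows "integrable lebesgue (\<lambda>x. (1 + 2 * (u x)\<^sup>2) * (G x \<bullet> k x) + 2 * u x * (norm (G x))\<^sup>2 * \<phi> x)"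
    "integrable lebesgue (\<lambda>x. (h (u x) + lam * u x) * \<phi> x)"
    "(LINT x|lebesgue. (1 + 2 * (u x)\<^sup>2) * (G x \<bullet> k x) + 2 * u x * (norm (G x))\<^sup>2 * \<phi> x)
     = (LINT x|lebesgue. (h (u x) + lam * u x) * \<phi> x)"
proof -
  obtain R where R: "\<And>x. norm x > R \<Longrightarrow> \<phi> x = 0" using test_function_supp[OF t] by blast
  note kc = test_function_gradient[OF t k]
  note pc = GDERIV_continuous_on[OF k, of UNIV]
  have k0: "norm x > R \<Longrightarrow> k x = 0" for x by (rule GDERIV_supp[OF k R])
  obtain Mk where Mk: "\<And>x. norm (k x) \<le> Mk" "Mk > 0" using continuous_supp_bounded[OF kc k0] by blast
  obtain Mp where Mp: "\<And>x. norm (\<phi> x) \<le> Mp" "Mp > 0" using continuous_supp_bounded[OF pc R] by blast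
  have [measurable]: "\<phi> \<in> borel_measurable lebesgue" "k \<in> borel_measurable lebesgue"
    by (rule continuous_on_imp_lebesgue_measurable[OF pc] continuous_on_imp_lebesgue_measurable[OF kc])+
  define M where "M = max 1 (max Mk Mp)"
  have M: "M \<ge> 1" "norm (k x) \<le> M" "\<bar>\<phi> x\<bar> \<le> M" for x
    using Mk(1)[of x] Mp(1)[of x] by (auto simp: M_def)
  have M0: "M > 0" "0 \<le> M" using M(1) by auto
  have k2: "integrable lebesgue (\<lambda>x. (norm (k x))\<^sup>2)"
    by (rule integrable_continuous_supp[where R = R]) (auto intro!: continuous_intros kc simp: k0)
  have p2: "integrable lebesgue (\<lambda>x. (\<phi> x)\<^sup>2)"
    by (rule integrable_continuous_supp[where R = R]) (auto intro!: continuous_intros pc simp: R)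
  \<comment> \<open>One integrable function that dominates, up to powers of \<open>M\<close>, the
    products of \<open>u\<close>, \<open>G\<close>, \<open>\<phi>\<close> and \<open>k\<close> in
    the expansion.\<close>
  let ?w = "\<lambda>x. (u x)\<^sup>2 + (norm (G x))\<^sup>2 + (norm (G x))\<^sup>2 * (u x)\<^sup>2 + (norm (k x))\<^sup>2 + (\<phi> x)\<^sup>2"
  have wi: "integrable lebesgue ?w" using u2 G2 uG2 k2 p2 by simp
  have by_w: "integrable lebesgue f" if "f \<in> borel_measurable lebesgue" "\<And>x. \<bar>f x\<bar> \<le> K * ?w x" for f K
  proof (rule Bochner_Integration.integrable_bound[of _ "\<lambda>x. K * ?w x"])
    show "AE x in lebesgue. norm (f x) \<le> norm (K * ?w x)"
      by (intro AE_I2) (use that(2) abs_ge_self order_trans in \<open>auto intro!: order_trans[OF that(2)]\<close>)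
  qed (use wi that(1) in auto)
  have w0: "0 \<le> (u x)\<^sup>2" "0 \<le> (norm (G x))\<^sup>2" "0 \<le> (norm (G x))\<^sup>2 * (u x)\<^sup>2" "0 \<le> (norm (k x))\<^sup>2" "0 \<le> (\<phi> x)\<^sup>2" for x by auto
  have MM: "1 \<le> M * M" using M(1) mult_mono[of 1 M 1 M] by simp
  have gk: "\<bar>G x \<bullet> k x\<bar> \<le> norm (G x) * norm (k x)" for x by (rule Cauchy_Schwarz_ineq2)
  have gk1: "\<bar>G x \<bullet> k x\<bar> \<le> norm (G x) * M" for x
    using gk[of x] mult_left_mono[OF M(2)[of x] norm_ge_zero[of "G x"]] by linarith
  have gk2: "\<bar>G x \<bullet> k x\<bar> \<le> (norm (G x))\<^sup>2 + (norm (k x))\<^sup>2" for x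
    using gk[of x] abs_mult_le_squares[of "norm (G x)" "norm (k x)"] by simp
  have ug: "\<bar>u x\<bar> * norm (G x) \<le> (u x)\<^sup>2 + (norm (G x))\<^sup>2" for x
    using abs_mult_le_squares[of "u x" "norm (G x)"] by simp
  have p_sq: "(\<phi> x)\<^sup>2 \<le> M * M" for x
    using mult_mono[OF M(3)[of x] M(3)[of x]] M0 by (simp add: power2_eq_square)
  have k_sq: "(norm (k x))\<^sup>2 \<le> M * M" for x
    using mult_mono[OF M(2)[of x] M(2)[of x]] M0 by (simp add: power2_eq_square)
  have i1: "integrable lebesgue (\<lambda>x. G x \<bullet> k x)"
    by (rule by_w[where K = 1]) (use gk2 w0 in \<open>auto intro: order_trans[OF gk2]\<close>)
  have i2: "integrable lebesgue (\<lambda>x. (u x)\<^sup>2 * (G x \<bullet> k x))"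
  proof (rule by_w[where K = M])
    fix x
    have "\<bar>u x\<bar> * (\<bar>u x\<bar> * norm (G x)) \<le> (u x)\<^sup>2 + (norm (G x))\<^sup>2 * (u x)\<^sup>2"
      using abs_mult_le_squares[of "u x" "u x * norm (G x)"]
      by (simp add: power_mult_distrib abs_mult mult_ac)
    then have 1: "\<bar>u x\<bar> * (\<bar>u x\<bar> * norm (G x)) \<le> ?w x" using w0[of x] by linarith
    have "\<bar>(u x)\<^sup>2 * (G x \<bullet> k x)\<bar> \<le> (u x)\<^sup>2 * (norm (G x) * M)"
      unfolding abs_mult by (intro mult_mono gk1) auto
    also have "\<dots> = M * (\<bar>u x\<bar> * (\<bar>u x\<bar> * norm (G x)))" by (simp add: power2_eq_square)
    also have "\<dots> \<le> M * ?w x" using 1 M0 by (intro mult_left_mono)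
    finally show "\<bar>(u x)\<^sup>2 * (G x \<bullet> k x)\<bar> \<le> M * ?w x" .
  qed measurable
  have i3: "integrable lebesgue (\<lambda>x. u x * (norm (G x))\<^sup>2 * \<phi> x)"
  proof (rule by_w[where K = M])
    fix x
    have "\<bar>u x\<bar> \<le> 1 + (u x)\<^sup>2" using abs_mult_le_squares[of 1 "u x"] by simp
    then have "\<bar>u x\<bar> * (norm (G x))\<^sup>2 \<le> (1 + (u x)\<^sup>2) * (norm (G x))\<^sup>2" by (intro mult_right_mono) auto
    also have "(1 + (u x)\<^sup>2) * (norm (G x))\<^sup>2 = (norm (G x))\<^sup>2 + (norm (G x))\<^sup>2 * (u x)\<^sup>2" by (simp add: algebra_simps)
    finally have 1: "\<bar>u x\<bar> * (norm (G x))\<^sup>2 \<le> ?w x" using w0[of x] by linarith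
    have "\<bar>u x * (norm (G x))\<^sup>2 * \<phi> x\<bar> \<le> (\<bar>u x\<bar> * (norm (G x))\<^sup>2) * M"
      unfolding abs_mult by (intro mult_mono M) auto
    also have "\<dots> \<le> ?w x * M" using 1 M0 by (intro mult_right_mono)
    finally show "\<bar>u x * (norm (G x))\<^sup>2 * \<phi> x\<bar> \<le> M * ?w x" by (simp only: mult.commute)
  qed measurable
  have i5: "integrable lebesgue (\<lambda>x. (u x)\<^sup>2 * (norm (k x))\<^sup>2)"
  proof (rule by_w[where K = "M * M"])
    fix x
    have "(u x)\<^sup>2 * (norm (k x))\<^sup>2 \<le> (u x)\<^sup>2 * (M * M)" by (intro mult_left_mono k_sq) auto
    also have "\<dots> \<le> ?w x * (M * M)" using w0[of x] M0 by (intro mult_right_mono; (linarith | simp))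
    finally show "\<bar>(u x)\<^sup>2 * (norm (k x))\<^sup>2\<bar> \<le> M * M * ?w x" by (simp add: mult.commute)
  qed measurable
  have i6: "integrable lebesgue (\<lambda>x. u x * \<phi> x * (G x \<bullet> k x))"
  proof (rule by_w[where K = "M * M"])
    fix x
    have "\<bar>u x * \<phi> x * (G x \<bullet> k x)\<bar> \<le> \<bar>u x\<bar> * M * (norm (G x) * M)"
      unfolding abs_mult using M0 by (intro mult_mono gk1 M) auto
    also have "\<dots> = (\<bar>u x\<bar> * norm (G x)) * (M * M)" by simp
    also have "\<dots> \<le> ?w x * (M * M)" using ug[of x] w0[of x] M0 by (intro mult_right_mono; (linarith | simp))
    finally show "\<bar>u x * \<phi> x * (G x \<bullet> k x)\<bar> \<le> M * M * ?w x" by (simp only: mult.commute)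
  qed measurable
  have i7: "integrable lebesgue (\<lambda>x. (\<phi> x)\<^sup>2 * (norm (G x))\<^sup>2)"
  proof (rule by_w[where K = "M * M"])
    fix x
    have "(\<phi> x)\<^sup>2 * (norm (G x))\<^sup>2 \<le> (M * M) * (norm (G x))\<^sup>2" by (intro mult_right_mono p_sq) auto
    also have "\<dots> \<le> (M * M) * ?w x" using w0[of x] M0 by (intro mult_left_mono; (linarith | simp))
    finally show "\<bar>(\<phi> x)\<^sup>2 * (norm (G x))\<^sup>2\<bar> \<le> M * M * ?w x" by simp
  qed measurable
  have i8: "integrable lebesgue (\<lambda>x. u x * \<phi> x * (norm (k x))\<^sup>2)"
  proof (rule by_w[where K = "M * M"])
    fix x
    have "\<bar>u x * \<phi> x * (norm (k x))\<^sup>2\<bar> \<le> (\<bar>u x\<bar> * \<bar>\<phi> x\<bar>) * (M * M)"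
      unfolding abs_mult using k_sq[of x] by (intro mult_left_mono) auto
    also have "\<bar>u x\<bar> * \<bar>\<phi> x\<bar> \<le> (u x)\<^sup>2 + (\<phi> x)\<^sup>2"
      by (rule abs_mult_le_squares)
    then have "(\<bar>u x\<bar> * \<bar>\<phi> x\<bar>) * (M * M) \<le> ?w x * (M * M)" using w0[of x] M0 by (intro mult_right_mono; (linarith | simp))
    finally show "\<bar>u x * \<phi> x * (norm (k x))\<^sup>2\<bar> \<le> M * M * ?w x" by (simp only: mult.commute)
  qed measurable
  have i9: "integrable lebesgue (\<lambda>x. (\<phi> x)\<^sup>2 * (G x \<bullet> k x))"
  proof (rule by_w[where K = "M * M"])
    fix x
    have "\<bar>(\<phi> x)\<^sup>2 * (G x \<bullet> k x)\<bar> \<le> (M * M) * \<bar>G x \<bullet> k x\<bar>"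
      unfolding abs_mult using p_sq[of x] by (intro mult_right_mono) auto
    also have "\<dots> \<le> (M * M) * ?w x" using gk2[of x] w0[of x] M0 by (intro mult_left_mono; (linarith | simp))
    finally show "\<bar>(\<phi> x)\<^sup>2 * (G x \<bullet> k x)\<bar> \<le> M * M * ?w x" .
  qed measurable
  have i10: "integrable lebesgue (\<lambda>x. (\<phi> x)\<^sup>2 * (norm (k x))\<^sup>2)"
  proof (rule by_w[where K = "M * M"])
    fix x
    have "(\<phi> x)\<^sup>2 * (norm (k x))\<^sup>2 \<le> (M * M) * (norm (k x))\<^sup>2" by (intro mult_right_mono p_sq) auto
    also have "\<dots> \<le> (M * M) * ?w x" using w0[of x] M0 by (intro mult_left_mono; (linarith | simp))
    finally show "\<bar>(\<phi> x)\<^sup>2 * (norm (k x))\<^sup>2\<bar> \<le> M * M * ?w x" by simp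
  qed measurable
  have i11: "integrable lebesgue (\<lambda>x. u x * \<phi> x)"
  proof (rule by_w[where K = 1])
    fix x
    show "\<bar>u x * \<phi> x\<bar> \<le> 1 * ?w x"
      using abs_mult_le_squares[of "u x" "\<phi> x"] w0[of x] unfolding abs_mult mult_1 by linarith
  qed measurable
  have i12: "integrable lebesgue (\<lambda>x. h (u x) * \<phi> x)"
    using integrable_bounded_scaleR[OF integrable_h, of \<phi> M] M(3) by (simp add: mult.commute)
  let ?c0 = "\<lambda>x. (1 + 2 * (u x)\<^sup>2) * (norm (G x))\<^sup>2"
  let ?c1 = "\<lambda>x. (1 + 2 * (u x)\<^sup>2) * (G x \<bullet> k x) + 2 * u x * (norm (G x))\<^sup>2 * \<phi> x"
  let ?c2 = "\<lambda>x. (1 + 2 * (u x)\<^sup>2) * (norm (k x))\<^sup>2 + 8 * (u x * \<phi> x * (G x \<bullet> k x)) + 2 * ((\<phi> x)\<^sup>2 * (norm (G x))\<^sup>2)"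
  let ?c3 = "\<lambda>x. 4 * (u x * \<phi> x * (norm (k x))\<^sup>2) + 4 * ((\<phi> x)\<^sup>2 * (G x \<bullet> k x))"
  let ?c4 = "\<lambda>x. 2 * ((\<phi> x)\<^sup>2 * (norm (k x))\<^sup>2)"
  have c: "integrable lebesgue ?c0" "integrable lebesgue ?c1" "integrable lebesgue ?c2" "integrable lebesgue ?c3" "integrable lebesgue ?c4"
    using i1 i2 i3 i5 i6 i7 i8 i9 i10 G2 k2 integrable_mult_right[OF uG2, of 2] integrable_mult_right[OF i3, of 2]
      integrable_mult_right[OF i2, of 2] integrable_mult_right[OF i5, of 2]
    by (simp_all add: distrib_right mult.assoc mult.commute[of "(norm (G _))\<^sup>2" "(u _)\<^sup>2"])
  show "integrable lebesgue ?c1" by (rule c(2))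
  show hi: "integrable lebesgue (\<lambda>x. (h (u x) + lam * u x) * \<phi> x)"
    using i12 integrable_mult_right[OF i11, of lam] by (simp add: distrib_right mult.assoc)
  define I0 I1 I2 I3 I4 where I_defs: "I0 = integral\<^sup>L lebesgue ?c0" "I1 = integral\<^sup>L lebesgue ?c1"
    "I2 = integral\<^sup>L lebesgue ?c2" "I3 = integral\<^sup>L lebesgue ?c3" "I4 = integral\<^sup>L lebesgue ?c4"
  have kin: "(LINT x|lebesgue. (1 + 2 * (u x + \<tau> * \<phi> x)\<^sup>2) * (norm (weak_gradient (\<lambda>x. u x + \<tau> * \<phi> x) x))\<^sup>2)
      = I0 + \<tau> * (2 * I1) + \<tau>\<^sup>2 * I2 + \<tau> ^ 3 * I3 + \<tau> ^ 4 * I4" for \<tau>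
  proof -
    have "GDERIV (\<lambda>x. \<tau> * \<phi> x) x :> \<tau> *\<^sub>R k x" for x
      using GDERIV_mult[OF GDERIV_const k, of \<tau> x] by simp
    then have wk: "has_weak_gradient (\<lambda>x. \<tau> * \<phi> x) (\<lambda>x. \<tau> *\<^sub>R k x)"
      by (rule C1_has_weak_gradient) (intro continuous_intros kc)
    note W = has_weak_gradient_add[OF wg wk]
    note [measurable] = has_weak_gradientD(4)[OF has_weak_gradient_weak_gradient[OF W]]
    \<comment> \<open>The gradient in \<open>J\<close> is a chosen representative, equal to
      \<open>G + \<tau> * k\<close> almost everywhere.\<close>
    have "(LINT x|lebesgue. (1 + 2 * (u x + \<tau> * \<phi> x)\<^sup>2) * (norm (weak_gradient (\<lambda>x. u x + \<tau> * \<phi> x) x))\<^sup>2)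
        = (LINT x|lebesgue. (1 + 2 * (u x + \<tau> * \<phi> x)\<^sup>2) * (norm (G x + \<tau> *\<^sub>R k x))\<^sup>2)"
    proof (rule integral_cong_AE)
      show "AE x in lebesgue. (1 + 2 * (u x + \<tau> * \<phi> x)\<^sup>2) * (norm (weak_gradient (\<lambda>x. u x + \<tau> * \<phi> x) x))\<^sup>2
          = (1 + 2 * (u x + \<tau> * \<phi> x)\<^sup>2) * (norm (G x + \<tau> *\<^sub>R k x))\<^sup>2"
        using weak_gradient_AE[OF W] by eventually_elim simp
    qed measurable
    also have "\<dots> = (LINT x|lebesgue. ?c0 x + \<tau> * (2 * ?c1 x) + \<tau>\<^sup>2 * ?c2 x + \<tau> ^ 3 * ?c3 x + \<tau> ^ 4 * ?c4 x)"
      by (simp only: kinetic_expansion)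
    also have "\<dots> = I0 + \<tau> * (2 * I1) + \<tau>\<^sup>2 * I2 + \<tau> ^ 3 * I3 + \<tau> ^ 4 * I4"
      unfolding I_defs by (rule integral_quartic[OF c])
    finally show ?thesis .
  qed
  have mass: "(LINT x|lebesgue. (u x + \<tau> * \<phi> x)\<^sup>2) = (LINT x|lebesgue. (u x)\<^sup>2) + 2 * \<tau> * (LINT x|lebesgue. u x * \<phi> x) + \<tau>\<^sup>2 * (LINT x|lebesgue. (\<phi> x)\<^sup>2)" for \<tau>
  proof -
    have "(u x + \<tau> * \<phi> x)\<^sup>2 = (u x)\<^sup>2 + 2 * \<tau> * (u x * \<phi> x) + \<tau>\<^sup>2 * (\<phi> x)\<^sup>2" for x
      by (simp add: power2_eq_square algebra_simps)
    then show ?thesis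
      using u2 i11 p2 by (simp only: Bochner_Integration.integral_add Bochner_Integration.integrable_add integrable_mult_right integral_mult_right_zero)
  qed
  let ?t = "\<lambda>n. 1 / real (Suc n)"
  have t0: "?t n \<noteq> 0" for n by simp
  have tl: "?t \<longlonglongrightarrow> 0" using LIMSEQ_inverse_real_of_nat by (simp add: divide_inverse)
  let ?P = "\<lambda>n. LINT x|lebesgue. (H (u x + ?t n * \<phi> x) - H (u x)) / ?t n"
  have aux: "b = a + \<tau> * ((b - a) / \<tau>)" if "\<tau> \<noteq> 0" for a b \<tau> :: real using that by simp
  have pot: "(LINT x|lebesgue. H (u x + ?t n * \<phi> x)) = (LINT x|lebesgue. H (u x)) + ?t n * ?P n" for n
  proof -
    have "(LINT x|lebesgue. H (u x + ?t n * \<phi> x)) = (LINT x|lebesgue. H (u x) + ?t n * ((H (u x + ?t n * \<phi> x) - H (u x)) / ?t n))"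
      by (rule Bochner_Integration.integral_cong[OF refl], rule aux[OF t0])
    also have "\<dots> = (LINT x|lebesgue. H (u x)) + ?t n * ?P n"
      using integrable_H potential_derivative(2)[OF pc R]
      by (simp only: Bochner_Integration.integral_add integrable_mult_right integral_mult_right_zero)
    finally show ?thesis .
  qed
  let ?U = "LINT x|lebesgue. u x * \<phi> x" and ?V = "LINT x|lebesgue. (\<phi> x)\<^sup>2"
  \<comment> \<open>The expansion at \<open>\<tau> = 0\<close> replaces the chosen gradient of
    \<open>u\<close> by \<open>G\<close>.\<close>
  have J0: "J h lam u = 1/2 * I0 - lam/2 * (LINT x|lebesgue. (u x)\<^sup>2) - (LINT x|lebesgue. H (u x))"
    using kin[of 0] by (simp add: J_def)
  have quot: "(J h lam (\<lambda>x. u x + ?t n * \<phi> x) - J h lam u) / ?t n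
      = I1 + ?t n * I2 / 2 + (?t n)\<^sup>2 * I3 / 2 + (?t n) ^ 3 * I4 / 2 - lam * ?U - lam/2 * ?t n * ?V - ?P n" for n
  proof -
    have alg: "((1/2 * (i0 + \<tau> * (2 * i1) + \<tau>\<^sup>2 * i2 + \<tau> ^ 3 * i3 + \<tau> ^ 4 * i4) - lam/2 * (m + 2 * \<tau> * U + \<tau>\<^sup>2 * V) - (P0 + \<tau> * P))
        - (1/2 * i0 - lam/2 * m - P0)) / \<tau> = i1 + \<tau> * i2 / 2 + \<tau>\<^sup>2 * i3 / 2 + \<tau> ^ 3 * i4 / 2 - lam * U - lam/2 * \<tau> * V - P"
      if "\<tau> \<noteq> 0" for i0 i1 i2 i3 i4 m U V P0 P \<tau> :: real
      using that by (simp add: field_simps power2_eq_square power3_eq_cube power4_eq_xxxx)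
    show ?thesis
      unfolding J0 unfolding J_def kin mass pot by (rule alg[OF t0])
  qed
  have l1: "(\<lambda>n. (J h lam (\<lambda>x. u x + ?t n * \<phi> x) - J h lam u) / ?t n) \<longlonglongrightarrow>
      I1 + 0 * I2 / 2 + 0\<^sup>2 * I3 / 2 + 0 ^ 3 * I4 / 2 - lam * ?U - lam/2 * 0 * ?V - (LINT x|lebesgue. h (u x) * \<phi> x)"
    unfolding quot by (intro tendsto_diff tendsto_add tendsto_divide tendsto_mult tendsto_power tendsto_const tl potential_derivative(1)[OF pc R]) auto
  have t_right: "filterlim ?t (at_right 0) sequentially"
    unfolding filterlim_at using tl by auto
  have l2: "(\<lambda>n. (J h lam (\<lambda>x. u x + ?t n * \<phi> x) - J h lam u) / ?t n) \<longlonglongrightarrow> 0"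
    by (rule filterlim_compose[OF sol[unfolded weak_solution_def, rule_format, OF t] t_right])
  have "I1 = lam * ?U + (LINT x|lebesgue. h (u x) * \<phi> x)"
    using LIMSEQ_unique[OF l1 l2] by simp
  also have "\<dots> = (LINT x|lebesgue. (h (u x) + lam * u x) * \<phi> x)"
    using i12 i11 by (simp add: distrib_right mult.assoc)
  finally show "integral\<^sup>L lebesgue ?c1 = (LINT x|lebesgue. (h (u x) + lam * u x) * \<phi> x)"
    by (simp only: I_defs)
qed

end

section \<open>Mollified divergence form equations\<close>

lemma integrable_scaleR_supp:
  fixes u :: "real ^ 'n \<Rightarrow> real" and k :: "real ^ 'n \<Rightarrow> 'b::euclidean_space"
  assumes u: "locally_integrable u" and c: "continuous_on UNIV k" and s: "\<And>x. norm x > R \<Longrightarrow> k x = 0"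
  shows "integrable lebesgue (\<lambda>x. u x *\<^sub>R k x)"
proof -
  obtain B where B: "\<And>x. norm (k x) \<le> B" "B > 0" using continuous_supp_bounded[OF c s] by blast
  show ?thesis
  proof (rule Bochner_Integration.integrable_bound)
    show "integrable lebesgue (\<lambda>x. B * (indicator (cball 0 R) x *\<^sub>R u x))"
      by (intro integrable_mult_right set_integrable_cball u)
    show "(\<lambda>x. u x *\<^sub>R k x) \<in> borel_measurable lebesgue"
      using locally_integrable_measurable[OF u] continuous_on_imp_lebesgue_measurable[OF c] by measurable
    show "AE x in lebesgue. norm (u x *\<^sub>R k x) \<le> norm (B * (indicator (cball 0 R) x *\<^sub>R u x))"
    proof (intro AE_I2)
      fix x
      show "norm (u x *\<^sub>R k x) \<le> norm (B * (indicator (cball 0 R) x *\<^sub>R u x))"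
      proof (cases "norm x \<le> R")
        case True
        then show ?thesis using mult_right_mono[OF B(1)[of x], of "\<bar>u x\<bar>"] B(2) by (simp add: abs_mult mult.commute)
      qed (simp add: s)
    qed
  qed
qed

lemma integral_vec_nth:
  fixes f :: "'a \<Rightarrow> real ^ 'n"
  assumes "integrable M f"
  shows "integrable M (\<lambda>x. f x $ i)" "(LINT x|M. f x $ i) = (LINT x|M. f x) $ i"
  using integrable_bounded_linear[OF bounded_linear_vec_nth assms] integral_bounded_linear[OF bounded_linear_vec_nth assms]
  by auto

text \<open>The equation \<open>- div V = F\<close> in the sense of distributions.\<close>

definition weak_divergence :: "(real ^ 'n \<Rightarrow> real ^ 'n) \<Rightarrow> (real ^ 'n \<Rightarrow> real) \<Rightarrow> bool" where
  "weak_divergence V F \<longleftrightarrow> (\<forall>\<phi> g. test_function \<phi> \<longrightarrow> (\<forall>x. GDERIV \<phi> x :> g x) \<longrightarrow>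
     (LINT x|lebesgue. V x \<bullet> g x) = (LINT x|lebesgue. F x * \<phi> x))"

text \<open>Row \<open>i\<close> of the Jacobian of the mollified field, with the derivative on the
  kernel so that no regularity of \<open>V\<close> is involved.\<close>

definition conv_grad :: "real \<Rightarrow> (real ^ 'n \<Rightarrow> real ^ 'n) \<Rightarrow> 'n \<Rightarrow> real ^ 'n \<Rightarrow> real ^ 'n" where
  "conv_grad e V i x = (LINT y|lebesgue. V y $ i *\<^sub>R moll_grad e (x - y))"

lemma
  fixes V :: "real ^ 'n \<Rightarrow> real ^ 'n"
  assumes V: "locally_integrable V" and e: "0 < e"
  shows integrable_conv_grad: "integrable lebesgue (\<lambda>y. V y $ i *\<^sub>R moll_grad e (x - y))"
    and conv_grad_nth: "conv_grad e V i x $ j = (LINT y|lebesgue. V y $ i * moll_grad e (x - y) $ j)"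
    and GDERIV_conv_nth: "GDERIV (\<lambda>x. conv (moll e) V x $ i) x :> conv_grad e V i x"
    and continuous_on_conv_grad: "continuous_on UNIV (conv_grad e V i)"
proof -
  let ?V = "\<lambda>i y. V y $ i"
  have Vi: "locally_integrable (?V i)" for i
    by (rule locally_integrable_bounded_linear[OF V bounded_linear_vec_nth])
  have cV: "conv (moll e) V x $ i = conv (moll e) (?V i) x" for x i
    by (rule conv_bounded_linear[OF V e bounded_linear_vec_nth])
  have gs: "moll_grad e x = 0" if "norm x > e" for x :: "real ^ 'n" using moll_grad_supp[OF e, of x] that by simp
  have gc: "continuous_on UNIV (\<lambda>y. moll_grad e (x - y))" for x :: "real ^ 'n"
    by (intro continuous_on_compose2[OF moll_continuous(2)[of UNIV]] continuous_intros) auto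
  have g0: "moll_grad e (x - y) = 0" if "norm y > norm x + e" for x y :: "real ^ 'n"
    using that norm_triangle_ineq2[of y x] by (intro gs) (simp add: norm_minus_commute)
  show Di: "integrable lebesgue (\<lambda>y. ?V i y *\<^sub>R moll_grad e (x - y))" for i x
    by (rule integrable_scaleR_supp[OF Vi gc g0])
  show nth: "conv_grad e V i x $ j = (LINT y|lebesgue. V y $ i * moll_grad e (x - y) $ j)" for i j x
    using integral_vec_nth(2)[OF Di[of i x], of j] by (simp add: conv_grad_def)
  show "GDERIV (\<lambda>x. conv (moll e) V x $ i) x :> conv_grad e V i x"
    unfolding cV conv_grad_def
    by (rule GDERIV_conv[OF Vi GDERIV_moll moll_continuous(2), of e]) (use moll_supp[OF e] in \<open>auto intro: less_imp_le\<close>)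
  have "continuous_on UNIV (conv (\<lambda>z. moll_grad e z $ j) (?V i))" for j
    by (rule continuous_on_conv[OF Vi, where R = e]) (auto intro!: continuous_intros moll_continuous simp: gs)
  then have "continuous_on UNIV (\<lambda>x. \<chi> j. conv (\<lambda>z. moll_grad e z $ j) (?V i) x)"
    by (intro continuous_on_vec_lambda)
  moreover have "(\<chi> j. conv (\<lambda>z. moll_grad e z $ j) (?V i) x) = conv_grad e V i x" for x
    by (simp add: vec_eq_iff conv_def nth mult.commute)
  ultimately show "continuous_on UNIV (conv_grad e V i)" by simp
qed

text \<open>The trace of the Jacobian is the equation tested with \<open>moll e (x - y)\<close>, up
  to the sign from reflecting the kernel.\<close>

lemma conv_grad_div:
  fixes V :: "real ^ 'n \<Rightarrow> real ^ 'n" and F :: "real ^ 'n \<Rightarrow> real"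
  assumes V: "locally_integrable V" and eq: "weak_divergence V F" and e: "0 < e"
  shows "(\<Sum>i\<in>UNIV. conv_grad e V i x $ i) = - conv (moll e) F x"
proof -
  note Di = integrable_conv_grad[OF V e]
  have "(\<Sum>i\<in>UNIV. conv_grad e V i x $ i) = (\<Sum>i\<in>UNIV. (LINT y|lebesgue. V y $ i * moll_grad e (x - y) $ i))"
    by (simp add: conv_grad_nth[OF V e])
  also have "\<dots> = (LINT y|lebesgue. (\<Sum>i\<in>UNIV. V y $ i * moll_grad e (x - y) $ i))"
    using integral_vec_nth(1)[OF Di[of _ x]] by (intro Bochner_Integration.integral_sum[symmetric]) simp
  also have "\<dots> = - (LINT y|lebesgue. V y \<bullet> (- moll_grad e (x - y)))"
    by (simp add: inner_vec_def sum_negf)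
  also have "(LINT y|lebesgue. V y \<bullet> (- moll_grad e (x - y))) = (LINT y|lebesgue. F y * moll e (x - y))"
    by (rule eq[unfolded weak_divergence_def, rule_format]) (rule test_function_moll[OF e])+
  finally show ?thesis by (simp add: conv_def mult.commute)
qed

text \<open>A curl-free field has symmetric mollified Jacobian: integrate by parts onto the Hessian of the kernel.\<close>

lemma conv_grad_sym:
  fixes v :: "real ^ 'n \<Rightarrow> real"
  assumes w: "has_weak_gradient v V" and e: "0 < e"
  shows "conv_grad e V i x $ j = conv_grad e V j x $ i"
proof -
  note V = has_weak_gradientD[OF w]
  have hs: "moll_hess e x j = 0" if "norm x > e" for x :: "real ^ 'n" and j
    using moll_slope_supp[OF e less_imp_le[OF that]] by (simp add: moll_hess_def)
  have hi: "integrable lebesgue (\<lambda>y. v y *\<^sub>R moll_hess e (x - y) j)" for j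
  proof (rule integrable_scaleR_supp[OF V(1), where R = "norm x + e"])
    show "continuous_on UNIV (\<lambda>y. moll_hess e (x - y) j)"
      by (intro continuous_on_compose2[OF moll_continuous(3)[of UNIV]] continuous_intros) auto
    show "moll_hess e (x - y) j = 0" if "norm y > norm x + e" for y
      using that norm_triangle_ineq2[of y x] by (intro hs) (simp add: norm_minus_commute)
  qed
  have *: "conv_grad e V i x $ j = (LINT y|lebesgue. v y * moll_hess e (x - y) j $ i)" for i j
  proof -
    have "(LINT y|lebesgue. v y *\<^sub>R (- moll_hess e (x - y) j)) = - (LINT y|lebesgue. moll_grad e (x - y) $ j *\<^sub>R V y)"
      by (rule V(5)[OF test_function_moll_grad[OF e]])
    then have "(LINT y|lebesgue. v y *\<^sub>R moll_hess e (x - y) j) $ i = (LINT y|lebesgue. moll_grad e (x - y) $ j *\<^sub>R V y) $ i"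
      by simp
    moreover have "integrable lebesgue (\<lambda>y. moll_grad e (x - y) $ j *\<^sub>R V y)"
      by (rule integrable_conv[OF V(2), where R = e])
        (auto intro!: continuous_intros moll_continuous simp: moll_grad_supp[OF e less_imp_le])
    ultimately show ?thesis
      using integral_vec_nth(2)[OF hi[of j], of i] integral_vec_nth(2)[of lebesgue "\<lambda>y. moll_grad e (x - y) $ j *\<^sub>R V y" i]
      by (simp add: conv_grad_nth[OF V(2) e] mult.commute)
  qed
  show ?thesis unfolding * by (simp only: moll_hess_sym[of e _ j i])
qed

text \<open>The mollified field satisfies the mollified equation pointwise, so it may be tested with
  continuously differentiable functions, in particular with functions of the mollified solution
  itself.\<close>

lemma mollified_equation:
  fixes V :: "real ^ 'n \<Rightarrow> real ^ 'n" and F \<psi> :: "real ^ 'n \<Rightarrow> real"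
  assumes V: "locally_integrable V" and eq: "weak_divergence V F"
    and e: "0 < e"
    and k: "\<And>x. GDERIV \<psi> x :> k x" and kc: "continuous_on UNIV k" and R: "\<And>x. norm x > R \<Longrightarrow> \<psi> x = 0"
  shows "(LINT x|lebesgue. conv (moll e) V x \<bullet> k x) = (LINT x|lebesgue. conv (moll e) F x * \<psi> x)"
proof -
  let ?D = "conv_grad e V" and ?V = "\<lambda>i x. conv (moll e) V x $ i"
  note Dc = continuous_on_conv_grad[OF V e] and D = GDERIV_conv_nth[OF V e]
  have k0: "norm x > R \<Longrightarrow> k x = 0" for x by (rule GDERIV_supp[OF k R])
  note pc = GDERIV_continuous_on[OF k, of UNIV]
  have vc: "continuous_on UNIV (?V i)" for i by (rule GDERIV_continuous_on[OF D])
  have i1: "integrable lebesgue (\<lambda>x. ?V i x *\<^sub>R k x)" for i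
    by (rule integrable_continuous_supp[where R = R]) (intro continuous_intros vc kc, simp add: k0)
  have i2: "integrable lebesgue (\<lambda>x. \<psi> x *\<^sub>R ?D i x)" for i
    by (rule integrable_continuous_supp[where R = R]) (intro continuous_intros Dc pc, simp add: R)
  have comp: "(LINT x|lebesgue. ?V i x * k x $ i) = - (LINT x|lebesgue. \<psi> x * ?D i x $ i)" for i
  proof -
    have "(LINT x|lebesgue. ?V i x *\<^sub>R k x) $ i = (- (LINT x|lebesgue. \<psi> x *\<^sub>R ?D i x)) $ i"
      by (simp only: integral_by_parts[OF D Dc k kc R])
    then show ?thesis using integral_vec_nth(2)[OF i1[of i], of i] integral_vec_nth(2)[OF i2[of i], of i] by simp
  qed
  have "(LINT x|lebesgue. conv (moll e) V x \<bullet> k x) = (LINT x|lebesgue. (\<Sum>i\<in>UNIV. ?V i x * k x $ i))"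
    by (simp add: inner_vec_def)
  also have "\<dots> = (\<Sum>i\<in>UNIV. (LINT x|lebesgue. ?V i x * k x $ i))"
    using integral_vec_nth(1)[OF i1] by (intro Bochner_Integration.integral_sum) simp
  also have "\<dots> = - (\<Sum>i\<in>UNIV. (LINT x|lebesgue. \<psi> x * ?D i x $ i))"
    by (simp add: comp sum_negf)
  also have "(\<Sum>i\<in>UNIV. (LINT x|lebesgue. \<psi> x * ?D i x $ i)) = (LINT x|lebesgue. (\<Sum>i\<in>UNIV. \<psi> x * ?D i x $ i))"
    using integral_vec_nth(1)[OF i2] by (intro Bochner_Integration.integral_sum[symmetric]) simp
  also have "(\<lambda>x. \<Sum>i\<in>UNIV. \<psi> x * ?D i x $ i) = (\<lambda>x. - (conv (moll e) F x * \<psi> x))"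
    by (simp add: sum_distrib_left[symmetric] conv_grad_div[OF V eq e] mult.commute)
  finally show ?thesis by simp
qed

text \<open>The square turns the positive part into a continuously differentiable function with an
  explicit gradient, from which bounds uniform in \<open>R\<close> can be read off.\<close>

definition cutoff :: "real \<Rightarrow> real ^ 'n \<Rightarrow> real" where
  "cutoff R x = (max 0 (1 - (x \<bullet> x) / R\<^sup>2))\<^sup>2"

definition cutoff_grad :: "real \<Rightarrow> real ^ 'n \<Rightarrow> real ^ 'n" where
  "cutoff_grad R x = (- (4 / R\<^sup>2) * max 0 (1 - (x \<bullet> x) / R\<^sup>2)) *\<^sub>R x"

lemma DERIV_max_sq: "((\<lambda>s. (max 0 s)\<^sup>2) has_real_derivative 2 * max 0 s) (at (s :: real))"
proof -
  consider "s > 0" | "s < 0" | "s = 0" by linarith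
  then show ?thesis
  proof cases
    case 1
    have "((\<lambda>s. s\<^sup>2) has_real_derivative 2 * s) (at s)" by (auto intro!: derivative_eq_intros)
    moreover have "eventually (\<lambda>s. s\<^sup>2 = (max 0 s)\<^sup>2) (nhds s)"
      using eventually_nhds_in_open[of "{0<..}" s] 1 by (auto elim!: eventually_mono)
    ultimately have "((\<lambda>s. (max 0 s)\<^sup>2) has_real_derivative 2 * s) (at s)"
      using DERIV_cong_ev[of s s "\<lambda>s. s\<^sup>2" "\<lambda>s. (max 0 s)\<^sup>2" "2 * s" "2 * s"] by simp
    then show ?thesis using 1 by simp
  next
    case 2
    have "eventually (\<lambda>s. 0 = (max 0 s)\<^sup>2) (nhds s)"
      using eventually_nhds_in_open[of "{..<0}" s] 2 by (auto elim!: eventually_mono)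
    then have "((\<lambda>s. (max 0 s)\<^sup>2) has_real_derivative 0) (at s)"
      using DERIV_cong_ev[of s s "\<lambda>s. 0" "\<lambda>s. (max 0 s)\<^sup>2" 0 0] by simp
    then show ?thesis using 2 by simp
  next
    case 3
    have "((\<lambda>x. (max 0 x)\<^sup>2 / x) \<longlongrightarrow> 0) (at (0::real))"
    proof (rule Lim_null_comparison)
      show "eventually (\<lambda>x. norm ((max 0 x)\<^sup>2 / x) \<le> \<bar>x\<bar>) (at (0::real))"
        by (auto simp: eventually_at_filter max_def power2_eq_square)
    qed (auto intro!: tendsto_eq_intros)
    then show ?thesis using 3 by (simp add: DERIV_def)
  qed
qed

lemma GDERIV_cutoff:
  fixes x :: "real ^ 'n"
  shows "GDERIV (cutoff R) x :> cutoff_grad R x"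
proof -
  have "((\<lambda>x::real ^ 'n. 1 - (x \<bullet> x) / R\<^sup>2) has_derivative (\<lambda>h. - (2 * (h \<bullet> x) / R\<^sup>2))) (at x)"
    unfolding divide_inverse by (auto intro!: derivative_eq_intros simp: inner_commute)
  then have "GDERIV (\<lambda>x::real ^ 'n. 1 - (x \<bullet> x) / R\<^sup>2) x :> (- 2 / R\<^sup>2) *\<^sub>R x"
    by (simp add: gderiv_def)
  from GDERIV_DERIV_compose[OF this DERIV_max_sq]
  have "GDERIV (cutoff R) x :> (2 * max 0 (1 - (x \<bullet> x) / R\<^sup>2)) *\<^sub>R (- 2 / R\<^sup>2) *\<^sub>R x"
    unfolding cutoff_def[abs_def] .
  then show ?thesis by (rule GDERIV_subst) (simp add: cutoff_grad_def mult_ac)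
qed

lemma continuous_on_cutoff_grad: "continuous_on A (cutoff_grad R)"
  unfolding cutoff_grad_def divide_inverse by (intro continuous_intros)

lemma cutoff_supp: "0 < R \<Longrightarrow> norm x \<ge> R \<Longrightarrow> max 0 (1 - (x \<bullet> x) / R\<^sup>2) = 0"
  by (auto simp: dot_square_norm power_mono max_def divide_le_eq)

lemma cutoff_0: "0 < R \<Longrightarrow> norm x > R \<Longrightarrow> cutoff R x = 0"
  using cutoff_supp[of R x] by (simp add: cutoff_def)

lemma cutoff_base: "0 \<le> max 0 (1 - (x \<bullet> x) / R\<^sup>2)" "max 0 (1 - (x \<bullet> x) / R\<^sup>2) \<le> 1"
  by auto

lemma cutoff_bounds: "0 \<le> cutoff R x" "cutoff R x \<le> 1"
  unfolding cutoff_def using cutoff_base[of x R] by (auto simp: power_le_one)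

text \<open>The three bounds serve different limits as \<open>R\<close> grows: \<open>4 / R\<close>
  kills boundary terms with an integrable flux, 4 dominates the boundary terms of the Pohozaev
  identity, which carry an extra factor \<open>x\<close>, and the last makes these tend to 0
  pointwise.\<close>

lemma norm_cutoff_grad:
  assumes "0 < R"
  shows "norm (cutoff_grad R x) \<le> 4 / R" "norm x * norm (cutoff_grad R x) \<le> 4"
    "norm x * norm (cutoff_grad R x) \<le> 4 / R\<^sup>2 * (norm x)\<^sup>2"
proof -
  let ?m = "max 0 (1 - (x \<bullet> x) / R\<^sup>2)"
  have n: "norm (cutoff_grad R x) = 4 / R\<^sup>2 * ?m * norm x"
    using cutoff_base(1)[of x R] by (simp add: cutoff_grad_def abs_mult)
  have mx: "?m * norm x \<le> R"
  proof (cases "norm x \<ge> R")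
    case True
    then show ?thesis using cutoff_supp[OF assms True] assms by simp
  next
    case False
    have "?m * norm x \<le> 1 * norm x" by (intro mult_right_mono cutoff_base) simp
    then show ?thesis using False by linarith
  qed
  have "4 / R\<^sup>2 * (?m * norm x) \<le> 4 / R\<^sup>2 * R" using mx by (intro mult_left_mono) auto
  then show g: "norm (cutoff_grad R x) \<le> 4 / R" unfolding n using assms by (simp add: power2_eq_square mult.assoc)
  show "norm x * norm (cutoff_grad R x) \<le> 4"
  proof (cases "norm x \<ge> R")
    case True
    then show ?thesis unfolding n using cutoff_supp[OF assms True] by simp
  next
    case False
    have "norm x * norm (cutoff_grad R x) \<le> R * (4 / R)" using False g assms by (intro mult_mono) auto
    then show ?thesis using assms by simp
  qed
  have "?m * (4 / R\<^sup>2 * (norm x)\<^sup>2) \<le> 1 * (4 / R\<^sup>2 * (norm x)\<^sup>2)" by (intro mult_right_mono cutoff_base) simp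
  then show "norm x * norm (cutoff_grad R x) \<le> 4 / R\<^sup>2 * (norm x)\<^sup>2"
    unfolding n by (simp add: power2_eq_square mult_ac)
qed

lemma cutoff_tendsto: "(\<lambda>n. cutoff (real (Suc n)) x) \<longlonglongrightarrow> 1"
  and cutoff_grad_tendsto: "(\<lambda>n. norm x * norm (cutoff_grad (real (Suc n)) x)) \<longlonglongrightarrow> 0"
proof -
  have "(\<lambda>n. (inverse (real (Suc n)))\<^sup>2) \<longlonglongrightarrow> 0\<^sup>2" by (intro tendsto_power LIMSEQ_inverse_real_of_nat)
  then have i: "(\<lambda>n. 1 / (real (Suc n))\<^sup>2) \<longlonglongrightarrow> 0"
    by (simp only: divide_inverse mult_1 power_inverse power_zero_numeral)
  have "(\<lambda>n. (max 0 (1 - (x \<bullet> x) * (1 / (real (Suc n))\<^sup>2)))\<^sup>2) \<longlonglongrightarrow> (max 0 (1 - (x \<bullet> x) * 0))\<^sup>2"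
    by (intro tendsto_power tendsto_max tendsto_diff tendsto_mult tendsto_const i)
  then show "(\<lambda>n. cutoff (real (Suc n)) x) \<longlonglongrightarrow> 1" by (simp add: cutoff_def del: of_nat_Suc)
  show "(\<lambda>n. norm x * norm (cutoff_grad (real (Suc n)) x)) \<longlonglongrightarrow> 0"
  proof (rule Lim_null_comparison)
    show "eventually (\<lambda>n. norm (norm x * norm (cutoff_grad (real (Suc n)) x)) \<le> 4 * (norm x)\<^sup>2 * (1 / (real (Suc n))\<^sup>2)) sequentially"
      using norm_cutoff_grad(3)[of "real (Suc _)" x] by (intro always_eventually allI) (simp add: mult_ac del: of_nat_Suc)
    show "(\<lambda>n. 4 * (norm x)\<^sup>2 * (1 / (real (Suc n))\<^sup>2)) \<longlonglongrightarrow> 0"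
      using tendsto_mult[OF tendsto_const[of "4 * (norm x)\<^sup>2"] i] by simp
  qed
qed

text \<open>The test function is \<open>\<beta> (conv (moll e) w x) * \<psi> x\<close>: as
  \<open>V\<close> is the gradient of \<open>w\<close>, the chain rule produces the quadratic
  term.\<close>

lemma mollified_equation_composed:
  fixes V :: "real ^ 'n \<Rightarrow> real ^ 'n" and F \<psi> w :: "real ^ 'n \<Rightarrow> real"
  assumes w: "has_weak_gradient w V"
    and eq: "weak_divergence V F"
    and e: "0 < e"
    and k: "\<And>x. GDERIV \<psi> x :> k x" and kc: "continuous_on UNIV k" and R: "\<And>x. norm x > R \<Longrightarrow> \<psi> x = 0"
    and d: "\<And>t. (\<beta> has_real_derivative \<beta>' t) (at t)" and c: "continuous_on UNIV \<beta>'"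
  shows "(LINT x|lebesgue. \<beta>' (conv (moll e) w x) * (norm (conv (moll e) V x))\<^sup>2 * \<psi> x) =
      (LINT x|lebesgue. conv (moll e) F x * \<beta> (conv (moll e) w x) * \<psi> x)
      - (LINT x|lebesgue. \<beta> (conv (moll e) w x) * (conv (moll e) V x \<bullet> k x))"
    "integrable lebesgue (\<lambda>x. \<beta>' (conv (moll e) w x) * (norm (conv (moll e) V x))\<^sup>2 * \<psi> x)"
proof -
  note V = has_weak_gradientD[OF w]
  let ?w = "conv (moll e) w" and ?V = "conv (moll e) V"
  have cb: "continuous_on UNIV \<beta>" using d by (meson DERIV_continuous continuous_at_imp_continuous_on)
  have wc: "continuous_on UNIV ?w" and vc: "continuous_on UNIV ?V"
    by (rule continuous_on_conv_moll[OF V(1) e] continuous_on_conv_moll[OF V(2) e])+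
  have bc: "continuous_on UNIV (\<lambda>x. \<beta> (?w x))" "continuous_on UNIV (\<lambda>x. \<beta>' (?w x))"
    by (rule continuous_on_compose2[OF cb wc] continuous_on_compose2[OF c wc]; simp)+
  note pc = GDERIV_continuous_on[OF k, of UNIV]
  have k0: "norm x > R \<Longrightarrow> k x = 0" for x by (rule GDERIV_supp[OF k R])
  have g: "GDERIV (\<lambda>x. \<beta> (?w x) * \<psi> x) x :> \<beta> (?w x) *\<^sub>R k x + \<psi> x *\<^sub>R (\<beta>' (?w x) *\<^sub>R ?V x)" for x
    by (intro GDERIV_mult k GDERIV_DERIV_compose[OF GDERIV_mollify[OF w e] d])
  have "(LINT x|lebesgue. ?V x \<bullet> (\<beta> (?w x) *\<^sub>R k x + \<psi> x *\<^sub>R (\<beta>' (?w x) *\<^sub>R ?V x))) = (LINT x|lebesgue. conv (moll e) F x * (\<beta> (?w x) * \<psi> x))"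
  proof (rule mollified_equation[OF V(2) eq e g, where R = R])
    show "continuous_on UNIV (\<lambda>x. \<beta> (?w x) *\<^sub>R k x + \<psi> x *\<^sub>R (\<beta>' (?w x) *\<^sub>R ?V x))"
      by (intro continuous_intros bc kc pc vc)
  qed (auto simp: R)
  moreover have "?V x \<bullet> (\<beta> (?w x) *\<^sub>R k x + \<psi> x *\<^sub>R (\<beta>' (?w x) *\<^sub>R ?V x)) =
      \<beta> (?w x) * (?V x \<bullet> k x) + \<beta>' (?w x) * (norm (?V x))\<^sup>2 * \<psi> x" for x
    by (simp add: inner_add_right dot_square_norm)
  moreover have i1: "integrable lebesgue (\<lambda>x. \<beta> (?w x) * (?V x \<bullet> k x))"
    by (rule integrable_continuous_supp[where R = R]) (intro continuous_intros bc kc vc, simp add: k0)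
  moreover show i2: "integrable lebesgue (\<lambda>x. \<beta>' (?w x) * (norm (?V x))\<^sup>2 * \<psi> x)"
    by (rule integrable_continuous_supp[where R = R]) (intro continuous_intros bc pc vc, simp add: R)
  ultimately show "(LINT x|lebesgue. \<beta>' (?w x) * (norm (?V x))\<^sup>2 * \<psi> x) =
      (LINT x|lebesgue. conv (moll e) F x * \<beta> (?w x) * \<psi> x) - (LINT x|lebesgue. \<beta> (?w x) * (?V x \<bullet> k x))"
    by (simp add: mult.assoc)
qed

text \<open>The limit of the mollified identity. \<open>F\<close> is only locally integrable, so
  \<open>\<beta>\<close> is taken bounded. If the square of \<open>norm V\<close> is not known to be
  integrable, the quadratic term is handled by Fatou, which needs signs and leaves an inequality; if
  it is, Jensen's inequality supplies a majorant and the identity persists.\<close>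

lemma
  fixes V :: "real ^ 'n \<Rightarrow> real ^ 'n" and F \<psi> w :: "real ^ 'n \<Rightarrow> real"
  assumes w: "has_weak_gradient w V" and F: "locally_integrable F"
    and eq: "weak_divergence V F"
    and k: "\<And>x. GDERIV \<psi> x :> k x" and kc: "continuous_on UNIV k" and R: "\<And>x. norm x > R \<Longrightarrow> \<psi> x = 0"
    and d: "\<And>t. (\<beta> has_real_derivative \<beta>' t) (at t)" and c: "continuous_on UNIV \<beta>'"
    and b: "\<And>t. \<bar>\<beta> t\<bar> \<le> B"
  shows kato_inequality:
      "(\<And>t. 0 \<le> \<beta>' t) \<Longrightarrow> (\<And>x. 0 \<le> \<psi> x) \<Longrightarrow> integrable lebesgue (\<lambda>x. \<beta>' (w x) * (norm (V x))\<^sup>2 * \<psi> x) \<and>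
        (LINT x|lebesgue. \<beta>' (w x) * (norm (V x))\<^sup>2 * \<psi> x) \<le>
        (LINT x|lebesgue. F x * \<beta> (w x) * \<psi> x) - (LINT x|lebesgue. \<beta> (w x) * (V x \<bullet> k x))"
    and renormalized_equation:
      "(\<And>t. \<bar>\<beta>' t\<bar> \<le> B') \<Longrightarrow> locally_integrable (\<lambda>x. (norm (V x))\<^sup>2) \<Longrightarrow>
        (LINT x|lebesgue. \<beta>' (w x) * (norm (V x))\<^sup>2 * \<psi> x) =
        (LINT x|lebesgue. F x * \<beta> (w x) * \<psi> x) - (LINT x|lebesgue. \<beta> (w x) * (V x \<bullet> k x))"
    and renormalized_integrable1: "integrable lebesgue (\<lambda>x. F x * \<beta> (w x) * \<psi> x)"
    and renormalized_integrable2: "integrable lebesgue (\<lambda>x. \<beta> (w x) * (V x \<bullet> k x))"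
proof -
  note V = has_weak_gradientD[OF w]
  have B: "B \<ge> 0" using b[of 0] by linarith
  have cb: "continuous_on UNIV \<beta>" using d by (meson DERIV_continuous continuous_at_imp_continuous_on)
  note pc = GDERIV_continuous_on[OF k, of UNIV]
  have k0: "norm x > R \<Longrightarrow> k x = 0" for x by (rule GDERIV_supp[OF k R])
  have [measurable]: "\<beta> \<in> borel_measurable borel" "\<beta>' \<in> borel_measurable borel" "w \<in> borel_measurable lebesgue"
    "V \<in> borel_measurable lebesgue" "F \<in> borel_measurable lebesgue" "\<psi> \<in> borel_measurable lebesgue" "k \<in> borel_measurable lebesgue"
    using cb c V(3,4) locally_integrable_measurable[OF F] continuous_on_imp_lebesgue_measurable[OF pc] continuous_on_imp_lebesgue_measurable[OF kc]
    by (auto intro: borel_measurable_continuous_onI)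
  obtain Bk where Bk: "\<And>x. norm (k x) \<le> Bk" "Bk > 0" using continuous_supp_bounded[OF kc k0] by blast
  obtain Bp where Bp: "\<And>x. norm (\<psi> x) \<le> Bp" "Bp > 0" using continuous_supp_bounded[OF pc R] by blast
  \<comment> \<open>Proved for an arbitrary sequence of radii, since the inequality and the identity
    use different sequences.\<close>
  have main: "(\<lambda>n. LINT x|lebesgue. conv (moll (e n)) F x * \<beta> (conv (moll (e n)) w x) * \<psi> x) \<longlonglongrightarrow> (LINT x|lebesgue. F x * \<beta> (w x) * \<psi> x)"
    "integrable lebesgue (\<lambda>x. F x * \<beta> (w x) * \<psi> x)"
    "(\<lambda>n. LINT x|lebesgue. \<beta> (conv (moll (e n)) w x) * (conv (moll (e n)) V x \<bullet> k x)) \<longlonglongrightarrow> (LINT x|lebesgue. \<beta> (w x) * (V x \<bullet> k x))"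
    "integrable lebesgue (\<lambda>x. \<beta> (w x) * (V x \<bullet> k x))"
    if e: "\<forall>n. 0 < e n" and D: "integrable lebesgue D"
    and lw: "AE x in lebesgue. norm x \<le> R \<longrightarrow> (\<lambda>n. conv (moll (e n)) w x) \<longlonglongrightarrow> w x"
    and lV: "AE x in lebesgue. norm x \<le> R \<longrightarrow> (\<lambda>n. conv (moll (e n)) V x) \<longlonglongrightarrow> V x"
    and lF: "AE x in lebesgue. norm x \<le> R \<longrightarrow> (\<lambda>n. conv (moll (e n)) F x) \<longlonglongrightarrow> F x"
    and bD: "AE x in lebesgue. norm x \<le> R \<longrightarrow> (\<forall>n. norm (conv (moll (e n)) V x) \<le> D x \<and> \<bar>conv (moll (e n)) F x\<bar> \<le> D x)"
    for e :: "nat \<Rightarrow> real" and D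
  proof -
    let ?w = "\<lambda>n. conv (moll (e n)) w" and ?V = "\<lambda>n. conv (moll (e n)) V" and ?F = "\<lambda>n. conv (moll (e n)) F"
    have wc: "continuous_on UNIV (?w n)" "continuous_on UNIV (?V n)" "continuous_on UNIV (?F n)" for n
      using continuous_on_conv_moll[OF V(1)] continuous_on_conv_moll[OF V(2)] continuous_on_conv_moll[OF F] e by blast+
    note [measurable] = continuous_on_imp_lebesgue_measurable[OF wc(1)] continuous_on_imp_lebesgue_measurable[OF wc(2)]
      continuous_on_imp_lebesgue_measurable[OF wc(3)]
    have lb: "(\<lambda>n. \<beta> (?w n x)) \<longlonglongrightarrow> \<beta> (w x)" if "(\<lambda>n. ?w n x) \<longlonglongrightarrow> w x" for x
    proof -
      have "isCont \<beta> (w x)" using cb by (simp add: continuous_on_eq_continuous_at)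
      then show ?thesis by (rule isCont_tendsto_compose[OF _ that])
    qed
    have A1: "AE x in lebesgue. norm x \<le> R \<longrightarrow> (\<lambda>n. ?F n x * \<beta> (?w n x) * \<psi> x) \<longlonglongrightarrow> F x * \<beta> (w x) * \<psi> x"
      using lw lF by eventually_elim (auto intro!: tendsto_mult lb)
    have W1: "integrable lebesgue (\<lambda>x. D x * B * Bp)" using D by simp
    have B1: "AE x in lebesgue. norm x \<le> R \<longrightarrow> (\<forall>n. norm (?F n x * \<beta> (?w n x) * \<psi> x) \<le> D x * B * Bp)"
      using bD
    proof eventually_elim
      case (elim x)
      show ?case
      proof (intro impI allI)
        fix n assume "norm x \<le> R"
        then have "\<bar>?F n x\<bar> \<le> D x" using elim by blast
        then have 2: "\<bar>?F n x\<bar> * \<bar>\<beta> (?w n x)\<bar> \<le> D x * B"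
          by (intro mult_mono[OF _ b]) linarith+
        have "0 \<le> \<bar>?F n x\<bar> * \<bar>\<beta> (?w n x)\<bar>" by simp
        then have 0: "0 \<le> D x * B" using 2 by (rule order_trans)
        have "(\<bar>?F n x\<bar> * \<bar>\<beta> (?w n x)\<bar>) * \<bar>\<psi> x\<bar> \<le> (D x * B) * Bp"
          by (rule mult_mono[OF 2 Bp(1)[of x, unfolded real_norm_def] 0 abs_ge_zero])
        then show "norm (?F n x * \<beta> (?w n x) * \<psi> x) \<le> D x * B * Bp" by (simp add: abs_mult)
      qed
    qed
    note * = ball_dominated_convergence[where R = R and f = "\<lambda>n x. ?F n x * \<beta> (?w n x) * \<psi> x" and g = "\<lambda>x. F x * \<beta> (w x) * \<psi> x", OF _ _ _ _ A1 W1 B1]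
    show "(\<lambda>n. LINT x|lebesgue. ?F n x * \<beta> (?w n x) * \<psi> x) \<longlonglongrightarrow> (LINT x|lebesgue. F x * \<beta> (w x) * \<psi> x)"
      by (rule *(1)) (auto simp: R)
    show "integrable lebesgue (\<lambda>x. F x * \<beta> (w x) * \<psi> x)"
      by (rule *(2)) (auto simp: R)
    have A2: "AE x in lebesgue. norm x \<le> R \<longrightarrow> (\<lambda>n. \<beta> (?w n x) * (?V n x \<bullet> k x)) \<longlonglongrightarrow> \<beta> (w x) * (V x \<bullet> k x)"
      using lw lV by eventually_elim (auto intro!: tendsto_mult tendsto_inner lb)
    have W2: "integrable lebesgue (\<lambda>x. B * (D x * Bk))" using D by simp
    have B2: "AE x in lebesgue. norm x \<le> R \<longrightarrow> (\<forall>n. norm (\<beta> (?w n x) * (?V n x \<bullet> k x)) \<le> B * (D x * Bk))"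
      using bD
    proof eventually_elim
      case (elim x)
      show ?case
      proof (intro impI allI)
        fix n assume "norm x \<le> R"
        then have "norm (?V n x) \<le> D x" using elim by blast
        moreover from this have "0 \<le> D x" by (rule order_trans[OF norm_ge_zero])
        ultimately have "norm (?V n x) * norm (k x) \<le> D x * Bk" using Bk(1)[of x] by (intro mult_mono) auto
        then have "\<bar>?V n x \<bullet> k x\<bar> \<le> D x * Bk" using Cauchy_Schwarz_ineq2[of "?V n x" "k x"] by linarith
        then show "norm (\<beta> (?w n x) * (?V n x \<bullet> k x)) \<le> B * (D x * Bk)"
          unfolding real_norm_def abs_mult using B by (intro mult_mono b) auto
      qed
    qed
    note * = ball_dominated_convergence[where R = R and f = "\<lambda>n x. \<beta> (?w n x) * (?V n x \<bullet> k x)" and g = "\<lambda>x. \<beta> (w x) * (V x \<bullet> k x)", OF _ _ _ _ A2 W2 B2]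
    show "(\<lambda>n. LINT x|lebesgue. \<beta> (?w n x) * (?V n x \<bullet> k x)) \<longlonglongrightarrow> (LINT x|lebesgue. \<beta> (w x) * (V x \<bullet> k x))"
      by (rule *(1)) (auto simp: k0)
    show "integrable lebesgue (\<lambda>x. \<beta> (w x) * (V x \<bullet> k x))"
      by (rule *(2)) (auto simp: k0)
  qed
  have lb': "(\<lambda>n. \<beta>' (z n)) \<longlonglongrightarrow> \<beta>' (w x)" if "z \<longlonglongrightarrow> w x" for x and z :: "nat \<Rightarrow> real"
  proof -
    have "isCont \<beta>' (w x)" using c by (simp add: continuous_on_eq_continuous_at)
    then show ?thesis by (rule isCont_tendsto_compose[OF _ that])
  qed
  obtain e D where e: "\<forall>n. 0 < e n" and D: "integrable lebesgue D"
    and lw: "AE x in lebesgue. norm x \<le> R \<longrightarrow> (\<lambda>n. conv (moll (e n)) w x) \<longlonglongrightarrow> w x"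
    and lV: "AE x in lebesgue. norm x \<le> R \<longrightarrow> (\<lambda>n. conv (moll (e n)) V x) \<longlonglongrightarrow> V x"
    and lF: "AE x in lebesgue. norm x \<le> R \<longrightarrow> (\<lambda>n. conv (moll (e n)) F x) \<longlonglongrightarrow> F x"
    and bD: "AE x in lebesgue. norm x \<le> R \<longrightarrow> (\<forall>n. \<bar>conv (moll (e n)) w x\<bar> \<le> D x \<and>
       norm (conv (moll (e n)) V x) \<le> D x \<and> norm (conv (moll (e n)) F x) \<le> D x)"
    using mollify_weak_gradient[OF w F, of R] .
  have bD': "AE x in lebesgue. norm x \<le> R \<longrightarrow> (\<forall>n. norm (conv (moll (e n)) V x) \<le> D x \<and> \<bar>conv (moll (e n)) F x\<bar> \<le> D x)"
    using bD by eventually_elim auto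
  note m = main[OF e D lw lV lF bD']
  show "integrable lebesgue (\<lambda>x. F x * \<beta> (w x) * \<psi> x)" "integrable lebesgue (\<lambda>x. \<beta> (w x) * (V x \<bullet> k x))"
    by (rule m(2) m(4))+
  {
    assume p: "\<And>t. 0 \<le> \<beta>' t" "\<And>x. 0 \<le> \<psi> x"
    let ?K = "(LINT x|lebesgue. F x * \<beta> (w x) * \<psi> x) - (LINT x|lebesgue. \<beta> (w x) * (V x \<bullet> k x))"
    let ?f = "\<lambda>n x. \<beta>' (conv (moll (e n)) w x) * (norm (conv (moll (e n)) V x))\<^sup>2 * \<psi> x"
    have q: "integral\<^sup>L lebesgue (?f n) = (LINT x|lebesgue. conv (moll (e n)) F x * \<beta> (conv (moll (e n)) w x) * \<psi> x)
        - (LINT x|lebesgue. \<beta> (conv (moll (e n)) w x) * (conv (moll (e n)) V x \<bullet> k x))"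
      "integrable lebesgue (?f n)" for n
      by (rule mollified_equation_composed[OF w eq e[rule_format] k kc _ d c]; erule R)+
    have l: "(\<lambda>n. integral\<^sup>L lebesgue (?f n)) \<longlonglongrightarrow> ?K"
      unfolding q(1) by (intro tendsto_diff m(1) m(3))
    have AE: "AE x in lebesgue. (\<lambda>n. ?f n x) \<longlonglongrightarrow> \<beta>' (w x) * (norm (V x))\<^sup>2 * \<psi> x"
      using lw lV
    proof eventually_elim
      case (elim x)
      then show ?case by (cases "norm x \<le> R") (auto intro!: tendsto_mult tendsto_power tendsto_norm lb' simp: R)
    qed
    \<comment> \<open>The integrals only converge to \<open>?K\<close>, so the eventual bound for
      Fatou needs a slack \<open>\<delta>\<close>, removed afterwards.\<close>
    have fb: "integrable lebesgue (\<lambda>x. \<beta>' (w x) * (norm (V x))\<^sup>2 * \<psi> x)"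
      "(LINT x|lebesgue. \<beta>' (w x) * (norm (V x))\<^sup>2 * \<psi> x) \<le> ?K + \<delta>" if "\<delta> > 0" for \<delta>
    proof -
      have ev: "eventually (\<lambda>n. integral\<^sup>L lebesgue (?f n) \<le> ?K + \<delta>) sequentially"
        using order_tendstoD(2)[OF l, of "?K + \<delta>"] that by (auto elim: eventually_mono)
      have nn: "AE x in lebesgue. 0 \<le> ?f n x" for n using p by (intro AE_I2 mult_nonneg_nonneg) auto
      have ms: "(\<lambda>x. \<beta>' (w x) * (norm (V x))\<^sup>2 * \<psi> x) \<in> borel_measurable lebesgue" by measurable
      show "integrable lebesgue (\<lambda>x. \<beta>' (w x) * (norm (V x))\<^sup>2 * \<psi> x)"
        "(LINT x|lebesgue. \<beta>' (w x) * (norm (V x))\<^sup>2 * \<psi> x) \<le> ?K + \<delta>"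
        using Fatou_bound[OF q(2) nn ms AE ev] by auto
    qed
    show "integrable lebesgue (\<lambda>x. \<beta>' (w x) * (norm (V x))\<^sup>2 * \<psi> x) \<and>
        (LINT x|lebesgue. \<beta>' (w x) * (norm (V x))\<^sup>2 * \<psi> x) \<le> ?K"
      using fb(1)[of 1] fb(2) field_le_epsilon by auto
  }
  {
    assume p: "\<And>t. \<bar>\<beta>' t\<bar> \<le> B'" and V2: "locally_integrable (\<lambda>x. (norm (V x))\<^sup>2)"
    have B': "B' \<ge> 0" using p[of 0] by linarith
    \<comment> \<open>Mollifying the square of \<open>norm V\<close> along with \<open>F\<close>
      gives a majorant \<open>D\<close> that, by Jensen, also bounds the squared norm of the
      mollified \<open>V\<close>.\<close>
    note FV = locally_integrable_Pair[OF F V2]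
    obtain e D where e: "\<forall>n. 0 < e n" and D: "integrable lebesgue D"
      and lw: "AE x in lebesgue. norm x \<le> R \<longrightarrow> (\<lambda>n. conv (moll (e n)) w x) \<longlonglongrightarrow> w x"
      and lV: "AE x in lebesgue. norm x \<le> R \<longrightarrow> (\<lambda>n. conv (moll (e n)) V x) \<longlonglongrightarrow> V x"
      and lFV: "AE x in lebesgue. norm x \<le> R \<longrightarrow> (\<lambda>n. conv (moll (e n)) (\<lambda>x. (F x, (norm (V x))\<^sup>2)) x) \<longlonglongrightarrow> (F x, (norm (V x))\<^sup>2)"
      and bD: "AE x in lebesgue. norm x \<le> R \<longrightarrow> (\<forall>n. \<bar>conv (moll (e n)) w x\<bar> \<le> D x \<and>
         norm (conv (moll (e n)) V x) \<le> D x \<and> norm (conv (moll (e n)) (\<lambda>x. (F x, (norm (V x))\<^sup>2)) x) \<le> D x)"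
      using mollify_weak_gradient[OF w FV, of R] .
    have pr: "conv (moll (e n)) (\<lambda>x. (F x, (norm (V x))\<^sup>2)) x = (conv (moll (e n)) F x, conv (moll (e n)) (\<lambda>x. (norm (V x))\<^sup>2) x)" for n x
      by (rule conv_Pair[OF F V2 e[rule_format]])
    have lF: "AE x in lebesgue. norm x \<le> R \<longrightarrow> (\<lambda>n. conv (moll (e n)) F x) \<longlonglongrightarrow> F x"
      using lFV unfolding pr by eventually_elim (auto dest: tendsto_fst)
    have bD': "AE x in lebesgue. norm x \<le> R \<longrightarrow> (\<forall>n. norm (conv (moll (e n)) V x) \<le> D x \<and> \<bar>conv (moll (e n)) F x\<bar> \<le> D x)"
      using bD unfolding pr
    proof eventually_elim
      case (elim x)
      then show ?case using norm_fst_le order_trans by (fastforce simp flip: real_norm_def)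
    qed
    have bV2: "AE x in lebesgue. norm x \<le> R \<longrightarrow> (\<forall>n. (norm (conv (moll (e n)) V x))\<^sup>2 \<le> D x)"
      using bD unfolding pr
    proof eventually_elim
      case (elim x)
      show ?case
      proof (intro impI allI)
        fix n assume "norm x \<le> R"
        then have "norm (conv (moll (e n)) F x, conv (moll (e n)) (\<lambda>x. (norm (V x))\<^sup>2) x) \<le> D x" using elim by blast
        then have "norm (conv (moll (e n)) (\<lambda>x. (norm (V x))\<^sup>2) x) \<le> D x"
          using norm_snd_le[of "conv (moll (e n)) (\<lambda>x. (norm (V x))\<^sup>2) x" "conv (moll (e n)) F x"] by linarith
        then show "(norm (conv (moll (e n)) V x))\<^sup>2 \<le> D x"
          using conv_jensen[OF V(2) V2 e[rule_format, of n], of x] by simp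
      qed
    qed
    note m = main[OF e D lw lV lF bD']
    let ?K = "(LINT x|lebesgue. F x * \<beta> (w x) * \<psi> x) - (LINT x|lebesgue. \<beta> (w x) * (V x \<bullet> k x))"
    let ?f = "\<lambda>n x. \<beta>' (conv (moll (e n)) w x) * (norm (conv (moll (e n)) V x))\<^sup>2 * \<psi> x"
    have q: "integral\<^sup>L lebesgue (?f n) = (LINT x|lebesgue. conv (moll (e n)) F x * \<beta> (conv (moll (e n)) w x) * \<psi> x)
        - (LINT x|lebesgue. \<beta> (conv (moll (e n)) w x) * (conv (moll (e n)) V x \<bullet> k x))"
      "integrable lebesgue (?f n)" for n
      by (rule mollified_equation_composed[OF w eq e[rule_format] k kc _ d c]; erule R)+
    have l: "(\<lambda>n. integral\<^sup>L lebesgue (?f n)) \<longlonglongrightarrow> ?K"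
      unfolding q(1) by (intro tendsto_diff m(1) m(3))
    have "(\<lambda>n. integral\<^sup>L lebesgue (?f n)) \<longlonglongrightarrow> (LINT x|lebesgue. \<beta>' (w x) * (norm (V x))\<^sup>2 * \<psi> x)"
    proof (rule ball_dominated_convergence(1)[where R = R])
      show "?f n \<in> borel_measurable lebesgue" for n using q(2) by (rule borel_measurable_integrable)
      show "AE x in lebesgue. norm x \<le> R \<longrightarrow> (\<lambda>n. ?f n x) \<longlonglongrightarrow> \<beta>' (w x) * (norm (V x))\<^sup>2 * \<psi> x"
        using lw lV by eventually_elim (auto intro!: tendsto_mult tendsto_power tendsto_norm lb')
      show "integrable lebesgue (\<lambda>x. B' * D x * Bp)" using D by simp
      show "AE x in lebesgue. norm x \<le> R \<longrightarrow> (\<forall>n. norm (?f n x) \<le> B' * D x * Bp)"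
        using bV2
      proof eventually_elim
        case (elim x)
        show ?case
        proof (intro impI allI)
          fix n assume "norm x \<le> R"
          then have 1: "(norm (conv (moll (e n)) V x))\<^sup>2 \<le> D x" using elim by blast
          then have 0: "0 \<le> D x" by (rule order_trans[OF zero_le_power2])
          have 2: "\<bar>\<beta>' (conv (moll (e n)) w x)\<bar> * (norm (conv (moll (e n)) V x))\<^sup>2 \<le> B' * D x"
            by (rule mult_mono[OF p 1 B' zero_le_power2])
          have "\<bar>\<beta>' (conv (moll (e n)) w x)\<bar> * (norm (conv (moll (e n)) V x))\<^sup>2 * \<bar>\<psi> x\<bar> \<le> B' * D x * Bp"
            by (rule mult_mono[OF 2 Bp(1)[of x, unfolded real_norm_def] mult_nonneg_nonneg[OF B' 0] abs_ge_zero])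
          then show "norm (?f n x) \<le> B' * D x * Bp" by (simp add: abs_mult)
        qed
      qed
    qed (auto simp: R)
    with l show "(LINT x|lebesgue. \<beta>' (w x) * (norm (V x))\<^sup>2 * \<psi> x) = ?K"
      using LIMSEQ_unique by blast
  }
qed

section \<open>Improved integrability\<close>

text \<open>Young's inequality for \<open>f / A\<close> and \<open>g / B\<close> with the weights
  \<open>\<alpha>\<close> and \<open>\<beta>\<close>; positive upper bounds instead of the integrals
  avoid the case of a vanishing function.\<close>

lemma Holder_bound:
  fixes f g :: "'a \<Rightarrow> real"
  assumes f: "integrable M f" "\<And>x. 0 \<le> f x" "integral\<^sup>L M f \<le> A" "0 < A"
    and g: "integrable M g" "\<And>x. 0 \<le> g x" "integral\<^sup>L M g \<le> B" "0 < B"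
    and ab: "0 < \<alpha>" "0 < \<beta>" "\<alpha> + \<beta> = 1"
  shows "integrable M (\<lambda>x. f x powr \<alpha> * g x powr \<beta>)" "(LINT x|M. f x powr \<alpha> * g x powr \<beta>) \<le> A powr \<alpha> * B powr \<beta>"
proof -
  have [measurable]: "f \<in> borel_measurable M" "g \<in> borel_measurable M" using f g by auto
  have pt: "f x powr \<alpha> * g x powr \<beta> \<le> A powr \<alpha> * B powr \<beta> * (\<alpha> * (f x / A) + \<beta> * (g x / B))" for x
  proof -
    have "f x powr \<alpha> * g x powr \<beta> = (A * (f x / A)) powr \<alpha> * (B * (g x / B)) powr \<beta>"
      using f(4) g(4) by simp
    also have "\<dots> = A powr \<alpha> * B powr \<beta> * ((f x / A) powr \<alpha> * (g x / B) powr \<beta>)"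
      by (simp only: powr_mult mult_ac)
    also have "\<dots> \<le> A powr \<alpha> * B powr \<beta> * (\<alpha> * (f x / A) + \<beta> * (g x / B))"
    proof (intro mult_left_mono)
      show "(f x / A) powr \<alpha> * (g x / B) powr \<beta> \<le> \<alpha> * (f x / A) + \<beta> * (g x / B)"
      proof (cases "f x = 0 \<or> g x = 0")
        case True
        moreover have "0 \<le> \<alpha> * (f x / A) + \<beta> * (g x / B)"
          using f(2)[of x] f(4) g(2)[of x] g(4) ab by (intro add_nonneg_nonneg mult_nonneg_nonneg divide_nonneg_pos) auto
        ultimately show ?thesis by auto
      next
        case False
        then have "0 < f x / A" "0 < g x / B" using f(2)[of x] f(4) g(2)[of x] g(4) by auto
        then show ?thesis using ab by (intro Youngs_inequality_0) auto
      qed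
    qed auto
    finally show ?thesis .
  qed
  have di: "integrable M (\<lambda>x. A powr \<alpha> * B powr \<beta> * (\<alpha> * (f x / A) + \<beta> * (g x / B)))"
    using f(1) g(1) by simp
  show i: "integrable M (\<lambda>x. f x powr \<alpha> * g x powr \<beta>)"
    by (rule Bochner_Integration.integrable_bound[OF di]) (use pt in \<open>auto intro!: AE_I2 order_trans[OF _ abs_ge_self]\<close>)
  have "(LINT x|M. f x powr \<alpha> * g x powr \<beta>) \<le> (LINT x|M. A powr \<alpha> * B powr \<beta> * (\<alpha> * (f x / A) + \<beta> * (g x / B)))"
    by (rule integral_mono[OF i di pt])
  also have "\<dots> = A powr \<alpha> * B powr \<beta> * (\<alpha> * (integral\<^sup>L M f / A) + \<beta> * (integral\<^sup>L M g / B))"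
    using f(1) g(1) by simp
  also have "\<dots> \<le> A powr \<alpha> * B powr \<beta> * (\<alpha> * 1 + \<beta> * 1)"
    using f(3,4) g(3,4) ab by (intro mult_left_mono add_mono) auto
  finally show "(LINT x|M. f x powr \<alpha> * g x powr \<beta>) \<le> A powr \<alpha> * B powr \<beta>" using ab by simp
qed

text \<open>A primitive of \<open>1 + 2 * t^2\<close>, the coefficient of the quasilinear flux,
  which thereby becomes a gradient.\<close>

definition cubic :: "real \<Rightarrow> real" where
  "cubic t = t + 2/3 * t ^ 3"

definition cubic_inv :: "real \<Rightarrow> real" where
  "cubic_inv = inv cubic"

lemma DERIV_cubic: "(cubic has_real_derivative 1 + 2 * t\<^sup>2) (at t)"
  unfolding cubic_def[abs_def] by (auto intro!: derivative_eq_intros)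

lemma cubic_strict_mono: "strict_mono cubic"
proof (rule strict_monoI)
  fix x y :: real assume "x < y"
  then show "cubic x < cubic y"
    using DERIV_cubic one_two_sq_pos by (intro DERIV_pos_imp_increasing[of x y cubic]) blast+
qed

lemma cubic_inverse: "cubic_inv (cubic t) = t" "cubic (cubic_inv t) = t"
proof -
  have inj: "inj cubic" by (rule strict_mono_imp_inj_on[OF cubic_strict_mono])
  show "cubic_inv (cubic t) = t" unfolding cubic_inv_def by (rule inv_f_f[OF inj])
  have cont: "continuous_on A cubic" for A
    unfolding cubic_def by (intro continuous_intros)
  have "\<exists>s. cubic s = t" for t
  proof -
    have "cubic (- \<bar>t\<bar>) \<le> t" "t \<le> cubic \<bar>t\<bar>"
    proof -
      have "0 \<le> \<bar>t\<bar> ^ 3" "(- \<bar>t\<bar>) ^ 3 = - (\<bar>t\<bar> ^ 3)" by simp_all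
      then show "cubic (- \<bar>t\<bar>) \<le> t" "t \<le> cubic \<bar>t\<bar>" unfolding cubic_def by linarith+
    qed
    then show ?thesis using IVT'[of cubic "- \<bar>t\<bar>" t "\<bar>t\<bar>", OF _ _ _ cont] by auto
  qed
  then have "surj cubic" by (metis surjI)
  then show "cubic (cubic_inv t) = t" unfolding cubic_inv_def by (rule surj_f_inv_f)
qed

lemma DERIV_cubic_inv: "(cubic_inv has_real_derivative 1 / (1 + 2 * (cubic_inv t)\<^sup>2)) (at t)"
proof -
  have gc: "isCont cubic s" for s using DERIV_cubic DERIV_isCont by blast
  have "isCont cubic_inv (cubic s)" for s
    by (rule isCont_inverse_function[where d = 1]) (use cubic_inverse gc in auto)
  then have fc: "isCont cubic_inv t" for t by (metis cubic_inverse(2))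
  have "(cubic_inv has_real_derivative inverse (1 + 2 * (cubic_inv t)\<^sup>2)) (at t)"
    by (rule DERIV_inverse_function[where f = cubic and a = "t - 1" and b = "t + 1"])
       (use DERIV_cubic cubic_inverse fc in \<open>auto simp: one_two_sq_pos less_imp_neq[symmetric]\<close>)
  then show ?thesis by (simp add: divide_inverse)
qed

lemma continuous_on_cubic_inv: "continuous_on A cubic_inv"
  using DERIV_cubic_inv by (meson DERIV_continuous continuous_at_imp_continuous_on)

context critical_solution
begin

text \<open>In this notation the equation is \<open>- Laplace W = FW\<close>. The term quadratic in
  the gradient moves to the right-hand side, where it is only known to be integrable.\<close>

definition "W x = cubic (u x)"
definition "GW x = (1 + 2 * (u x)\<^sup>2) *\<^sub>R G x"
definition "FW x = h (u x) + lam * u x - 2 * u x * (norm (G x))\<^sup>2"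

lemma integrable_uG: "integrable lebesgue (\<lambda>x. \<bar>u x\<bar> * norm (G x))"
  by (rule Bochner_Integration.integrable_bound[of _ "\<lambda>x. (u x)\<^sup>2 + (norm (G x))\<^sup>2"])
    (use u2 G2 abs_mult_le_squares[of "u _" "norm (G _)"] in auto)

lemma integrable_u2G: "integrable lebesgue (\<lambda>x. (u x)\<^sup>2 * norm (G x))"
proof (rule Bochner_Integration.integrable_bound[of _ "\<lambda>x. (u x)\<^sup>2 + (norm (G x))\<^sup>2 * (u x)\<^sup>2"])
  show "AE x in lebesgue. norm ((u x)\<^sup>2 * norm (G x)) \<le> norm ((u x)\<^sup>2 + (norm (G x))\<^sup>2 * (u x)\<^sup>2)"
  proof (intro AE_I2)
    fix x
    have "(u x)\<^sup>2 * norm (G x) = \<bar>u x\<bar> * \<bar>u x * norm (G x)\<bar>" by (simp add: abs_mult power2_eq_square)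
    also have "\<dots> \<le> (u x)\<^sup>2 + (u x * norm (G x))\<^sup>2" by (rule abs_mult_le_squares)
    finally show "norm ((u x)\<^sup>2 * norm (G x)) \<le> norm ((u x)\<^sup>2 + (norm (G x))\<^sup>2 * (u x)\<^sup>2)"
      by (simp add: power_mult_distrib mult.commute)
  qed
qed (use u2 uG2 in auto)

lemma integrable_uGG: "integrable lebesgue (\<lambda>x. u x * (norm (G x))\<^sup>2)"
proof (rule Bochner_Integration.integrable_bound[of _ "\<lambda>x. (norm (G x))\<^sup>2 + (norm (G x))\<^sup>2 * (u x)\<^sup>2"])
  show "AE x in lebesgue. norm (u x * (norm (G x))\<^sup>2) \<le> norm ((norm (G x))\<^sup>2 + (norm (G x))\<^sup>2 * (u x)\<^sup>2)"
  proof (intro AE_I2)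
    fix x
    have "\<bar>u x\<bar> \<le> 1 + (u x)\<^sup>2" using abs_mult_le_squares[of 1 "u x"] by simp
    then have "(norm (G x))\<^sup>2 * \<bar>u x\<bar> \<le> (norm (G x))\<^sup>2 * (1 + (u x)\<^sup>2)" by (intro mult_left_mono) auto
    then show "norm (u x * (norm (G x))\<^sup>2) \<le> norm ((norm (G x))\<^sup>2 + (norm (G x))\<^sup>2 * (u x)\<^sup>2)"
      by (simp add: abs_mult distrib_left mult.commute)
  qed
qed (use G2 uG2 in auto)

lemma locally_integrable_u: "locally_integrable u"
  by (rule has_weak_gradientD(1)[OF wg])

lemma W_gradient: "has_weak_gradient W GW"
proof -
  have "has_weak_gradient (\<lambda>x. cubic (u x)) (\<lambda>x. (1 + 2 * (u x)\<^sup>2) *\<^sub>R G x)"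
  proof (rule has_weak_gradient_chain[OF wg DERIV_cubic, where E = "\<lambda>t. \<bar>t\<bar> + 2/3 * \<bar>t\<bar> ^ 3" and D = "\<lambda>t. 1 + 2 * t\<^sup>2"])
    show "continuous_on UNIV (\<lambda>t. 1 + 2 * t\<^sup>2 :: real)" by (intro continuous_intros)
    show "\<bar>cubic s\<bar> \<le> \<bar>t\<bar> + 2/3 * \<bar>t\<bar> ^ 3" if "\<bar>s\<bar> \<le> \<bar>t\<bar>" for s t
    proof -
      have "\<bar>s\<bar> ^ 3 \<le> \<bar>t\<bar> ^ 3" using that by (intro power_mono) auto
      moreover have "\<bar>cubic s\<bar> \<le> \<bar>s\<bar> + 2/3 * \<bar>s\<bar> ^ 3"
        using abs_triangle_ineq[of s "2/3 * s ^ 3"] by (simp add: cubic_def abs_mult power_abs)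
      ultimately show ?thesis using that by linarith
    qed
    have "\<bar>u x\<bar> powr 3 = \<bar>u x\<bar> ^ 3" for x by (cases "u x = 0") auto
    then have i3: "integrable lebesgue (\<lambda>x. \<bar>u x\<bar> ^ 3)" using integrable_u_powr[of 3] p_gt_2 by simp
    then show "locally_integrable (\<lambda>x. \<bar>u x\<bar> + 2/3 * \<bar>u x\<bar> ^ 3)"
      using locally_integrable_add[OF locally_integrable_norm[OF locally_integrable_u]
          locally_integrable_cmult[OF integrable_imp_locally_integrable[OF i3], of "2/3"]] by simp
    show "\<bar>1 + 2 * s\<^sup>2\<bar> \<le> 1 + 2 * t\<^sup>2" if "\<bar>s\<bar> \<le> \<bar>t\<bar>" for s t :: real
      using that by (simp add: abs_le_square_iff)
    show "locally_integrable (\<lambda>x. (1 + 2 * (u x)\<^sup>2) * norm (G x))"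
      using locally_integrable_add[OF locally_integrable_norm[OF has_weak_gradientD(2)[OF wg]]
          locally_integrable_cmult[OF integrable_imp_locally_integrable[OF integrable_u2G], of 2]]
      by (simp add: distrib_right mult.assoc)
  qed
  then show ?thesis by (simp add: W_def[abs_def] GW_def[abs_def])
qed

lemma FW_locally_integrable: "locally_integrable FW"
proof -
  have "locally_integrable (\<lambda>x. (h (u x) + lam * u x) + (- 2) * (u x * (norm (G x))\<^sup>2))"
    by (intro locally_integrable_add locally_integrable_cmult integrable_imp_locally_integrable
        integrable_h integrable_uGG locally_integrable_u)
  then show ?thesis by (simp add: FW_def[abs_def] mult.assoc)
qed

lemma W_equation: "weak_divergence GW FW"
  unfolding weak_divergence_def
proof (intro allI impI)
  fix \<phi> :: "real ^ 'n \<Rightarrow> real" and g assume t: "test_function \<phi>" and "\<forall>x. GDERIV \<phi> x :> g x"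
  then have g: "\<And>x. GDERIV \<phi> x :> g x" by blast
  obtain R where R: "\<And>x. norm x > R \<Longrightarrow> \<phi> x = 0" using test_function_supp[OF t] by blast
  note pc = GDERIV_continuous_on[OF g, of UNIV]
  obtain M where M: "\<And>x. norm (\<phi> x) \<le> M" using continuous_supp_bounded[OF pc R] by blast
  note e = weak_equation_u[OF t g]
  have i: "integrable lebesgue (\<lambda>x. 2 * u x * (norm (G x))\<^sup>2 * \<phi> x)"
    using integrable_mult_right[OF integrable_bounded_scaleR[OF integrable_uGG, of \<phi> M], of 2] M continuous_on_imp_lebesgue_measurable[OF pc]
    by (simp add: mult_ac)
  have "(LINT x|lebesgue. GW x \<bullet> g x) = (LINT x|lebesgue. ((1 + 2 * (u x)\<^sup>2) * (G x \<bullet> g x) + 2 * u x * (norm (G x))\<^sup>2 * \<phi> x) - 2 * u x * (norm (G x))\<^sup>2 * \<phi> x)"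
    by (simp add: GW_def)
  also have "\<dots> = (LINT x|lebesgue. (h (u x) + lam * u x) * \<phi> x) - (LINT x|lebesgue. 2 * u x * (norm (G x))\<^sup>2 * \<phi> x)"
    by (subst Bochner_Integration.integral_diff[OF e(1) i]) (simp only: e(3))
  also have "\<dots> = (LINT x|lebesgue. (h (u x) + lam * u x) * \<phi> x - 2 * u x * (norm (G x))\<^sup>2 * \<phi> x)"
    by (rule Bochner_Integration.integral_diff[OF e(2) i, symmetric])
  also have "\<dots> = (LINT x|lebesgue. FW x * \<phi> x)"
    by (simp add: FW_def left_diff_distrib)
  finally show "(LINT x|lebesgue. GW x \<bullet> g x) = (LINT x|lebesgue. FW x * \<phi> x)" .
qed

lemma GW_norm: "(norm (GW x))\<^sup>2 = (1 + 2 * (u x)\<^sup>2)\<^sup>2 * (norm (G x))\<^sup>2"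
  by (simp add: GW_def power_mult_distrib)

text \<open>Kato's inequality for \<open>b\<close> composed with \<open>cubic_inv\<close>, a
  function of \<open>u\<close> written as one of \<open>W\<close>. As \<open>b\<close> has the sign
  of its argument, both \<open>lam * u * b(u)\<close> and \<open>- 2 * u * b(u) * |G|^2\<close> are
  nonpositive and drop out, which leaves the nonlinearity; the cutoff term is of order
  \<open>1 / R\<close>.\<close>

lemma test_bounded:
  assumes d: "\<And>t. (b has_real_derivative b' t) (at t)" and c: "continuous_on UNIV b'" and B: "\<And>t. \<bar>b t\<bar> \<le> B"
    and p: "\<And>t. 0 \<le> b' t" and L: "\<And>t. \<bar>b t\<bar> \<le> L * \<bar>t\<bar>" and s: "\<And>t. 0 \<le> b t * t"
  shows "integrable lebesgue (\<lambda>x. b' (u x) * (1 + 2 * (u x)\<^sup>2) * (norm (G x))\<^sup>2)"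
    "(LINT x|lebesgue. b' (u x) * (1 + 2 * (u x)\<^sup>2) * (norm (G x))\<^sup>2) \<le> (LINT x|lebesgue. \<bar>h (u x) * b (u x)\<bar>)"
proof -
  have cb: "continuous_on UNIV b" using d by (meson DERIV_continuous continuous_at_imp_continuous_on)
  have [measurable]: "b \<in> borel_measurable borel" "b' \<in> borel_measurable borel"
    using cb c by (auto intro: borel_measurable_continuous_onI)
  have B0: "0 \<le> B" using B[of 0] by linarith
  have L0: "0 \<le> L" using L[of 1] by (simp add: order_trans[OF abs_ge_zero])
  let ?\<beta> = "\<lambda>t. b (cubic_inv t)" and ?\<beta>' = "\<lambda>t. b' (cubic_inv t) * (1 / (1 + 2 * (cubic_inv t)\<^sup>2))"
  have nz: "1 + 2 * t\<^sup>2 \<noteq> 0" for t :: real using one_two_sq_pos[of t] by simp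
  have d\<beta>: "(?\<beta> has_real_derivative ?\<beta>' t) (at t)" for t
    by (rule DERIV_chain2[OF d DERIV_cubic_inv])
  have c\<beta>: "continuous_on UNIV ?\<beta>'"
    by (intro continuous_intros continuous_on_compose2[OF c continuous_on_cubic_inv] continuous_on_cubic_inv) (auto simp: nz)
  have p\<beta>: "0 \<le> ?\<beta>' t" for t using p one_two_sq_pos[of "cubic_inv t"] by (intro mult_nonneg_nonneg) auto
  let ?f = "\<lambda>x. b' (u x) * (1 + 2 * (u x)\<^sup>2) * (norm (G x))\<^sup>2"
  let ?K = "LINT x|lebesgue. \<bar>h (u x) * b (u x)\<bar>"
  \<comment> \<open>Majorant of \<open>|b(u)| * |GW|\<close>: the linear bound on \<open>b\<close>
    meets the 1 in \<open>1 + 2 * u^2\<close>, and the constant bound meets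
    \<open>2 * u^2\<close>.\<close>
  let ?Q = "\<lambda>x. L * (\<bar>u x\<bar> * norm (G x)) + 2 * B * ((u x)\<^sup>2 * norm (G x))"
  have Qi: "integrable lebesgue ?Q" using integrable_uG integrable_u2G by simp
  have hb: "integrable lebesgue (\<lambda>x. \<bar>h (u x) * b (u x)\<bar>)"
    using integrable_bounded_scaleR[OF integrable_h, of "\<lambda>x. b (u x)" B] B by (intro integrable_abs) (simp add: mult.commute)
  \<comment> \<open>The factor \<open>1 / (1 + 2 * u^2)\<close> from the derivative of
    \<open>cubic_inv\<close> cancels one of the two such factors in the square of
    \<open>norm GW\<close>.\<close>
  have eq1: "?\<beta>' (W x) * (norm (GW x))\<^sup>2 * \<psi> = ?f x * \<psi>" for x \<psi>
    unfolding W_def cubic_inverse GW_norm using nz[of "u x"] by (simp add: power2_eq_square)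
  have st: "integrable lebesgue (\<lambda>x. ?f x * cutoff (real (Suc n)) x) \<and>
      (LINT x|lebesgue. ?f x * cutoff (real (Suc n)) x) \<le> ?K + 4 * inverse (real (Suc n)) * integral\<^sup>L lebesgue ?Q" for n
  proof -
    let ?R = "real (Suc n)"
    have R0: "?R > 0" by simp
    have cs: "cutoff ?R x = 0" if "norm x > ?R" for x :: "real ^ 'n" using cutoff_0[OF R0 that] .
    have k: "integrable lebesgue (\<lambda>x. ?\<beta>' (W x) * (norm (GW x))\<^sup>2 * cutoff ?R x) \<and>
        (LINT x|lebesgue. ?\<beta>' (W x) * (norm (GW x))\<^sup>2 * cutoff ?R x) \<le>
        (LINT x|lebesgue. FW x * ?\<beta> (W x) * cutoff ?R x) - (LINT x|lebesgue. ?\<beta> (W x) * (GW x \<bullet> cutoff_grad ?R x))"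
      by (rule kato_inequality[OF W_gradient FW_locally_integrable W_equation GDERIV_cutoff continuous_on_cutoff_grad _ d\<beta> c\<beta> B p\<beta> cutoff_bounds(1)])
        (erule cs)
    have i1: "integrable lebesgue (\<lambda>x. FW x * ?\<beta> (W x) * cutoff ?R x)"
      by (rule renormalized_integrable1[OF W_gradient FW_locally_integrable W_equation GDERIV_cutoff continuous_on_cutoff_grad _ d\<beta> c\<beta> B])
        (erule cs)
    have i2: "integrable lebesgue (\<lambda>x. ?\<beta> (W x) * (GW x \<bullet> cutoff_grad ?R x))"
      by (rule renormalized_integrable2[OF W_gradient FW_locally_integrable W_equation GDERIV_cutoff continuous_on_cutoff_grad _ d\<beta> c\<beta> B])
        (erule cs)
    have "(LINT x|lebesgue. FW x * ?\<beta> (W x) * cutoff ?R x) \<le> ?K"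
    proof (rule integral_mono[OF i1 hb])
      fix x
      have "FW x * b (u x) = h (u x) * b (u x) + lam * (b (u x) * u x) - 2 * (b (u x) * u x) * (norm (G x))\<^sup>2"
        by (simp add: FW_def algebra_simps)
      moreover have "lam * (b (u x) * u x) \<le> 0" using lam s[of "u x"] by (intro mult_nonpos_nonneg) auto
      moreover have "0 \<le> 2 * (b (u x) * u x) * (norm (G x))\<^sup>2" by (intro mult_nonneg_nonneg[OF mult_nonneg_nonneg[OF _ s]]) auto
      ultimately have "FW x * b (u x) \<le> \<bar>h (u x) * b (u x)\<bar>" by linarith
      then have "FW x * b (u x) * cutoff ?R x \<le> \<bar>h (u x) * b (u x)\<bar> * cutoff ?R x"
        by (intro mult_right_mono cutoff_bounds)
      also have "\<dots> \<le> \<bar>h (u x) * b (u x)\<bar> * 1" by (intro mult_left_mono cutoff_bounds) auto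
      finally show "FW x * ?\<beta> (W x) * cutoff ?R x \<le> \<bar>h (u x) * b (u x)\<bar>" by (simp add: W_def cubic_inverse)
    qed
    moreover have "- (LINT x|lebesgue. ?\<beta> (W x) * (GW x \<bullet> cutoff_grad ?R x)) \<le> 4 * inverse ?R * integral\<^sup>L lebesgue ?Q"
    proof -
      have "- (LINT x|lebesgue. ?\<beta> (W x) * (GW x \<bullet> cutoff_grad ?R x)) = (LINT x|lebesgue. - (?\<beta> (W x) * (GW x \<bullet> cutoff_grad ?R x)))" by simp
      also have "\<dots> \<le> (LINT x|lebesgue. 4 * inverse ?R * ?Q x)"
      proof (rule integral_mono)
        fix x
        have "\<bar>b (u x)\<bar> * norm (GW x) = \<bar>b (u x)\<bar> * norm (G x) + 2 * \<bar>b (u x)\<bar> * ((u x)\<^sup>2 * norm (G x))"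
          unfolding GW_def norm_scaleR abs_of_pos[OF one_two_sq_pos] by (simp add: algebra_simps)
        also have "\<dots> \<le> (L * \<bar>u x\<bar>) * norm (G x) + 2 * B * ((u x)\<^sup>2 * norm (G x))"
          by (intro add_mono mult_right_mono mult_left_mono L B) auto
        finally have 1: "\<bar>b (u x)\<bar> * norm (GW x) \<le> ?Q x" by (simp add: mult.assoc)
        have Q0: "0 \<le> ?Q x" using L0 B0 by simp
        have "- (?\<beta> (W x) * (GW x \<bullet> cutoff_grad ?R x)) \<le> \<bar>b (u x)\<bar> * \<bar>GW x \<bullet> cutoff_grad ?R x\<bar>"
          by (simp add: W_def cubic_inverse flip: abs_mult)
        also have "\<dots> \<le> \<bar>b (u x)\<bar> * (norm (GW x) * norm (cutoff_grad ?R x))"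
          by (intro mult_left_mono Cauchy_Schwarz_ineq2) auto
        also have "\<dots> = (\<bar>b (u x)\<bar> * norm (GW x)) * norm (cutoff_grad ?R x)" by simp
        also have "\<dots> \<le> ?Q x * (4 / ?R)" by (rule mult_mono[OF 1 norm_cutoff_grad(1)[OF R0] Q0 norm_ge_zero])
        also have "\<dots> = 4 * inverse ?R * ?Q x" by (simp only: divide_inverse mult_ac)
        finally show "- (?\<beta> (W x) * (GW x \<bullet> cutoff_grad ?R x)) \<le> 4 * inverse ?R * ?Q x" .
      qed (use i2 Qi in \<open>auto intro!: integrable_mult_right\<close>)
      finally show ?thesis by (simp only: integral_mult_right_zero)
    qed
    ultimately show ?thesis using k unfolding eq1 by linarith
  qed
  have lim: "(\<lambda>n. ?K + 4 * inverse (real (Suc n)) * integral\<^sup>L lebesgue ?Q) \<longlonglongrightarrow> ?K + 4 * 0 * integral\<^sup>L lebesgue ?Q"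
    by (intro tendsto_add tendsto_mult tendsto_const LIMSEQ_inverse_real_of_nat)
  have fb: "integrable lebesgue ?f" "integral\<^sup>L lebesgue ?f \<le> ?K + \<delta>" if "\<delta> > 0" for \<delta>
  proof -
    have "eventually (\<lambda>n. ?K + 4 * inverse (real (Suc n)) * integral\<^sup>L lebesgue ?Q < ?K + \<delta>) sequentially"
      using lim that by (intro order_tendstoD(2)) auto
    then have ev: "eventually (\<lambda>n. (LINT x|lebesgue. ?f x * cutoff (real (Suc n)) x) \<le> ?K + \<delta>) sequentially"
      by eventually_elim (use st in \<open>meson less_imp_le order_trans\<close>)
    have nn: "AE x in lebesgue. 0 \<le> ?f x * cutoff (real (Suc n)) x" for n
      using p one_two_sq_pos by (intro AE_I2 mult_nonneg_nonneg cutoff_bounds) (auto intro: less_imp_le)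
    have l: "AE x in lebesgue. (\<lambda>n. ?f x * cutoff (real (Suc n)) x) \<longlonglongrightarrow> ?f x"
    proof (intro AE_I2)
      fix x
      show "(\<lambda>n. ?f x * cutoff (real (Suc n)) x) \<longlonglongrightarrow> ?f x"
        using tendsto_mult[OF tendsto_const[of "?f x"] cutoff_tendsto[of x]] by simp
    qed
    have ms: "?f \<in> borel_measurable lebesgue" by measurable
    show "integrable lebesgue ?f" "integral\<^sup>L lebesgue ?f \<le> ?K + \<delta>"
      using Fatou_bound[OF conjunct1[OF st] nn ms l ev] by auto
  qed
  show "integrable lebesgue ?f" by (rule fb(1)[OF zero_less_one])
  show "integral\<^sup>L lebesgue ?f \<le> ?K" using fb(2) by (rule field_le_epsilon)
qed

end

context critical_solution
begin

text \<open>Truncating the argument of \<open>b\<close> makes it bounded;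
  \<open>|h(u) * u| <= C * |u|^(2p)\<close> is integrable and dominates the right-hand sides up to
  the factor \<open>L\<close>, and Fatou passes to the limit on the left.\<close>

lemma test_linear:
  assumes d: "\<And>t. (b has_real_derivative b' t) (at t)" and c: "continuous_on UNIV b'"
    and p: "\<And>t. 0 \<le> b' t" and L: "\<And>t. \<bar>b t\<bar> \<le> L * \<bar>t\<bar>" and s: "\<And>t. 0 \<le> b t * t"
  shows "integrable lebesgue (\<lambda>x. b' (u x) * (1 + 2 * (u x)\<^sup>2) * (norm (G x))\<^sup>2)"
    "(LINT x|lebesgue. b' (u x) * (1 + 2 * (u x)\<^sup>2) * (norm (G x))\<^sup>2) \<le> (LINT x|lebesgue. \<bar>h (u x) * b (u x)\<bar>)"
proof -
  have cb: "continuous_on UNIV b" using d by (meson DERIV_continuous continuous_at_imp_continuous_on)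
  have [measurable]: "b \<in> borel_measurable borel" "b' \<in> borel_measurable borel"
    using cb c by (auto intro: borel_measurable_continuous_onI)
  have L0: "0 \<le> L" using L[of 1] by (simp add: order_trans[OF abs_ge_zero])
  let ?b = "\<lambda>j t. b (trunc j t)" and ?b' = "\<lambda>j t. b' (trunc j t) * trunc' j t"
  let ?K = "LINT x|lebesgue. \<bar>h (u x) * b (u x)\<bar>"
  let ?f = "\<lambda>j x. ?b' j (u x) * (1 + 2 * (u x)\<^sup>2) * (norm (G x))\<^sup>2"
  let ?g = "\<lambda>x. b' (u x) * (1 + 2 * (u x)\<^sup>2) * (norm (G x))\<^sup>2"
  have t: "integrable lebesgue (?f j)" "integral\<^sup>L lebesgue (?f j) \<le> (LINT x|lebesgue. \<bar>h (u x) * b (trunc j (u x))\<bar>)" for j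
  proof -
    have 1: "(?b j has_real_derivative ?b' j t) (at t)" for t by (rule DERIV_chain2[OF d DERIV_trunc])
    have 2: "continuous_on UNIV (?b' j)"
      by (intro continuous_intros continuous_on_compose2[OF c continuous_on_trunc] continuous_on_trunc') auto
    have 3: "\<bar>?b j t\<bar> \<le> L * real (Suc j)" for t
      by (rule order_trans[OF L]) (intro mult_left_mono abs_trunc_bound L0)
    have 4: "0 \<le> ?b' j t" for t using p trunc'_pos[of j t] by (intro mult_nonneg_nonneg) (auto intro: less_imp_le)
    have 5: "\<bar>?b j t\<bar> \<le> L * \<bar>t\<bar>" for t
      by (rule order_trans[OF L]) (intro mult_left_mono abs_trunc_le L0)
    \<comment> \<open>\<open>t\<close> is a positive multiple of \<open>trunc j t\<close>, so the
      sign condition at the truncated value carries over.\<close>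
    have 6: "0 \<le> ?b j t * t" for t
    proof -
      have "t = trunc j t * trunc_weight j t" using trunc_weight_pos[of j t] by (simp add: trunc_def)
      then have e: "?b j t * t = (?b j t * trunc j t) * trunc_weight j t" by (metis mult.assoc)
      show ?thesis unfolding e by (rule mult_nonneg_nonneg[OF s less_imp_le[OF trunc_weight_pos]])
    qed
    show "integrable lebesgue (?f j)" "integral\<^sup>L lebesgue (?f j) \<le> (LINT x|lebesgue. \<bar>h (u x) * b (trunc j (u x))\<bar>)"
      by (rule test_bounded[OF 1 2 3 4 5 6])+
  qed
  have lim: "(\<lambda>j. LINT x|lebesgue. \<bar>h (u x) * b (trunc j (u x))\<bar>) \<longlonglongrightarrow> ?K"
  proof (rule integral_dominated_convergence[where w = "\<lambda>x. C * L * \<bar>u x\<bar> powr (2 * p)"])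
    show "integrable lebesgue (\<lambda>x. C * L * \<bar>u x\<bar> powr (2 * p))" using integrable_u_2p by simp
    show "AE x in lebesgue. (\<lambda>j. \<bar>h (u x) * b (trunc j (u x))\<bar>) \<longlonglongrightarrow> \<bar>h (u x) * b (u x)\<bar>"
    proof (intro AE_I2 tendsto_rabs tendsto_mult tendsto_const)
      fix x
      have "isCont b (u x)" using cb by (simp add: continuous_on_eq_continuous_at)
      then show "(\<lambda>j. b (trunc j (u x))) \<longlonglongrightarrow> b (u x)" by (rule isCont_tendsto_compose[OF _ trunc_tendsto])
    qed
    show "AE x in lebesgue. norm \<bar>h (u x) * b (trunc j (u x))\<bar> \<le> C * L * \<bar>u x\<bar> powr (2 * p)" for j
    proof (intro AE_I2)
      fix x
      have "\<bar>b (trunc j (u x))\<bar> \<le> L * \<bar>u x\<bar>" by (rule order_trans[OF L]) (intro mult_left_mono abs_trunc_le L0)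
      then have "\<bar>h (u x)\<bar> * \<bar>b (trunc j (u x))\<bar> \<le> (C * \<bar>u x\<bar> powr (2 * p - 1)) * (L * \<bar>u x\<bar>)"
        using C_pos by (intro mult_mono h_growth) auto
      also have "\<dots> = C * L * (\<bar>u x\<bar> powr (2 * p - 1) * \<bar>u x\<bar> powr 1)" by simp
      also have "\<bar>u x\<bar> powr (2 * p - 1) * \<bar>u x\<bar> powr 1 = \<bar>u x\<bar> powr (2 * p)" by (simp only: powr_add[symmetric] diff_add_cancel)
      finally show "norm \<bar>h (u x) * b (trunc j (u x))\<bar> \<le> C * L * \<bar>u x\<bar> powr (2 * p)" by (simp add: abs_mult)
    qed
  qed measurable
  have fb: "integrable lebesgue ?g" "integral\<^sup>L lebesgue ?g \<le> ?K + \<delta>" if "\<delta> > 0" for \<delta>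
  proof -
    have "eventually (\<lambda>j. (LINT x|lebesgue. \<bar>h (u x) * b (trunc j (u x))\<bar>) < ?K + \<delta>) sequentially"
      using lim that by (intro order_tendstoD(2)) auto
    then have ev: "eventually (\<lambda>j. integral\<^sup>L lebesgue (?f j) \<le> ?K + \<delta>) sequentially"
      by eventually_elim (use t(2) in \<open>meson less_imp_le order_trans\<close>)
    have nn: "AE x in lebesgue. 0 \<le> ?f j x" for j
      using p one_two_sq_pos trunc'_pos by (intro AE_I2 mult_nonneg_nonneg) (auto intro: less_imp_le)
    have l: "AE x in lebesgue. (\<lambda>j. ?f j x) \<longlonglongrightarrow> ?g x"
    proof (intro AE_I2)
      fix x
      have "isCont b' (u x)" using c by (simp add: continuous_on_eq_continuous_at)
      then have "(\<lambda>j. b' (trunc j (u x))) \<longlonglongrightarrow> b' (u x)" by (rule isCont_tendsto_compose[OF _ trunc_tendsto])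
      from tendsto_mult[OF this trunc'_tendsto[of "u x"]]
      have "(\<lambda>j. ?b' j (u x)) \<longlonglongrightarrow> b' (u x)" by simp
      then show "(\<lambda>j. ?f j x) \<longlonglongrightarrow> ?g x" by (intro tendsto_mult tendsto_const)
    qed
    have ms: "?g \<in> borel_measurable lebesgue" by measurable
    show "integrable lebesgue ?g" "integral\<^sup>L lebesgue ?g \<le> ?K + \<delta>"
      using Fatou_bound[OF t(1) nn ms l ev] by auto
  qed
  show "integrable lebesgue ?g" by (rule fb(1)[OF zero_less_one])
  show "integral\<^sup>L lebesgue ?g \<le> ?K" using fb(2) by (rule field_le_epsilon)
qed

text \<open>Brezis--Kato: the potential \<open>|u|\<^sup>2\<^sup>p\<^sup>-\<^sup>4\<close> has a small \<open>L\<^sup>p\<^sup>/\<^sup>(\<^sup>p\<^sup>-\<^sup>2\<^sup>)\<close> norm on \<open>{|u| > A}\<close>, so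
  there its contribution is absorbed by the Dirichlet integral through the Sobolev inequality.\<close>

lemma brezis_kato:
  shows integrable_u6G: "integrable lebesgue (\<lambda>x. (u x) ^ 6 * (norm (G x))\<^sup>2)"
    and integrable_u_4p: "integrable lebesgue (\<lambda>x. \<bar>u x\<bar> powr (4 * p))"
proof -
  \<comment> \<open>Holder exponents: \<open>\<theta>\<close> turns \<open>|u|^(2p)\<close> into the
    potential \<open>|u|^(2p-4)\<close>, and \<open>2 / p\<close> goes with the critical
    power.\<close>
  define \<theta> where "\<theta> = 1 - 2 / p"
  have \<theta>: "0 < \<theta>" "0 < 2 / p" "\<theta> + 2 / p = 1" "2 * p * \<theta> = 2 * p - 4"
    using p_gt_2 by (auto simp: \<theta>_def field_simps)
  let ?I = "LINT x|lebesgue. \<bar>u x\<bar> powr (2 * p)"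
  \<comment> \<open>The threshold at which the absorbed term, after all constants, has the factor
    1/2.\<close>
  define \<delta> where "\<delta> = (1 / (16 * C * S powr (2 / p))) powr (1 / \<theta>)"
  have \<delta>: "\<delta> > 0" "8 * C * (\<delta> powr \<theta> * S powr (2 / p)) = 1 / 2"
    using C_pos S_pos \<theta> by (auto simp: \<delta>_def powr_powr field_simps)
  \<comment> \<open>The part of the critical integral where \<open>|u| > A\<close>; it falls below
    \<open>\<delta>\<close> for large \<open>A\<close>.\<close>
  let ?T = "\<lambda>A x. if \<bar>u x\<bar> > A then \<bar>u x\<bar> powr (2 * p) else 0"
  have Ti: "integrable lebesgue (?T A)" for A
    by (rule Bochner_Integration.integrable_bound[OF integrable_u_2p]) auto
  have "(\<lambda>n. LINT x|lebesgue. ?T (real n) x) \<longlonglongrightarrow> (LINT x|(lebesgue :: (real ^ 'n) measure). 0)"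
  proof (rule integral_dominated_convergence[OF _ _ integrable_u_2p])
    show "AE x in lebesgue. (\<lambda>n. ?T (real n) x) \<longlonglongrightarrow> 0"
    proof (intro AE_I2 tendsto_eventually)
      fix x
      obtain N where "\<bar>u x\<bar> \<le> real N" using real_arch_simple by blast
      then show "eventually (\<lambda>n. ?T (real n) x = 0) sequentially"
        by (intro eventually_sequentiallyI[of N]) auto
    qed
  qed auto
  then have "eventually (\<lambda>n. (LINT x|lebesgue. ?T (real n) x) < \<delta>) sequentially"
    using \<delta>(1) by (intro order_tendstoD(2)) auto
  then obtain n where "(LINT x|lebesgue. ?T (real n) x) < \<delta>" by (auto simp: eventually_sequentially)
  then obtain A where A: "A \<ge> 0" "(LINT x|lebesgue. ?T A x) \<le> \<delta>" by (intro that[of "real n"]) auto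
  \<comment> \<open>The test function \<open>b = u * trunc^4\<close> matches
    \<open>z = u^2 * trunc^2\<close>: \<open>|grad z|^2\<close> is at most 8 times the tested
    integrand, and \<open>|h(u) * b|\<close> is at most \<open>C * |u|^(2p-4) * z^2\<close>.\<close>
  let ?z = "\<lambda>k t. t\<^sup>2 * (trunc k t)\<^sup>2" and ?z' = "\<lambda>k t. 2 * t * (trunc k t)\<^sup>2 + t\<^sup>2 * (2 * trunc k t * trunc' k t)"
  let ?b = "\<lambda>k t. t * trunc k t ^ 4" and ?b' = "\<lambda>k t. trunc k t ^ 4 + t * (4 * trunc k t ^ 3 * trunc' k t)"
  let ?Y = "\<lambda>k. LINT x|lebesgue. (norm (?z' k (u x) *\<^sub>R G x))\<^sup>2"
  \<comment> \<open>What \<open>y <= 8 * C * A^4 * I + (y + 1) / 2\<close> yields for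
    \<open>y\<close>, where \<open>I\<close> is the integral \<open>?I\<close>.\<close>
  define Y0 where "Y0 = 16 * C * A ^ 4 * ?I + 1"
  have I0: "0 \<le> ?I" by (simp add: integral_nonneg_AE)
  have Y0: "Y0 > 0" using I0 A C_pos unfolding Y0_def by (intro add_nonneg_pos mult_nonneg_nonneg) auto
  have zz: "\<bar>?z' k t\<bar> \<le> 4 * (\<bar>t\<bar> * (trunc k t)\<^sup>2)" for k t
  proof -
    have "\<bar>t\<^sup>2 * (2 * trunc k t * trunc' k t)\<bar> = 2 * \<bar>t\<bar> * \<bar>trunc k t\<bar> * (\<bar>t\<bar> * trunc' k t)"
      using trunc'_pos[of k t] by (simp add: abs_mult power2_eq_square)
    also have "\<dots> \<le> 2 * \<bar>t\<bar> * \<bar>trunc k t\<bar> * \<bar>trunc k t\<bar>"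
      by (intro mult_left_mono abs_mult_trunc'_le) auto
    finally have "\<bar>t\<^sup>2 * (2 * trunc k t * trunc' k t)\<bar> \<le> 2 * (\<bar>t\<bar> * (trunc k t)\<^sup>2)" by (simp add: power2_eq_square mult.assoc)
    moreover have "\<bar>2 * t * (trunc k t)\<^sup>2\<bar> = 2 * (\<bar>t\<bar> * (trunc k t)\<^sup>2)" by (simp add: abs_mult)
    ultimately show ?thesis using abs_triangle_ineq[of "2 * t * (trunc k t)\<^sup>2" "t\<^sup>2 * (2 * trunc k t * trunc' k t)"] by linarith
  qed
  have b'_ge: "trunc k t ^ 4 \<le> ?b' k t" for k t
  proof -
    have "t * (4 * trunc k t ^ 3 * trunc' k t) = 4 * (trunc k t * t) * (trunc k t)\<^sup>2 * trunc' k t"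
      by (simp add: power2_eq_square power3_eq_cube)
    also have "\<dots> \<ge> 0" using trunc'_pos[of k t] by (intro mult_nonneg_nonneg[OF mult_nonneg_nonneg[OF mult_nonneg_nonneg[OF _ trunc_sgn]]]) auto
    finally show ?thesis by simp
  qed
  have t2: "(trunc k t)\<^sup>2 \<le> (real (Suc k))\<^sup>2" for k t
    using power_mono[OF abs_trunc_bound[of k t], of 2] by simp
  have t4: "trunc k t ^ 4 \<le> real (Suc k) ^ 4" for k t
    using power_mono[OF abs_trunc_bound[of k t], of 4] by simp
  have dz: "(?z k has_real_derivative ?z' k t) (at t)" for k t
    using DERIV_trunc[of k t] by (auto intro!: derivative_eq_intros simp: power2_eq_square)
  have db: "(?b k has_real_derivative ?b' k t) (at t)" for k t
    using DERIV_trunc[of k t] by (auto intro!: derivative_eq_intros)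
  have cz: "continuous_on UNIV (?z' k)" "continuous_on UNIV (?b' k)" for k
    by (intro continuous_intros continuous_on_trunc continuous_on_trunc')+
  have gz: "has_weak_gradient (\<lambda>x. ?z k (u x)) (\<lambda>x. ?z' k (u x) *\<^sub>R G x)" for k
  proof (rule has_weak_gradient_chain[OF wg dz cz(1), where E = "\<lambda>t. (real (Suc k))\<^sup>2 * t\<^sup>2" and D = "\<lambda>t. 4 * (real (Suc k))\<^sup>2 * \<bar>t\<bar>"])
    fix s t :: real assume st: "\<bar>s\<bar> \<le> \<bar>t\<bar>"
    have "s\<^sup>2 * (trunc k s)\<^sup>2 \<le> t\<^sup>2 * (real (Suc k))\<^sup>2"
      using st by (intro mult_mono t2) (auto simp: abs_le_square_iff)
    then show "\<bar>?z k s\<bar> \<le> (real (Suc k))\<^sup>2 * t\<^sup>2" by (simp add: mult.commute del: of_nat_Suc)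
    have "\<bar>s\<bar> * (trunc k s)\<^sup>2 \<le> \<bar>t\<bar> * (real (Suc k))\<^sup>2" using st by (intro mult_mono t2) auto
    then show "\<bar>?z' k s\<bar> \<le> 4 * (real (Suc k))\<^sup>2 * \<bar>t\<bar>" using zz[of s k] by (simp add: mult.commute mult.left_commute del: of_nat_Suc)
  next
    show "locally_integrable (\<lambda>x. (real (Suc k))\<^sup>2 * (u x)\<^sup>2)"
      using u2 by (intro integrable_imp_locally_integrable integrable_mult_right) auto
    show "locally_integrable (\<lambda>x. 4 * (real (Suc k))\<^sup>2 * \<bar>u x\<bar> * norm (G x))"
      using integrable_mult_right[OF integrable_uG, of "4 * (real (Suc k))\<^sup>2"]
      by (intro integrable_imp_locally_integrable) (simp add: mult.assoc)
  qed
  have z2: "integrable lebesgue (\<lambda>x. (?z k (u x))\<^sup>2)" for k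
  proof (rule Bochner_Integration.integrable_bound[of _ "\<lambda>x. real (Suc k) ^ 4 * (u x) ^ 4"])
    show "AE x in lebesgue. norm ((?z k (u x))\<^sup>2) \<le> norm (real (Suc k) ^ 4 * (u x) ^ 4)"
    proof (intro AE_I2)
      fix x
      have "(?z k (u x))\<^sup>2 = trunc k (u x) ^ 4 * u x ^ 4" by (simp add: power_mult_distrib mult.commute)
      also have "\<dots> \<le> real (Suc k) ^ 4 * u x ^ 4" by (intro mult_right_mono t4) auto
      finally show "norm ((?z k (u x))\<^sup>2) \<le> norm (real (Suc k) ^ 4 * (u x) ^ 4)" by simp
    qed
  qed (use integrable_u4 in auto)
  have test: "integrable lebesgue (\<lambda>x. ?b' k (u x) * (1 + 2 * (u x)\<^sup>2) * (norm (G x))\<^sup>2)"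
    "(LINT x|lebesgue. ?b' k (u x) * (1 + 2 * (u x)\<^sup>2) * (norm (G x))\<^sup>2) \<le> (LINT x|lebesgue. \<bar>h (u x) * ?b k (u x)\<bar>)" for k
  proof -
    have 1: "0 \<le> ?b' k t" for t by (rule order_trans[OF _ b'_ge]) simp
    have 2: "\<bar>?b k t\<bar> \<le> real (Suc k) ^ 4 * \<bar>t\<bar>" for t
      using mult_right_mono[OF t4[of k t], of "\<bar>t\<bar>"] by (simp add: abs_mult mult.commute del: of_nat_Suc)
    have 3: "0 \<le> ?b k t * t" for t
    proof -
      have e: "?b k t * t = t\<^sup>2 * trunc k t ^ 4" by (simp add: power2_eq_square)
      show ?thesis unfolding e by simp
    qed
    show "integrable lebesgue (\<lambda>x. ?b' k (u x) * (1 + 2 * (u x)\<^sup>2) * (norm (G x))\<^sup>2)"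
      "(LINT x|lebesgue. ?b' k (u x) * (1 + 2 * (u x)\<^sup>2) * (norm (G x))\<^sup>2) \<le> (LINT x|lebesgue. \<bar>h (u x) * ?b k (u x)\<bar>)"
      by (rule test_linear[OF db cz(2) 1 2 3])+
  qed
  have zb: "(norm (?z' k (u x) *\<^sub>R G x))\<^sup>2 \<le> 8 * (?b' k (u x) * (1 + 2 * (u x)\<^sup>2) * (norm (G x))\<^sup>2)" for k x
  proof -
    have "\<bar>?z' k (u x)\<bar>\<^sup>2 \<le> (4 * (\<bar>u x\<bar> * (trunc k (u x))\<^sup>2))\<^sup>2" by (intro power_mono zz) auto
    also have "\<dots> = 16 * (u x)\<^sup>2 * trunc k (u x) ^ 4" by (simp add: power_mult_distrib)
    also have "\<dots> \<le> 8 * (1 + 2 * (u x)\<^sup>2) * ?b' k (u x)"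
      by (rule mult_mono[OF _ b'_ge]) auto
    finally have "\<bar>?z' k (u x)\<bar>\<^sup>2 * (norm (G x))\<^sup>2 \<le> 8 * (1 + 2 * (u x)\<^sup>2) * ?b' k (u x) * (norm (G x))\<^sup>2"
      by (intro mult_right_mono) auto
    moreover have "(norm (?z' k (u x) *\<^sub>R G x))\<^sup>2 = \<bar>?z' k (u x)\<bar>\<^sup>2 * (norm (G x))\<^sup>2"
      by (simp only: norm_scaleR power_mult_distrib real_norm_def)
    ultimately show ?thesis by (simp only: mult_ac)
  qed
  have Yi: "integrable lebesgue (\<lambda>x. (norm (?z' k (u x) *\<^sub>R G x))\<^sup>2)" for k
  proof (rule Bochner_Integration.integrable_bound[OF integrable_mult_right[OF test(1)[of k], of 8]])
    show "AE x in lebesgue. norm ((norm (?z' k (u x) *\<^sub>R G x))\<^sup>2) \<le> norm (8 * (?b' k (u x) * (1 + 2 * (u x)\<^sup>2) * (norm (G x))\<^sup>2))"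
    proof (intro AE_I2)
      fix x
      have "norm ((norm (?z' k (u x) *\<^sub>R G x))\<^sup>2) = (norm (?z' k (u x) *\<^sub>R G x))\<^sup>2" by (simp only: real_norm_def abs_power2)
      also note zb[of x k]
      also have "8 * (?b' k (u x) * (1 + 2 * (u x)\<^sup>2) * (norm (G x))\<^sup>2) \<le> norm (8 * (?b' k (u x) * (1 + 2 * (u x)\<^sup>2) * (norm (G x))\<^sup>2))"
        unfolding real_norm_def by (rule abs_ge_self)
      finally show "norm ((norm (?z' k (u x) *\<^sub>R G x))\<^sup>2) \<le> norm (8 * (?b' k (u x) * (1 + 2 * (u x)\<^sup>2) * (norm (G x))\<^sup>2))" .
    qed
  qed measurable
  have Yb: "?Y k \<le> Y0" for k
  proof -
    define y where "y = ?Y k"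
    have Ynn: "0 \<le> y" unfolding y_def by (intro integral_nonneg_AE AE_I2 zero_le_power2)
    \<comment> \<open>The shift by 1 supplies the strictly positive bound that the Sobolev and
      Holder inequalities ask for.\<close>
    have y1: "?Y k \<le> y + 1" unfolding y_def by linarith
    have y2: "0 < y + 1" using Ynn by linarith
    have zi: "integrable lebesgue (\<lambda>x. \<bar>?z k (u x)\<bar> powr p)" "(LINT x|lebesgue. \<bar>?z k (u x)\<bar> powr p) \<le> S * (y + 1) powr (p / 2)"
      by (rule sobolevD[OF gz z2 Yi y1 y2])+
    let ?X = "LINT x|lebesgue. \<bar>h (u x) * ?b k (u x)\<bar>"
    let ?P = "\<lambda>x. ?T A x powr \<theta> * (\<bar>?z k (u x)\<bar> powr p) powr (2 / p)"
    have H: "integrable lebesgue ?P" "(LINT x|lebesgue. ?P x) \<le> \<delta> powr \<theta> * (S * (y + 1) powr (p / 2)) powr (2 / p)"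
      by (rule Holder_bound[OF Ti[of A] _ A(2) \<delta>(1) zi(1) _ zi(2) _ \<theta>(1-3)]; use S_pos Ynn in auto)+
    have SY: "(S * (y + 1) powr (p / 2)) powr (2 / p) = S powr (2 / p) * (y + 1)"
      using p_gt_2 Ynn by (simp add: powr_mult powr_powr)
    have pt: "\<bar>h (u x) * ?b k (u x)\<bar> \<le> C * (A ^ 4 * \<bar>u x\<bar> powr (2 * p) + ?P x)" for x
    proof (cases "u x = 0")
      case False
      have z2p: "(\<bar>?z k (u x)\<bar> powr p) powr (2 / p) = u x ^ 4 * trunc k (u x) ^ 4"
      proof -
        have "trunc k (u x) \<noteq> 0" using False trunc_weight_pos[of k "u x"] by (simp add: trunc_def)
        then have "\<bar>?z k (u x)\<bar> > 0" using False by simp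
        then have "(\<bar>?z k (u x)\<bar> powr p) powr (2 / p) = \<bar>?z k (u x)\<bar> ^ 2"
          using p_gt_2 by (simp add: powr_powr)
        then show ?thesis by (simp add: power_mult_distrib)
      qed
      have "\<bar>h (u x) * ?b k (u x)\<bar> \<le> C * \<bar>u x\<bar> powr (2 * p - 1) * (\<bar>u x\<bar> * trunc k (u x) ^ 4)"
        using mult_right_mono[OF h_growth[of "u x"], of "\<bar>u x\<bar> * trunc k (u x) ^ 4"] by (simp add: abs_mult)
      also have "\<dots> = C * ((\<bar>u x\<bar> powr (2 * p - 1) * \<bar>u x\<bar> powr 1) * trunc k (u x) ^ 4)" by simp
      also have "\<bar>u x\<bar> powr (2 * p - 1) * \<bar>u x\<bar> powr 1 = \<bar>u x\<bar> powr (2 * p)" by (simp only: powr_add[symmetric] diff_add_cancel)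
      finally have 1: "\<bar>h (u x) * ?b k (u x)\<bar> \<le> C * (\<bar>u x\<bar> powr (2 * p) * trunc k (u x) ^ 4)" .
      \<comment> \<open>On \<open>|u| > A\<close> the potential is left to Holder's inequality;
        elsewhere \<open>|trunc k u| <= |u| <= A\<close>.\<close>
      have 2: "\<bar>u x\<bar> powr (2 * p) * trunc k (u x) ^ 4 \<le> A ^ 4 * \<bar>u x\<bar> powr (2 * p) + ?P x"
      proof (cases "\<bar>u x\<bar> > A")
        case True
        have "\<bar>u x\<bar> powr (2 * p) = \<bar>u x\<bar> powr (2 * p - 4) * \<bar>u x\<bar> powr 4" by (simp only: powr_add[symmetric] diff_add_cancel)
        also have "\<bar>u x\<bar> powr 4 = u x ^ 4" using False by simp
        also have "\<bar>u x\<bar> powr (2 * p - 4) = ?T A x powr \<theta>" using True \<theta>(4) by (simp add: powr_powr)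
        finally have e: "\<bar>u x\<bar> powr (2 * p) = ?T A x powr \<theta> * u x ^ 4" .
        have "\<bar>u x\<bar> powr (2 * p) * trunc k (u x) ^ 4 = ?T A x powr \<theta> * u x ^ 4 * trunc k (u x) ^ 4"
          by (rule arg_cong[OF e])
        also have "\<dots> = ?P x" by (simp only: z2p mult.assoc)
        finally have "\<bar>u x\<bar> powr (2 * p) * trunc k (u x) ^ 4 = ?P x" .
        then show ?thesis using A(1) by simp
      next
        case F: False
        then have "trunc k (u x) ^ 4 \<le> A ^ 4"
          using power_mono[of "\<bar>trunc k (u x)\<bar>" A 4] abs_trunc_le[of k "u x"] by simp
        then have "\<bar>u x\<bar> powr (2 * p) * trunc k (u x) ^ 4 \<le> \<bar>u x\<bar> powr (2 * p) * A ^ 4" by (intro mult_left_mono) auto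
        then show ?thesis using F by (simp add: mult.commute)
      qed
      have "C * (\<bar>u x\<bar> powr (2 * p) * trunc k (u x) ^ 4) \<le> C * (A ^ 4 * \<bar>u x\<bar> powr (2 * p) + ?P x)"
        using C_pos by (intro mult_left_mono 2) auto
      with 1 show ?thesis by linarith
    qed (use C_pos A(1) in auto)
    have di: "integrable lebesgue (\<lambda>x. C * (A ^ 4 * \<bar>u x\<bar> powr (2 * p) + ?P x))"
      by (intro integrable_mult_right Bochner_Integration.integrable_add integrable_u_2p H(1))
    have Xi: "integrable lebesgue (\<lambda>x. \<bar>h (u x) * ?b k (u x)\<bar>)"
      by (rule Bochner_Integration.integrable_bound[OF di])
        (use order_trans[OF pt abs_ge_self] in \<open>auto simp del: abs_mult\<close>)
    have "?X \<le> (LINT x|lebesgue. C * (A ^ 4 * \<bar>u x\<bar> powr (2 * p) + ?P x))"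
      by (rule integral_mono[OF Xi di pt])
    also have "\<dots> = C * (A ^ 4 * ?I + (LINT x|lebesgue. ?P x))"
      by (simp only: integral_mult_right_zero Bochner_Integration.integral_add[OF integrable_mult_right[OF integrable_u_2p] H(1)])
    also have "\<dots> \<le> C * (A ^ 4 * ?I + \<delta> powr \<theta> * (S powr (2 / p) * (y + 1)))"
      using H(2) C_pos unfolding SY by (intro mult_left_mono add_left_mono) auto
    finally have X: "8 * ?X \<le> 8 * C * A ^ 4 * ?I + 8 * C * (\<delta> powr \<theta> * S powr (2 / p)) * (y + 1)"
      by (simp add: algebra_simps)
    have "y \<le> (LINT x|lebesgue. 8 * (?b' k (u x) * (1 + 2 * (u x)\<^sup>2) * (norm (G x))\<^sup>2))"
      unfolding y_def by (rule integral_mono[OF Yi integrable_mult_right[OF test(1)] zb])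
    also have "\<dots> \<le> 8 * ?X" unfolding integral_mult_right_zero using test(2)[of k] by linarith
    also note X
    finally have "y \<le> 8 * C * A ^ 4 * ?I + (1 / 2) * (y + 1)" unfolding \<delta>(2) .
    then have "y \<le> Y0" unfolding Y0_def by argo
    then show ?thesis unfolding y_def .
  qed
  have lz: "(\<lambda>k. ?z' k t) \<longlonglongrightarrow> 4 * t ^ 3" for t
  proof -
    have "(\<lambda>k. ?z' k t) \<longlonglongrightarrow> 2 * t * t\<^sup>2 + t\<^sup>2 * (2 * t * 1)"
      by (intro tendsto_add tendsto_mult tendsto_power tendsto_const trunc_tendsto trunc'_tendsto)
    moreover have "2 * t * t\<^sup>2 + t\<^sup>2 * (2 * t * 1) = 4 * t ^ 3" by (simp add: power2_eq_square power3_eq_cube)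
    ultimately show ?thesis by (simp only:)
  qed
  \<comment> \<open>In the limit \<open>z\<close> becomes \<open>u^4\<close> with gradient
    \<open>4 * u^3 * G\<close>; the Sobolev inequality for \<open>z\<close> gives the power
    \<open>4p\<close> afterwards.\<close>
  have "integrable lebesgue (\<lambda>x. (norm ((4 * (u x) ^ 3) *\<^sub>R G x))\<^sup>2)"
  proof (rule Fatou_bound(1)[OF Yi _ _ _ eventuallyI[OF Yb]])
    show "AE x in lebesgue. (\<lambda>k. (norm (?z' k (u x) *\<^sub>R G x))\<^sup>2) \<longlonglongrightarrow> (norm ((4 * (u x) ^ 3) *\<^sub>R G x))\<^sup>2"
      by (intro AE_I2 tendsto_power tendsto_norm tendsto_scaleR tendsto_const lz)
  qed auto
  moreover have "(norm ((4 * (u x) ^ 3) *\<^sub>R G x))\<^sup>2 = 16 * ((u x) ^ 6 * (norm (G x))\<^sup>2)" for x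
    by (simp add: power_mult_distrib flip: power_mult)
  ultimately show "integrable lebesgue (\<lambda>x. (u x) ^ 6 * (norm (G x))\<^sup>2)" by simp
  note s = sobolevD[OF gz z2 Yi Yb Y0]
  have "integrable lebesgue (\<lambda>x. \<bar>(u x)\<^sup>2 * (u x)\<^sup>2\<bar> powr p)"
  proof (rule Fatou_bound(1)[OF s(1) _ _ _ eventuallyI[OF s(2)]])
    show "AE x in lebesgue. (\<lambda>k. \<bar>?z k (u x)\<bar> powr p) \<longlonglongrightarrow> \<bar>(u x)\<^sup>2 * (u x)\<^sup>2\<bar> powr p"
    proof (intro AE_I2)
      fix x
      show "(\<lambda>k. \<bar>?z k (u x)\<bar> powr p) \<longlonglongrightarrow> \<bar>(u x)\<^sup>2 * (u x)\<^sup>2\<bar> powr p"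
        using p_gt_2 by (intro tendsto_powr' tendsto_rabs tendsto_mult tendsto_power trunc_tendsto tendsto_const) auto
    qed
  qed auto
  moreover have "\<bar>(u x)\<^sup>2 * (u x)\<^sup>2\<bar> powr p = \<bar>u x\<bar> powr (4 * p)" for x
  proof (cases "u x = 0")
    case False
    then have "\<bar>(u x)\<^sup>2 * (u x)\<^sup>2\<bar> = \<bar>u x\<bar> powr 4" by (simp flip: power_add)
    then show ?thesis by (simp only: powr_powr)
  qed simp
  ultimately show "integrable lebesgue (\<lambda>x. \<bar>u x\<bar> powr (4 * p))" by simp
qed

end

section \<open>The Pohozaev identity\<close>

lemma GDERIV_sum:
  "finite A \<Longrightarrow> (\<And>i. i \<in> A \<Longrightarrow> GDERIV (f i) x :> g i) \<Longrightarrow> GDERIV (\<lambda>x. \<Sum>i\<in>A. f i x) x :> (\<Sum>i\<in>A. g i)"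
  unfolding gderiv_def inner_sum_right by (rule has_derivative_sum) simp

text \<open>Contains no derivative of \<open>V\<close>: in the divergence behind it the second-order
  terms cancel by symmetry of the Jacobian or combine into \<open>div V = - g\<close>. It therefore
  makes sense for a Sobolev function with gradient \<open>V\<close>.\<close>

definition pohozaev_density ::
    "real ^ 'n \<Rightarrow> real \<Rightarrow> real ^ 'n \<Rightarrow> real \<Rightarrow> real ^ 'n \<Rightarrow> real" where
  "pohozaev_density x g V \<eta> k = (norm V)\<^sup>2 * \<eta> + (x \<bullet> V) * (V \<bullet> k)
     - (norm V)\<^sup>2 / 2 * (real CARD('n) * \<eta> + x \<bullet> k) - g * (x \<bullet> V) * \<eta>"

text \<open>The integrand is the divergence of \<open>(x \<bullet> P) \<eta> P - (norm P)\<^sup>2 / 2 * \<eta> x\<close>.\<close>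

lemma pohozaev_smooth:
  fixes P :: "real ^ 'n \<Rightarrow> real ^ 'n" and D :: "'n \<Rightarrow> real ^ 'n \<Rightarrow> real ^ 'n"
  assumes P: "\<And>i x. GDERIV (\<lambda>x. P x $ i) x :> D i x" and Dc: "\<And>i. continuous_on UNIV (D i)"
    and sym: "\<And>i j x. D i x $ j = D j x $ i" and div: "\<And>x. (\<Sum>i\<in>UNIV. D i x $ i) = - g x"
    and \<eta>: "\<And>x. GDERIV \<eta> x :> k x" and kc: "continuous_on UNIV k" and R: "\<And>x. norm x > R \<Longrightarrow> \<eta> x = 0"
  shows "(LINT x|lebesgue. pohozaev_density x (g x) (P x) (\<eta> x) (k x)) = 0"
proof -
  define q where "q x = (\<Sum>j\<in>UNIV. x $ j * P x $ j)" for x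
  define m where "m x = (\<Sum>j\<in>UNIV. 1 / 2 * (P x $ j * P x $ j))" for x
  define A where "A x = (\<Sum>j\<in>UNIV. x $ j *\<^sub>R D j x + P x $ j *\<^sub>R axis j 1)" for x
  define B where "B x = (\<Sum>j\<in>UNIV. P x $ j *\<^sub>R D j x)" for x
  define Y where "Y i x = (P x $ i * q x - m x * x $ i) * \<eta> x" for i x
  define Y' where "Y' i x = (P x $ i * q x - m x * x $ i) *\<^sub>R k x +
      \<eta> x *\<^sub>R ((P x $ i *\<^sub>R A x + q x *\<^sub>R D i x) - (m x *\<^sub>R axis i 1 + x $ i *\<^sub>R B x))" for i x
  have q: "GDERIV q x :> A x" for x
    unfolding q_def[abs_def] A_def by (intro GDERIV_sum GDERIV_mult GDERIV_component P) simp
  have m: "GDERIV m x :> B x" for x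
  proof -
    have "GDERIV m x :> (\<Sum>j\<in>UNIV. (1 / 2) *\<^sub>R (P x $ j *\<^sub>R D j x + P x $ j *\<^sub>R D j x) + (P x $ j * P x $ j) *\<^sub>R 0)"
      unfolding m_def[abs_def] by (intro GDERIV_sum GDERIV_mult GDERIV_const P) simp
    moreover have "(1 / 2) *\<^sub>R (v + v) + c *\<^sub>R 0 = v" for v :: "real ^ 'n" and c :: real by (simp flip: scaleR_2)
    ultimately show ?thesis unfolding B_def by (simp only:)
  qed
  have Y: "GDERIV (Y i) x :> Y' i x" for i x
    unfolding Y_def[abs_def] Y'_def by (intro GDERIV_mult GDERIV_diff P GDERIV_component q m \<eta>)
  have c: "continuous_on UNIV (\<lambda>x. P x $ i)" "continuous_on UNIV \<eta>" "continuous_on UNIV q" "continuous_on UNIV m" for i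
    by (rule GDERIV_continuous_on[OF P] GDERIV_continuous_on[OF \<eta>] GDERIV_continuous_on[OF q] GDERIV_continuous_on[OF m])+
  have AB: "continuous_on UNIV A" "continuous_on UNIV B"
    unfolding A_def[abs_def] B_def[abs_def] by (intro continuous_intros c Dc)+
  have Yc: "continuous_on UNIV (Y' i)" for i
    unfolding Y'_def[abs_def] by (intro continuous_intros c Dc AB kc)
  have Y0: "Y i x = 0" if "norm x > R" for i x using R[OF that] by (simp add: Y_def)
  have Y'0: "Y' i x = 0" if "norm x > R" for i x by (rule GDERIV_supp[OF Y Y0 that])
  have Yi: "integrable lebesgue (Y' i)" for i by (rule integrable_continuous_supp[OF Yc Y'0])
  have z: "(LINT x|lebesgue. Y' i x) = 0" for i by (rule integral_GDERIV_eq_0[OF Y Yc Y0])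
  have "(LINT x|lebesgue. (\<Sum>i\<in>UNIV. Y' i x $ i)) = (\<Sum>i\<in>UNIV. (LINT x|lebesgue. Y' i x $ i))"
    by (rule Bochner_Integration.integral_sum) (rule integral_vec_nth(1)[OF Yi])
  also have "\<dots> = 0" using z by (simp add: integral_vec_nth(2)[OF Yi])
  finally have "(LINT x|lebesgue. (\<Sum>i\<in>UNIV. Y' i x $ i)) = 0" .
  moreover have "(\<Sum>i\<in>UNIV. Y' i x $ i) = pohozaev_density x (g x) (P x) (\<eta> x) (k x)" for x
  proof -
    have qx: "q x = x \<bullet> P x" by (simp add: q_def inner_vec_def)
    have mx: "m x = (norm (P x))\<^sup>2 / 2"
      by (simp add: m_def inner_vec_def power2_norm_eq_inner sum_distrib_left sum_divide_distrib)
    have Ai: "A x $ i = P x $ i + (\<Sum>j\<in>UNIV. x $ j * D j x $ i)" for i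
    proof -
      have "A x $ i = (\<Sum>j\<in>UNIV. x $ j * D j x $ i) + (\<Sum>j\<in>UNIV. if j = i then P x $ j else 0)"
        unfolding A_def by (simp add: sum.distrib axis_def if_distrib cong: if_cong)
      then show ?thesis by simp
    qed
    \<comment> \<open>The one place where symmetry of the Jacobian enters: it identifies the
      second-order part of \<open>P . grad (x . P)\<close> with
      \<open>x . grad (|P|^2 / 2)\<close>.\<close>
    have cross: "(\<Sum>i\<in>UNIV. P x $ i * (\<Sum>j\<in>UNIV. x $ j * D j x $ i)) = (\<Sum>i\<in>UNIV. x $ i * B x $ i)"
    proof -
      have e: "P x $ i * (x $ j * D j x $ i) = x $ j * (P x $ i * D i x $ j)" for i j
        unfolding sym[of j x i] by (rule mult.left_commute)
      have "(\<Sum>i\<in>UNIV. P x $ i * (\<Sum>j\<in>UNIV. x $ j * D j x $ i)) = (\<Sum>i\<in>UNIV. \<Sum>j\<in>UNIV. P x $ i * (x $ j * D j x $ i))"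
        by (simp add: sum_distrib_left)
      also have "\<dots> = (\<Sum>j\<in>UNIV. \<Sum>i\<in>UNIV. x $ j * (P x $ i * D i x $ j))"
        unfolding e by (rule sum.swap)
      also have "\<dots> = (\<Sum>j\<in>UNIV. x $ j * B x $ j)" by (simp add: B_def sum_distrib_left)
      finally show ?thesis .
    qed
    have "(\<Sum>i\<in>UNIV. Y' i x $ i) = (\<Sum>i\<in>UNIV. q x * (P x $ i * k x $ i) - m x * (x $ i * k x $ i)
        + \<eta> x * (P x $ i * P x $ i) + \<eta> x * (P x $ i * (\<Sum>j\<in>UNIV. x $ j * D j x $ i)) + (\<eta> x * q x) * D i x $ i
        - \<eta> x * m x - \<eta> x * (x $ i * B x $ i))"
      unfolding Y'_def by (rule sum.cong) (simp_all add: Ai axis_def algebra_simps)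
    also have "\<dots> = q x * (P x \<bullet> k x) - m x * (x \<bullet> k x) + \<eta> x * (P x \<bullet> P x)
        + \<eta> x * (\<Sum>i\<in>UNIV. P x $ i * (\<Sum>j\<in>UNIV. x $ j * D j x $ i)) + \<eta> x * q x * (- g x)
        - real CARD('n) * (\<eta> x * m x) - \<eta> x * (\<Sum>i\<in>UNIV. x $ i * B x $ i)"
      unfolding div[symmetric]
      by (simp only: sum.distrib sum_subtractf sum_distrib_left[symmetric] inner_vec_def inner_real_def sum_constant)
        (simp only: mult.left_commute)
    also have "\<dots> = pohozaev_density x (g x) (P x) (\<eta> x) (k x)"
      unfolding cross pohozaev_density_def qx mx power2_norm_eq_inner by (simp add: algebra_simps)
    finally show ?thesis .
  qed
  ultimately show ?thesis by simp
qed

text \<open>Every term is quadratic in \<open>(g, V)\<close>, so a common bound \<open>D\<close> of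
  the two squares suffices; the other factor involves only \<open>x\<close> and the cutoff.\<close>

lemma pohozaev_density_bound:
  fixes x V k :: "real ^ 'n" and g \<eta> :: real
  assumes V: "(norm V)\<^sup>2 \<le> D" and g: "g\<^sup>2 \<le> D"
  shows "\<bar>pohozaev_density x g V \<eta> k\<bar> \<le> D * ((1 + real CARD('n)) * \<bar>\<eta>\<bar> + 2 * (norm x * norm k) + 2 * (norm x * \<bar>\<eta>\<bar>))"
proof -
  let ?N = "real CARD('n)"
  have gV: "\<bar>g\<bar> * norm V \<le> 2 * D" using abs_mult_le_squares[of g "norm V"] V g by simp
  have D: "D \<ge> 0" using V by (rule order_trans[OF zero_le_power2])
  have xV: "\<bar>x \<bullet> V\<bar> \<le> norm x * norm V" "\<bar>V \<bullet> k\<bar> \<le> norm V * norm k" "\<bar>x \<bullet> k\<bar> \<le> norm x * norm k"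
    by (rule Cauchy_Schwarz_ineq2)+
  have 1: "\<bar>(norm V)\<^sup>2 * \<eta>\<bar> \<le> D * \<bar>\<eta>\<bar>" unfolding abs_mult using V by (intro mult_right_mono) auto
  have "\<bar>(x \<bullet> V) * (V \<bullet> k)\<bar> \<le> (norm x * norm V) * (norm V * norm k)"
    unfolding abs_mult by (rule mult_mono[OF xV(1,2)]) auto
  also have "\<dots> = (norm V)\<^sup>2 * (norm x * norm k)" by (simp add: power2_eq_square mult_ac)
  also have "\<dots> \<le> D * (norm x * norm k)" using V by (intro mult_right_mono) auto
  finally have 2: "\<bar>(x \<bullet> V) * (V \<bullet> k)\<bar> \<le> D * (norm x * norm k)" .
  have "\<bar>?N * \<eta> + x \<bullet> k\<bar> \<le> ?N * \<bar>\<eta>\<bar> + norm x * norm k"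
    using abs_triangle_ineq[of "?N * \<eta>" "x \<bullet> k"] xV(3) by (simp add: abs_mult)
  then have "\<bar>(norm V)\<^sup>2 / 2 * (?N * \<eta> + x \<bullet> k)\<bar> \<le> D * (?N * \<bar>\<eta>\<bar> + norm x * norm k)"
    unfolding abs_mult using V D by (intro mult_mono) auto
  then have 3: "\<bar>(norm V)\<^sup>2 / 2 * (?N * \<eta> + x \<bullet> k)\<bar> \<le> D * (?N * \<bar>\<eta>\<bar>) + D * (norm x * norm k)"
    by (simp only: distrib_left)
  have "\<bar>g * (x \<bullet> V) * \<eta>\<bar> \<le> \<bar>g\<bar> * (norm x * norm V) * \<bar>\<eta>\<bar>"
    unfolding abs_mult by (intro mult_right_mono mult_left_mono xV) auto
  also have "\<dots> = (\<bar>g\<bar> * norm V) * (norm x * \<bar>\<eta>\<bar>)" by (simp add: mult_ac)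
  also have "\<dots> \<le> (2 * D) * (norm x * \<bar>\<eta>\<bar>)" by (rule mult_right_mono[OF gV]) simp
  finally have 4: "\<bar>g * (x \<bullet> V) * \<eta>\<bar> \<le> 2 * (D * (norm x * \<bar>\<eta>\<bar>))" by simp
  have "D * ((1 + ?N) * \<bar>\<eta>\<bar> + 2 * (norm x * norm k) + 2 * (norm x * \<bar>\<eta>\<bar>)) =
      D * \<bar>\<eta>\<bar> + D * (?N * \<bar>\<eta>\<bar>) + 2 * (D * (norm x * norm k)) + 2 * (D * (norm x * \<bar>\<eta>\<bar>))"
    by (simp add: algebra_simps)
  then show ?thesis unfolding pohozaev_density_def using 1 2 3 4 by linarith
qed

text \<open>Mollifications satisfy the identity exactly. Mollifying the squares of
  \<open>norm V\<close> and \<open>g\<close> along with \<open>g\<close> gives, by Jensen, one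
  majorant for the squares of both mollified functions; this is where local square integrability of
  the right-hand side is used.\<close>

lemma pohozaev_cutoff:
  fixes V :: "real ^ 'n \<Rightarrow> real ^ 'n" and g v \<eta> :: "real ^ 'n \<Rightarrow> real"
  assumes w: "has_weak_gradient v V" and g: "locally_integrable g" and eq: "weak_divergence V g"
    and V2: "locally_integrable (\<lambda>x. (norm (V x))\<^sup>2)" and g2: "locally_integrable (\<lambda>x. (g x)\<^sup>2)"
    and \<eta>: "\<And>x. GDERIV \<eta> x :> k x" and kc: "continuous_on UNIV k" and R: "\<And>x. norm x > R \<Longrightarrow> \<eta> x = 0"
  shows "integrable lebesgue (\<lambda>x. pohozaev_density x (g x) (V x) (\<eta> x) (k x))"
    "(LINT x|lebesgue. pohozaev_density x (g x) (V x) (\<eta> x) (k x)) = 0"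
proof -
  note V = has_weak_gradientD[OF w]
  let ?T = "\<lambda>x. (g x, (norm (V x))\<^sup>2, (g x)\<^sup>2)"
  note Vg = locally_integrable_Pair[OF V2 g2]
  note T = locally_integrable_Pair[OF g Vg]
  obtain e D where e: "\<forall>n. 0 < e n" and D: "integrable lebesgue D"
    and "AE x in lebesgue. norm x \<le> R \<longrightarrow> (\<lambda>n. conv (moll (e n)) v x) \<longlonglongrightarrow> v x"
    and lV: "AE x in lebesgue. norm x \<le> R \<longrightarrow> (\<lambda>n. conv (moll (e n)) V x) \<longlonglongrightarrow> V x"
    and lT: "AE x in lebesgue. norm x \<le> R \<longrightarrow> (\<lambda>n. conv (moll (e n)) ?T x) \<longlonglongrightarrow> ?T x"
    and bD: "AE x in lebesgue. norm x \<le> R \<longrightarrow> (\<forall>n. \<bar>conv (moll (e n)) v x\<bar> \<le> D x \<and>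
       norm (conv (moll (e n)) V x) \<le> D x \<and> norm (conv (moll (e n)) ?T x) \<le> D x)"
    using mollify_weak_gradient[OF w T, of R] .
  let ?V = "\<lambda>n. conv (moll (e n)) V" and ?g = "\<lambda>n. conv (moll (e n)) g"
  let ?D = "\<lambda>n i. conv_grad (e n) V i"
  let ?M = "\<lambda>x. (1 + real CARD('n)) * \<bar>\<eta> x\<bar> + 2 * (norm x * norm (k x)) + 2 * (norm x * \<bar>\<eta> x\<bar>)"
  have T_eq: "conv (moll (e n)) ?T x = (?g n x, conv (moll (e n)) (\<lambda>x. (norm (V x))\<^sup>2) x, conv (moll (e n)) (\<lambda>x. (g x)\<^sup>2) x)" for n x
    using conv_Pair[OF g Vg e[rule_format]] conv_Pair[OF V2 g2 e[rule_format]] by simp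
  have lg: "AE x in lebesgue. norm x \<le> R \<longrightarrow> (\<lambda>n. ?g n x) \<longlonglongrightarrow> g x"
    using lT unfolding T_eq by eventually_elim (auto dest: tendsto_fst)
  have bd: "AE x in lebesgue. norm x \<le> R \<longrightarrow> (\<forall>n. (norm (?V n x))\<^sup>2 \<le> D x \<and> (?g n x)\<^sup>2 \<le> D x)"
    using bD
  proof eventually_elim
    case (elim x)
    show ?case
    proof (intro impI allI)
      fix n assume "norm x \<le> R"
      then have "norm (conv (moll (e n)) ?T x) \<le> D x" using elim by blast
      then have n: "norm (?g n x, conv (moll (e n)) (\<lambda>x. (norm (V x))\<^sup>2) x, conv (moll (e n)) (\<lambda>x. (g x)\<^sup>2) x) \<le> D x"
        unfolding T_eq .
      have nb: "b \<le> d \<and> c \<le> d" if "norm (a, b, c) \<le> d" for a b c d :: real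
        using that norm_snd_le[of "(b, c)" a] norm_fst_le[of b c] norm_snd_le[of c b] unfolding real_norm_def by linarith
      have 1: "(norm (?V n x))\<^sup>2 \<le> conv (moll (e n)) (\<lambda>x. (norm (V x))\<^sup>2) x"
        by (rule conv_jensen[OF V(2) V2 e[rule_format]])
      have 2: "(?g n x)\<^sup>2 \<le> conv (moll (e n)) (\<lambda>x. (g x)\<^sup>2) x"
        using conv_jensen[OF g _ e[rule_format], of n x] g2 by simp
      show "(norm (?V n x))\<^sup>2 \<le> D x \<and> (?g n x)\<^sup>2 \<le> D x"
        using nb[OF n] 1 2 by linarith
    qed
  qed
  note pc = GDERIV_continuous_on[OF \<eta>, of UNIV]
  have k0: "norm x > R \<Longrightarrow> k x = 0" for x by (rule GDERIV_supp[OF \<eta> R])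
  have Mc: "continuous_on UNIV ?M" by (intro continuous_intros pc kc)
  have M0: "?M x = 0" if "norm x > R" for x using that by (simp add: R k0)
  obtain B where B: "\<And>x. norm (?M x) \<le> B" "B > 0" using continuous_supp_bounded[OF Mc M0] by blast
  have wc: "continuous_on UNIV (?V n)" "continuous_on UNIV (?g n)" for n
    using continuous_on_conv_moll[OF V(2)] continuous_on_conv_moll[OF g] e by blast+
  have [measurable]: "g \<in> borel_measurable lebesgue" "V \<in> borel_measurable lebesgue" "\<eta> \<in> borel_measurable lebesgue"
      "k \<in> borel_measurable lebesgue" "(\<lambda>x::real ^ 'n. x) \<in> borel_measurable lebesgue"
    by (rule V(4) locally_integrable_measurable[OF g] continuous_on_imp_lebesgue_measurable[OF pc]
      continuous_on_imp_lebesgue_measurable[OF kc] continuous_on_imp_lebesgue_measurable[OF continuous_on_id])+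
  have l: "AE x in lebesgue. norm x \<le> R \<longrightarrow>
      (\<lambda>n. pohozaev_density x (?g n x) (?V n x) (\<eta> x) (k x)) \<longlonglongrightarrow> pohozaev_density x (g x) (V x) (\<eta> x) (k x)"
    using lg lV
  proof eventually_elim
    case (elim x)
    show ?case
    proof
      assume n: "norm x \<le> R"
      show "(\<lambda>n. pohozaev_density x (?g n x) (?V n x) (\<eta> x) (k x)) \<longlonglongrightarrow> pohozaev_density x (g x) (V x) (\<eta> x) (k x)"
        unfolding pohozaev_density_def
        by (intro tendsto_diff tendsto_add tendsto_mult tendsto_divide tendsto_power tendsto_norm tendsto_inner tendsto_const
            elim(1)[rule_format, OF n] elim(2)[rule_format, OF n]) simp
    qed
  qed
  have Di: "integrable lebesgue (\<lambda>x. D x * B)" using D by simp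
  have b: "AE x in lebesgue. norm x \<le> R \<longrightarrow> (\<forall>n. norm (pohozaev_density x (?g n x) (?V n x) (\<eta> x) (k x)) \<le> D x * B)"
    using bd
  proof eventually_elim
    case (elim x)
    show ?case
    proof (intro impI allI)
      fix n assume "norm x \<le> R"
      then have *: "(norm (?V n x))\<^sup>2 \<le> D x" "(?g n x)\<^sup>2 \<le> D x" using elim by blast+
      have "D x * ?M x \<le> D x * B"
        using B(1)[of x] order_trans[OF zero_le_power2 *(2)] by (intro mult_left_mono) auto
      then show "norm (pohozaev_density x (?g n x) (?V n x) (\<eta> x) (k x)) \<le> D x * B"
        using pohozaev_density_bound[OF *, of x "\<eta> x" "k x"] by simp
    qed
  qed
  have m: "(\<lambda>x. pohozaev_density x (?g n x) (?V n x) (\<eta> x) (k x)) \<in> borel_measurable lebesgue" for n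
    unfolding pohozaev_density_def
    by (intro continuous_on_imp_lebesgue_measurable continuous_intros wc pc kc) auto
  have m': "(\<lambda>x. pohozaev_density x (g x) (V x) (\<eta> x) (k x)) \<in> borel_measurable lebesgue"
    unfolding pohozaev_density_def by measurable
  have z: "pohozaev_density x a b (\<eta> x) (k x) = 0" if "norm x > R" for x a b
    using that by (simp add: pohozaev_density_def R k0)
  note dc = ball_dominated_convergence[where R = R, OF m m' z z l Di b]
  have s: "(LINT x|lebesgue. pohozaev_density x (?g n x) (?V n x) (\<eta> x) (k x)) = 0" for n
    by (rule pohozaev_smooth[where D = "?D n"])
      (use GDERIV_conv_nth[OF V(2) e[rule_format]] continuous_on_conv_grad[OF V(2) e[rule_format]] kc
        conv_grad_sym[OF w e[rule_format]] conv_grad_div[OF V(2) eq e[rule_format]] \<eta> R in blast)+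
  show "integrable lebesgue (\<lambda>x. pohozaev_density x (g x) (V x) (\<eta> x) (k x))" by (rule dc(2))
  show "(LINT x|lebesgue. pohozaev_density x (g x) (V x) (\<eta> x) (k x)) = 0"
    using dc(1) unfolding s by (simp add: LIMSEQ_const_iff)
qed

section \<open>The dual equation\<close>

text \<open>The derivative of \<open>dual_inverse\<close>, that is \<open>1 / f'(v)\<close> at
  \<open>v = dual_inverse t\<close>.\<close>

definition arc_rate :: "real \<Rightarrow> real" where
  "arc_rate t = sqrt (1 + 2 * t\<^sup>2)"

lemma arc_rate:
  shows arc_rate_ge_1: "1 \<le> arc_rate t" and arc_rate_sq: "arc_rate t * arc_rate t = 1 + 2 * t\<^sup>2"
    and arc_rate_le: "arc_rate t \<le> 1 + 2 * \<bar>t\<bar>" and abs_le_arc_rate: "\<bar>t\<bar> \<le> arc_rate t"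
    and continuous_on_arc_rate: "continuous_on A arc_rate"
proof -
  show "arc_rate t \<le> 1 + 2 * \<bar>t\<bar>"
  proof -
    have "(1 + 2 * \<bar>t\<bar>)\<^sup>2 = 1 + 4 * \<bar>t\<bar> + 4 * t\<^sup>2" by (simp add: power2_sum power_mult_distrib)
    then have "1 + 2 * t\<^sup>2 \<le> (1 + 2 * \<bar>t\<bar>)\<^sup>2" by simp
    then show ?thesis unfolding arc_rate_def by (intro real_le_lsqrt) auto
  qed
  show "\<bar>t\<bar> \<le> arc_rate t" unfolding arc_rate_def by (intro real_le_rsqrt) simp
qed (auto simp: arc_rate_def[abs_def] intro!: continuous_intros)

lemma arc_rate_pos: "0 < arc_rate t"
  using arc_rate_ge_1[of t] by linarith

lemma DERIV_arc_rate: "(arc_rate has_real_derivative 2 * t / arc_rate t) (at t)"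
proof -
  have "((\<lambda>t. 1 + 2 * t\<^sup>2) has_real_derivative 4 * t) (at t)" by (auto intro!: derivative_eq_intros)
  from DERIV_chain2[OF DERIV_real_sqrt[OF one_two_sq_pos] this]
  show ?thesis by (simp add: arc_rate_def[abs_def] field_simps)
qed

lemma DERIV_dual_inverse: "(dual_inverse has_real_derivative arc_rate t) (at t)"
  unfolding arc_rate_def by (rule dual_inverse_deriv)

lemma dual_inverse_sgn: "0 \<le> dual_inverse t * t"
proof -
  have "0 \<le> t \<longleftrightarrow> 0 \<le> dual_inverse t"
    using strict_mono_less_eq[OF dual_inverse_strict_mono, of 0 t] by (simp add: dual_inverse_def[of 0])
  then show ?thesis by (cases "0 \<le> t") (auto intro: mult_nonneg_nonneg mult_nonpos_nonpos)
qed

text \<open>\<open>\<theta>\<close> is the quotient \<open>f'(v) * v / f(v)\<close> for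
  \<open>v = dual_inverse t\<close>; at \<open>t = 0\<close>, where the quotient is undefined, any
  value in the range will do.\<close>

lemma dual_inverse_ratio:
  obtains \<theta> where "1 / 2 \<le> \<theta>" "\<theta> \<le> 1" "dual_inverse t / arc_rate t = \<theta> * t"
proof (cases "t = 0")
  case True
  then show thesis by (intro that[of 1]) (auto simp: dual_inverse_def)
next
  case False
  let ?d = "\<bar>t\<bar> * arc_rate t" and ?\<theta> = "\<bar>dual_inverse t\<bar> / (\<bar>t\<bar> * arc_rate t)"
  have d: "?d > 0" using False arc_rate_pos[of t] by simp
  have b: "?d / 2 \<le> \<bar>dual_inverse t\<bar>" "\<bar>dual_inverse t\<bar> \<le> ?d"
    unfolding arc_rate_def by (rule dual_inverse_bounds)+
  have s: "\<bar>dual_inverse t\<bar> * t = \<bar>t\<bar> * dual_inverse t"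
    using dual_inverse_sgn[of t] by (auto simp: abs_if zero_le_mult_iff)
  have "1 / 2 \<le> ?\<theta>" using b(1) unfolding pos_le_divide_eq[OF d] by simp
  moreover have "?\<theta> \<le> 1" using b(2) unfolding pos_divide_le_eq[OF d] by simp
  moreover have "dual_inverse t / arc_rate t = ?\<theta> * t"
    using False arc_rate_pos[of t] s by (simp add: divide_simps)
  ultimately show thesis by (rule that)
qed

context critical_solution
begin

text \<open>The dual variable, its gradient and the right-hand side
  \<open>(h(f(v)) + lam * f(v)) * f'(v)\<close>, all expressed through \<open>u\<close>.\<close>

definition "dual_u x = dual_inverse (u x)"
definition "dual_grad x = arc_rate (u x) *\<^sub>R G x"
definition "dual_rhs x = (h (u x) + lam * u x) / arc_rate (u x)"

lemma dual_measurable [measurable]: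
  "arc_rate \<in> borel_measurable borel" "dual_inverse \<in> borel_measurable borel"
  "dual_u \<in> borel_measurable lebesgue" "dual_grad \<in> borel_measurable lebesgue" "dual_rhs \<in> borel_measurable lebesgue"
proof -
  have "continuous_on UNIV dual_inverse"
    using dual_inverse_deriv by (meson DERIV_continuous continuous_at_imp_continuous_on)
  then show [measurable]: "arc_rate \<in> borel_measurable borel" "dual_inverse \<in> borel_measurable borel"
    by (auto intro: borel_measurable_continuous_onI continuous_on_arc_rate)
  show "dual_u \<in> borel_measurable lebesgue" "dual_grad \<in> borel_measurable lebesgue" "dual_rhs \<in> borel_measurable lebesgue"
    unfolding dual_u_def[abs_def] dual_grad_def[abs_def] dual_rhs_def[abs_def] by measurable
qed

lemma dual_gradient: "has_weak_gradient dual_u dual_grad"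
proof -
  have "has_weak_gradient (\<lambda>x. dual_inverse (u x)) (\<lambda>x. arc_rate (u x) *\<^sub>R G x)"
  proof (rule has_weak_gradient_chain[OF wg DERIV_dual_inverse continuous_on_arc_rate,
        where E = "\<lambda>t. \<bar>t\<bar> + 2 * t\<^sup>2" and D = "\<lambda>t. 1 + 2 * \<bar>t\<bar>"])
    show "\<bar>dual_inverse s\<bar> \<le> \<bar>t\<bar> + 2 * t\<^sup>2" if "\<bar>s\<bar> \<le> \<bar>t\<bar>" for s t
    proof -
      have "\<bar>dual_inverse s\<bar> \<le> \<bar>s\<bar> * arc_rate s" unfolding arc_rate_def by (rule dual_inverse_bounds)
      also have "\<dots> \<le> \<bar>t\<bar> * (1 + 2 * \<bar>t\<bar>)"
        using that arc_rate_le[of s] by (intro mult_mono) (auto intro: less_imp_le[OF arc_rate_pos])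
      also have "\<dots> = \<bar>t\<bar> + 2 * t\<^sup>2" by (simp add: power2_eq_square algebra_simps)
      finally show ?thesis .
    qed
    show "locally_integrable (\<lambda>x. \<bar>u x\<bar> + 2 * (u x)\<^sup>2)"
      using locally_integrable_add[OF locally_integrable_norm[OF locally_integrable_u]
          locally_integrable_cmult[OF integrable_imp_locally_integrable[OF u2], of 2]] by simp
    show "\<bar>arc_rate s\<bar> \<le> 1 + 2 * \<bar>t\<bar>" if "\<bar>s\<bar> \<le> \<bar>t\<bar>" for s t
      using that arc_rate_le[of s] arc_rate_pos[of s] by linarith
    show "locally_integrable (\<lambda>x. (1 + 2 * \<bar>u x\<bar>) * norm (G x))"
      using locally_integrable_add[OF locally_integrable_norm[OF has_weak_gradientD(2)[OF wg]]
          locally_integrable_cmult[OF integrable_imp_locally_integrable[OF integrable_uG], of 2]]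
      by (simp add: distrib_right mult.assoc)
  qed
  then show ?thesis by (simp add: dual_u_def[abs_def] dual_grad_def[abs_def])
qed

lemma norm_dual_grad: "(norm (dual_grad x))\<^sup>2 = (norm (G x))\<^sup>2 + 2 * ((norm (G x))\<^sup>2 * (u x)\<^sup>2)"
  by (simp add: dual_grad_def power_mult_distrib power2_eq_square[of "arc_rate _"] arc_rate_sq algebra_simps)

lemma integrable_dual_grad: "integrable lebesgue (\<lambda>x. (norm (dual_grad x))\<^sup>2)"
  unfolding norm_dual_grad using G2 uG2 by simp

lemma integrable_dual_u: "integrable lebesgue (\<lambda>x. (dual_u x)\<^sup>2)"
proof (rule Bochner_Integration.integrable_bound[of _ "\<lambda>x. (u x)\<^sup>2 + 2 * (u x) ^ 4"])
  show "AE x in lebesgue. norm ((dual_u x)\<^sup>2) \<le> norm ((u x)\<^sup>2 + 2 * (u x) ^ 4)"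
  proof (intro AE_I2)
    fix x
    have "\<bar>dual_u x\<bar> \<le> \<bar>u x\<bar> * arc_rate (u x)" unfolding arc_rate_def dual_u_def by (rule dual_inverse_bounds)
    then have "\<bar>dual_u x\<bar>\<^sup>2 \<le> (\<bar>u x\<bar> * arc_rate (u x))\<^sup>2" by (intro power_mono) auto
    also have "\<dots> = (u x)\<^sup>2 + 2 * (u x) ^ 4"
      by (simp add: power_mult_distrib power2_eq_square[of "arc_rate _"] arc_rate_sq) (simp add: algebra_simps flip: power_add)
    finally show "norm ((dual_u x)\<^sup>2) \<le> norm ((u x)\<^sup>2 + 2 * (u x) ^ 4)" by simp
  qed
qed (use u2 integrable_u4 in auto)

text \<open>Division by \<open>arc_rate\<close> gains one power of growth. The square of the dual
  right-hand side then needs only \<open>|u|^(4p-4)\<close>, whose exponent lies between 2 and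
  \<open>4p\<close>.\<close>

lemma h_arc_rate: "\<bar>h t / arc_rate t\<bar> \<le> C * \<bar>t\<bar> powr (2 * p - 2)"
proof (cases "t = 0")
  case True
  then show ?thesis using h_growth[of 0] by simp
next
  case False
  have "\<bar>t\<bar> powr (2 * p - 1) = \<bar>t\<bar> powr ((2 * p - 2) + 1)" by simp
  also have "\<dots> = \<bar>t\<bar> powr (2 * p - 2) * \<bar>t\<bar>" using False by (simp only: powr_add powr_one abs_ge_zero)
  also have "\<dots> \<le> \<bar>t\<bar> powr (2 * p - 2) * arc_rate t" by (intro mult_left_mono abs_le_arc_rate) simp
  finally have "C * \<bar>t\<bar> powr (2 * p - 1) \<le> C * (\<bar>t\<bar> powr (2 * p - 2) * arc_rate t)"
    using C_pos by (intro mult_left_mono) auto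
  then have "\<bar>h t\<bar> \<le> C * \<bar>t\<bar> powr (2 * p - 2) * arc_rate t" using h_growth[of t] by simp
  then show ?thesis using arc_rate_pos[of t] by (simp add: abs_divide pos_divide_le_eq)
qed

lemma integrable_u_4p_4: "integrable lebesgue (\<lambda>x. \<bar>u x\<bar> powr (4 * p - 4))"
  by (rule Bochner_Integration.integrable_bound[of _ "\<lambda>x. (u x)\<^sup>2 + \<bar>u x\<bar> powr (4 * p)"])
    (use u2 integrable_u_4p powr_interpolate[of "4 * p - 4" "4 * p"] p_gt_2 in auto)

lemma integrable_dual_rhs: "integrable lebesgue (\<lambda>x. (dual_rhs x)\<^sup>2)"
proof (rule Bochner_Integration.integrable_bound[of _ "\<lambda>x. 2 * C\<^sup>2 * \<bar>u x\<bar> powr (4 * p - 4) + 2 * lam\<^sup>2 * (u x)\<^sup>2"])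
  show "AE x in lebesgue. norm ((dual_rhs x)\<^sup>2) \<le> norm (2 * C\<^sup>2 * \<bar>u x\<bar> powr (4 * p - 4) + 2 * lam\<^sup>2 * (u x)\<^sup>2)"
  proof (intro AE_I2)
    fix x
    have "\<bar>h (u x) / arc_rate (u x)\<bar>\<^sup>2 \<le> (C * \<bar>u x\<bar> powr (2 * p - 2))\<^sup>2"
      by (intro power_mono h_arc_rate) auto
    also have "\<dots> = C\<^sup>2 * \<bar>u x\<bar> powr (4 * p - 4)"
      by (simp add: power_mult_distrib power2_eq_square[of "_ powr _"] flip: powr_add)
    finally have 1: "(h (u x) / arc_rate (u x))\<^sup>2 \<le> C\<^sup>2 * \<bar>u x\<bar> powr (4 * p - 4)" by (simp only: power2_abs)
    have "\<bar>lam * u x / arc_rate (u x)\<bar> \<le> \<bar>lam * u x\<bar> / 1"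
      unfolding abs_divide using arc_rate_ge_1[of "u x"] by (intro divide_left_mono) auto
    then have "\<bar>lam * u x / arc_rate (u x)\<bar>\<^sup>2 \<le> \<bar>lam * u x\<bar>\<^sup>2" by (intro power_mono) auto
    then have 2: "(lam * u x / arc_rate (u x))\<^sup>2 \<le> lam\<^sup>2 * (u x)\<^sup>2" by (simp add: power_mult_distrib power_divide)
    have "(a + b)\<^sup>2 \<le> 2 * a\<^sup>2 + 2 * b\<^sup>2" for a b :: real
      using zero_le_power2[of "a - b"] by (simp add: power2_eq_square algebra_simps)
    then have "(dual_rhs x)\<^sup>2 \<le> 2 * (h (u x) / arc_rate (u x))\<^sup>2 + 2 * (lam * u x / arc_rate (u x))\<^sup>2"
      unfolding dual_rhs_def add_divide_distrib .
    then show "norm ((dual_rhs x)\<^sup>2) \<le> norm (2 * C\<^sup>2 * \<bar>u x\<bar> powr (4 * p - 4) + 2 * lam\<^sup>2 * (u x)\<^sup>2)"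
      using 1 2 by (simp add: mult.assoc)
  qed
qed (use u2 integrable_u_4p_4 in auto)

lemma dual_rhs_locally_integrable: "locally_integrable dual_rhs"
proof -
  have "locally_integrable (\<lambda>x. norm (h (u x)) + norm (lam * u x))"
    by (intro locally_integrable_add locally_integrable_norm locally_integrable_cmult locally_integrable_u
        integrable_imp_locally_integrable integrable_h)
  then show ?thesis
  proof (rule locally_integrable_bound)
    show "AE x in lebesgue. norm (dual_rhs x) \<le> norm (norm (h (u x)) + norm (lam * u x))"
    proof (intro AE_I2)
      fix x
      have "\<bar>dual_rhs x\<bar> \<le> \<bar>h (u x) + lam * u x\<bar> / 1"
        unfolding dual_rhs_def abs_divide using arc_rate_ge_1[of "u x"] by (intro divide_left_mono) auto
      then show "norm (dual_rhs x) \<le> norm (norm (h (u x)) + norm (lam * u x))"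
        using abs_triangle_ineq[of "h (u x)" "lam * u x"] by simp
    qed
  qed measurable
qed

text \<open>The leading term \<open>4 * u^4 * |G|^2\<close> is interpolated between
  \<open>u^2 * |G|^2\<close> and \<open>u^6 * |G|^2\<close>, the latter from the Brezis-Kato step.
  This upgrades Kato's inequality for \<open>W\<close> to an identity.\<close>

lemma integrable_GW: "integrable lebesgue (\<lambda>x. (norm (GW x))\<^sup>2)"
proof (rule Bochner_Integration.integrable_bound[of _
      "\<lambda>x. (norm (G x))\<^sup>2 + 8 * ((norm (G x))\<^sup>2 * (u x)\<^sup>2) + 4 * ((u x) ^ 6 * (norm (G x))\<^sup>2)"])
  show "AE x in lebesgue. norm ((norm (GW x))\<^sup>2) \<le>
      norm ((norm (G x))\<^sup>2 + 8 * ((norm (G x))\<^sup>2 * (u x)\<^sup>2) + 4 * ((u x) ^ 6 * (norm (G x))\<^sup>2))"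
  proof (intro AE_I2)
    fix x
    have "\<bar>u x\<bar> * \<bar>u x ^ 3\<bar> \<le> (u x)\<^sup>2 + (u x ^ 3)\<^sup>2" by (rule abs_mult_le_squares)
    moreover have "\<bar>u x\<bar> * \<bar>u x ^ 3\<bar> = u x ^ 4" "(u x ^ 3)\<^sup>2 = u x ^ 6"
      by (simp_all flip: abs_mult power_Suc power_mult)
    ultimately have "u x ^ 4 \<le> (u x)\<^sup>2 + u x ^ 6" by simp
    then have "(1 + 2 * (u x)\<^sup>2)\<^sup>2 \<le> 1 + 8 * (u x)\<^sup>2 + 4 * u x ^ 6"
      by (simp add: power2_eq_square algebra_simps power4_eq_xxxx)
    then have "(norm (GW x))\<^sup>2 \<le> (1 + 8 * (u x)\<^sup>2 + 4 * u x ^ 6) * (norm (G x))\<^sup>2"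
      unfolding GW_norm by (intro mult_right_mono) auto
    also have "\<dots> = (norm (G x))\<^sup>2 + 8 * ((norm (G x))\<^sup>2 * (u x)\<^sup>2) + 4 * ((u x) ^ 6 * (norm (G x))\<^sup>2)"
      by (simp add: algebra_simps)
    finally show "norm ((norm (GW x))\<^sup>2) \<le>
        norm ((norm (G x))\<^sup>2 + 8 * ((norm (G x))\<^sup>2 * (u x)\<^sup>2) + 4 * ((u x) ^ 6 * (norm (G x))\<^sup>2))" by simp
  qed
  have [measurable]: "GW \<in> borel_measurable lebesgue" unfolding GW_def[abs_def] by measurable
  show "(\<lambda>x. (norm (GW x))\<^sup>2) \<in> borel_measurable lebesgue" by measurable
qed (use G2 uG2 integrable_u6G in auto)

text \<open>Renormalizing the equation for \<open>W\<close> with the factor \<open>1 / arc_rate u\<close> cancels the term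
  \<open>- 2 u \<bar>G\<bar>\<^sup>2\<close>, and the dual equation remains.\<close>

lemma dual_equation: "weak_divergence dual_grad dual_rhs"
  unfolding weak_divergence_def
proof (intro allI impI)
  fix \<phi> :: "real ^ 'n \<Rightarrow> real" and g assume t: "test_function \<phi>" and "\<forall>x. GDERIV \<phi> x :> g x"
  then have g: "\<And>x. GDERIV \<phi> x :> g x" by blast
  obtain R where R: "\<And>x. norm x > R \<Longrightarrow> \<phi> x = 0" using test_function_supp[OF t] by blast
  note gc = test_function_gradient[OF t g]
  let ?b = "\<lambda>s. 1 / arc_rate (cubic_inv s)"
  let ?b' = "\<lambda>s. - (2 * cubic_inv s / (arc_rate (cubic_inv s)) ^ 3) * (1 / (1 + 2 * (cubic_inv s)\<^sup>2))"
  have dr: "((\<lambda>t. 1 / arc_rate t) has_real_derivative - (2 * t / (arc_rate t) ^ 3)) (at t)" for t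
  proof -
    have "((\<lambda>t. 1 / arc_rate t) has_real_derivative (0 * arc_rate t - 1 * (2 * t / arc_rate t)) / (arc_rate t * arc_rate t)) (at t)"
      using arc_rate_pos[of t] by (intro DERIV_divide DERIV_const DERIV_arc_rate) simp
    then show ?thesis by (simp add: power3_eq_cube mult.assoc)
  qed
  have d: "(?b has_real_derivative ?b' s) (at s)" for s
    by (rule DERIV_chain2[OF dr DERIV_cubic_inv])
  have c: "continuous_on UNIV ?b'"
    using arc_rate_pos one_two_sq_pos
    by (intro continuous_intros continuous_on_cubic_inv continuous_on_compose2[OF continuous_on_arc_rate])
      (auto simp: less_imp_neq[symmetric])
  have b: "\<bar>?b s\<bar> \<le> 1" for s using arc_rate_ge_1[of "cubic_inv s"] by simp
  have b': "\<bar>?b' s\<bar> \<le> 2" for s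
  proof -
    let ?t = "cubic_inv s"
    have "\<bar>?t\<bar> * 1 \<le> arc_rate ?t * (arc_rate ?t)\<^sup>2"
      using abs_le_arc_rate[of ?t] arc_rate_ge_1[of ?t] by (intro mult_mono) auto
    then have "\<bar>2 * ?t / (arc_rate ?t) ^ 3\<bar> \<le> 2"
      using arc_rate_pos[of ?t] by (simp add: abs_divide abs_mult pos_divide_le_eq power3_eq_cube power2_eq_square)
    moreover have "\<bar>1 / (1 + 2 * ?t\<^sup>2)\<bar> \<le> 1" using one_two_sq_pos[of ?t] by (simp add: abs_divide)
    ultimately have "\<bar>2 * ?t / (arc_rate ?t) ^ 3\<bar> * \<bar>1 / (1 + 2 * ?t\<^sup>2)\<bar> \<le> 2 * 1" by (intro mult_mono) auto
    then show ?thesis by (simp only: abs_mult abs_minus_cancel mult_1_right)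
  qed
  have e: "(LINT x|lebesgue. ?b' (W x) * (norm (GW x))\<^sup>2 * \<phi> x) =
      (LINT x|lebesgue. FW x * ?b (W x) * \<phi> x) - (LINT x|lebesgue. ?b (W x) * (GW x \<bullet> g x))"
    by (rule renormalized_equation[OF W_gradient FW_locally_integrable W_equation g gc _ d c b b'
        integrable_imp_locally_integrable[OF integrable_GW]]) (erule R)
  have i: "integrable lebesgue (\<lambda>x. FW x * ?b (W x) * \<phi> x)"
    by (rule renormalized_integrable1[OF W_gradient FW_locally_integrable W_equation g gc _ d c b]) (erule R)
  have ip: "integrable lebesgue (\<lambda>x. dual_rhs x * \<phi> x)"
    using integrable_scaleR_supp[OF dual_rhs_locally_integrable GDERIV_continuous_on[OF g] R] by simp
  have cW: "cubic_inv (W x) = u x" for x by (simp add: W_def cubic_inverse)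
  have V: "?b (W x) * (GW x \<bullet> g x) = dual_grad x \<bullet> g x" for x
    unfolding cW GW_def dual_grad_def arc_rate_sq[symmetric] using arc_rate_pos[of "u x"] by simp
  \<comment> \<open>With \<open>r = arc_rate u\<close> the left side is
    \<open>- 2 * u / r^3 * r^(-2) * r^4 * |G|^2 = - 2 * u * |G|^2 / r\<close>, times
    \<open>\<phi>\<close>: exactly the gradient term of \<open>FW\<close> multiplied by
    \<open>1 / r\<close>.\<close>
  have "?b' (W x) * (norm (GW x))\<^sup>2 * \<phi> x = FW x * ?b (W x) * \<phi> x - dual_rhs x * \<phi> x" for x
    unfolding cW GW_norm FW_def dual_rhs_def arc_rate_sq[symmetric]
    using arc_rate_pos[of "u x"] by (simp add: field_simps power2_eq_square power3_eq_cube)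
  then have "(LINT x|lebesgue. FW x * ?b (W x) * \<phi> x) - (LINT x|lebesgue. dual_rhs x * \<phi> x) =
      (LINT x|lebesgue. FW x * ?b (W x) * \<phi> x) - (LINT x|lebesgue. dual_grad x \<bullet> g x)"
    using e unfolding V by (simp only: Bochner_Integration.integral_diff[OF i ip])
  then show "(LINT x|lebesgue. dual_grad x \<bullet> g x) = (LINT x|lebesgue. dual_rhs x * \<phi> x)" by simp
qed

text \<open>In the lower bound \<open>\<theta> >= 1/2\<close> is applied to
  \<open>h(u) * u >= 2 * p * H(u)\<close> and \<open>\<theta> <= 1\<close> to the term with
  \<open>lam < 0\<close>, so 1/2 and \<open>2 * p\<close> combine to \<open>p\<close>. The second
  bound makes the product integrable.\<close>

lemma dual_rhs_mult:
  shows "p * H (u x) + lam * (u x)\<^sup>2 \<le> dual_rhs x * dual_u x"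
    and "\<bar>dual_rhs x * dual_u x\<bar> \<le> C * \<bar>u x\<bar> powr (2 * p) - lam * (u x)\<^sup>2"
proof -
  obtain \<theta> where \<theta>: "1 / 2 \<le> \<theta>" "\<theta> \<le> 1" "dual_inverse (u x) / arc_rate (u x) = \<theta> * u x"
    by (rule dual_inverse_ratio)
  have "dual_rhs x * dual_u x = (h (u x) + lam * u x) * (dual_inverse (u x) / arc_rate (u x))"
    by (simp add: dual_rhs_def dual_u_def)
  also have "\<dots> = \<theta> * (h (u x) * u x) - \<theta> * (- lam * (u x)\<^sup>2)"
    unfolding \<theta>(3) by (simp add: power2_eq_square algebra_simps)
  finally have e: "dual_rhs x * dual_u x = \<theta> * (h (u x) * u x) - \<theta> * (- lam * (u x)\<^sup>2)" .
  have hu: "2 * p * H (u x) \<le> h (u x) * u x" by (rule H_le_ht)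
  then have h0: "0 \<le> h (u x) * u x"
    using H_nonneg[of "u x"] p_gt_2 by (intro order_trans[OF _ hu] mult_nonneg_nonneg) auto
  have l0: "0 \<le> - lam * (u x)\<^sup>2" using lam by (intro mult_nonneg_nonneg) auto
  have 1: "1 / 2 * (h (u x) * u x) \<le> \<theta> * (h (u x) * u x)" "\<theta> * (h (u x) * u x) \<le> 1 * (h (u x) * u x)"
    using \<theta> by (intro mult_right_mono h0; simp)+
  have 2: "0 * (- lam * (u x)\<^sup>2) \<le> \<theta> * (- lam * (u x)\<^sup>2)" "\<theta> * (- lam * (u x)\<^sup>2) \<le> 1 * (- lam * (u x)\<^sup>2)"
    using \<theta> by (intro mult_right_mono l0; simp)+
  show "p * H (u x) + lam * (u x)\<^sup>2 \<le> dual_rhs x * dual_u x" unfolding e using 1 2 hu by linarith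
  have "h (u x) * u x \<le> C * \<bar>u x\<bar> powr (2 * p)"
  proof -
    have "h (u x) * u x \<le> \<bar>h (u x)\<bar> * \<bar>u x\<bar>" using abs_ge_self[of "h (u x) * u x"] by (simp only: abs_mult)
    also have "\<dots> \<le> C * \<bar>u x\<bar> powr (2 * p - 1) * \<bar>u x\<bar>" by (intro mult_right_mono h_growth) auto
    also have "\<dots> = C * (\<bar>u x\<bar> powr (2 * p - 1) * \<bar>u x\<bar> powr 1)" by simp
    also have "\<bar>u x\<bar> powr (2 * p - 1) * \<bar>u x\<bar> powr 1 = \<bar>u x\<bar> powr (2 * p)" by (simp only: powr_add[symmetric] diff_add_cancel)
    finally show ?thesis .
  qed
  then show "\<bar>dual_rhs x * dual_u x\<bar> \<le> C * \<bar>u x\<bar> powr (2 * p) - lam * (u x)\<^sup>2"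
    unfolding e using 1 2 h0 by linarith
qed

lemma integrable_dual_pairing: "integrable lebesgue (\<lambda>x. dual_rhs x * dual_u x)"
proof (rule Bochner_Integration.integrable_bound[of _ "\<lambda>x. C * \<bar>u x\<bar> powr (2 * p) - lam * (u x)\<^sup>2"])
  show "AE x in lebesgue. norm (dual_rhs x * dual_u x) \<le> norm (C * \<bar>u x\<bar> powr (2 * p) - lam * (u x)\<^sup>2)"
    unfolding real_norm_def using order_trans[OF dual_rhs_mult(2) abs_ge_self] by (intro AE_I2)
qed (use u2 integrable_u_2p in auto)

section \<open>The two integral identities for the dual variable\<close>

lemma nehari: "(LINT x|lebesgue. (norm (dual_grad x))\<^sup>2) = (LINT x|lebesgue. dual_rhs x * dual_u x)"
proof -
  let ?e = "\<lambda>j. cutoff (real (Suc j)) :: real ^ 'n \<Rightarrow> real" and ?k = "\<lambda>j. cutoff_grad (real (Suc j)) :: real ^ 'n \<Rightarrow> real ^ 'n"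
  have R: "0 < real (Suc j)" for j by simp
  have [measurable]: "?e j \<in> borel_measurable lebesgue" "?k j \<in> borel_measurable lebesgue" for j
    using continuous_on_imp_lebesgue_measurable[OF GDERIV_continuous_on[OF GDERIV_cutoff[of "real (Suc j)"]]]
      continuous_on_imp_lebesgue_measurable[OF continuous_on_cutoff_grad[of UNIV "real (Suc j)"]] by blast+
  have e1: "\<bar>?e j x\<bar> \<le> 1" for j x using cutoff_bounds[where R = "real (Suc j)" and x = x] by linarith
  \<comment> \<open>Truncation height and cutoff radius are tied to the same index \<open>j\<close>:
    the truncation is bounded, so the renormalized equation applies, and the cutoff term is of order
    \<open>1 / j\<close>.\<close>
  have eq: "(LINT x|lebesgue. trunc' j (dual_u x) * (norm (dual_grad x))\<^sup>2 * ?e j x) =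
      (LINT x|lebesgue. dual_rhs x * trunc j (dual_u x) * ?e j x)
      - (LINT x|lebesgue. trunc j (dual_u x) * (dual_grad x \<bullet> ?k j x))" for j
  proof (rule renormalized_equation[OF dual_gradient dual_rhs_locally_integrable dual_equation GDERIV_cutoff
        continuous_on_cutoff_grad _ DERIV_trunc continuous_on_trunc' abs_trunc_bound])
    show "norm x > real (Suc j) \<Longrightarrow> ?e j x = 0" for x by (rule cutoff_0[OF R])
    show "\<bar>trunc' j t\<bar> \<le> 1" for t using trunc'_pos[of j t] trunc'_le_1[of j t] by linarith
    show "locally_integrable (\<lambda>x. (norm (dual_grad x))\<^sup>2)"
      by (rule integrable_imp_locally_integrable[OF integrable_dual_grad])
  qed
  have l1: "(\<lambda>j. LINT x|lebesgue. trunc' j (dual_u x) * (norm (dual_grad x))\<^sup>2 * ?e j x) \<longlonglongrightarrow> (LINT x|lebesgue. (norm (dual_grad x))\<^sup>2)"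
  proof (rule integral_dominated_convergence[OF _ _ integrable_dual_grad])
    show "AE x in lebesgue. (\<lambda>j. trunc' j (dual_u x) * (norm (dual_grad x))\<^sup>2 * ?e j x) \<longlonglongrightarrow> (norm (dual_grad x))\<^sup>2"
    proof (intro AE_I2)
      fix x
      have "(\<lambda>j. trunc' j (dual_u x) * (norm (dual_grad x))\<^sup>2 * ?e j x) \<longlonglongrightarrow> 1 * (norm (dual_grad x))\<^sup>2 * 1"
        by (intro tendsto_mult trunc'_tendsto cutoff_tendsto tendsto_const)
      then show "(\<lambda>j. trunc' j (dual_u x) * (norm (dual_grad x))\<^sup>2 * ?e j x) \<longlonglongrightarrow> (norm (dual_grad x))\<^sup>2" by simp
    qed
    show "AE x in lebesgue. norm (trunc' j (dual_u x) * (norm (dual_grad x))\<^sup>2 * ?e j x) \<le> (norm (dual_grad x))\<^sup>2" for j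
    proof (intro AE_I2)
      fix x
      have "\<bar>trunc' j (dual_u x)\<bar> \<le> 1" using trunc'_pos[of j "dual_u x"] trunc'_le_1[of j "dual_u x"] by linarith
      then have "\<bar>trunc' j (dual_u x)\<bar> * (norm (dual_grad x))\<^sup>2 * \<bar>?e j x\<bar> \<le> 1 * (norm (dual_grad x))\<^sup>2 * 1"
        by (intro mult_mono e1) auto
      then show "norm (trunc' j (dual_u x) * (norm (dual_grad x))\<^sup>2 * ?e j x) \<le> (norm (dual_grad x))\<^sup>2"
        by (simp add: abs_mult)
    qed
  qed measurable
  have l2: "(\<lambda>j. LINT x|lebesgue. dual_rhs x * trunc j (dual_u x) * ?e j x) \<longlonglongrightarrow> (LINT x|lebesgue. dual_rhs x * dual_u x)"
  proof (rule integral_dominated_convergence[OF _ _ integrable_abs[OF integrable_dual_pairing]])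
    show "AE x in lebesgue. (\<lambda>j. dual_rhs x * trunc j (dual_u x) * ?e j x) \<longlonglongrightarrow> dual_rhs x * dual_u x"
    proof (intro AE_I2)
      fix x
      have "(\<lambda>j. dual_rhs x * trunc j (dual_u x) * ?e j x) \<longlonglongrightarrow> dual_rhs x * dual_u x * 1"
        by (intro tendsto_mult trunc_tendsto cutoff_tendsto tendsto_const)
      then show "(\<lambda>j. dual_rhs x * trunc j (dual_u x) * ?e j x) \<longlonglongrightarrow> dual_rhs x * dual_u x" by simp
    qed
    show "AE x in lebesgue. norm (dual_rhs x * trunc j (dual_u x) * ?e j x) \<le> \<bar>dual_rhs x * dual_u x\<bar>" for j
    proof (intro AE_I2)
      fix x
      have "\<bar>dual_rhs x\<bar> * \<bar>trunc j (dual_u x)\<bar> * \<bar>?e j x\<bar> \<le> \<bar>dual_rhs x\<bar> * \<bar>dual_u x\<bar> * 1"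
        by (intro mult_mono e1 abs_trunc_le) auto
      then show "norm (dual_rhs x * trunc j (dual_u x) * ?e j x) \<le> \<bar>dual_rhs x * dual_u x\<bar>"
        by (simp add: abs_mult)
    qed
  qed measurable
  have l3: "(\<lambda>j. LINT x|lebesgue. trunc j (dual_u x) * (dual_grad x \<bullet> ?k j x)) \<longlonglongrightarrow> (LINT x|(lebesgue :: (real ^ 'n) measure). 0 :: real)"
  proof (rule integral_dominated_convergence[where w = "\<lambda>x. ((dual_u x)\<^sup>2 + (norm (dual_grad x))\<^sup>2) * 4"])
    have *: "\<bar>trunc j (dual_u x) * (dual_grad x \<bullet> ?k j x)\<bar> \<le> ((dual_u x)\<^sup>2 + (norm (dual_grad x))\<^sup>2) * (4 / real (Suc j))" for j x
    proof -
      have "\<bar>dual_grad x \<bullet> ?k j x\<bar> \<le> norm (dual_grad x) * norm (?k j x)" by (rule Cauchy_Schwarz_ineq2)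
      also have "\<dots> \<le> norm (dual_grad x) * (4 / real (Suc j))"
        by (intro mult_left_mono norm_cutoff_grad(1)[OF R]) simp
      finally have "\<bar>trunc j (dual_u x)\<bar> * \<bar>dual_grad x \<bullet> ?k j x\<bar> \<le> \<bar>dual_u x\<bar> * (norm (dual_grad x) * (4 / real (Suc j)))"
        by (intro mult_mono abs_trunc_le) auto
      also have "\<dots> = (\<bar>dual_u x\<bar> * \<bar>norm (dual_grad x)\<bar>) * (4 / real (Suc j))" by (simp del: of_nat_Suc)
      also have "\<dots> \<le> ((dual_u x)\<^sup>2 + (norm (dual_grad x))\<^sup>2) * (4 / real (Suc j))"
        by (intro mult_right_mono abs_mult_le_squares) simp
      finally show ?thesis by (simp only: abs_mult)
    qed
    show "AE x in lebesgue. norm (trunc j (dual_u x) * (dual_grad x \<bullet> ?k j x)) \<le> ((dual_u x)\<^sup>2 + (norm (dual_grad x))\<^sup>2) * 4" for j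
    proof (intro AE_I2)
      fix x
      have "((dual_u x)\<^sup>2 + (norm (dual_grad x))\<^sup>2) * (4 / real (Suc j)) \<le> ((dual_u x)\<^sup>2 + (norm (dual_grad x))\<^sup>2) * 4"
        by (intro mult_left_mono) (auto simp: divide_le_eq)
      then show "norm (trunc j (dual_u x) * (dual_grad x \<bullet> ?k j x)) \<le> ((dual_u x)\<^sup>2 + (norm (dual_grad x))\<^sup>2) * 4"
        unfolding real_norm_def by (rule order_trans[OF *])
    qed
    show "AE x in lebesgue. (\<lambda>j. trunc j (dual_u x) * (dual_grad x \<bullet> ?k j x)) \<longlonglongrightarrow> 0"
    proof (intro AE_I2)
      fix x
      have "(\<lambda>j. ((dual_u x)\<^sup>2 + (norm (dual_grad x))\<^sup>2) * (4 * inverse (real (Suc j)))) \<longlonglongrightarrow>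
          ((dual_u x)\<^sup>2 + (norm (dual_grad x))\<^sup>2) * (4 * 0)"
        by (intro tendsto_mult tendsto_const LIMSEQ_inverse_real_of_nat)
      then have z: "(\<lambda>j. ((dual_u x)\<^sup>2 + (norm (dual_grad x))\<^sup>2) * (4 / real (Suc j))) \<longlonglongrightarrow> 0"
        by (simp only: divide_inverse mult_zero_right)
      show "(\<lambda>j. trunc j (dual_u x) * (dual_grad x \<bullet> ?k j x)) \<longlonglongrightarrow> 0"
        by (rule Lim_null_comparison[OF always_eventually z]) (use * in simp)
    qed
    show "integrable lebesgue (\<lambda>x. ((dual_u x)\<^sup>2 + (norm (dual_grad x))\<^sup>2) * 4)"
      using integrable_dual_u integrable_dual_grad by simp
  qed measurable
  have "(LINT x|lebesgue. (norm (dual_grad x))\<^sup>2) = (LINT x|lebesgue. dual_rhs x * dual_u x) - (LINT x|(lebesgue :: (real ^ 'n) measure). 0 :: real)"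
    by (rule LIMSEQ_unique[OF l1[unfolded eq] tendsto_diff[OF l2 l3]])
  then show ?thesis by simp
qed

text \<open>A primitive of \<open>h(t) + lam * t\<close> evaluated at \<open>u\<close>: its gradient
  is \<open>dual_rhs * dual_grad\<close>, so the last term of the Pohozaev density can be integrated
  by parts.\<close>

definition "potential x = H (u x) + lam / 2 * (u x)\<^sup>2"

lemma integrable_potential: "integrable lebesgue potential"
  unfolding potential_def[abs_def] using integrable_H u2 by simp

lemma potential_gradient: "has_weak_gradient potential (\<lambda>x. (h (u x) + lam * u x) *\<^sub>R G x)"
  unfolding potential_def[abs_def]
proof (rule has_weak_gradient_chain[OF wg, where E = "\<lambda>t. C * \<bar>t\<bar> powr (2 * p) + - lam * t\<^sup>2"
      and D = "\<lambda>t. C * \<bar>t\<bar> powr (2 * p - 1) + - lam * \<bar>t\<bar>" and \<Phi> = "\<lambda>t. H t + lam / 2 * t\<^sup>2"])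
  show "((\<lambda>t. H t + lam / 2 * t\<^sup>2) has_real_derivative h t + lam * t) (at t)" for t
    by (rule derivative_eq_intros DERIV_H refl | simp)+
  show "continuous_on UNIV (\<lambda>t. h t + lam * t)" by (intro continuous_intros h_cont)
  show "\<bar>H s + lam / 2 * s\<^sup>2\<bar> \<le> C * \<bar>t\<bar> powr (2 * p) + - lam * t\<^sup>2" if "\<bar>s\<bar> \<le> \<bar>t\<bar>" for s t
  proof -
    have "C * \<bar>s\<bar> powr (2 * p) \<le> C * \<bar>t\<bar> powr (2 * p)"
      using that C_pos p_gt_2 by (intro mult_left_mono powr_mono2) auto
    moreover have "- lam * s\<^sup>2 \<le> - lam * t\<^sup>2" using that lam by (intro mult_left_mono) (auto simp: abs_le_square_iff)
    moreover have "0 \<le> - lam * s\<^sup>2" using lam by (intro mult_nonneg_nonneg) auto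
    moreover have "lam / 2 * s\<^sup>2 = - (- lam * s\<^sup>2) / 2" by simp
    ultimately show ?thesis using H_growth[of s] H_nonneg[of s] by linarith
  qed
  show "locally_integrable (\<lambda>x. C * \<bar>u x\<bar> powr (2 * p) + - lam * (u x)\<^sup>2)"
    by (intro locally_integrable_add locally_integrable_cmult integrable_imp_locally_integrable u2 integrable_u_2p)
  show "\<bar>h s + lam * s\<bar> \<le> C * \<bar>t\<bar> powr (2 * p - 1) + - lam * \<bar>t\<bar>" if "\<bar>s\<bar> \<le> \<bar>t\<bar>" for s t
  proof -
    have "- lam * \<bar>s\<bar> \<le> - lam * \<bar>t\<bar>" using that lam by (intro mult_left_mono) auto
    moreover have "\<bar>lam * s\<bar> = - lam * \<bar>s\<bar>" using lam by (simp add: abs_mult)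
    ultimately show ?thesis using h_growth_mono[OF that] abs_triangle_ineq[of "h s" "lam * s"] by linarith
  qed
  \<comment> \<open>\<open>|u|^(2p-1) * |G|\<close> is the product of \<open>|u|^(2p-2)\<close> and
    \<open>|u| * |G|\<close>, both square integrable.\<close>
  have "integrable lebesgue (\<lambda>x. \<bar>u x\<bar> powr (2 * p - 1) * norm (G x))"
  proof (rule Bochner_Integration.integrable_bound[of _ "\<lambda>x. \<bar>u x\<bar> powr (4 * p - 4) + (norm (G x))\<^sup>2 * (u x)\<^sup>2"])
    show "AE x in lebesgue. norm (\<bar>u x\<bar> powr (2 * p - 1) * norm (G x)) \<le> norm (\<bar>u x\<bar> powr (4 * p - 4) + (norm (G x))\<^sup>2 * (u x)\<^sup>2)"
    proof (intro AE_I2)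
      fix x
      have "\<bar>u x\<bar> powr (2 * p - 1) = \<bar>u x\<bar> powr ((2 * p - 2) + 1)" by simp
      also have "\<dots> = \<bar>u x\<bar> powr (2 * p - 2) * \<bar>u x\<bar>" by (simp only: powr_add powr_one abs_ge_zero)
      finally have "\<bar>u x\<bar> powr (2 * p - 1) * norm (G x) = \<bar>\<bar>u x\<bar> powr (2 * p - 2)\<bar> * \<bar>u x * norm (G x)\<bar>"
        by (simp add: abs_mult)
      also have "\<dots> \<le> (\<bar>u x\<bar> powr (2 * p - 2))\<^sup>2 + (u x * norm (G x))\<^sup>2" by (rule abs_mult_le_squares)
      also have "\<dots> = \<bar>u x\<bar> powr (4 * p - 4) + (norm (G x))\<^sup>2 * (u x)\<^sup>2"
        by (simp add: power_mult_distrib power2_eq_square[of "_ powr _"] flip: powr_add)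
      finally show "norm (\<bar>u x\<bar> powr (2 * p - 1) * norm (G x)) \<le> norm (\<bar>u x\<bar> powr (4 * p - 4) + (norm (G x))\<^sup>2 * (u x)\<^sup>2)"
        by simp
    qed
  qed (use integrable_u_4p_4 uG2 in auto)
  then have "locally_integrable (\<lambda>x. C * (\<bar>u x\<bar> powr (2 * p - 1) * norm (G x)) + - lam * (\<bar>u x\<bar> * norm (G x)))"
    by (intro locally_integrable_add locally_integrable_cmult integrable_imp_locally_integrable integrable_uG)
  then show "locally_integrable (\<lambda>x. (C * \<bar>u x\<bar> powr (2 * p - 1) + - lam * \<bar>u x\<bar>) * norm (G x))"
    by (simp only: distrib_right mult.assoc)
qed

text \<open>With cutoffs of growing radius all terms containing the cutoff gradient disappear,
  leaving \<open>(1 - N/2) * A + N * B = 0\<close> for the integrals \<open>A\<close> of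
  \<open>|dual_grad|^2\<close> and \<open>B\<close> of the potential. Multiplying by
  \<open>- 2 * p\<close> and using \<open>(N - 2) * p = 2 * N\<close> gives the constant.\<close>

lemma pohozaev: "(LINT x|lebesgue. (norm (dual_grad x))\<^sup>2) = p * (LINT x|lebesgue. potential x)"
proof -
  let ?N = "real CARD('n)"
  let ?e = "\<lambda>n. cutoff (real (Suc n)) :: real ^ 'n \<Rightarrow> real" and ?k = "\<lambda>n. cutoff_grad (real (Suc n)) :: real ^ 'n \<Rightarrow> real ^ 'n"
  let ?V = "\<lambda>x. (norm (dual_grad x))\<^sup>2" and ?Q = potential and ?q = "\<lambda>x. (h (u x) + lam * u x) *\<^sub>R G x"
  let ?d = "\<lambda>n x. ?N * ?e n x + x \<bullet> ?k n x"
  let ?Z = "\<lambda>n x. ?V x * ?e n x + (x \<bullet> dual_grad x) * (dual_grad x \<bullet> ?k n x) + (?Q x - ?V x / 2) * ?d n x"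
  have R: "0 < real (Suc n)" for n by simp
  note ec = GDERIV_continuous_on[OF GDERIV_cutoff[of "real (Suc _)"], of UNIV]
  note kc = continuous_on_cutoff_grad[of UNIV "real (Suc _)"]
  note s = cutoff_0[OF R]
  note Q = has_weak_gradientD[OF potential_gradient]
  have ks: "?k n x = 0" if "norm x > real (Suc n)" for n x by (rule GDERIV_supp[OF GDERIV_cutoff s that])
  have [measurable]: "?e n \<in> borel_measurable lebesgue" "?k n \<in> borel_measurable lebesgue" "?Q \<in> borel_measurable lebesgue"
      "(\<lambda>x::real ^ 'n. x) \<in> borel_measurable lebesgue" for n
    by (rule continuous_on_imp_lebesgue_measurable ec kc Q(3) continuous_on_id)+
  have Qd: "integrable lebesgue (\<lambda>x. ?Q x * ?d n x)" for n
  proof -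
    have c: "continuous_on UNIV (?d n)" by (intro continuous_intros ec kc)
    have z: "?d n x = 0" if "norm x > real (Suc n)" for x using s[OF that] ks[OF that] by (simp del: of_nat_Suc)
    show ?thesis using integrable_scaleR_supp[OF Q(1) c z] by simp
  qed
  \<comment> \<open>The potential is integrated against \<open>?d n\<close>, the divergence of the
    field \<open>cutoff * x\<close>, component by component; each component is a C^1 test function
    with bounded support.\<close>
  have Qe: "integrable lebesgue (\<lambda>x. x \<bullet> ?q x * ?e n x)"
    and parts: "(LINT x|lebesgue. ?Q x * ?d n x) = - (LINT x|lebesgue. x \<bullet> ?q x * ?e n x)" for n
  proof -
    let ?t = "\<lambda>i x. x $ i * ?e n x" and ?t' = "\<lambda>i x. x $ i *\<^sub>R ?k n x + ?e n x *\<^sub>R axis i 1"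
    have t: "GDERIV (?t i) x :> ?t' i x" for i x by (intro GDERIV_mult GDERIV_component GDERIV_cutoff)
    have tc: "continuous_on UNIV (?t' i)" "continuous_on UNIV (?t i)" for i by (intro continuous_intros ec kc)+
    have t0: "?t i x = 0" if "norm x > real (Suc n)" for i x using s[OF that] by simp
    have t0': "?t' i x = 0" if "norm x > real (Suc n)" for i x using s[OF that] ks[OF that] by simp
    have i1: "integrable lebesgue (\<lambda>x. ?Q x *\<^sub>R ?t' i x)" for i
      by (rule integrable_scaleR_supp[OF Q(1) tc(1) t0'])
    have i2: "integrable lebesgue (\<lambda>x. ?t i x *\<^sub>R ?q x)" for i
      by (rule integrable_supp_scaleR[OF Q(2) tc(2) t0])
    note c1 = integral_vec_nth[OF i1] and c2 = integral_vec_nth[OF i2]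
    have e1: "?Q x * ?d n x = (\<Sum>i\<in>UNIV. (?Q x *\<^sub>R ?t' i x) $ i)" for x
      by (simp add: inner_vec_def axis_def sum.distrib distrib_left sum_distrib_left mult_ac)
    have e2: "x \<bullet> ?q x * ?e n x = (\<Sum>i\<in>UNIV. (?t i x *\<^sub>R ?q x) $ i)" for x
      unfolding inner_vec_def sum_distrib_right by (intro sum.cong refl) simp
    show "integrable lebesgue (\<lambda>x. x \<bullet> ?q x * ?e n x)"
      unfolding e2 by (intro Bochner_Integration.integrable_sum c2(1))
    have "(LINT x|lebesgue. ?Q x * ?d n x) = (\<Sum>i\<in>UNIV. (LINT x|lebesgue. (?Q x *\<^sub>R ?t' i x)) $ i)"
      unfolding e1 by (subst Bochner_Integration.integral_sum[OF c1(1)]) (simp only: c1(2))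
    also have "\<dots> = (\<Sum>i\<in>UNIV. (- (LINT x|lebesgue. ?t i x *\<^sub>R ?q x)) $ i)"
      by (simp only: weak_gradient_C1_test[OF potential_gradient t tc(1) t0])
    also have "\<dots> = - (\<Sum>i\<in>UNIV. (LINT x|lebesgue. ?t i x *\<^sub>R ?q x) $ i)"
      by (simp only: vector_uminus_component sum_negf)
    also have "(\<Sum>i\<in>UNIV. (LINT x|lebesgue. ?t i x *\<^sub>R ?q x) $ i) = (LINT x|lebesgue. x \<bullet> ?q x * ?e n x)"
      unfolding e2 by (subst Bochner_Integration.integral_sum[OF c2(1)]) (simp only: c2(2))
    finally show "(LINT x|lebesgue. ?Q x * ?d n x) = - (LINT x|lebesgue. x \<bullet> ?q x * ?e n x)" .
  qed
  have Z0: "(LINT x|lebesgue. ?Z n x) = 0" for n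
  proof -
    have g2: "locally_integrable (\<lambda>x. (dual_rhs x)\<^sup>2)" "locally_integrable ?V"
      by (rule integrable_imp_locally_integrable integrable_dual_rhs integrable_dual_grad)+
    let ?P = "\<lambda>x. pohozaev_density x (dual_rhs x) (dual_grad x) (?e n x) (?k n x)"
    have P: "integrable lebesgue ?P" "integral\<^sup>L lebesgue ?P = 0"
      by (rule pohozaev_cutoff[OF dual_gradient dual_rhs_locally_integrable dual_equation g2(2,1) GDERIV_cutoff kc];
        erule s)+
    have "dual_rhs x * (x \<bullet> dual_grad x) = x \<bullet> ?q x" for x
      using arc_rate_pos[of "u x"] by (simp add: dual_rhs_def dual_grad_def)
    then have "?Z n x = (?P x + x \<bullet> ?q x * ?e n x) + ?Q x * ?d n x" for x
      unfolding pohozaev_density_def by (simp add: algebra_simps)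
    then have "(LINT x|lebesgue. ?Z n x) = (LINT x|lebesgue. (?P x + x \<bullet> ?q x * ?e n x) + ?Q x * ?d n x)" by presburger
    also have "\<dots> = 0"
      unfolding Bochner_Integration.integral_add[OF Bochner_Integration.integrable_add[OF P(1) Qe] Qd]
        Bochner_Integration.integral_add[OF P(1) Qe] P(2) parts by simp
    finally show ?thesis .
  qed
  \<comment> \<open>The constant \<open>9 + N\<close> collects 1 and 4 from the first two terms and
    \<open>N + 4\<close> from the factor \<open>?d n\<close>.\<close>
  have bd: "\<bar>?Z n x\<bar> \<le> (?V x + \<bar>?Q x\<bar>) * (9 + ?N)" for n x
  proof -
    have e: "0 \<le> ?e n x" "?e n x \<le> 1" by (rule cutoff_bounds)+
    have k: "norm x * norm (?k n x) \<le> 4" by (rule norm_cutoff_grad(2)[OF R])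
    have 1: "\<bar>?V x * ?e n x\<bar> \<le> ?V x * 1" unfolding abs_mult using e by (intro mult_mono) auto
    have "\<bar>(x \<bullet> dual_grad x) * (dual_grad x \<bullet> ?k n x)\<bar> \<le> (norm x * norm (dual_grad x)) * (norm (dual_grad x) * norm (?k n x))"
      unfolding abs_mult by (rule mult_mono[OF Cauchy_Schwarz_ineq2 Cauchy_Schwarz_ineq2]) auto
    also have "\<dots> = ?V x * (norm x * norm (?k n x))" by (simp add: power2_eq_square mult_ac)
    also have "\<dots> \<le> ?V x * 4" by (rule mult_left_mono[OF k]) simp
    finally have 2: "\<bar>(x \<bullet> dual_grad x) * (dual_grad x \<bullet> ?k n x)\<bar> \<le> ?V x * 4" .
    have "\<bar>x \<bullet> ?k n x\<bar> \<le> 4" using Cauchy_Schwarz_ineq2[of x "?k n x"] k by linarith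
    moreover have "0 \<le> ?N * ?e n x" "?N * ?e n x \<le> ?N * 1" using e by (intro mult_nonneg_nonneg mult_left_mono; simp)+
    ultimately have "\<bar>?d n x\<bar> \<le> ?N + 4" by linarith
    moreover have "\<bar>?Q x - ?V x / 2\<bar> \<le> ?V x + \<bar>?Q x\<bar>" using zero_le_power2[of "norm (dual_grad x)"] by linarith
    ultimately have 3: "\<bar>(?Q x - ?V x / 2) * ?d n x\<bar> \<le> (?V x + \<bar>?Q x\<bar>) * (?N + 4)"
      unfolding abs_mult by (intro mult_mono) auto
    have "(?V x + \<bar>?Q x\<bar>) * (9 + ?N) = (?V x + \<bar>?Q x\<bar>) * (?N + 4) + ?V x * 1 + ?V x * 4 + \<bar>?Q x\<bar> * 5"
      by (simp add: algebra_simps)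
    then show ?thesis using 1 2 3 abs_ge_zero[of "?Q x"] by linarith
  qed
  have lim: "(\<lambda>n. ?Z n x) \<longlonglongrightarrow> ?V x * 1 + 0 + (?Q x - ?V x / 2) * (?N * 1 + 0)" for x
  proof (intro tendsto_add tendsto_mult cutoff_tendsto tendsto_const)
    show "(\<lambda>n. (x \<bullet> dual_grad x) * (dual_grad x \<bullet> ?k n x)) \<longlonglongrightarrow> 0"
    proof (rule Lim_null_comparison[OF always_eventually])
      have "\<bar>(x \<bullet> dual_grad x) * (dual_grad x \<bullet> ?k n x)\<bar> \<le> (norm x * norm (dual_grad x)) * (norm (dual_grad x) * norm (?k n x))" for n
        unfolding abs_mult by (rule mult_mono[OF Cauchy_Schwarz_ineq2 Cauchy_Schwarz_ineq2]) auto
      then show "\<forall>n. norm ((x \<bullet> dual_grad x) * (dual_grad x \<bullet> ?k n x)) \<le> ?V x * (norm x * norm (?k n x))"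
        by (simp add: power2_eq_square mult_ac del: of_nat_Suc)
      show "(\<lambda>n. ?V x * (norm x * norm (?k n x))) \<longlonglongrightarrow> 0"
        using tendsto_mult[OF tendsto_const[of "?V x"] cutoff_grad_tendsto[of x]] by (simp del: of_nat_Suc)
    qed
    show "(\<lambda>n. x \<bullet> ?k n x) \<longlonglongrightarrow> 0"
      by (rule Lim_null_comparison[OF always_eventually cutoff_grad_tendsto[of x]])
        (simp add: Cauchy_Schwarz_ineq2 del: of_nat_Suc)
  qed
  have "(\<lambda>n. LINT x|lebesgue. ?Z n x) \<longlonglongrightarrow> (LINT x|lebesgue. ?V x * 1 + 0 + (?Q x - ?V x / 2) * (?N * 1 + 0))"
  proof (rule integral_dominated_convergence[where w = "\<lambda>x. (?V x + \<bar>?Q x\<bar>) * (9 + ?N)"])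
    show "integrable lebesgue (\<lambda>x. (?V x + \<bar>?Q x\<bar>) * (9 + ?N))"
      using integrable_dual_grad integrable_potential by simp
  qed (use lim bd in \<open>auto intro: AE_I2 simp del: of_nat_Suc\<close>)
  then have "(LINT x|lebesgue. ?V x * 1 + 0 + (?Q x - ?V x / 2) * (?N * 1 + 0)) = 0"
    unfolding Z0 by (simp add: LIMSEQ_const_iff)
  then have "(LINT x|lebesgue. ?V x * (1 - ?N / 2) + ?Q x * ?N) = 0" by (simp add: algebra_simps)
  then have z: "(LINT x|lebesgue. ?V x) * (1 - ?N / 2) + (LINT x|lebesgue. ?Q x) * ?N = 0"
    using integrable_dual_grad integrable_potential by simp
  let ?A = "LINT x|lebesgue. ?V x" and ?B = "LINT x|lebesgue. ?Q x"
  have "?A * ((?N - 2) * p) = 2 * p * (?B * ?N)" using arg_cong[OF z, of "\<lambda>t. t * (- 2 * p)"] by (simp add: algebra_simps)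
  then have "?N * ?A = ?N * (p * ?B)" unfolding p_eq by (simp add: mult_ac)
  then show ?thesis by simp
qed

lemma solution_trivial: "(LINT x|lebesgue. (u x)\<^sup>2) \<le> 0"
proof -
  let ?I = "LINT x|lebesgue. (u x)\<^sup>2" and ?J = "LINT x|lebesgue. H (u x)"
  have "p * ?J + lam * ?I = (LINT x|lebesgue. p * H (u x) + lam * (u x)\<^sup>2)"
    using integrable_H u2 by simp
  also have "\<dots> \<le> (LINT x|lebesgue. dual_rhs x * dual_u x)"
    using integrable_H u2 by (intro integral_mono integrable_dual_pairing dual_rhs_mult) simp
  also have "\<dots> = p * (LINT x|lebesgue. potential x)" unfolding nehari[symmetric] by (rule pohozaev)
  also have "(LINT x|lebesgue. potential x) = ?J + lam / 2 * ?I"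
    unfolding potential_def using integrable_H u2 by simp
  finally have "0 \<le> (lam * (p - 2)) * ?I" by (simp add: algebra_simps)
  moreover have "lam * (p - 2) < 0" using lam p_gt_2 by (simp add: mult_neg_pos)
  ultimately show ?thesis using mult_neg_pos[of "lam * (p - 2)" ?I] by argo
qed

end

theorem theorem1p3:
  fixes h :: "real \<Rightarrow> real" and a :: real
  assumes N: "CARD('n::finite) \<ge> 2"
    and energy: "Psi_well_defined_C1 TYPE('n) h"
    and h1: "continuous_on UNIV h" "h \<in> o[at 0](\<lambda>t. t)"
    and h2: "\<exists>\<mu>\<^sub>1 \<mu>\<^sub>2 :: real. \<mu>\<^sub>1 \<le> \<mu>\<^sub>2 \<and> ereal \<mu>\<^sub>1 \<ge> 2 * critical_exponent CARD('n) \<and>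
        (\<forall>t. t \<noteq> 0 \<longrightarrow> 0 < \<mu>\<^sub>1 * primitive h t \<and> \<mu>\<^sub>1 * primitive h t \<le> h t * t \<and>
                        h t * t \<le> \<mu>\<^sub>2 * primitive h t)"
    and h3: "mono_on {..<0} (\<lambda>t. (h t * t - 2 * primitive h t) /
                                   (\<bar>t\<bar> powr (3 + 4 / real CARD('n)) * t))"
            "mono_on {0<..} (\<lambda>t. (h t * t - 2 * primitive h t) /
                                   (\<bar>t\<bar> powr (3 + 4 / real CARD('n)) * t))"
    and a: "a > 0"
  shows "\<not> (\<exists>(u :: real ^ 'n \<Rightarrow> real) (lam :: real).
             u \<in> S_hat a \<and> lam < 0 \<and> weak_solution h u lam)"
proof
  assume "\<exists>(u :: real ^ 'n \<Rightarrow> real) (lam :: real). u \<in> S_hat a \<and> lam < 0 \<and> weak_solution h u lam"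
  then obtain u :: "real ^ 'n \<Rightarrow> real" and lam where u: "u \<in> S_hat a" and lam: "lam < 0" and sol: "weak_solution h u lam"
    by blast
  obtain \<mu>1 \<mu>2 :: real where mu: "\<mu>1 \<le> \<mu>2" "2 * critical_exponent CARD('n) \<le> ereal \<mu>1"
    and AR: "\<And>t. t \<noteq> 0 \<Longrightarrow> 0 < \<mu>1 * primitive h t \<and> \<mu>1 * primitive h t \<le> h t * t \<and> h t * t \<le> \<mu>2 * primitive h t"
    using h2 by blast
  \<comment> \<open>For \<open>N = 2\<close> the critical exponent is infinite, and no real
    \<open>\<mu>1\<close> dominates its double.\<close>
  have dim: "CARD('n) \<ge> 3"
  proof (rule ccontr)
    assume "\<not> CARD('n) \<ge> 3"
    then show False using mu(2) by (simp add: critical_exponent_def)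
  qed
  define p where "p = 2 * real CARD('n) / (real CARD('n) - 2)"
  have "critical_exponent CARD('n) = ereal p"
    using dim by (simp add: critical_exponent_def p_def)
  then have "2 * critical_exponent CARD('n) = ereal (2 * p)"
    using times_ereal.simps(1)[of 2 p] by (metis numeral_eq_ereal)
  then have p: "2 * p \<le> \<mu>1" using mu(2) by simp
  interpret energy_growth h \<mu>1 \<mu>2 p "TYPE('n)"
    by unfold_locales (use dim p_def energy h1(1) mu(1) p AR in auto)
  obtain S where S: "sobolev_inequality TYPE('n) p S" by (rule sobolev)
  obtain C0 where C0: "C0 > 0" "\<And>t. primitive h t \<le> C0 * \<bar>t\<bar> powr (2 * p)" by (rule H_upper) blast
  \<comment> \<open>One constant for both \<open>H\<close> and \<open>h\<close>; the factor
    \<open>|\<mu>2|\<close> comes from \<open>h t * t <= \<mu>2 * H t\<close>.\<close>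
  define C where "C = C0 * (1 + \<bar>\<mu>2\<bar>)"
  have C: "C > 0" "C0 \<le> C" "\<bar>\<mu>2\<bar> * C0 \<le> C" using C0(1) by (auto simp: C_def algebra_simps intro!: add_pos_nonneg)
  have H: "primitive h t \<le> C * \<bar>t\<bar> powr (2 * p)" for t
    using C0(2)[of t] mult_right_mono[OF C(2), of "\<bar>t\<bar> powr (2 * p)"] by simp
  have h_bound: "\<bar>h t\<bar> \<le> C * \<bar>t\<bar> powr (2 * p - 1)" if "t \<noteq> 0" for t
  proof -
    have "\<bar>h t\<bar> * \<bar>t\<bar> = h t * t" using h_sign[of t] by (simp flip: abs_mult)
    also have "\<dots> \<le> \<mu>2 * primitive h t" by (rule ht_le_H)
    also have "\<dots> \<le> \<bar>\<mu>2\<bar> * (C0 * \<bar>t\<bar> powr (2 * p))" using C0(2)[of t] H_nonneg[of t] by (intro mult_mono) auto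
    also have "\<dots> \<le> C * \<bar>t\<bar> powr (2 * p)"
      using mult_right_mono[OF C(3), of "\<bar>t\<bar> powr (2 * p)"] by (simp add: mult.assoc)
    also have "\<bar>t\<bar> powr (2 * p) = \<bar>t\<bar> powr (2 * p - 1) * \<bar>t\<bar> powr 1" by (simp only: powr_add[symmetric] diff_add_cancel)
    finally have "\<bar>h t\<bar> * \<bar>t\<bar> \<le> (C * \<bar>t\<bar> powr (2 * p - 1)) * \<bar>t\<bar>" by simp
    then show ?thesis by (rule mult_right_le_imp_le) (use that in simp)
  qed
  \<comment> \<open>At \<open>t = 0\<close> the power is 0, so the growth bound there demands
    \<open>h 0 = 0\<close>. Dividing by \<open>|t|\<close> cannot give this; continuity of
    \<open>h\<close> does.\<close>
  have h_0: "h 0 = 0"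
  proof (rule tendsto_unique[of "at (0 :: real)" h])
    show "(h \<longlongrightarrow> h 0) (at 0)" using h1(1) by (simp add: continuous_on_def)
    show "(h \<longlongrightarrow> 0) (at 0)"
    proof (rule Lim_null_comparison)
      show "eventually (\<lambda>t. norm (h t) \<le> C * \<bar>t\<bar> powr (2 * p - 1)) (at 0)"
        using h_bound by (auto simp: eventually_at_filter)
      have "((\<lambda>t::real. C * \<bar>t\<bar> powr (2 * p - 1)) \<longlongrightarrow> C * \<bar>0\<bar> powr (2 * p - 1)) (at 0)"
        using p_gt_2 by (intro tendsto_mult tendsto_const tendsto_powr' tendsto_rabs tendsto_ident_at) auto
      then show "((\<lambda>t::real. C * \<bar>t\<bar> powr (2 * p - 1)) \<longlongrightarrow> 0) (at 0)" by simp
    qed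
  qed simp
  have h: "\<bar>h t\<bar> \<le> C * \<bar>t\<bar> powr (2 * p - 1)" for t
    using h_bound[of t] h_0 by (cases "t = 0") auto
  have uH1: "u \<in> H1" and uG: "integrable lebesgue (\<lambda>x. (norm (weak_gradient u x))\<^sup>2 * (u x)\<^sup>2)"
    and ua: "(LINT x|lebesgue. (u x)\<^sup>2) = a"
    using u by (auto simp: S_hat_def K_set_def)
  interpret solution: critical_solution h p S C lam u "weak_gradient u"
    by unfold_locales
      (fact p_gt_2 p_eq h1(1) H_nonneg H_le_ht C(1) H h S H1_has_weak_gradient[OF uH1] H1_integrable[OF uH1]
        H1_gradient_integrable[OF uH1] uG lam sol)+
  show False using solution.solution_trivial ua a by simp
qed

end
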